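(* Let $X$ be a simplicial complex in $\mathbb R^n$ and let $\mathrm{Co}_k^{S}$, $k\ge0$, be a singular cone operator on $X$ with contraction point $a\in|X|$. For $k\ge1$ let $\mathcal P^k : V_h^k\to V_h^{k-1}$ be the operator on Whitney forms determined by $\int_\sigma \mathcal P^k u = \int_{\mathrm{Co}^{S}_{k-1}(\sigma)} u$ for all $\sigma\in X^{k-1}$, $u\in V_h^k$, and define $\mathsf P^k : C^k(X)\to C^{k-1}(X)$ by $\mathsf P^k = R^{k-1}\mathcal P^kW^k$, where $R$ and $W$ are the de Rham and Whitney maps. Then $$(\mathsf d^{k-1}\mathsf P^k+\mathsf P^{k+1}\mathsf d^k)\alpha=\alpha\quad\text{for all }\alpha\in C^k(X),\ k\ge1,$$ $$\mathsf P^1\mathsf d^0\alpha=\alpha-\pi_W\alpha\quad\text{for all }\alpha\in C^0(X),$$ where $\pi_W\alpha\in C^0(X)$ is the cochain with $\langle\pi_W\alpha,v\rangle=(W^0\alpha)(a)$ for all $v\in X^0$.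
   Context: Chains. Fix a total order on the vertices of the geometric simplicial complex $X\subset\mathbb R^n$; each $k$-simplex $\sigma\in X^k$ is written $[v_0,\dots,v_k]$ with $v_0<\dots<v_k$. $C_k(X)$ is the real vector space with basis $X^k$, with boundary $\partial_k[v_0,\dots,v_k]=\sum_i(-1)^i[v_0,\dots,\widehat{v_i},\dots,v_k]$; $C^k(X)$ is the space of real $k$-cochains, $\langle\cdot,\cdot\rangle$ the cochain–chain pairing, and $\mathsf d^k$ the coboundary, $\langle\mathsf d^k\alpha,c\rangle=\langle\alpha,\partial_{k+1}c\rangle$. Singular chains. $Q_k$ is the standard simplex with vertices $q_0=0$, $q_i=e_i$ ($1\le i\le k$). A Lipschitz singular $k$-simplex of $M$ is a Lipschitz map $T:Q_k\to M$; $S_k^{\mathrm{Lip}}(M)$ is the real vector space of finite formal linear combinations of these. For points $a_0,\dots,a_k$, $L[a_0,\dots,a_k](x)=a_0+\sum_{i=1}^k x_i(a_i-a_0)$ on $Q_k$; for $\sigma=[v_0,\dots,v_k]$, $L\sigma=L[v_0,\dots,v_k]$. The boundary is $\partial_k^S T=\sum_{i=0}^k(-1)^i\,T\circ L[q_0,\dots,\widehat{q_i},\dots,q_k]$. A singular cone operator with contraction point $a\in|X|$ is a family of linear maps $\mathrm{Co}_k^S:C_k(X)\to S_{k+1}^{\mathrm{Lip}}(|X|)$ with $\mathrm{Co}^S_{k-1}(\partial_k\sigma)+\partial^S_{k+1}\mathrm{Co}^S_k(\sigma)=L\sigma$ for all $\sigma\in X^k$, $k\ge1$, and $\partial_1^S\mathrm{Co}_0^S(v)=L[v]-L[a]$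 for all $v\in X^0$. Whitney forms. $V_h^k$ is the span of the forms $w_\sigma=k!\sum_{i=0}^k(-1)^i\lambda_{v_i}\,d\lambda_{v_0}\wedge\dots\wedge\widehat{d\lambda_{v_i}}\wedge\dots\wedge d\lambda_{v_k}$, $\sigma=[v_0,\dots,v_k]\in X^k$, where $\lambda_v$ is the continuous piecewise linear hat function of the vertex $v$. The Whitney map is $W^k:C^k(X)\to V_h^k$, $W^k\alpha=\sum_{\sigma\in X^k}\langle\alpha,\sigma\rangle w_\sigma$, and the de Rham map $R^k$ is $\langle R^ku,\sigma\rangle=\int_\sigma u$. A Whitney $k$-form is smooth on each simplex, its traces on common faces agree, and it is uniquely determined by its integrals over all $\sigma\in X^k$, which may be prescribed arbitrarily. Integration. $\int_T u=\int_{Q_k}T^*u$ for a Lipschitz singular $k$-simplex $T$ of $|X|$, extended linearly to chains; here, for a.e. $q\in Q_k$, $(T^*u)(q)$ is the pullback under $DT(q)$ of the trace of $u$ on the simplex of $X$ whose relative interior contains $T(q)$ (for a.e. $q$ the image of $DT(q)$ is tangent to that simplex). For $k=0$ the integral is evaluation at a point. *)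

theory Defs
  imports "HOL-Analysis.Analysis" "HOL-Library.Poly_Mapping"
begin

text \<open>
  A geometric simplicial complex in Euclidean space is a set \<open>X\<close> satisfying the library predicate
  \<^const>\<open>simplicial_complex\<close> (finite; the empty simplex, of dimension \<open>-1\<close>, is harmless), with
  polyhedron \<open>\<Union>X\<close>.  A relation \<open>r\<close> totally orders the vertices, and a \<open>k\<close>-simplex is represented
  by its increasing vertex list \<open>[v\<^sub>0, \<dots>, v\<^sub>k]\<close>.  Formal linear combinations with real coefficients
  are finitely supported functions.
\<close>

definition vertices :: "'a::euclidean_space set set \<Rightarrow> 'a set" where
  "vertices X = {v. {v} \<in> X}"

definition simplices :: "'a::euclidean_space set set \<Rightarrow> 'a rel \<Rightarrow> nat \<Rightarrow> 'a list set" where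
  "simplices X r k =
     {\<sigma>. length \<sigma> = Suc k \<and> distinct \<sigma> \<and> sorted_wrt (\<lambda>u v. (u, v) \<in> r) \<sigma> \<and>
         \<not> affine_dependent (set \<sigma>) \<and> convex hull (set \<sigma>) \<in> X}"

definition delete_nth :: "nat \<Rightarrow> 'b list \<Rightarrow> 'b list" where
  "delete_nth i xs = take i xs @ drop (Suc i) xs"


subsection \<open>Simplicial chains and cochains\<close>

definition chains :: "'a::euclidean_space set set \<Rightarrow> 'a rel \<Rightarrow> nat \<Rightarrow> ('a list \<Rightarrow>\<^sub>0 real) set" where
  "chains X r k = {c. Poly_Mapping.keys c \<subseteq> simplices X r k}"

text \<open>The boundary is only used on chains of degree at least \<open>1\<close>.\<close>

definition boundary :: "('a list \<Rightarrow>\<^sub>0 real) \<Rightarrow> ('a list \<Rightarrow>\<^sub>0 real)" where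
  "boundary c =
     (\<Sum>\<sigma>\<in>Poly_Mapping.keys c. \<Sum>i<length \<sigma>.
        Poly_Mapping.single (delete_nth i \<sigma>) ((-1) ^ i * Poly_Mapping.lookup c \<sigma>))"

text \<open>A \<open>k\<close>-cochain is given by its values on the basis of \<open>k\<close>-simplices; it is extended by \<open>0\<close> to
  all other lists, so that equality of cochains is equality of functions.\<close>

definition cochains :: "'a::euclidean_space set set \<Rightarrow> 'a rel \<Rightarrow> nat \<Rightarrow> ('a list \<Rightarrow> real) set" where
  "cochains X r k = {\<alpha>. \<forall>\<sigma>. \<sigma> \<notin> simplices X r k \<longrightarrow> \<alpha> \<sigma> = 0}"

definition pairing :: "('a list \<Rightarrow> real) \<Rightarrow> ('a list \<Rightarrow>\<^sub>0 real) \<Rightarrow> real" where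
  "pairing \<alpha> c = (\<Sum>\<sigma>\<in>Poly_Mapping.keys c. Poly_Mapping.lookup c \<sigma> * \<alpha> \<sigma>)"

definition coboundary ::
  "'a::euclidean_space set set \<Rightarrow> 'a rel \<Rightarrow> nat \<Rightarrow> ('a list \<Rightarrow> real) \<Rightarrow> ('a list \<Rightarrow> real)" where
  "coboundary X r k \<alpha> =
     (\<lambda>\<sigma>. if \<sigma> \<in> simplices X r (Suc k)
          then pairing \<alpha> (boundary (Poly_Mapping.single \<sigma> 1)) else 0)"


subsection \<open>Lipschitz singular chains\<close>

text \<open>Points of \<open>\<real>\<^sup>k\<close> are functions in \<^term>\<open>extensional {1..k}\<close>, i.e. the points of the product
  measure space over the index set \<^term>\<open>{1..k}\<close>.  Maps on the standard simplex are extensional too.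
  The type class metric on \<^typ>\<open>nat \<Rightarrow> real\<close> is not Euclidean and is not used.\<close>

definition euclid_dist :: "nat \<Rightarrow> (nat \<Rightarrow> real) \<Rightarrow> (nat \<Rightarrow> real) \<Rightarrow> real" where
  "euclid_dist k x y = L2_set (\<lambda>i. x i - y i) {1..k}"

definition ref_simplex :: "nat \<Rightarrow> (nat \<Rightarrow> real) set" where
  "ref_simplex k = {x \<in> extensional {1..k}. (\<forall>i\<in>{1..k}. 0 \<le> x i) \<and> (\<Sum>i=1..k. x i) \<le> 1}"

definition ref_vertex :: "nat \<Rightarrow> nat \<Rightarrow> (nat \<Rightarrow> real)" where
  "ref_vertex k i = (\<lambda>j\<in>{1..k}. if j = i then 1 else 0)"

definition lin_simplex :: "'b::real_vector list \<Rightarrow> (nat \<Rightarrow> real) \<Rightarrow> 'b" where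
  "lin_simplex as =
     (\<lambda>x\<in>ref_simplex (length as - 1). as ! 0 + (\<Sum>i=1..length as - 1. x i *\<^sub>R (as ! i - as ! 0)))"

text \<open>The affine map \<open>L[q\<^sub>0, \<dots>, q\<^sub>i omitted, \<dots>, q\<^sub>k]\<close> into \<open>\<real>\<^sup>k\<close>, written coordinatewise.\<close>

definition face_map :: "nat \<Rightarrow> nat \<Rightarrow> (nat \<Rightarrow> real) \<Rightarrow> (nat \<Rightarrow> real)" where
  "face_map k i x =
     (\<lambda>j\<in>{1..k}. lin_simplex (map (\<lambda>p. p j) (delete_nth i (map (ref_vertex k) [0..<Suc k]))) x)"

definition lipschitz_simplices :: "nat \<Rightarrow> 'a::metric_space set \<Rightarrow> ((nat \<Rightarrow> real) \<Rightarrow> 'a) set" where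
  "lipschitz_simplices k M =
     {T \<in> ref_simplex k \<rightarrow>\<^sub>E M.
        \<exists>C. \<forall>x\<in>ref_simplex k. \<forall>y\<in>ref_simplex k. dist (T x) (T y) \<le> C * euclid_dist k x y}"

definition lipschitz_chains ::
  "nat \<Rightarrow> 'a::metric_space set \<Rightarrow> (((nat \<Rightarrow> real) \<Rightarrow> 'a) \<Rightarrow>\<^sub>0 real) set" where
  "lipschitz_chains k M = {c. Poly_Mapping.keys c \<subseteq> lipschitz_simplices k M}"

definition singular_boundary ::
  "nat \<Rightarrow> (((nat \<Rightarrow> real) \<Rightarrow> 'a) \<Rightarrow>\<^sub>0 real) \<Rightarrow> (((nat \<Rightarrow> real) \<Rightarrow> 'a) \<Rightarrow>\<^sub>0 real)" where
  "singular_boundary k c =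
     (\<Sum>T\<in>Poly_Mapping.keys c. \<Sum>i\<le>k.
        Poly_Mapping.single (restrict (T \<circ> face_map k i) (ref_simplex (k - 1)))
          ((-1) ^ i * Poly_Mapping.lookup c T))"

text \<open>\<^term>\<open>Poly_Mapping.map ((*) s) c\<close> is the scalar multiple of the chain \<open>c\<close> by \<open>s\<close>.\<close>

definition singular_cone_operator ::
  "'a::euclidean_space set set \<Rightarrow> 'a rel \<Rightarrow> 'a \<Rightarrow>
   (nat \<Rightarrow> ('a list \<Rightarrow>\<^sub>0 real) \<Rightarrow> (((nat \<Rightarrow> real) \<Rightarrow> 'a) \<Rightarrow>\<^sub>0 real)) \<Rightarrow> bool" where
  "singular_cone_operator X r a Co \<longleftrightarrow>
     a \<in> \<Union>X \<and>
     (\<forall>k. \<forall>c\<in>chains X r k. Co k c \<in> lipschitz_chains (Suc k) (\<Union>X)) \<and>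
     (\<forall>k. \<forall>c\<in>chains X r k. \<forall>d\<in>chains X r k. Co k (c + d) = Co k c + Co k d) \<and>
     (\<forall>k. \<forall>c\<in>chains X r k. \<forall>s.
        Co k (Poly_Mapping.map ((*) s) c) = Poly_Mapping.map ((*) s) (Co k c)) \<and>
     (\<forall>k\<ge>1. \<forall>\<sigma>\<in>simplices X r k.
        Co (k - 1) (boundary (Poly_Mapping.single \<sigma> 1)) +
        singular_boundary (k + 1) (Co k (Poly_Mapping.single \<sigma> 1)) =
        Poly_Mapping.single (lin_simplex \<sigma>) 1) \<and>
     (\<forall>v. [v] \<in> simplices X r 0 \<longrightarrow>
        singular_boundary 1 (Co 0 (Poly_Mapping.single [v] 1)) =
        Poly_Mapping.single (lin_simplex [v]) 1 - Poly_Mapping.single (lin_simplex [a]) 1)"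


subsection \<open>Whitney forms\<close>

text \<open>A piecewise form \<open>u\<close> assigns to a simplex \<open>\<tau>\<close> of the complex, a point \<open>x\<close> of \<open>\<tau>\<close> and a list of
  tangent vectors of \<open>\<tau>\<close> the value at \<open>x\<close> of the trace of \<open>u\<close> on \<open>\<tau>\<close>.\<close>

type_synonym 'a form = "'a set \<Rightarrow> 'a \<Rightarrow> 'a list \<Rightarrow> real"

text \<open>The continuous piecewise linear hat function of the vertex \<open>v\<close>, extended by \<open>0\<close> off \<open>\<Union>X\<close>.\<close>

definition hat :: "'a::euclidean_space set set \<Rightarrow> 'a \<Rightarrow> 'a \<Rightarrow> real" where
  "hat X v =
     (THE f. continuous_on (\<Union>X) f \<and>
        (\<forall>\<tau>\<in>X. \<forall>x\<in>\<tau>. \<forall>y\<in>\<tau>. \<forall>t\<in>{0..1}.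
           f ((1 - t) *\<^sub>R x + t *\<^sub>R y) = (1 - t) * f x + t * f y) \<and>
        (\<forall>w\<in>vertices X. f w = (if w = v then 1 else 0)) \<and>
        (\<forall>x. x \<notin> \<Union>X \<longrightarrow> f x = 0))"

text \<open>The exterior product of covectors, normalised so that \<open>dx\<^sub>1 \<and> \<dots> \<and> dx\<^sub>k\<close> is \<open>1\<close> on
  \<open>(e\<^sub>1, \<dots>, e\<^sub>k)\<close>: the determinant of the matrix of values.\<close>

definition wedge :: "('a \<Rightarrow> real) list \<Rightarrow> 'a list \<Rightarrow> real" where
  "wedge \<beta>s hs =
     (\<Sum>p | p permutes {..<length \<beta>s}.
        of_int (sign p) * (\<Prod>j<length \<beta>s. (\<beta>s ! j) (hs ! p j)))"

text \<open>The differential of a hat function restricted to \<open>\<tau>\<close> is the derivative within \<open>\<tau>\<close>; on tangent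
  vectors of \<open>\<tau>\<close> it does not depend on the choice made by \<^const>\<open>frechet_derivative\<close>.\<close>

definition whitney_form :: "'a::euclidean_space set set \<Rightarrow> 'a list \<Rightarrow> 'a form" where
  "whitney_form X \<sigma> \<tau> x hs =
     fact (length \<sigma> - 1) *
     (\<Sum>i<length \<sigma>. (-1) ^ i * hat X (\<sigma> ! i) x *
        wedge (map (\<lambda>v. frechet_derivative (hat X v) (at x within \<tau>)) (delete_nth i \<sigma>)) hs)"

definition whitney_map ::
  "'a::euclidean_space set set \<Rightarrow> 'a rel \<Rightarrow> nat \<Rightarrow> ('a list \<Rightarrow> real) \<Rightarrow> 'a form" where
  "whitney_map X r k \<alpha> =
     (\<lambda>\<tau> x hs. \<Sum>\<sigma>\<in>simplices X r k. \<alpha> \<sigma> * whitney_form X \<sigma> \<tau> x hs)"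

definition whitney_space ::
  "'a::euclidean_space set set \<Rightarrow> 'a rel \<Rightarrow> nat \<Rightarrow> 'a form set" where
  "whitney_space X r k =
     {(\<lambda>\<tau> x hs. \<Sum>\<sigma>\<in>simplices X r k. c \<sigma> * whitney_form X \<sigma> \<tau> x hs) | c. True}"


subsection \<open>Integration\<close>

text \<open>The simplex of \<open>X\<close> whose relative interior contains \<open>x\<close>.\<close>

definition carrier_simplex :: "'a::euclidean_space set set \<Rightarrow> 'a \<Rightarrow> 'a set" where
  "carrier_simplex X x = (THE \<tau>. \<tau> \<in> X \<and> x \<in> rel_interior \<tau>)"

text \<open>Frechet differentiability at \<open>q\<close> of a map on the standard \<open>k\<close>-simplex; the linear map \<open>DT(q)\<close>
  is given by the images \<open>D i\<close> of the unit vectors \<open>e\<^sub>i\<close>, for \<open>i\<close> in \<^term>\<open>{1..k}\<close>.\<close>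

definition has_total_derivative ::
  "nat \<Rightarrow> ((nat \<Rightarrow> real) \<Rightarrow> 'a::real_normed_vector) \<Rightarrow> (nat \<Rightarrow> 'a) \<Rightarrow> (nat \<Rightarrow> real) \<Rightarrow> bool" where
  "has_total_derivative k T D q \<longleftrightarrow>
     (\<forall>\<epsilon>>0. \<exists>\<delta>>0. \<forall>x\<in>ref_simplex k. euclid_dist k x q < \<delta> \<longrightarrow>
        norm (T x - T q - (\<Sum>i=1..k. (x i - q i) *\<^sub>R D i)) \<le> \<epsilon> * euclid_dist k x q)"

definition total_derivative ::
  "nat \<Rightarrow> ((nat \<Rightarrow> real) \<Rightarrow> 'a::real_normed_vector) \<Rightarrow> (nat \<Rightarrow> real) \<Rightarrow> (nat \<Rightarrow> 'a)" where
  "total_derivative k T q = (SOME D. has_total_derivative k T D q)"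

text \<open>The coefficient of \<open>T\<^sup>*u\<close> with respect to \<open>dx\<^sub>1 \<and> \<dots> \<and> dx\<^sub>k\<close>.\<close>

definition pullback ::
  "'a::euclidean_space set set \<Rightarrow> nat \<Rightarrow> ((nat \<Rightarrow> real) \<Rightarrow> 'a) \<Rightarrow> 'a form \<Rightarrow> (nat \<Rightarrow> real) \<Rightarrow> real" where
  "pullback X k T u q =
     u (carrier_simplex X (T q)) (T q) (map (total_derivative k T q) [1..<Suc k])"

text \<open>The completed product of the Borel-Lebesgue measures is Lebesgue measure on \<open>\<real>\<^sup>k\<close>; completeness
  makes the value on null sets irrelevant.  For \<open>k = 0\<close> it is the unit mass at the only point, so
  that integration is evaluation.\<close>

definition integral_simplex ::
  "'a::euclidean_space set set \<Rightarrow> nat \<Rightarrow> ((nat \<Rightarrow> real) \<Rightarrow> 'a) \<Rightarrow> 'a form \<Rightarrow> real" where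
  "integral_simplex X k T u =
     (LINT q:ref_simplex k|completion (\<Pi>\<^sub>M i\<in>{1..k}. lborel). pullback X k T u q)"

definition integral_chain ::
  "'a::euclidean_space set set \<Rightarrow> nat \<Rightarrow> (((nat \<Rightarrow> real) \<Rightarrow> 'a) \<Rightarrow>\<^sub>0 real) \<Rightarrow> 'a form \<Rightarrow> real" where
  "integral_chain X k c u =
     (\<Sum>T\<in>Poly_Mapping.keys c. Poly_Mapping.lookup c T * integral_simplex X k T u)"

definition de_rham_map ::
  "'a::euclidean_space set set \<Rightarrow> 'a rel \<Rightarrow> nat \<Rightarrow> 'a form \<Rightarrow> ('a list \<Rightarrow> real)" where
  "de_rham_map X r k u =
     (\<lambda>\<sigma>. if \<sigma> \<in> simplices X r k then integral_simplex X k (lin_simplex \<sigma>) u else 0)"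


subsection \<open>The operators induced by a cone operator\<close>

definition whitney_cone_operator ::
  "'a::euclidean_space set set \<Rightarrow> 'a rel \<Rightarrow>
   (nat \<Rightarrow> ('a list \<Rightarrow>\<^sub>0 real) \<Rightarrow> (((nat \<Rightarrow> real) \<Rightarrow> 'a) \<Rightarrow>\<^sub>0 real)) \<Rightarrow>
   nat \<Rightarrow> 'a form \<Rightarrow> 'a form" where
  "whitney_cone_operator X r Co k u =
     (THE w. w \<in> whitney_space X r (k - 1) \<and>
        (\<forall>\<sigma>\<in>simplices X r (k - 1).
           integral_simplex X (k - 1) (lin_simplex \<sigma>) w =
           integral_chain X k (Co (k - 1) (Poly_Mapping.single \<sigma> 1)) u))"

definition cochain_cone_operator ::
  "'a::euclidean_space set set \<Rightarrow> 'a rel \<Rightarrow>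
   (nat \<Rightarrow> ('a list \<Rightarrow>\<^sub>0 real) \<Rightarrow> (((nat \<Rightarrow> real) \<Rightarrow> 'a) \<Rightarrow>\<^sub>0 real)) \<Rightarrow>
   nat \<Rightarrow> ('a list \<Rightarrow> real) \<Rightarrow> ('a list \<Rightarrow> real)" where
  "cochain_cone_operator X r Co k \<alpha> =
     de_rham_map X r (k - 1) (whitney_cone_operator X r Co k (whitney_map X r k \<alpha>))"

text \<open>The constant \<open>0\<close>-cochain whose value is that of the Whitney \<open>0\<close>-form of \<open>\<alpha>\<close> at the point \<open>a\<close>.\<close>

definition pi_W ::
  "'a::euclidean_space set set \<Rightarrow> 'a rel \<Rightarrow> 'a \<Rightarrow> ('a list \<Rightarrow> real) \<Rightarrow> ('a list \<Rightarrow> real)" where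
  "pi_W X r a \<alpha> =
     (\<lambda>\<sigma>. if \<sigma> \<in> simplices X r 0 then whitney_map X r 0 \<alpha> (carrier_simplex X a) a [] else 0)"

end

theory Submission
  imports Defs "Jordan_Normal_Form.Determinant"
begin

text \<open>
  The crux is Stokes' theorem for a Whitney form \<open>u\<close> and a Lipschitz singular simplex \<open>T\<close>. The hat
  functions along \<open>T\<close> are Lipschitz on the standard simplex, hence differentiable almost everywhere by
  Rademacher's theorem, and at such points the pullback of the Whitney form of \<open>[v\<^sub>0, \<dots>, v\<^sub>k]\<close> is \<open>k!\<close>
  times the determinant with rows \<open>(f\<^sub>b, \<partial>\<^sub>1f\<^sub>b, \<dots>, \<partial>\<^sub>kf\<^sub>b)\<close>, where \<open>f\<^sub>b\<close> is the hat function of \<open>v\<^sub>b\<close> along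
  \<open>T\<close>. At a point where a nonnegative hat function vanishes, its gradient vanishes as well, so only the
  vertices of the simplex that carries \<open>T q\<close> contribute.

  For such determinants of arbitrary Lipschitz functions, Stokes' theorem is obtained by replacing each
  function by its Bernstein polynomial in barycentric coordinates. Bernstein polynomials have bounded
  first derivatives that converge wherever the function is differentiable, and they are compatible with
  restriction to faces; so dominated convergence applies on the simplex and on each face. As homogeneous
  polynomials they satisfy Stokes' theorem by Euler's relation, Piola's identity and the Dirichlet
  integrals of monomials.

  Summation over all vertices, with the hat functions adding up to \<open>1\<close>, shows that the Whitney map
  commutes with the differentials, and the de Rham map inverts the Whitney map. Hence both assertions
  result from integrating \<open>W \<alpha>\<close> over the two sides of the cone identities.
\<close>

text \<open>The faces of the standard simplex are null sets, so differentiability almost everywhere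
  on the simplex says nothing about the integrands on the boundary; smoothing by convolution would
  give convergence in the interior only. The approximation has to be one whose tangential
  derivatives on a face depend on the values on that face alone, which dictates the choice of
  Bernstein polynomials: on each face, Rademacher's theorem is applied anew to the restricted
  functions. Since the derivatives are bounded and converge pointwise almost everywhere, their
  determinants converge without any weak-continuity argument.

  A second obstacle is that \<open>T\<close> may cross simplices of \<open>X\<close> on a wild set,
  so its domain cannot be cut into pieces with smooth integrands. Expressing everything by the
  functions \<open>hat X v\<close> along \<open>T\<close> removes it: they are Lipschitz on the
  whole domain, and the rows of vertices outside the carrier vanish by themselves. The combinatorics
  of \<open>X\<close> enters where vertices inside one carrier must span a simplex of
  \<open>X\<close>.

  Homogeneous coordinates treat all faces alike and reduce the exact identities to
  monomials.\<close>

section \<open>Lipschitz functions on the line\<close>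

text \<open>The covering theorem for balls asks only that a small ball contain the point, not that
  it be centred there. Intervals with \<open>x\<close> as an endpoint are therefore allowed, which
  is what difference quotients at \<open>x\<close> provide.\<close>

lemma vitali_intervals:
  fixes S T :: "real set" and P :: "real \<Rightarrow> real \<Rightarrow> bool"
  assumes "open T" "S \<subseteq> T"
    and *: "\<And>x \<delta>. x \<in> S \<Longrightarrow> \<delta> > 0 \<Longrightarrow> \<exists>a b. a < b \<and> a \<le> x \<and> x \<le> b \<and> b - a < \<delta> \<and> P a b"
  obtains C :: "(real \<times> real) set" where "countable C"
    "\<And>a b. (a, b) \<in> C \<Longrightarrow> a < b \<and> {a..b} \<subseteq> T \<and> P a b"
    "disjoint_family_on (\<lambda>(a, b). {a..b}) C"
    "negligible (S - (\<Union>(a, b)\<in>C. {a..b}))"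
proof -
  define K where "K = {(a, b). a < b \<and> {a..b} \<subseteq> T \<and> P a b}"
  define m r where "m = (\<lambda>(a::real, b). (a + b) / 2)" and "r = (\<lambda>(a::real, b). (b - a) / 2)"
  have cb: "cball (m i) (r i) = (case i of (a, b) \<Rightarrow> {a..b})" for i
  proof (cases i)
    case (Pair a b)
    have "(a + b) / 2 - (b - a) / 2 = a" "(a + b) / 2 + (b - a) / 2 = b" by argo+
    then show ?thesis by (simp add: Pair m_def r_def cball_eq_atLeastAtMost)
  qed
  obtain C where C: "countable C" "C \<subseteq> K"
     "pairwise (\<lambda>i j. disjnt (cball (m i) (r i)) (cball (m j) (r j))) C"
     "negligible (S - (\<Union>i\<in>C. cball (m i) (r i)))"
  proof (rule Vitali_covering_theorem_cballs[of K r S m])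
    show "0 < r i" if "i \<in> K" for i using that by (auto simp: K_def r_def)
    show "\<exists>i. i \<in> K \<and> x \<in> cball (m i) (r i) \<and> r i < d" if "x \<in> S" "0 < d" for x d
    proof -
      obtain e where e: "e > 0" "ball x e \<subseteq> T" using assms(1)[unfolded open_contains_ball, rule_format, OF subsetD[OF assms(2) \<open>x \<in> S\<close>]] by blast
      obtain a b where ab: "a < b" "a \<le> x" "x \<le> b" "b - a < min d e" "P a b"
        using *[OF \<open>x \<in> S\<close>, of "min d e"] e \<open>0 < d\<close> by auto
      have "{a..b} \<subseteq> T" using ab e by (auto simp: dist_real_def subset_iff)
      moreover have "x \<in> cball (m (a, b)) (r (a, b))" unfolding cb using ab by simp
      ultimately show ?thesis using ab \<open>0 < d\<close>
        by (intro exI[of _ "(a, b)"]) (auto simp: K_def r_def)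
    qed
  qed
  show thesis
  proof (rule that[OF C(1)])
    show "a < b \<and> {a..b} \<subseteq> T \<and> P a b" if "(a, b) \<in> C" for a b using that C(2) by (auto simp: K_def)
    show "disjoint_family_on (\<lambda>(a, b). {a..b}) C"
      using C(3) unfolding disjoint_family_on_def pairwise_def disjnt_def cb by auto
    show "negligible (S - (\<Union>(a, b)\<in>C. {a..b}))" using C(4) unfolding cb by auto
  qed
qed

text \<open>Lebesgue's argument: \<open>S\<close> is covered by intervals of slope below p inside an
  open set of almost the same measure, and inside their interiors once more by intervals of slope
  above q. With \<mu> the Stieltjes measure of F, this gives q |S| \<le> \<mu>(\<open>W\<close>)
  \<le> \<mu>(\<open>U\<close>) \<le> p (|S| + e) for every e > 0, which forces |S| = 0. Boundedness
  of \<open>S\<close> keeps |S| finite.\<close>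

lemma mono_oscillation_null:
  fixes F :: "real \<Rightarrow> real" and p q :: real
  assumes mono: "\<And>x y. x \<le> y \<Longrightarrow> F x \<le> F y" and cont: "continuous_on UNIV F" and pq: "0 < p" "p < q"
    and S: "S \<in> sets borel" "S \<subseteq> {-N<..<N}"
    and lo: "\<And>x \<delta>. x \<in> S \<Longrightarrow> \<delta> > 0 \<Longrightarrow> \<exists>a b. a < b \<and> a \<le> x \<and> x \<le> b \<and> b - a < \<delta> \<and> F b - F a < p * (b - a)"
    and hi: "\<And>x \<delta>. x \<in> S \<Longrightarrow> \<delta> > 0 \<Longrightarrow> \<exists>a b. a < b \<and> a \<le> x \<and> x \<le> b \<and> b - a < \<delta> \<and> F b - F a > q * (b - a)"
  shows "emeasure lborel S = 0"
proof -
  define \<mu> where "\<mu> = interval_measure F"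
  have [simp]: "sets \<mu> = sets borel" by (simp add: \<mu>_def)
  have \<mu>: "emeasure \<mu> {a..b} = ennreal (F b - F a)" if "a \<le> b" for a b
    unfolding \<mu>_def by (rule emeasure_interval_measure_Icc[OF that]) (use mono cont in auto)
  have UN: "emeasure M (\<Union>(a, b)\<in>C. {a..b}) = (\<integral>\<^sup>+i. emeasure M (case i of (a, b) \<Rightarrow> {a..b}) \<partial>count_space C)"
    if "sets M = sets borel" "countable C" "disjoint_family_on (\<lambda>(a, b). {a..b}) C" for M :: "real measure" and C
    using that by (intro emeasure_UN_countable) (auto split: prod.splits)
  have bound: "ennreal q * emeasure lborel S \<le> ennreal p * (emeasure lborel S + ennreal e)" if e: "e > 0" for e
  proof -
    have "S \<in> sets lebesgue" using S by (simp add: sets_completionI_sets)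
    then obtain T where T: "open T" "S \<subseteq> T" "T - S \<in> lmeasurable" "emeasure lebesgue (T - S) < ennreal e"
      using sets_lebesgue_outer_open[OF _ e] by metis
    have "emeasure lborel T = emeasure lborel S + emeasure lborel (T - S)"
      using S T by (subst plus_emeasure) (auto simp: Un_absorb1)
    also have "emeasure lborel (T - S) = emeasure lebesgue (T - S)"
      using S T by simp
    finally have TS: "emeasure lborel T \<le> emeasure lborel S + ennreal e"
      using T(4) by (simp add: add_left_mono)
    obtain C where C: "countable C" "\<And>a b. (a, b) \<in> C \<Longrightarrow> a < b \<and> {a..b} \<subseteq> T \<and> F b - F a < p * (b - a)"
        "disjoint_family_on (\<lambda>(a, b). {a..b}) C" "negligible (S - (\<Union>(a, b)\<in>C. {a..b}))"
      using vitali_intervals[OF T(1,2), of "\<lambda>a b. F b - F a < p * (b - a)"] lo by metis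
    define U where "U = (\<Union>(a, b)\<in>C. {a..b})"
    \<comment> \<open>The second covering needs an open set to be contained in; removing the
      endpoints costs a countable set only.\<close>
    define V where "V = (\<Union>(a, b)\<in>C. {a<..<b})"
    have U[measurable]: "U \<in> sets borel" unfolding U_def using C(1) by (intro sets.countable_UN'') auto
    have oV: "open V" unfolding V_def by auto
    have VU: "V \<subseteq> U" unfolding U_def V_def by (rule UN_mono) auto
    have UT: "U \<subseteq> T" unfolding U_def using C(2) by fast
    have UV: "countable (U - V)"
    proof (rule countable_subset)
      show "U - V \<subseteq> fst ` C \<union> snd ` C" unfolding U_def V_def by force
      show "countable (fst ` C \<union> snd ` C)" using C(1) by simp
    qed
    have "emeasure \<mu> U \<le> (\<integral>\<^sup>+i. ennreal p * emeasure lborel (case i of (a, b) \<Rightarrow> {a..b}) \<partial>count_space C)"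
      unfolding U_def UN[OF \<open>sets \<mu> = sets borel\<close> C(1,3)]
    proof (rule nn_integral_mono)
      fix i assume i: "i \<in> space (count_space C)"
      obtain a b where ab: "i = (a, b)" by (cases i)
      then have "(a, b) \<in> C" using i by simp
      note D = C(2)[OF this]
      then show "emeasure \<mu> (case i of (a, b) \<Rightarrow> {a..b}) \<le> ennreal p * emeasure lborel (case i of (a, b) \<Rightarrow> {a..b})"
        unfolding ab using pq by (simp add: \<mu> ennreal_mult[symmetric] ennreal_leI)
    qed
    also have "\<dots> = ennreal p * emeasure lborel U"
      unfolding U_def UN[OF sets_lborel C(1,3)] by (rule nn_integral_cmult) simp
    also have "\<dots> \<le> ennreal p * emeasure lborel T"
      using UT T(1) by (intro mult_left_mono emeasure_mono) auto
    finally have 1: "emeasure \<mu> U \<le> ennreal p * (emeasure lborel S + ennreal e)"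
      using TS by (meson dual_order.trans mult_left_mono zero_le)
    obtain C' where C': "countable C'" "\<And>a b. (a, b) \<in> C' \<Longrightarrow> a < b \<and> {a..b} \<subseteq> V \<and> F b - F a > q * (b - a)"
        "disjoint_family_on (\<lambda>(a, b). {a..b}) C'" "negligible (S \<inter> V - (\<Union>(a, b)\<in>C'. {a..b}))"
      using vitali_intervals[OF oV, of "S \<inter> V" "\<lambda>a b. F b - F a > q * (b - a)"] hi by (metis Int_iff inf_le2)
    define W where "W = (\<Union>(a, b)\<in>C'. {a..b})"
    have W[measurable]: "W \<in> sets borel" unfolding W_def using C'(1) by (intro sets.countable_UN'') auto
    have WV: "W \<subseteq> V" unfolding W_def using C'(2) by fast
    have "negligible (S - W)"
    proof (rule negligible_subset)
      show "S - W \<subseteq> (S - U) \<union> ((U - V) \<union> (S \<inter> V - W))" using WV VU by auto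
      show "negligible ((S - U) \<union> ((U - V) \<union> (S \<inter> V - W)))"
        using C(4) C'(4) countable_imp_null_set_lborel[OF UV] unfolding U_def[symmetric] W_def[symmetric]
        by (intro negligible_Un) (auto simp: negligible_iff_null_sets null_sets_completionI)
    qed
    then have "emeasure lborel (S - W) = 0"
      using S W negligible_iff_emeasure0[of "S - W"] by (simp add: sets_completionI_sets)
    then have "emeasure lborel S \<le> emeasure lborel W"
      using S W emeasure_mono[of S "(S - W) \<union> W" lborel] emeasure_subadditive[of "S - W" lborel W] by force
    then have "ennreal q * emeasure lborel S \<le> ennreal q * emeasure lborel W" by (rule mult_left_mono) simp
    also have "\<dots> = (\<integral>\<^sup>+i. ennreal q * emeasure lborel (case i of (a, b) \<Rightarrow> {a..b}) \<partial>count_space C')"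
      unfolding W_def UN[OF sets_lborel C'(1,3)] by (rule nn_integral_cmult[symmetric]) simp
    also have "\<dots> \<le> emeasure \<mu> W"
      unfolding W_def UN[OF \<open>sets \<mu> = sets borel\<close> C'(1,3)]
    proof (rule nn_integral_mono)
      fix i assume i: "i \<in> space (count_space C')"
      obtain a b where ab: "i = (a, b)" by (cases i)
      then have "(a, b) \<in> C'" using i by simp
      note D = C'(2)[OF this]
      then show "ennreal q * emeasure lborel (case i of (a, b) \<Rightarrow> {a..b}) \<le> emeasure \<mu> (case i of (a, b) \<Rightarrow> {a..b})"
        unfolding ab using pq by (simp add: \<mu> ennreal_mult[symmetric] ennreal_leI)
    qed
    also have "\<dots> \<le> emeasure \<mu> U" using WV VU by (intro emeasure_mono) auto
    finally show ?thesis using 1 by simp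
  qed
  have "emeasure lborel S \<le> emeasure lborel {-N<..<N}" using S by (intro emeasure_mono) auto
  also have "\<dots> < \<infinity>" by (cases "N \<ge> -N") auto
  finally have "emeasure lborel S \<noteq> \<infinity>" by simp
  then obtain s where s: "s \<ge> 0" "emeasure lborel S = ennreal s" by (cases "emeasure lborel S") auto
  have "q * s \<le> p * (s + e)" if "e > 0" for e
    using bound[OF that] s pq that by (simp add: ennreal_mult[symmetric] ennreal_plus[symmetric] del: ennreal_plus)
  then have "(q - p) * s \<le> p * e" if "e > 0" for e using that by (simp add: algebra_simps)
  then have "(q - p) * s \<le> p * (e / p)" if "e > 0" for e using that pq by (meson divide_pos_pos)
  then have "(q - p) * s \<le> 0 + e" if "e > 0" for e using that pq by simp
  then have "(q - p) * s \<le> 0" by (rule field_le_epsilon)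
  then have "s \<le> 0" using pq by (simp add: mult_le_0_iff)
  then show ?thesis using s by simp
qed

text \<open>Adding L x makes f nondecreasing with difference quotients in [0, 2 L]. Where they have
  no limit, they fall below p and rise above q at arbitrarily small scales for some rational p < q,
  and each of these countably many sets is null.\<close>

lemma lipschitz_differentiable_ae:
  fixes f :: "real \<Rightarrow> real"
  assumes f: "L-lipschitz_on UNIV f"
  shows "AE x in lborel. \<exists>d. (f has_field_derivative d) (at x)"
proof -
  define F where "F x = f x + L * x" for x
  have L: "L \<ge> 0" using f by (rule lipschitz_on_nonneg)
  have fL: "\<bar>f y - f x\<bar> \<le> L * \<bar>y - x\<bar>" for x y
    using lipschitz_onD[OF f, of y x] by (simp add: dist_real_def)
  have mono: "F x \<le> F y" if "x \<le> y" for x y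
    using fL[of y x] that unfolding F_def by (simp add: algebra_simps abs_le_iff)
  have cont: "continuous_on UNIV F"
    unfolding F_def using lipschitz_on_continuous_on[OF f] by (intro continuous_intros)
  define Q where "Q x h = (F (x + h) - F x) / h" for x h
  have Qb: "0 \<le> Q x h \<and> Q x h \<le> 2 * L" if "h \<noteq> 0" for x h
  proof -
    have "F (x + h) - F x = f (x + h) - f x + L * h" by (simp add: F_def algebra_simps)
    then show ?thesis using fL[of "x + h" x] that unfolding Q_def
      by (cases "h > 0") (auto simp: divide_simps abs_le_iff algebra_simps)
  qed
  define E where "E p q N = {-real N<..<real N} \<inter>
      (\<Inter>n::nat. {x. \<exists>h. 0 < \<bar>h\<bar> \<and> \<bar>h\<bar> < 1 / Suc n \<and> Q x h < p} \<inter> {x. \<exists>h. 0 < \<bar>h\<bar> \<and> \<bar>h\<bar> < 1 / Suc n \<and> Q x h > q})"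
    for p q :: real and N :: nat
  have op: "open {x. \<exists>h. P h \<and> h \<noteq> 0 \<and> Q x h < p}" "open {x. \<exists>h. P h \<and> h \<noteq> 0 \<and> Q x h > p}" for P p
  proof -
    have c: "continuous_on UNIV (\<lambda>x. Q x h)" for h
      unfolding Q_def by (cases "h = 0") (auto intro!: continuous_intros continuous_on_compose2[OF cont])
    have "{x. \<exists>h. P h \<and> h \<noteq> 0 \<and> Q x h < p} = (\<Union>h\<in>{h. P h \<and> h \<noteq> 0}. {x. Q x h < p})"
        "{x. \<exists>h. P h \<and> h \<noteq> 0 \<and> Q x h > p} = (\<Union>h\<in>{h. P h \<and> h \<noteq> 0}. {x. p < Q x h})" by auto
    then show "open {x. \<exists>h. P h \<and> h \<noteq> 0 \<and> Q x h < p}" "open {x. \<exists>h. P h \<and> h \<noteq> 0 \<and> Q x h > p}"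
      using c by (auto intro!: open_UN open_Collect_less continuous_intros)
  qed
  have meas: "E p q N \<in> sets borel" for p q N
    unfolding E_def zero_less_abs_iff
    using op(1)[of "\<lambda>h. \<bar>h\<bar> < 1 / real (Suc _)" p] op(2)[of "\<lambda>h. \<bar>h\<bar> < 1 / real (Suc _)" q]
    by (intro sets.Int sets.countable_INT'' borel_open) (auto simp: conj_ac)
  have null: "emeasure lborel (E p q N) = 0" if "p < q" for p q N
  proof (cases "p > 0")
    case False
    have "\<not> Q x h < p" if "0 < \<bar>h\<bar>" for x h using Qb[of h x] False that by auto
    then have "E p q N = {}" unfolding E_def by blast
    then show ?thesis by simp
  next
    case True
    have dq: "F (max x (x + h)) - F (min x (x + h)) = Q x h * (max x (x + h) - min x (x + h))"
        "max x (x + h) - min x (x + h) = \<bar>h\<bar>" if "h \<noteq> 0" for x h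
      using that by (auto simp: Q_def max_def min_def field_simps)
    show ?thesis
    proof (rule mono_oscillation_null[OF mono cont True that meas])
      show "E p q N \<subseteq> {-real N<..<real N}" by (auto simp: E_def)
      fix x \<delta> :: real assume x: "x \<in> E p q N" and "\<delta> > 0"
      obtain n :: nat where n: "1 / Suc n < \<delta>" using nat_approx_posE[OF \<open>\<delta> > 0\<close>] by blast
      have *: "\<exists>h. 0 < \<bar>h\<bar> \<and> \<bar>h\<bar> < 1 / Suc n \<and> Q x h < p" "\<exists>h. 0 < \<bar>h\<bar> \<and> \<bar>h\<bar> < 1 / Suc n \<and> Q x h > q"
        using x unfolding E_def by blast+
      obtain h where "h \<noteq> 0" "\<bar>h\<bar> < 1 / Suc n" "Q x h < p" using *(1) zero_less_abs_iff by blast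
      then show "\<exists>a b. a < b \<and> a \<le> x \<and> x \<le> b \<and> b - a < \<delta> \<and> F b - F a < p * (b - a)"
        using n dq[of h x] by (intro exI[of _ "min x (x + h)"] exI[of _ "max x (x + h)"]) auto
      obtain h where "h \<noteq> 0" "\<bar>h\<bar> < 1 / Suc n" "Q x h > q" using *(2) zero_less_abs_iff by blast
      then show "\<exists>a b. a < b \<and> a \<le> x \<and> x \<le> b \<and> b - a < \<delta> \<and> F b - F a > q * (b - a)"
        using n dq[of h x] by (intro exI[of _ "min x (x + h)"] exI[of _ "max x (x + h)"]) auto
    qed
  qed
  have "AE x in lborel. \<forall>p\<in>\<rat>. \<forall>q\<in>\<rat>. \<forall>N. p < q \<longrightarrow> x \<notin> E p q N"
    using null meas by (intro AE_ball_countable'[OF _ countable_rat] AE_all_countable[THEN iffD2] allI AE_impI AE_not_in)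
      (auto simp: null_sets_def)
  then show ?thesis
  proof eventually_elim
    case (elim x)
    obtain N :: nat where N: "\<bar>x\<bar> < real N" using reals_Archimedean2 by blast
    let ?l = "Liminf (at 0) (\<lambda>h. ereal (Q x h))" and ?u = "Limsup (at 0) (\<lambda>h. ereal (Q x h))"
    have "?l = ?u"
    proof (rule ccontr)
      assume "?l \<noteq> ?u"
      moreover have "?l \<le> ?u" by (intro Liminf_le_Limsup) simp
      ultimately have "?l < ?u" by simp
      then obtain p where p: "?l < ereal (of_rat p)" "ereal (of_rat p) < ?u" using ereal_dense3 by blast
      then obtain q where q: "ereal (of_rat p) < ereal (of_rat q)" "ereal (of_rat q) < ?u" using ereal_dense3 by blast
      have "\<exists>h. h \<noteq> 0 \<and> \<bar>h\<bar> < d \<and> Q x h < of_rat p" if "d > 0" for d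
      proof (rule ccontr)
        assume "\<not> (\<exists>h. h \<noteq> 0 \<and> \<bar>h\<bar> < d \<and> Q x h < of_rat p)"
        then have "\<forall>\<^sub>F h in at 0. ereal (of_rat p) \<le> ereal (Q x h)"
          using that unfolding eventually_at by (intro exI[of _ d]) (auto simp: not_less dist_real_def)
        then show False using Liminf_bounded p(1) by (metis leD)
      qed
      moreover have "\<exists>h. h \<noteq> 0 \<and> \<bar>h\<bar> < d \<and> Q x h > of_rat q" if "d > 0" for d
      proof (rule ccontr)
        assume "\<not> (\<exists>h. h \<noteq> 0 \<and> \<bar>h\<bar> < d \<and> Q x h > of_rat q)"
        then have "\<forall>\<^sub>F h in at 0. ereal (Q x h) \<le> ereal (of_rat q)"
          using that unfolding eventually_at by (intro exI[of _ d]) (auto simp: not_less dist_real_def)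
        then show False using Limsup_bounded q(2) by (metis leD)
      qed
      ultimately have "x \<in> E (of_rat p) (of_rat q) N" using N unfolding E_def by (auto simp: abs_less_iff)
      then show False using elim q(1) by (auto simp: Rats_def)
    qed
    moreover have ev: "\<forall>\<^sub>F h in at 0. 0 \<le> Q x h \<and> Q x h \<le> 2 * L"
      unfolding eventually_at using Qb by (intro exI[of _ 1]) auto
    have "0 \<le> ?l" using ev by (intro Liminf_bounded) (auto elim: eventually_mono)
    moreover have "?u \<le> ereal (2 * L)" using ev by (intro Limsup_bounded) (auto elim!: eventually_mono)
    ultimately have "0 \<le> ?u" "?u \<le> ereal (2 * L)" "?l = ?u" by simp_all
    then obtain d where d: "?l = ereal d" by (cases ?u) auto
    have "((\<lambda>h. ereal (Q x h)) \<longlongrightarrow> ereal d) (at 0)"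
      using d \<open>?l = ?u\<close> by (intro Liminf_eq_Limsup) auto
    then have "((\<lambda>h. Q x h) \<longlongrightarrow> d) (at 0)" by simp
    then have F: "(F has_field_derivative d) (at x)" unfolding DERIV_def Q_def .
    have "((\<lambda>x. F x - L * x) has_field_derivative (d - L * 1)) (at x)"
      by (intro DERIV_diff[OF F]) (auto intro!: derivative_eq_intros)
    then show ?case by (auto simp: F_def)
  qed
qed

section \<open>Rademacher's theorem\<close>

abbreviation lpi :: "'i set \<Rightarrow> ('i \<Rightarrow> real) measure" where
  "lpi I \<equiv> Pi\<^sub>M I (\<lambda>_. lborel)"

lemma product_sigma_finite_lborel: "product_sigma_finite (\<lambda>_::'i. lborel :: real measure)"
  by (rule product_sigma_finite.intro) (rule sigma_finite_lborel)

text \<open>Arguments are arbitrary functions, not only points of the product space: then f cannot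
  depend on coordinates outside I, and x + t v may be formed without restricting it to I.\<close>

definition lip1 :: "'i set \<Rightarrow> real \<Rightarrow> (('i \<Rightarrow> real) \<Rightarrow> real) \<Rightarrow> bool" where
  "lip1 I L f \<longleftrightarrow> (\<forall>x y. \<bar>f x - f y\<bar> \<le> L * (\<Sum>i\<in>I. \<bar>x i - y i\<bar>))"

lemma lip1D: "lip1 I L f \<Longrightarrow> \<bar>f x - f y\<bar> \<le> L * (\<Sum>i\<in>I. \<bar>x i - y i\<bar>)"
  by (simp add: lip1_def)

lemma lip1_cong: "lip1 I L f \<Longrightarrow> (\<And>i. i \<in> I \<Longrightarrow> x i = y i) \<Longrightarrow> f x = f y"
  using lip1D[of I L f x y] by simp

lemma lip1_tendsto:
  assumes f: "lip1 I L f" and X: "\<And>i. i \<in> I \<Longrightarrow> ((\<lambda>j. X j i) \<longlongrightarrow> x i) F"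
  shows "((\<lambda>j. f (X j)) \<longlongrightarrow> f x) F"
proof (rule Lim_null[THEN iffD2], rule Lim_null_comparison)
  show "\<forall>\<^sub>F j in F. norm (f (X j) - f x) \<le> L * (\<Sum>i\<in>I. \<bar>X j i - x i\<bar>)"
    using lip1D[OF f] by simp
  have "((\<lambda>j. L * (\<Sum>i\<in>I. \<bar>X j i - x i\<bar>)) \<longlongrightarrow> L * (\<Sum>i\<in>I. \<bar>x i - x i\<bar>)) F"
    by (intro tendsto_intros X)
  then show "((\<lambda>j. L * (\<Sum>i\<in>I. \<bar>X j i - x i\<bar>)) \<longlongrightarrow> 0) F" by simp
qed

text \<open>Such a function is continuous for the product topology on all functions, whose Borel
  sets are the product sigma-algebra when the index type is countable. The map \<open>E\<close>,
  which puts 0 outside I, carries measurability over to the extensional points.\<close>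

lemma lip1_measurable:
  fixes f :: "('i::countable \<Rightarrow> real) \<Rightarrow> real"
  assumes f: "lip1 I L f"
  shows "f \<in> borel_measurable (lpi I)"
proof -
  define E where "E = (\<lambda>(x::'i \<Rightarrow> real) i. if i \<in> I then x i else 0)"
  have "continuous_on UNIV f"
    unfolding continuous_on_def
    by (intro ballI lip1_tendsto[OF f] continuous_on_product_coordinates[unfolded continuous_on_def, rule_format, OF UNIV_I])
  then have "f \<in> borel_measurable (Pi\<^sub>M UNIV (\<lambda>_. borel))"
    using borel_measurable_continuous_onI measurable_cong_sets[OF sets_PiM_equal_borel refl] by blast
  moreover have "E \<in> lpi I \<rightarrow>\<^sub>M Pi\<^sub>M UNIV (\<lambda>_. borel)"
  proof (rule measurable_PiM_single')
    fix i :: 'i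
    show "(\<lambda>x. E x i) \<in> lpi I \<rightarrow>\<^sub>M borel" unfolding E_def by (cases "i \<in> I") auto
  qed auto
  ultimately have "(\<lambda>x. f (E x)) \<in> borel_measurable (lpi I)" by measurable
  moreover have "f (E x) = f x" for x by (rule lip1_cong[OF f]) (simp add: E_def)
  ultimately show ?thesis by simp
qed

lemma distr_lpi_translation:
  assumes I: "finite I"
  shows "distr (lpi I) (lpi I) (\<lambda>x. \<lambda>i\<in>I. x i + v i) = lpi I"
proof -
  interpret product_sigma_finite "\<lambda>_. lborel :: real measure" by (rule product_sigma_finite_lborel)
  show ?thesis
  proof (rule PiM_eqI[OF I])
    fix A assume A: "\<And>i. i \<in> I \<Longrightarrow> A i \<in> sets (lborel :: real measure)"
    have pre: "(\<lambda>x. \<lambda>i\<in>I. x i + v i) -` (Pi\<^sub>E I A) \<inter> space (lpi I) = Pi\<^sub>E I (\<lambda>i. (+) (v i) -` A i)"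
      by (auto simp: space_PiM PiE_iff add.commute)
    have m: "(+) (v i) -` A i \<in> sets borel" if "i \<in> I" for i
      using measurable_sets[of "(+) (v i)" borel borel "A i"] A[OF that] by simp
    have "emeasure (distr (lpi I) (lpi I) (\<lambda>x. \<lambda>i\<in>I. x i + v i)) (Pi\<^sub>E I A) = emeasure (lpi I) (Pi\<^sub>E I (\<lambda>i. (+) (v i) -` A i))"
      using A I by (subst emeasure_distr) (auto simp: pre intro!: sets_PiM_I_finite measurable_restrict)
    also have "\<dots> = (\<Prod>i\<in>I. emeasure lborel ((+) (v i) -` A i))"
      using m by (intro emeasure_PiM I) auto
    also have "\<dots> = (\<Prod>i\<in>I. emeasure lborel (A i))"
    proof (rule prod.cong[OF refl])
      fix i assume "i \<in> I"
      have "emeasure lborel (A i) = emeasure (distr lborel borel ((+) (v i))) (A i)" by (simp add: lborel_distr_plus)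
      also have "\<dots> = emeasure lborel ((+) (v i) -` A i)" using A[OF \<open>i \<in> I\<close>] by (subst emeasure_distr) auto
      finally show "emeasure lborel ((+) (v i) -` A i) = emeasure lborel (A i)" by simp
    qed
    finally show "emeasure (distr (lpi I) (lpi I) (\<lambda>x. \<lambda>i\<in>I. x i + v i)) (Pi\<^sub>E I A) = (\<Prod>i\<in>I. emeasure lborel (A i))" .
  qed simp
qed

text \<open>Differentiability becomes a condition on countably many increments, so the set of points
  where a directional derivative exists is measurable.\<close>

lemma derivative_iff_rational_cauchy:
  fixes g :: "real \<Rightarrow> real"
  assumes g: "continuous_on UNIV g"
  shows "(\<exists>d. (g has_field_derivative d) (at 0)) \<longleftrightarrow>
    (\<forall>n::nat. \<exists>m::nat. \<forall>h\<in>\<rat>. \<forall>h'\<in>\<rat>. 0 < \<bar>h\<bar> \<and> \<bar>h\<bar> < 1 / Suc m \<and> 0 < \<bar>h'\<bar> \<and> \<bar>h'\<bar> < 1 / Suc m \<longrightarrow>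
       \<bar>(g h - g 0) / h - (g h' - g 0) / h'\<bar> \<le> 1 / Suc n)" (is "?l \<longleftrightarrow> ?r")
proof
  assume ?l
  then obtain d where d: "((\<lambda>h. (g h - g 0) / h) \<longlongrightarrow> d) (at 0)" by (auto simp: DERIV_def)
  show ?r
  proof
    fix n :: nat
    obtain e where e: "e > 0" "\<And>h. h \<noteq> 0 \<Longrightarrow> \<bar>h\<bar> < e \<Longrightarrow> \<bar>(g h - g 0) / h - d\<bar> < 1 / Suc n / 2"
      using LIM_D[OF d, of "1 / Suc n / 2"] by auto
    obtain m :: nat where m: "1 / Suc m < e" using nat_approx_posE[OF e(1)] by blast
    have "\<bar>(g h - g 0) / h - (g h' - g 0) / h'\<bar> \<le> 1 / Suc n"
      if "0 < \<bar>h\<bar>" "\<bar>h\<bar> < 1 / Suc m" "0 < \<bar>h'\<bar>" "\<bar>h'\<bar> < 1 / Suc m" for h h'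
    proof -
      have "\<bar>(g h - g 0) / h - d\<bar> < 1 / Suc n / 2" "\<bar>(g h' - g 0) / h' - d\<bar> < 1 / Suc n / 2"
        using e(2) m that by auto
      moreover have "\<bar>a - d\<bar> < c / 2 \<Longrightarrow> \<bar>b - d\<bar> < c / 2 \<Longrightarrow> \<bar>a - b\<bar> \<le> c" for a b c :: real by linarith
      ultimately show ?thesis by blast
    qed
    then show "\<exists>m::nat. \<forall>h\<in>\<rat>. \<forall>h'\<in>\<rat>. 0 < \<bar>h\<bar> \<and> \<bar>h\<bar> < 1 / Suc m \<and> 0 < \<bar>h'\<bar> \<and> \<bar>h'\<bar> < 1 / Suc m \<longrightarrow>
       \<bar>(g h - g 0) / h - (g h' - g 0) / h'\<bar> \<le> 1 / Suc n" by blast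
  qed
next
  assume r: ?r
  define q where "q h = (g h - g 0) / h" for h
  have q: "isCont q h" if "h \<noteq> 0" for h
    unfolding q_def using g that by (intro continuous_intros) (auto simp: continuous_on_eq_continuous_at)
  have rat_seq: "\<exists>X. (\<forall>j. X j \<in> \<rat> \<and> 0 < \<bar>X j\<bar> \<and> \<bar>X j\<bar> < b) \<and> X \<longlonglongrightarrow> h" if "0 < \<bar>h\<bar>" "\<bar>h\<bar> < b" for h b :: real
  proof -
    \<comment> \<open>Keeps the approximating rationals nonzero and below b in absolute
      value.\<close>
    define e where "e = min \<bar>h\<bar> (b - \<bar>h\<bar>)"
    have e: "e > 0" using that by (simp add: e_def)
    have "\<exists>r\<in>\<rat>. \<bar>r - h\<bar> < e / real (Suc j)" for j :: nat
    proof -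
      have "e / Suc j > 0" using e by simp
      then have "h - e / Suc j < h + e / Suc j" by linarith
      then obtain r where "r \<in> \<rat>" "h - e / Suc j < r" "r < h + e / Suc j" using Rats_dense_in_real by blast
      then show ?thesis by (intro bexI[of _ r]) (auto simp: abs_less_iff)
    qed
    then obtain X where X: "\<And>j. X j \<in> \<rat>" "\<And>j. \<bar>X j - h\<bar> < e / real (Suc j)" by metis
    have "e / real (Suc j) \<le> e / 1" for j by (rule divide_left_mono) (use e in auto)
    then have "\<bar>X j - h\<bar> < e" for j using X(2)[of j] by (smt (verit) div_by_1)
    then have "0 < \<bar>X j\<bar> \<and> \<bar>X j\<bar> < b" for j using e unfolding e_def by (smt (verit))
    moreover have "X \<longlonglongrightarrow> h"
    proof (rule Lim_null[THEN iffD2], rule Lim_null_comparison)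
      show "\<forall>\<^sub>F j in sequentially. norm (X j - h) \<le> e / real (Suc j)" using X(2) by (simp add: less_imp_le)
      show "(\<lambda>j. e / real (Suc j)) \<longlonglongrightarrow> 0" by (rule LIMSEQ_Suc, rule lim_const_over_n)
    qed
    ultimately show ?thesis using X(1) by blast
  qed
  have r': "\<exists>m::nat. \<forall>h h'. 0 < \<bar>h\<bar> \<and> \<bar>h\<bar> < 1 / Suc m \<and> 0 < \<bar>h'\<bar> \<and> \<bar>h'\<bar> < 1 / Suc m \<longrightarrow> \<bar>q h - q h'\<bar> \<le> 1 / Suc n" for n :: nat
  proof -
    obtain m :: nat where m: "\<And>h h'. h \<in> \<rat> \<Longrightarrow> h' \<in> \<rat> \<Longrightarrow> 0 < \<bar>h\<bar> \<and> \<bar>h\<bar> < 1 / Suc m \<Longrightarrow> 0 < \<bar>h'\<bar> \<and> \<bar>h'\<bar> < 1 / Suc m \<Longrightarrow> \<bar>q h - q h'\<bar> \<le> 1 / Suc n"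
      using r unfolding q_def by meson
    have "\<bar>q h - q h'\<bar> \<le> 1 / Suc n" if hh: "0 < \<bar>h\<bar>" "\<bar>h\<bar> < 1 / Suc m" "0 < \<bar>h'\<bar>" "\<bar>h'\<bar> < 1 / Suc m" for h h'
    proof -
      obtain X where X: "\<And>j. X j \<in> \<rat> \<and> 0 < \<bar>X j\<bar> \<and> \<bar>X j\<bar> < 1 / Suc m" "X \<longlonglongrightarrow> h" using rat_seq[OF hh(1,2)] by blast
      obtain Y where Y: "\<And>j. Y j \<in> \<rat> \<and> 0 < \<bar>Y j\<bar> \<and> \<bar>Y j\<bar> < 1 / Suc m" "Y \<longlonglongrightarrow> h'" using rat_seq[OF hh(3,4)] by blast
      have "(\<lambda>j. \<bar>q (X j) - q (Y j)\<bar>) \<longlonglongrightarrow> \<bar>q h - q h'\<bar>"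
        using X(2) Y(2) that by (intro tendsto_intros isCont_tendsto_compose[OF q]) auto
      then show ?thesis by (rule LIMSEQ_le_const2) (use m X(1) Y(1) in blast)
    qed
    then show ?thesis by blast
  qed
  define a where "a j = q (1 / real (Suc j))" for j
  have aC: "Cauchy a"
  proof (rule metric_CauchyI)
    fix e :: real assume "e > 0"
    then obtain n :: nat where n: "1 / Suc n < e" using nat_approx_posE by blast
    obtain m :: nat where m: "\<And>h h'. 0 < \<bar>h\<bar> \<Longrightarrow> \<bar>h\<bar> < 1 / Suc m \<Longrightarrow> 0 < \<bar>h'\<bar> \<Longrightarrow> \<bar>h'\<bar> < 1 / Suc m \<Longrightarrow> \<bar>q h - q h'\<bar> \<le> 1 / Suc n"
      using r'[of n] by blast
    show "\<exists>M. \<forall>i\<ge>M. \<forall>j\<ge>M. dist (a i) (a j) < e"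
    proof (intro exI allI impI)
      fix i j assume "i \<ge> Suc m" "j \<ge> Suc m"
      then have "\<bar>a i - a j\<bar> \<le> 1 / Suc n" unfolding a_def by (intro m) (auto simp: divide_simps)
      then show "dist (a i) (a j) < e" using n by (simp add: dist_real_def)
    qed
  qed
  then obtain d where d: "a \<longlonglongrightarrow> d" using Cauchy_convergent convergent_def by blast
  have "(q \<longlongrightarrow> d) (at 0)"
  proof (rule LIM_I)
    fix e :: real assume "e > 0"
    then obtain n :: nat where n: "1 / Suc n < e" using nat_approx_posE by blast
    obtain m :: nat where m: "\<And>h h'. 0 < \<bar>h\<bar> \<Longrightarrow> \<bar>h\<bar> < 1 / Suc m \<Longrightarrow> 0 < \<bar>h'\<bar> \<Longrightarrow> \<bar>h'\<bar> < 1 / Suc m \<Longrightarrow> \<bar>q h - q h'\<bar> \<le> 1 / Suc n"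
      using r'[of n] by blast
    have "\<bar>q h - d\<bar> \<le> 1 / Suc n" if "h \<noteq> 0" "\<bar>h\<bar> < 1 / Suc m" for h
    proof -
      have "(\<lambda>j. \<bar>q h - a j\<bar>) \<longlonglongrightarrow> \<bar>q h - d\<bar>" by (intro tendsto_intros d)
      moreover have "\<exists>M. \<forall>j\<ge>M. \<bar>q h - a j\<bar> \<le> 1 / Suc n"
        using that unfolding a_def by (intro exI[of _ "Suc m"] allI impI m) (auto simp: divide_simps)
      ultimately show ?thesis by (rule LIMSEQ_le_const2)
    qed
    then show "\<exists>s>0. \<forall>x. x \<noteq> 0 \<and> norm (x - 0) < s \<longrightarrow> norm (q x - d) < e"
      using n by (intro exI[of _ "1 / real (Suc m)"]) (auto intro: le_less_trans)
  qed
  then show ?l unfolding DERIV_def q_def by auto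
qed

section \<open>Directional derivatives: existence almost everywhere and linearity in the
  direction\<close>

definition dir_deriv :: "(('i \<Rightarrow> real) \<Rightarrow> real) \<Rightarrow> ('i \<Rightarrow> real) \<Rightarrow> ('i \<Rightarrow> real) \<Rightarrow> real \<Rightarrow> bool" where
  "dir_deriv f v x d \<longleftrightarrow> ((\<lambda>t. f (\<lambda>i. x i + t * v i)) has_field_derivative d) (at 0)"

lemma lip1_line:
  assumes "lip1 I L f" "L \<ge> 0"
  shows "(L * (\<Sum>i\<in>I. \<bar>v i\<bar>))-lipschitz_on UNIV (\<lambda>t. f (\<lambda>i. x i + t * v i))"
proof (rule lipschitz_onI)
  fix s t :: real
  have "\<bar>f (\<lambda>i. x i + s * v i) - f (\<lambda>i. x i + t * v i)\<bar> \<le> L * (\<Sum>i\<in>I. \<bar>(x i + s * v i) - (x i + t * v i)\<bar>)"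
    by (rule lip1D[OF assms(1)])
  also have "(\<Sum>i\<in>I. \<bar>(x i + s * v i) - (x i + t * v i)\<bar>) = (\<Sum>i\<in>I. \<bar>(s - t) * v i\<bar>)"
    by (simp add: algebra_simps)
  also have "(\<Sum>i\<in>I. \<bar>(s - t) * v i\<bar>) = (\<Sum>i\<in>I. \<bar>v i\<bar>) * \<bar>s - t\<bar>"
    unfolding abs_mult sum_distrib_left[symmetric] by (rule mult.commute)
  finally show "dist (f (\<lambda>i. x i + s * v i)) (f (\<lambda>i. x i + t * v i)) \<le> L * (\<Sum>i\<in>I. \<bar>v i\<bar>) * dist s t"
    by (simp add: dist_real_def mult.assoc)
qed (use assms in \<open>auto intro!: mult_nonneg_nonneg sum_nonneg\<close>)

lemma lip1_translate: "lip1 I L f \<Longrightarrow> lip1 I L (\<lambda>x. f (\<lambda>i. x i + v i))"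
  unfolding lip1_def by (metis (no_types, lifting) add_diff_cancel_right sum.cong)

text \<open>Fubini without coordinates adapted to v: the exceptional set \<open>N\<close> has the
  same measure as its translates, so that measure is averaged over the translations by t v with t in
  [0, 1]. After exchanging the integrals, the one-dimensional theorem on each line parallel to v
  makes the inner integral vanish.\<close>

lemma dir_deriv_ae:
  fixes f :: "('i::countable \<Rightarrow> real) \<Rightarrow> real"
  assumes I: "finite I" and f: "lip1 I L f" and L: "L \<ge> 0"
  shows "AE x in lpi I. \<exists>d. dir_deriv f v x d"
proof -
  interpret product_sigma_finite "\<lambda>_::'i. lborel :: real measure" by (rule product_sigma_finite_lborel)
  interpret P: sigma_finite_measure "lpi I" by (rule sigma_finite[OF I])
  interpret pair_sigma_finite lborel "lpi I" ..
  define N where "N = {x \<in> space (lpi I). \<not> (\<exists>d. dir_deriv f v x d)}"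
  have cont: "continuous_on UNIV (\<lambda>t. f (\<lambda>i. x i + t * v i))" for x
    by (rule lipschitz_on_continuous_on[OF lip1_line[OF f L]])
  have fm[measurable]: "(\<lambda>x. f (\<lambda>i. x i + t * v i)) \<in> borel_measurable (lpi I)" for t
    by (rule lip1_measurable[OF lip1_translate[OF f]])
  have [measurable]: "f \<in> borel_measurable (lpi I)" by (rule lip1_measurable[OF f])
  have [measurable]: "Measurable.pred (lpi I) (\<lambda>x. \<exists>d. dir_deriv f v x d)"
    unfolding dir_deriv_def derivative_iff_rational_cauchy[OF cont]
    using countable_rat by (intro pred_intros_countable pred_intros_countable_bounded) measurable
  have N: "N \<in> sets (lpi I)" unfolding N_def by measurable
  have tr1: "(\<lambda>x. indicator N (\<lambda>i\<in>I. x i + t * v i) :: ennreal) \<in> borel_measurable (lpi I)" for t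
    by (rule measurable_compose[OF _ borel_measurable_indicator[OF N]]) (auto intro!: measurable_restrict)
  have tr2: "(\<lambda>z. indicator N (\<lambda>i\<in>I. snd z i + fst z * v i) :: ennreal) \<in> borel_measurable (lborel \<Otimes>\<^sub>M lpi I)"
    by (rule measurable_compose[OF _ borel_measurable_indicator[OF N]]) (auto intro!: measurable_restrict)
  have "emeasure (lpi I) N = (\<integral>\<^sup>+x. indicator N (\<lambda>i\<in>I. x i + t * v i) \<partial>lpi I)" for t
  proof -
    have "emeasure (lpi I) N = (\<integral>\<^sup>+x. indicator N x \<partial>distr (lpi I) (lpi I) (\<lambda>x. \<lambda>i\<in>I. x i + t * v i))"
      unfolding distr_lpi_translation[OF I] using N by simp
    also have "\<dots> = (\<integral>\<^sup>+x. indicator N (\<lambda>i\<in>I. x i + t * v i) \<partial>lpi I)"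
      using N by (intro nn_integral_distr) (auto intro!: measurable_restrict)
    finally show ?thesis .
  qed
  then have "emeasure (lpi I) N = (\<integral>\<^sup>+t. indicator {0..1} t * (\<integral>\<^sup>+x. indicator N (\<lambda>i\<in>I. x i + t * v i) \<partial>lpi I) \<partial>lborel)"
    by (simp add: nn_integral_multc)
  also have "\<dots> = (\<integral>\<^sup>+t. (\<integral>\<^sup>+x. indicator {0..1} t * indicator N (\<lambda>i\<in>I. x i + t * v i) \<partial>lpi I) \<partial>lborel)"
    by (intro nn_integral_cong nn_integral_cmult[symmetric] tr1)
  also have "\<dots> = (\<integral>\<^sup>+x. (\<integral>\<^sup>+t. indicator {0..1} t * indicator N (\<lambda>i\<in>I. x i + t * v i) \<partial>lborel) \<partial>lpi I)"
    using tr2 by (intro Fubini'[symmetric]) (auto simp: split_beta' intro!: borel_measurable_times measurable_compose[OF measurable_fst])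
  also have "\<dots> = (\<integral>\<^sup>+x. 0 \<partial>lpi I)"
  proof (rule nn_integral_cong)
    fix x
    have "AE t in lborel. \<exists>d. ((\<lambda>t. f (\<lambda>i. x i + t * v i)) has_field_derivative d) (at t)"
      by (rule lipschitz_differentiable_ae[OF lip1_line[OF f L]])
    then have "AE t in lborel. (\<lambda>i\<in>I. x i + t * v i) \<notin> N"
    proof eventually_elim
      case (elim t)
      then obtain d where d: "((\<lambda>t. f (\<lambda>i. x i + t * v i)) has_field_derivative d) (at (0 + t))" by auto
      have "dir_deriv f v (\<lambda>i\<in>I. x i + t * v i) d"
        unfolding dir_deriv_def
      proof (subst DERIV_cong_ev[OF refl _ refl])
        show "((\<lambda>s. f (\<lambda>i. x i + (s + t) * v i)) has_field_derivative d) (at 0)"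
          using d by (rule DERIV_shift[THEN iffD1])
        show "\<forall>\<^sub>F s in nhds 0. f (\<lambda>i. (\<lambda>i\<in>I. x i + t * v i) i + s * v i) = f (\<lambda>i. x i + (s + t) * v i)"
          by (intro always_eventually allI lip1_cong[OF f]) (simp add: algebra_simps)
      qed
      then show ?case unfolding N_def by blast
    qed
    then have "AE t in lborel. indicator {0..1} t * indicator N (\<lambda>i\<in>I. x i + t * v i) = (0::ennreal)"
      by eventually_elim simp
    then show "(\<integral>\<^sup>+t. indicator {0..1} t * indicator N (\<lambda>i\<in>I. x i + t * v i) \<partial>lborel) = 0"
      using nn_integral_cong_AE by fastforce
  qed
  finally have "N \<in> null_sets (lpi I)" using N by (simp add: null_sets_def)
  then show ?thesis by (rule AE_I') (auto simp: N_def)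
qed

text \<open>A sequential limit defined at every point: for Lipschitz f it is measurable by
  construction, and it equals the directional derivative wherever that exists.\<close>

definition lim_deriv :: "(('i \<Rightarrow> real) \<Rightarrow> real) \<Rightarrow> ('i \<Rightarrow> real) \<Rightarrow> ('i \<Rightarrow> real) \<Rightarrow> real" where
  "lim_deriv f v x = lim (\<lambda>j. (f (\<lambda>i. x i + 1 / real (Suc j) * v i) - f x) / (1 / real (Suc j)))"

lemma dir_deriv_lim:
  assumes "dir_deriv f v x d"
  shows "(\<lambda>j. (f (\<lambda>i. x i + 1 / real (Suc j) * v i) - f x) / (1 / real (Suc j))) \<longlonglongrightarrow> d"
proof -
  have "((\<lambda>h. (f (\<lambda>i. x i + h * v i) - f x) / h) \<longlongrightarrow> d) (at 0)"
    using assms unfolding dir_deriv_def DERIV_def by simp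
  moreover have "filterlim (\<lambda>j. 1 / real (Suc j)) (at 0) sequentially"
    using LIMSEQ_Suc[OF lim_const_over_n[of "1::real"]] by (auto simp: filterlim_at)
  ultimately show ?thesis by (rule filterlim_compose)
qed

lemma dir_deriv_imp_lim_deriv: "dir_deriv f v x d \<Longrightarrow> lim_deriv f v x = d"
  unfolding lim_deriv_def by (intro limI dir_deriv_lim)

lemma lip1_quotient_bound:
  assumes f: "lip1 I L f"
  shows "\<bar>(f (\<lambda>i. x i + 1 / real (Suc j) * v i) - f x) / (1 / real (Suc j))\<bar> \<le> L * (\<Sum>i\<in>I. \<bar>v i\<bar>)"
proof -
  have "\<bar>f (\<lambda>i. x i + 1 / real (Suc j) * v i) - f x\<bar> \<le> L * (\<Sum>i\<in>I. \<bar>x i + 1 / real (Suc j) * v i - x i\<bar>)"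
    by (rule lip1D[OF f])
  also have "(\<Sum>i\<in>I. \<bar>x i + 1 / real (Suc j) * v i - x i\<bar>) = 1 / real (Suc j) * (\<Sum>i\<in>I. \<bar>v i\<bar>)"
    by (simp add: sum_divide_distrib)
  finally show ?thesis by (simp add: abs_mult divide_simps)
qed

lemma box_integrable:
  fixes B C :: real
  assumes I: "finite I" and g: "g \<in> borel_measurable (lpi I)" and b: "\<And>x. \<bar>g x\<bar> \<le> C * indicator {x. \<forall>i\<in>I. \<bar>x i\<bar> \<le> B} x"
  shows "integrable (lpi I) g" and "integrable (lpi I) (\<lambda>x. C * indicator {x. \<forall>i\<in>I. \<bar>x i\<bar> \<le> B} x)"
proof -
  interpret product_sigma_finite "\<lambda>_. lborel :: real measure" by (rule product_sigma_finite_lborel)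
  have "emeasure (lpi I) (Pi\<^sub>E I (\<lambda>_. {-B..B})) = (\<Prod>i\<in>I. emeasure lborel {-B..B})" by (rule emeasure_PiM[OF I]) auto
  also have "\<dots> < \<infinity>"
    by (cases "B \<ge> 0") (auto simp: less_top[symmetric] ennreal_power power_0_left)
  finally have "integrable (lpi I) (\<lambda>x. C * indicator (Pi\<^sub>E I (\<lambda>_. {-B..B})) x)"
    using I by (intro integrable_mult_right integrable_real_indicator sets_PiM_I_finite) auto
  moreover have "indicator (Pi\<^sub>E I (\<lambda>_. {-B..B})) x = (indicator {x. \<forall>i\<in>I. \<bar>x i\<bar> \<le> B} x :: real)" if "x \<in> space (lpi I)" for x
  proof -
    have "x \<in> Pi\<^sub>E I (\<lambda>_. {-B..B}) \<longleftrightarrow> (\<forall>i\<in>I. \<bar>x i\<bar> \<le> B)"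
      using that by (simp add: space_PiM PiE_iff abs_le_iff minus_le_iff conj_commute)
    then show ?thesis by (simp add: indicator_def)
  qed
  ultimately show *: "integrable (lpi I) (\<lambda>x. C * indicator {x. \<forall>i\<in>I. \<bar>x i\<bar> \<le> B} x)"
    by (subst Bochner_Integration.integrable_cong[OF refl, of _ _ "\<lambda>x. C * indicator (Pi\<^sub>E I (\<lambda>_. {-B..B})) x"]) auto
  show "integrable (lpi I) g"
    by (rule Bochner_Integration.integrable_bound[OF * g]) (auto intro!: AE_I2 order_trans[OF b])
qed

lemma lim_deriv_measurable:
  fixes f :: "('i::countable \<Rightarrow> real) \<Rightarrow> real"
  assumes f: "lip1 I L f"
  shows "lim_deriv f v \<in> borel_measurable (lpi I)"
proof -
  have [measurable]: "f \<in> borel_measurable (lpi I)" by (rule lip1_measurable[OF f])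
  have [measurable]: "(\<lambda>x. f (\<lambda>i. x i + t * v i)) \<in> borel_measurable (lpi I)" for t
    by (rule lip1_measurable[OF lip1_translate[OF f]])
  show ?thesis unfolding lim_deriv_def by measurable
qed

text \<open>The difference quotient in direction \<open>u + v\<close> telescopes into one in direction \<open>u\<close> and a translated
  one in direction \<open>v\<close>; the translation is moved to the weight \<open>w\<close>.\<close>

lemma lim_deriv_add_weak:
  fixes f w :: "('i::countable \<Rightarrow> real) \<Rightarrow> real"
  assumes I: "finite I" and f: "lip1 I L f" and L: "L \<ge> 0"
    and w[measurable]: "w \<in> borel_measurable (lpi I)" and wb: "\<And>x. \<bar>w x\<bar> \<le> C * indicator {x. \<forall>i\<in>I. \<bar>x i\<bar> \<le> B} x"
    and wI: "\<And>x y. (\<And>i. i \<in> I \<Longrightarrow> x i = y i) \<Longrightarrow> w x = w y"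
    and wc: "\<And>x. (\<lambda>j. w (\<lambda>i. x i - 1 / real (Suc j) * u i)) \<longlonglongrightarrow> w x"
  shows "(\<integral>x. w x * (lim_deriv f (\<lambda>i. u i + v i) x - lim_deriv f u x - lim_deriv f v x) \<partial>lpi I) = 0"
proof -
  define q where "q v j x = (f (\<lambda>i. x i + 1 / real (Suc j) * v i) - f x) / (1 / real (Suc j))" for v x and j :: nat
  \<comment> \<open>Shifting by u / (j + 1) moves no coordinate by more than \<open>U\<close>, so
    all shifted weights live in one box of half-width B + U and one integrable bound serves for all
    j.\<close>
  define U where "U = (\<Sum>i\<in>I. \<bar>u i\<bar>)"
  have [measurable]: "f \<in> borel_measurable (lpi I)" by (rule lip1_measurable[OF f])
  have ftr[measurable]: "(\<lambda>x. f (\<lambda>i. x i + t * v i)) \<in> borel_measurable (lpi I)" for t v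
    by (rule lip1_measurable[OF lip1_translate[OF f]])
  have qm[measurable]: "q v j \<in> borel_measurable (lpi I)" for v j unfolding q_def by measurable
  have dm[measurable]: "lim_deriv f v \<in> borel_measurable (lpi I)" for v by (rule lim_deriv_measurable[OF f])
  have qb: "\<bar>q v j x\<bar> \<le> L * (\<Sum>i\<in>I. \<bar>v i\<bar>)" for v j x unfolding q_def by (rule lip1_quotient_bound[OF f])
  have ae: "AE x in lpi I. (\<lambda>j. q v j x) \<longlonglongrightarrow> lim_deriv f v x" for v
    using dir_deriv_ae[OF I f L, of v]
  proof eventually_elim
    case (elim x)
    then obtain d where d: "dir_deriv f v x d" by blast
    show ?case using dir_deriv_lim[OF d] unfolding q_def dir_deriv_imp_lim_deriv[OF d] .
  qed
  have conv: "(\<lambda>j. \<integral>x. W j x * q v j x \<partial>lpi I) \<longlonglongrightarrow> (\<integral>x. w x * lim_deriv f v x \<partial>lpi I)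
      \<and> (\<forall>j. integrable (lpi I) (\<lambda>x. W j x * q v j x)) \<and> integrable (lpi I) (\<lambda>x. w x * lim_deriv f v x)"
    if W[measurable]: "\<And>j. W j \<in> borel_measurable (lpi I)" and Wb: "\<And>j x. \<bar>W j x\<bar> \<le> \<bar>C\<bar> * indicator {x. \<forall>i\<in>I. \<bar>x i\<bar> \<le> B + U} x"
      and Wc: "\<And>x. (\<lambda>j. W j x) \<longlonglongrightarrow> w x" for W v
  proof -
    have b: "\<bar>W j x * q v j x\<bar> \<le> (\<bar>C\<bar> * (L * (\<Sum>i\<in>I. \<bar>v i\<bar>))) * indicator {x. \<forall>i\<in>I. \<bar>x i\<bar> \<le> B + U} x" for j x
    proof -
      have "\<bar>W j x * q v j x\<bar> \<le> (\<bar>C\<bar> * indicator {x. \<forall>i\<in>I. \<bar>x i\<bar> \<le> B + U} x) * (L * (\<Sum>i\<in>I. \<bar>v i\<bar>))"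
        unfolding abs_mult by (intro mult_mono Wb qb) auto
      then show ?thesis by (simp add: mult_ac)
    qed
    have int: "integrable (lpi I) (\<lambda>x. (\<bar>C\<bar> * (L * (\<Sum>i\<in>I. \<bar>v i\<bar>))) * indicator {x. \<forall>i\<in>I. \<bar>x i\<bar> \<le> B + U} x)"
      by (rule box_integrable(2)[OF I _ b[of 0]]) measurable
    have lim: "AE x in lpi I. (\<lambda>j. W j x * q v j x) \<longlonglongrightarrow> w x * lim_deriv f v x"
      using ae[of v] by eventually_elim (intro tendsto_intros Wc)
    have m: "(\<lambda>x. w x * lim_deriv f v x) \<in> borel_measurable (lpi I)" "\<And>j. (\<lambda>x. W j x * q v j x) \<in> borel_measurable (lpi I)"
      by measurable
    have bb: "AE x in lpi I. norm (W j x * q v j x) \<le> (\<bar>C\<bar> * (L * (\<Sum>i\<in>I. \<bar>v i\<bar>))) * indicator {x. \<forall>i\<in>I. \<bar>x i\<bar> \<le> B + U} x" for j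
      unfolding real_norm_def using b[of j] by (intro AE_I2)
    note dc = m int lim bb
    show ?thesis
      by (intro conjI allI integral_dominated_convergence[OF dc] integrable_dominated_convergence[OF dc]
          integrable_dominated_convergence2[OF dc])
  qed
  have ind: "indicator {x. \<forall>i\<in>I. \<bar>x i\<bar> \<le> B} (\<lambda>i. x i - 1 / real (Suc j) * u i) \<le> (indicator {x. \<forall>i\<in>I. \<bar>x i\<bar> \<le> B + U} x :: real)" for x j
  proof -
    have "\<bar>x i\<bar> \<le> B + U" if "\<bar>x i - 1 / real (Suc j) * u i\<bar> \<le> B" "i \<in> I" for i
    proof -
      have "\<bar>1 / real (Suc j) * u i\<bar> \<le> \<bar>u i\<bar>" by (simp add: abs_mult divide_simps distrib_left)
      also have "\<dots> \<le> U" unfolding U_def using that I by (intro member_le_sum) auto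
      finally show ?thesis using that by linarith
    qed
    then show ?thesis by (auto simp: indicator_def)
  qed
  have "U \<ge> 0" unfolding U_def by (intro sum_nonneg) auto
  then have ind0: "indicator {x. \<forall>i\<in>I. \<bar>x i\<bar> \<le> B} x \<le> (indicator {x. \<forall>i\<in>I. \<bar>x i\<bar> \<le> B + U} x :: real)" for x
    by (auto simp: indicator_def intro: order_trans)
  have wb': "\<bar>w x\<bar> \<le> \<bar>C\<bar> * indicator {x. \<forall>i\<in>I. \<bar>x i\<bar> \<le> B} x" for x
    by (rule order_trans[OF wb mult_right_mono]) auto
  have b0: "\<bar>w x\<bar> \<le> \<bar>C\<bar> * indicator {x. \<forall>i\<in>I. \<bar>x i\<bar> \<le> B + U} x" for x
    using order_trans[OF wb' mult_left_mono[OF ind0]] by simp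
  define ws where "ws j x = w (\<lambda>i. x i - 1 / real (Suc j) * u i)" for x and j :: nat
  have trm: "(\<lambda>x. \<lambda>i\<in>I. x i - 1 / real (Suc j) * u i) \<in> lpi I \<rightarrow>\<^sub>M lpi I" for j :: nat
    by (auto intro!: measurable_restrict)
  have wseq: "ws j x = w (\<lambda>i\<in>I. x i - 1 / real (Suc j) * u i)" for j x unfolding ws_def by (rule wI) simp
  have wsm: "ws j \<in> borel_measurable (lpi I)" for j
    unfolding wseq by (rule measurable_compose[OF trm w])
  have bs: "\<bar>ws j x\<bar> \<le> \<bar>C\<bar> * indicator {x. \<forall>i\<in>I. \<bar>x i\<bar> \<le> B + U} x" for j x
    unfolding ws_def using order_trans[OF wb' mult_left_mono[OF ind]] by simp
  note c0 = conv[of "\<lambda>j. w", OF w b0 tendsto_const]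
  note c1 = conv[of ws, OF wsm bs wc[folded ws_def]]
  have "(\<integral>x. w x * q (\<lambda>i. u i + v i) j x \<partial>lpi I) = (\<integral>x. ws j x * q v j x \<partial>lpi I) + (\<integral>x. w x * q u j x \<partial>lpi I)" for j
  proof -
    have "(\<integral>x. ws j x * q v j x \<partial>lpi I) = (\<integral>x. ws j x * q v j x \<partial>distr (lpi I) (lpi I) (\<lambda>x. \<lambda>i\<in>I. x i + 1 / real (Suc j) * u i))"
      by (simp add: distr_lpi_translation[OF I])
    also have "\<dots> = (\<integral>x. ws j (\<lambda>i\<in>I. x i + 1 / real (Suc j) * u i) * q v j (\<lambda>i\<in>I. x i + 1 / real (Suc j) * u i) \<partial>lpi I)"
      using wsm by (intro integral_distr) (auto intro!: measurable_restrict)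
    also have "\<dots> = (\<integral>x. w x * (q (\<lambda>i. u i + v i) j x - q u j x) \<partial>lpi I)"
    proof (rule Bochner_Integration.integral_cong[OF refl])
      fix x
      have 1: "ws j (\<lambda>i\<in>I. x i + 1 / real (Suc j) * u i) = w x" unfolding ws_def by (rule wI) simp
      have 2: "f (\<lambda>i. (\<lambda>i\<in>I. x i + 1 / real (Suc j) * u i) i + 1 / real (Suc j) * v i) = f (\<lambda>i. x i + 1 / real (Suc j) * (u i + v i))"
        by (rule lip1_cong[OF f]) (simp add: algebra_simps add_divide_distrib)
      have 3: "f (\<lambda>i\<in>I. x i + 1 / real (Suc j) * u i) = f (\<lambda>i. x i + 1 / real (Suc j) * u i)"
        by (rule lip1_cong[OF f]) simp
      have "q v j (\<lambda>i\<in>I. x i + 1 / real (Suc j) * u i) = q (\<lambda>i. u i + v i) j x - q u j x"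
        unfolding q_def 2 3 diff_divide_distrib[symmetric] by simp
      then show "ws j (\<lambda>i\<in>I. x i + 1 / real (Suc j) * u i) * q v j (\<lambda>i\<in>I. x i + 1 / real (Suc j) * u i) = w x * (q (\<lambda>i. u i + v i) j x - q u j x)"
        unfolding 1 by simp
    qed
    also have "\<dots> = (\<integral>x. w x * q (\<lambda>i. u i + v i) j x \<partial>lpi I) - (\<integral>x. w x * q u j x \<partial>lpi I)"
      unfolding right_diff_distrib using c0 by (intro Bochner_Integration.integral_diff) auto
    finally show ?thesis by simp
  qed
  then have "(\<lambda>j. \<integral>x. w x * q (\<lambda>i. u i + v i) j x \<partial>lpi I) \<longlonglongrightarrow> (\<integral>x. w x * lim_deriv f v x \<partial>lpi I) + (\<integral>x. w x * lim_deriv f u x \<partial>lpi I)"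
    using tendsto_add[OF c1[THEN conjunct1] c0[THEN conjunct1]] by simp
  then have "(\<integral>x. w x * lim_deriv f (\<lambda>i. u i + v i) x \<partial>lpi I) = (\<integral>x. w x * lim_deriv f v x \<partial>lpi I) + (\<integral>x. w x * lim_deriv f u x \<partial>lpi I)"
    using c0[of "\<lambda>i. u i + v i"] LIMSEQ_unique by blast
  then show ?thesis using c0 by (simp add: right_diff_distrib)
qed

lemma lim_deriv_bound:
  assumes f: "lip1 I L f" and d: "dir_deriv f v x d"
  shows "\<bar>lim_deriv f v x\<bar> \<le> L * (\<Sum>i\<in>I. \<bar>v i\<bar>)"
proof -
  have "\<bar>d\<bar> \<le> L * (\<Sum>i\<in>I. \<bar>v i\<bar>)"
    by (rule LIMSEQ_le_const2[OF tendsto_rabs[OF dir_deriv_lim[OF d]]]) (use lip1_quotient_bound[OF f] in blast)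
  then show ?thesis using dir_deriv_imp_lim_deriv[OF d] by simp
qed

text \<open>Testing \<open>e = lim_deriv f (u + v) - lim_deriv f u - lim_deriv f v\<close> against cut-off difference
  quotients, which converge to \<open>e\<close> itself, yields that the integral of \<open>e\<^sup>2\<close> vanishes.\<close>

lemma lim_deriv_add:
  fixes f :: "('i::countable \<Rightarrow> real) \<Rightarrow> real"
  assumes I: "finite I" and f: "lip1 I L f" and L: "L \<ge> 0"
  shows "AE x in lpi I. lim_deriv f (\<lambda>i. u i + v i) x = lim_deriv f u x + lim_deriv f v x"
proof -
  define q where "q v j x = (f (\<lambda>i. x i + 1 / real (Suc j) * v i) - f x) / (1 / real (Suc j))" for v x and j :: nat
  define e where "e x = lim_deriv f (\<lambda>i. u i + v i) x - lim_deriv f u x - lim_deriv f v x" for x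
  define g where "g j x = q (\<lambda>i. u i + v i) j x - q u j x - q v j x" for j x
  define K where "K = L * (\<Sum>i\<in>I. \<bar>u i + v i\<bar>) + L * (\<Sum>i\<in>I. \<bar>u i\<bar>) + L * (\<Sum>i\<in>I. \<bar>v i\<bar>)"
  have K: "K \<ge> 0" using L unfolding K_def by (intro add_nonneg_nonneg mult_nonneg_nonneg sum_nonneg) auto
  \<comment> \<open>A continuous cut-off with bounded support; a constant bound on the whole space
    would in general not be integrable.\<close>
  define \<psi> where "\<psi> R x = max 0 (real R - (\<Sum>i\<in>I. \<bar>x i\<bar>))" for R :: nat and x :: "'i \<Rightarrow> real"
  have [measurable]: "f \<in> borel_measurable (lpi I)" by (rule lip1_measurable[OF f])
  have [measurable]: "(\<lambda>x. f (\<lambda>i. x i + t * v i)) \<in> borel_measurable (lpi I)" for t v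
    by (rule lip1_measurable[OF lip1_translate[OF f]])
  have qm[measurable]: "q v j \<in> borel_measurable (lpi I)" for v j unfolding q_def by measurable
  have gm[measurable]: "g j \<in> borel_measurable (lpi I)" for j unfolding g_def by measurable
  have dm[measurable]: "lim_deriv f v \<in> borel_measurable (lpi I)" for v by (rule lim_deriv_measurable[OF f])
  have em[measurable]: "e \<in> borel_measurable (lpi I)" unfolding e_def by measurable
  have pm[measurable]: "\<psi> R \<in> borel_measurable (lpi I)" for R unfolding \<psi>_def by measurable
  have qb: "\<bar>q v j x\<bar> \<le> L * (\<Sum>i\<in>I. \<bar>v i\<bar>)" for v j x unfolding q_def by (rule lip1_quotient_bound[OF f])
  have gb: "\<bar>g j x\<bar> \<le> K" for j x
    using qb[of "\<lambda>i. u i + v i" j x] qb[of u j x] qb[of v j x] unfolding g_def K_def by linarith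
  have pb: "\<bar>\<psi> R x\<bar> \<le> real R * indicator {x. \<forall>i\<in>I. \<bar>x i\<bar> \<le> real R} x" for R x
  proof (cases "\<forall>i\<in>I. \<bar>x i\<bar> \<le> real R")
    case True
    have "0 \<le> (\<Sum>i\<in>I. \<bar>x i\<bar>)" by (intro sum_nonneg) auto
    then show ?thesis using True by (simp add: \<psi>_def)
  next
    case False
    then obtain i where "i \<in> I" "\<bar>x i\<bar> > real R" by force
    moreover have "\<bar>x i\<bar> \<le> (\<Sum>i\<in>I. \<bar>x i\<bar>)" using \<open>i \<in> I\<close> I by (intro member_le_sum) auto
    ultimately show ?thesis by (simp add: \<psi>_def)
  qed
  have wb: "\<bar>\<psi> R x * g j x\<bar> \<le> (real R * K) * indicator {x. \<forall>i\<in>I. \<bar>x i\<bar> \<le> real R} x" for R j x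
  proof -
    have "\<bar>\<psi> R x * g j x\<bar> \<le> (real R * indicator {x. \<forall>i\<in>I. \<bar>x i\<bar> \<le> real R} x) * K"
      unfolding abs_mult by (intro mult_mono pb gb) auto
    then show ?thesis by (simp add: mult_ac)
  qed
  have seq: "(\<lambda>j. 1 / real (Suc j)) \<longlonglongrightarrow> 0" by (rule LIMSEQ_Suc[OF lim_const_over_n])
  \<comment> \<open>The weight in \<open>lim_deriv_add_weak\<close> has to be continuous along
    translations. The measurable function e is not known to be, but its approximants
    \<open>g j\<close> are, being built from difference quotients of f.\<close>
  have zero: "(\<integral>x. (\<psi> R x * g j x) * e x \<partial>lpi I) = 0" for R j
    unfolding e_def
  proof (rule lim_deriv_add_weak[OF I f L _ wb])
    fix x y :: "'i \<Rightarrow> real" assume xy: "\<And>i. i \<in> I \<Longrightarrow> x i = y i"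
    have "f x = f y" "f (\<lambda>i. x i + t * v i) = f (\<lambda>i. y i + t * v i)" for t v
      using xy by (auto intro!: lip1_cong[OF f])
    then have "q w j x = q w j y" for w unfolding q_def by (simp only:)
    then have "g j x = g j y" unfolding g_def by simp
    then show "\<psi> R x * g j x = \<psi> R y * g j y" using xy unfolding \<psi>_def by simp
  next
    fix x :: "'i \<Rightarrow> real"
    have c: "(\<lambda>j. x i - 1 / real (Suc j) * u i) \<longlonglongrightarrow> x i" for i
      using tendsto_diff[OF tendsto_const[of "x i"] tendsto_mult_right[OF seq, of "u i"]] by simp
    have cc: "(\<lambda>k. f (\<lambda>i. x i - 1 / real (Suc k) * u i)) \<longlonglongrightarrow> f x"
        "(\<lambda>k. f (\<lambda>i. x i - 1 / real (Suc k) * u i + t * v i)) \<longlonglongrightarrow> f (\<lambda>i. x i + t * v i)" for t v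
      by (intro lip1_tendsto[OF f] tendsto_intros c)+
    show "(\<lambda>k. \<psi> R (\<lambda>i. x i - 1 / real (Suc k) * u i) * g j (\<lambda>i. x i - 1 / real (Suc k) * u i)) \<longlonglongrightarrow> \<psi> R x * g j x"
      unfolding \<psi>_def g_def q_def by (intro tendsto_intros c cc) simp_all
  qed measurable
  have "AE x in lpi I. \<forall>w\<in>{u, v, \<lambda>i. u i + v i}. \<exists>d. dir_deriv f w x d"
    using dir_deriv_ae[OF I f L] by (intro AE_finite_allI) auto
  then have good: "AE x in lpi I. (\<lambda>j. g j x) \<longlonglongrightarrow> e x \<and> \<bar>e x\<bar> \<le> K"
  proof eventually_elim
    case (elim x)
    have l: "(\<lambda>j. q w j x) \<longlonglongrightarrow> lim_deriv f w x" "\<bar>lim_deriv f w x\<bar> \<le> L * (\<Sum>i\<in>I. \<bar>w i\<bar>)"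
      if w: "w \<in> {u, v, \<lambda>i. u i + v i}" for w
    proof -
      obtain d where d: "dir_deriv f w x d" using elim w by blast
      show "(\<lambda>j. q w j x) \<longlonglongrightarrow> lim_deriv f w x"
        using dir_deriv_lim[OF d] unfolding q_def dir_deriv_imp_lim_deriv[OF d] .
      show "\<bar>lim_deriv f w x\<bar> \<le> L * (\<Sum>i\<in>I. \<bar>w i\<bar>)" by (rule lim_deriv_bound[OF f d])
    qed
    have "(\<lambda>j. g j x) \<longlonglongrightarrow> e x" unfolding g_def e_def by (intro tendsto_diff l) auto
    moreover have "\<bar>e x\<bar> \<le> K"
      using l(2)[of u] l(2)[of v] l(2)[of "\<lambda>i. u i + v i"] unfolding e_def K_def by auto
    ultimately show ?case by blast
  qed
  have "AE x in lpi I. \<psi> R x * e x * e x = 0" for R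
  proof -
    have int: "integrable (lpi I) (\<lambda>x. (real R * (K * K)) * indicator {x. \<forall>i\<in>I. \<bar>x i\<bar> \<le> real R} x)"
    proof (rule box_integrable(2)[OF I])
      show "\<bar>\<psi> R x * (K * K)\<bar> \<le> (real R * (K * K)) * indicator {x. \<forall>i\<in>I. \<bar>x i\<bar> \<le> real R} x" for x
        using mult_right_mono[OF pb[of R x], of "K * K"] K by (simp add: abs_mult mult_ac)
    qed measurable
    have lim: "AE x in lpi I. (\<lambda>j. (\<psi> R x * g j x) * e x) \<longlonglongrightarrow> \<psi> R x * e x * e x"
      using good by eventually_elim (intro tendsto_intros, auto)
    have bd: "AE x in lpi I. norm ((\<psi> R x * g j x) * e x) \<le> (real R * (K * K)) * indicator {x. \<forall>i\<in>I. \<bar>x i\<bar> \<le> real R} x" for j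
      using good
    proof eventually_elim
      case (elim x)
      have "\<bar>(\<psi> R x * g j x) * e x\<bar> \<le> ((real R * K) * indicator {x. \<forall>i\<in>I. \<bar>x i\<bar> \<le> real R} x) * K"
        unfolding abs_mult[of _ "e x"] using elim K by (intro mult_mono wb) (auto intro!: mult_nonneg_nonneg)
      then show ?case by (simp add: mult_ac)
    qed
    have m: "(\<lambda>x. \<psi> R x * e x * e x) \<in> borel_measurable (lpi I)" "\<And>j. (\<lambda>x. (\<psi> R x * g j x) * e x) \<in> borel_measurable (lpi I)"
      by measurable
    note dc = m int lim bd
    have "(\<integral>x. \<psi> R x * e x * e x \<partial>lpi I) = 0"
      using integral_dominated_convergence[OF dc] unfolding zero by (simp add: LIMSEQ_const_iff)
    moreover have "0 \<le> \<psi> R x * e x * e x" for x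
      unfolding mult.assoc by (rule mult_nonneg_nonneg) (auto simp: \<psi>_def)
    ultimately show ?thesis
      using integral_nonneg_eq_0_iff_AE[OF integrable_dominated_convergence[OF dc]] by simp
  qed
  then have "AE x in lpi I. \<forall>R. \<psi> R x * e x * e x = 0" by (simp only: AE_all_countable) blast
  then show ?thesis
  proof eventually_elim
    case (elim x)
    obtain R :: nat where "(\<Sum>i\<in>I. \<bar>x i\<bar>) < real R" using reals_Archimedean2 by blast
    then have "\<psi> R x > 0" by (simp add: \<psi>_def)
    then have "e x = 0" using elim[rule_format, of R] by simp
    then show ?case unfolding e_def by simp
  qed
qed

lemma dir_deriv_scale:
  assumes "dir_deriv f v x d"
  shows "dir_deriv f (\<lambda>i. c * v i) x (c * d)"
proof -
  have "((\<lambda>t. f (\<lambda>i. x i + t * v i)) has_field_derivative d) (at (c * 0))"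
    using assms unfolding dir_deriv_def by simp
  moreover have "((\<lambda>t. c * t) has_field_derivative c) (at 0)" by (auto intro!: derivative_eq_intros)
  ultimately have "((\<lambda>t. f (\<lambda>i. x i + (c * t) * v i)) has_field_derivative d * c) (at 0)"
    by (rule DERIV_chain2)
  then show ?thesis unfolding dir_deriv_def by (simp add: mult_ac)
qed

text \<open>Induction adds one coordinate of the direction at a time. The exceptional null set may
  depend on v, so only countably many directions can be treated at once.\<close>

lemma lim_deriv_linear:
  fixes f :: "('i::countable \<Rightarrow> real) \<Rightarrow> real"
  assumes I: "finite I" and f: "lip1 I L f" and L: "L \<ge> 0" and J: "finite J"
  shows "AE x in lpi I. lim_deriv f (\<lambda>i. if i \<in> J then v i else 0) x =
    (\<Sum>i\<in>J. v i * lim_deriv f (\<lambda>l. if l = i then 1 else 0) x)"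
  using J
proof induction
  case empty
  have "dir_deriv f (\<lambda>i. 0) x 0" for x unfolding dir_deriv_def by simp
  then show ?case by (simp add: dir_deriv_imp_lim_deriv)
next
  case (insert m J)
  have eq: "(\<lambda>i. (if i \<in> J then v i else 0) + v m * (if i = m then 1 else 0)) = (\<lambda>i. if i \<in> insert m J then v i else 0)"
    using insert.hyps by auto
  show ?case
    using insert.IH lim_deriv_add[OF I f L, of "\<lambda>i. if i \<in> J then v i else 0" "\<lambda>i. v m * (if i = m then 1 else 0)"]
      dir_deriv_ae[OF I f L, of "\<lambda>i. if i = m then 1 else 0"]
  proof eventually_elim
    case (elim x)
    then obtain d where d: "dir_deriv f (\<lambda>i. if i = m then 1 else 0) x d" by blast
    have "lim_deriv f (\<lambda>i. v m * (if i = m then 1 else 0)) x = v m * lim_deriv f (\<lambda>i. if i = m then 1 else 0) x"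
      unfolding dir_deriv_imp_lim_deriv[OF d] by (rule dir_deriv_imp_lim_deriv[OF dir_deriv_scale[OF d]])
    then show ?case using elim insert.hyps unfolding eq by simp
  qed
qed

section \<open>Total differentiability almost everywhere\<close>

definition diff1_at :: "'i set \<Rightarrow> (('i \<Rightarrow> real) \<Rightarrow> real) \<Rightarrow> ('i \<Rightarrow> real) \<Rightarrow> ('i \<Rightarrow> real) \<Rightarrow> bool" where
  "diff1_at I f D x \<longleftrightarrow> (\<forall>\<epsilon>>0. \<exists>\<delta>>0. \<forall>y. (\<Sum>i\<in>I. \<bar>y i - x i\<bar>) < \<delta> \<longrightarrow>
     \<bar>f y - f x - (\<Sum>i\<in>I. D i * (y i - x i))\<bar> \<le> \<epsilon> * (\<Sum>i\<in>I. \<bar>y i - x i\<bar>))"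

text \<open>Up to an error of relative size \<open>1/N\<close>, every direction is one of finitely many grid directions.\<close>

theorem rademacher:
  fixes f :: "('i::countable \<Rightarrow> real) \<Rightarrow> real"
  assumes I: "finite I" and f: "lip1 I L f" and L: "L \<ge> 0"
  shows "AE x in lpi I. \<exists>D. diff1_at I f D x"
proof -
  \<comment> \<open>Finitely many directions with coordinates in [-1, 1] and spacing 1 / (N + 1);
    over all N they are countably many, so one null set serves for all of them.\<close>
  define G where "G N = (\<lambda>m i. if i \<in> I then of_int (m i) / real (Suc N) else 0) ` (Pi\<^sub>E I (\<lambda>_. {- int (Suc N)..int (Suc N)}))" for N
  have G: "finite (G N)" for N unfolding G_def using I by (intro finite_imageI finite_PiE) auto
  have "AE x in lpi I. \<exists>d. dir_deriv f w x d \<and> d = (\<Sum>i\<in>I. w i * lim_deriv f (\<lambda>l. if l = i then 1 else 0) x)" if "w \<in> G N" for w N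
  proof -
    have w: "(\<lambda>i. if i \<in> I then w i else 0) = w" using that unfolding G_def by auto
    show ?thesis using dir_deriv_ae[OF I f L, of w] lim_deriv_linear[OF I f L I, of w] unfolding w
      by eventually_elim (metis dir_deriv_imp_lim_deriv)
  qed
  then have "AE x in lpi I. \<forall>N. \<forall>w\<in>G N. dir_deriv f w x (\<Sum>i\<in>I. w i * lim_deriv f (\<lambda>l. if l = i then 1 else 0) x)"
    unfolding AE_all_countable using G by (intro allI AE_finite_allI) auto
  then show ?thesis
  proof eventually_elim
    case (elim x)
    define D where "D i = lim_deriv f (\<lambda>l. if l = i then 1 else 0) x" for i
    \<comment> \<open>Rounding a displacement of l1-norm s to the grid moves each coordinate by at
      most s / n. This costs at most \<open>L * card I\<close> times s / n in the value of f, and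
      the sum of the \<open>\<bar>D i\<bar>\<close> times s / n in the linear part.\<close>
    define C where "C = L * card I + (\<Sum>i\<in>I. \<bar>D i\<bar>)"
    have C: "C \<ge> 0" unfolding C_def using L by (intro add_nonneg_nonneg mult_nonneg_nonneg sum_nonneg) auto
    have "diff1_at I f D x"
      unfolding diff1_at_def
    proof (intro allI impI)
      fix \<epsilon> :: real assume "\<epsilon> > 0"
      obtain N :: nat where "2 * C / \<epsilon> < real N" using reals_Archimedean2 by blast
      then have "2 * C / \<epsilon> < real (Suc N)" by simp
      then have N: "C / real (Suc N) \<le> \<epsilon> / 2" using \<open>\<epsilon> > 0\<close> by (simp add: field_simps)
      have "\<exists>\<delta>>0. \<forall>s. 0 < s \<and> s < \<delta> \<longrightarrow> \<bar>f (\<lambda>i. x i + s * w i) - f x - s * (\<Sum>i\<in>I. w i * D i)\<bar> \<le> \<epsilon> / 2 * s" if "w \<in> G N" for w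
      proof -
        have "((\<lambda>h. (f (\<lambda>i. x i + h * w i) - f x) / h) \<longlongrightarrow> (\<Sum>i\<in>I. w i * D i)) (at 0)"
          using elim that unfolding dir_deriv_def DERIV_def D_def by simp
        from LIM_D[OF this, of "\<epsilon> / 2"] obtain \<delta> where \<delta>: "\<delta> > 0"
          "\<And>h. h \<noteq> 0 \<Longrightarrow> \<bar>h\<bar> < \<delta> \<Longrightarrow> \<bar>(f (\<lambda>i. x i + h * w i) - f x) / h - (\<Sum>i\<in>I. w i * D i)\<bar> < \<epsilon> / 2"
          using \<open>\<epsilon> > 0\<close> by auto
        have "\<bar>f (\<lambda>i. x i + s * w i) - f x - s * (\<Sum>i\<in>I. w i * D i)\<bar> \<le> \<epsilon> / 2 * s" if s: "0 < s" "s < \<delta>" for s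
        proof -
          have "f (\<lambda>i. x i + s * w i) - f x - s * (\<Sum>i\<in>I. w i * D i) = s * ((f (\<lambda>i. x i + s * w i) - f x) / s - (\<Sum>i\<in>I. w i * D i))"
            using s by (simp add: field_simps)
          then have "\<bar>f (\<lambda>i. x i + s * w i) - f x - s * (\<Sum>i\<in>I. w i * D i)\<bar> = s * \<bar>(f (\<lambda>i. x i + s * w i) - f x) / s - (\<Sum>i\<in>I. w i * D i)\<bar>"
            using s by (simp add: abs_mult)
          also have "\<dots> \<le> s * (\<epsilon> / 2)" using \<delta>(2)[of s] s by (intro mult_left_mono) auto
          finally show ?thesis by (simp add: mult_ac)
        qed
        then show ?thesis using \<delta>(1) by blast
      qed
      then obtain \<delta> where \<delta>: "\<And>w. w \<in> G N \<Longrightarrow> \<delta> w > 0"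
         "\<And>w s. w \<in> G N \<Longrightarrow> 0 < s \<Longrightarrow> s < \<delta> w \<Longrightarrow> \<bar>f (\<lambda>i. x i + s * w i) - f x - s * (\<Sum>i\<in>I. w i * D i)\<bar> \<le> \<epsilon> / 2 * s"
        by metis
      define d where "d = Min (insert 1 (\<delta> ` G N))"
      have d: "d > 0" "\<And>w. w \<in> G N \<Longrightarrow> d \<le> \<delta> w" unfolding d_def using \<delta>(1) G by auto
      have "\<bar>f y - f x - (\<Sum>i\<in>I. D i * (y i - x i))\<bar> \<le> \<epsilon> * (\<Sum>i\<in>I. \<bar>y i - x i\<bar>)"
        if y: "(\<Sum>i\<in>I. \<bar>y i - x i\<bar>) < d" for y
      proof (cases "(\<Sum>i\<in>I. \<bar>y i - x i\<bar>) = 0")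
        case True
        then have *: "\<And>i. i \<in> I \<Longrightarrow> y i = x i" using I by (simp add: sum_nonneg_eq_0_iff)
        then have "f y = f x" by (rule lip1_cong[OF f])
        then show ?thesis using * by simp
      next
        case False
        define s where "s = (\<Sum>i\<in>I. \<bar>y i - x i\<bar>)"
        have "s \<ge> 0" unfolding s_def by (intro sum_nonneg) auto
        then have s: "s > 0" using False unfolding s_def by linarith
        define n where "n = real (Suc N)"
        have n: "n > 0" by (simp add: n_def)
        define w where "w i = (if i \<in> I then of_int \<lfloor>n * (y i - x i) / s\<rfloor> / n else 0)" for i
        have wG: "w \<in> G N"
          unfolding G_def
        proof (rule image_eqI)
          show "w = (\<lambda>i. if i \<in> I then of_int ((\<lambda>i\<in>I. \<lfloor>n * (y i - x i) / s\<rfloor>) i) / real (Suc N) else 0)"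
            by (auto simp: w_def n_def)
          show "(\<lambda>i\<in>I. \<lfloor>n * (y i - x i) / s\<rfloor>) \<in> Pi\<^sub>E I (\<lambda>_. {- int (Suc N)..int (Suc N)})"
          proof (rule restrict_PiE_iff[THEN iffD2], rule ballI)
            fix i assume "i \<in> I"
            then have "\<bar>y i - x i\<bar> \<le> s" unfolding s_def using I by (intro member_le_sum) auto
            then have "\<bar>(y i - x i) / s\<bar> \<le> 1" using s by simp
            then have "\<bar>n * ((y i - x i) / s)\<bar> \<le> n * 1" unfolding abs_mult using n by (intro mult_mono) auto
            then have "- n \<le> n * (y i - x i) / s \<and> n * (y i - x i) / s \<le> n"
              unfolding abs_le_iff times_divide_eq_right by linarith
            then have "of_int (- int (Suc N)) \<le> n * (y i - x i) / s" "n * (y i - x i) / s \<le> of_int (int (Suc N))" by (simp_all add: n_def)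
            then show "\<lfloor>n * (y i - x i) / s\<rfloor> \<in> {- int (Suc N)..int (Suc N)}"
              by (simp add: le_floor_iff floor_le_iff del: of_nat_Suc)
          qed
        qed
        have dev: "\<bar>(y i - x i) - s * w i\<bar> \<le> s / n" if "i \<in> I" for i
        proof -
          let ?t = "n * (y i - x i) / s"
          have "(y i - x i) - s * w i = s / n * (?t - of_int \<lfloor>?t\<rfloor>)" using that n s by (simp add: w_def field_simps)
          then have "\<bar>(y i - x i) - s * w i\<bar> = s / n * \<bar>?t - of_int \<lfloor>?t\<rfloor>\<bar>" using n s by (simp only: abs_mult) simp
          also have "\<dots> \<le> s / n * 1" using n s by (intro mult_left_mono) (linarith, simp)
          finally show ?thesis by simp
        qed
        have "s < \<delta> w" using y d(2)[OF wG] unfolding s_def by linarith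
        note e1 = \<delta>(2)[OF wG s this]
        have "\<bar>f y - f (\<lambda>i. x i + s * w i)\<bar> \<le> L * (\<Sum>i\<in>I. \<bar>y i - (x i + s * w i)\<bar>)" by (rule lip1D[OF f])
        also have "\<dots> \<le> L * (\<Sum>i\<in>I. s / n)" using dev L by (intro mult_left_mono sum_mono) (auto simp: algebra_simps)
        finally have e2: "\<bar>f y - f (\<lambda>i. x i + s * w i)\<bar> \<le> L * card I * (s / n)" by simp
        have "\<bar>(\<Sum>i\<in>I. D i * (y i - x i)) - s * (\<Sum>i\<in>I. w i * D i)\<bar> = \<bar>\<Sum>i\<in>I. D i * ((y i - x i) - s * w i)\<bar>"
          by (simp add: sum_distrib_left sum_subtractf[symmetric] algebra_simps)
        also have "\<dots> \<le> (\<Sum>i\<in>I. \<bar>D i\<bar> * (s / n))"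
          using dev by (intro order_trans[OF sum_abs] sum_mono) (auto simp: abs_mult simp del: times_divide_eq_right intro!: mult_left_mono)
        finally have e3: "\<bar>(\<Sum>i\<in>I. D i * (y i - x i)) - s * (\<Sum>i\<in>I. w i * D i)\<bar> \<le> (\<Sum>i\<in>I. \<bar>D i\<bar>) * (s / n)"
          by (simp only: sum_distrib_right)
        have "\<bar>f y - f x - (\<Sum>i\<in>I. D i * (y i - x i))\<bar> \<le> \<epsilon> / 2 * s + C * (s / n)"
          using e1 e2 e3 unfolding C_def distrib_right by linarith
        also have "C * (s / n) \<le> \<epsilon> / 2 * s"
          using mult_right_mono[OF N, of s] s by (simp add: n_def)
        finally show ?thesis by (simp add: s_def)
      qed
      then show "\<exists>\<delta>>0. \<forall>y. (\<Sum>i\<in>I. \<bar>y i - x i\<bar>) < \<delta> \<longrightarrow>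
         \<bar>f y - f x - (\<Sum>i\<in>I. D i * (y i - x i))\<bar> \<le> \<epsilon> * (\<Sum>i\<in>I. \<bar>y i - x i\<bar>)" using d(1) by blast
    qed
    then show ?case by blast
  qed
qed

section \<open>Bernstein polynomials on the simplex\<close>

text \<open>McShane's extension: the infimum over y in S of f y + L d(x, y). It makes functions
  given only on the simplex accessible to Rademacher's theorem on the whole space, with the same
  constant.\<close>

lemma lip1_extension:
  assumes "S \<noteq> {}" and L: "L \<ge> 0"
    and f: "\<And>x y. x \<in> S \<Longrightarrow> y \<in> S \<Longrightarrow> \<bar>f x - f y\<bar> \<le> L * (\<Sum>i\<in>I. \<bar>x i - y i\<bar>)"
  obtains g where "lip1 I L g" "\<And>x. x \<in> S \<Longrightarrow> g x = (f x :: real)"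
proof -
  define d :: "('a \<Rightarrow> real) \<Rightarrow> ('a \<Rightarrow> real) \<Rightarrow> real" where "d x y = (\<Sum>i\<in>I. \<bar>x i - y i\<bar>)" for x y
  have tri: "d x z \<le> d x y + d y z" for x y z
    unfolding d_def sum.distrib[symmetric] by (intro sum_mono) linarith
  have sym: "d x y = d y x" for x y unfolding d_def by (simp add: abs_minus_commute)
  have Ltri: "L * d x z \<le> L * d x y + L * d y z" for x y z
    using mult_left_mono[OF tri L] by (simp add: distrib_left)
  define g where "g x = (INF y\<in>S. f y + L * d x y)" for x
  obtain s where s: "s \<in> S" using assms(1) by blast
  have bdd: "bdd_below ((\<lambda>y. f y + L * d x y) ` S)" for x
  proof (rule bdd_belowI2)
    fix y assume "y \<in> S"
    then have "f s - f y \<le> L * d s y" using f[OF s, of y] unfolding d_def by linarith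
    then show "f s - L * d x s \<le> f y + L * d x y" using Ltri[of s y x] unfolding sym[of x s] by linarith
  qed
  have le: "g x \<le> g y + L * d x y" for x y
  proof -
    have "g x - L * d x y \<le> f z + L * d y z" if "z \<in> S" for z
    proof -
      have "g x \<le> f z + L * d x z" unfolding g_def using bdd that by (rule cINF_lower)
      then show ?thesis using Ltri[of x z y] by linarith
    qed
    then have "g x - L * d x y \<le> g y" unfolding g_def[of y] using assms(1) by (intro cINF_greatest) auto
    then show ?thesis by simp
  qed
  show thesis
  proof
    have "\<bar>g x - g y\<bar> \<le> L * d x y" for x y using le[of x y] le[of y x, unfolded sym[of y x]] by linarith
    then show "lip1 I L g" unfolding lip1_def d_def by blast
    fix x assume x: "x \<in> S"
    have "g x \<le> f x + L * d x x" unfolding g_def using bdd x by (rule cINF_lower)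
    moreover have "f x \<le> g x"
      unfolding g_def
    proof (rule cINF_greatest[OF assms(1)])
      fix y assume "y \<in> S"
      then show "f x \<le> f y + L * d x y" using f[OF x, of y] unfolding d_def by linarith
    qed
    ultimately show "g x = f x" by (simp add: d_def)
  qed
qed

definition lip_simplex :: "nat \<Rightarrow> real \<Rightarrow> ((nat \<Rightarrow> real) \<Rightarrow> real) \<Rightarrow> bool" where
  "lip_simplex k L f \<longleftrightarrow> L \<ge> 0 \<and> (\<forall>x\<in>ref_simplex k. \<forall>y\<in>ref_simplex k. \<bar>f x - f y\<bar> \<le> L * (\<Sum>i=1..k. \<bar>x i - y i\<bar>))"

text \<open>Only increments within the simplex are tested, because a singular simplex has no
  meaningful values elsewhere; at interior points this still determines D on
  \<open>{1..k}\<close>.\<close>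

definition diff_simplex :: "nat \<Rightarrow> ((nat \<Rightarrow> real) \<Rightarrow> real) \<Rightarrow> (nat \<Rightarrow> real) \<Rightarrow> (nat \<Rightarrow> real) \<Rightarrow> bool" where
  "diff_simplex k f D x \<longleftrightarrow> (\<forall>\<epsilon>>0. \<exists>\<delta>>0. \<forall>y\<in>ref_simplex k. (\<Sum>i=1..k. \<bar>y i - x i\<bar>) < \<delta> \<longrightarrow>
     \<bar>f y - f x - (\<Sum>i=1..k. D i * (y i - x i))\<bar> \<le> \<epsilon> * (\<Sum>i=1..k. \<bar>y i - x i\<bar>))"

lemma ref_simplex_nonempty: "(\<lambda>i\<in>{1..k}. 0) \<in> ref_simplex k"
  by (simp add: ref_simplex_def)

lemma lip_simplex_diff_ae:
  assumes f: "lip_simplex k L f"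
  shows "AE x in lpi {1..k}. x \<in> ref_simplex k \<longrightarrow> (\<exists>D. diff_simplex k f D x)"
proof -
  obtain g where g: "lip1 {1..k} L g" "\<And>x. x \<in> ref_simplex k \<Longrightarrow> g x = f x"
  proof (rule lip1_extension[of "ref_simplex k" L f "{1..k}"])
    show "ref_simplex k \<noteq> {}" using ref_simplex_nonempty by blast
  qed (use f in \<open>auto simp: lip_simplex_def\<close>)
  have "AE x in lpi {1..k}. \<exists>D. diff1_at {1..k} g D x"
    using g(1) f by (intro rademacher) (auto simp: lip_simplex_def)
  then show ?thesis
  proof eventually_elim
    case (elim x)
    then obtain D where D: "diff1_at {1..k} g D x" by blast
    have "diff_simplex k f D x" if "x \<in> ref_simplex k"
      unfolding diff_simplex_def
    proof (intro allI impI)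
      fix \<epsilon> :: real assume "\<epsilon> > 0"
      then obtain \<delta> where "\<delta> > 0" "\<And>y. (\<Sum>i=1..k. \<bar>y i - x i\<bar>) < \<delta> \<Longrightarrow>
          \<bar>g y - g x - (\<Sum>i=1..k. D i * (y i - x i))\<bar> \<le> \<epsilon> * (\<Sum>i=1..k. \<bar>y i - x i\<bar>)"
        using D unfolding diff1_at_def by blast
      then show "\<exists>\<delta>>0. \<forall>y\<in>ref_simplex k. (\<Sum>i=1..k. \<bar>y i - x i\<bar>) < \<delta> \<longrightarrow>
          \<bar>f y - f x - (\<Sum>i=1..k. D i * (y i - x i))\<bar> \<le> \<epsilon> * (\<Sum>i=1..k. \<bar>y i - x i\<bar>)"
        using g(2) that by (intro exI[of _ \<delta>]) force
    qed
    then show ?case by blast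
  qed
qed

text \<open>For a probability vector y this is the expectation of g(N), where N counts the outcomes
  of m independent draws from {0..k} with distribution y. For arbitrary y it is the same polynomial,
  homogeneous of degree m, in Bernstein form. Recursion on a single draw avoids multinomial
  coefficients.\<close>

primrec bern :: "nat \<Rightarrow> nat \<Rightarrow> ((nat \<Rightarrow> nat) \<Rightarrow> real) \<Rightarrow> (nat \<Rightarrow> real) \<Rightarrow> real" where
  "bern k 0 g y = g (\<lambda>_. 0)"
| "bern k (Suc m) g y = (\<Sum>c\<le>k. y c * bern k m (\<lambda>N. g (N(c := Suc (N c)))) y)"

lemma bern_add: "bern k m (\<lambda>N. g N + h N) y = bern k m g y + bern k m h y"
  by (induction m arbitrary: g h) (simp_all add: distrib_left sum.distrib)

lemma bern_cmult: "bern k m (\<lambda>N. a * g N) y = a * bern k m g y"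
  by (induction m arbitrary: g) (simp_all add: sum_distrib_left mult_ac)

lemma bern_diff: "bern k m (\<lambda>N. g N - h N) y = bern k m g y - bern k m h y"
  using bern_add[of k m g "\<lambda>N. - 1 * h N" y] unfolding bern_cmult by simp

lemma bern_sum: "bern k m (\<lambda>N. \<Sum>i\<in>A. g i N) y = (\<Sum>i\<in>A. bern k m (g i) y)"
  by (induction m arbitrary: g) (simp_all add: sum_distrib_left sum.swap[of _ A])

lemma bern_const: "bern k m (\<lambda>N. a) y = a * (\<Sum>c\<le>k. y c) ^ m"
proof (induction m)
  case (Suc m)
  show ?case unfolding bern.simps Suc sum_distrib_right[symmetric] by simp
qed simp

lemma sum_fun_upd_Suc: "c \<le> k \<Longrightarrow> (\<Sum>i\<le>k. (N(c := Suc (N c))) i) = Suc (\<Sum>i\<le>(k::nat). N i)"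
  by (subst (1 2) sum.remove[of _ c]) auto

lemma bern_mono:
  assumes "\<And>c. c \<le> k \<Longrightarrow> 0 \<le> y c" and "\<And>N. (\<Sum>i\<le>k. N i) = m \<Longrightarrow> g N \<le> h N"
  shows "bern k m g y \<le> bern k m h y"
  using assms(2)
proof (induction m arbitrary: g h)
  case 0
  then show ?case by simp
next
  case (Suc m)
  have "bern k m (\<lambda>N. g (N(c := Suc (N c)))) y \<le> bern k m (\<lambda>N. h (N(c := Suc (N c)))) y" if "c \<le> k" for c
    by (rule Suc.IH, rule Suc.prems) (use sum_fun_upd_Suc[OF that] in simp)
  then show ?case using assms(1) by (auto intro!: sum_mono mult_left_mono)
qed

lemma bern_cong:
  assumes "\<And>N. (\<Sum>i\<le>k. N i) = m \<Longrightarrow> g N = h N"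
  shows "bern k m g y = bern k m h y"
  using assms
proof (induction m arbitrary: g h)
  case 0
  then show ?case by simp
next
  case (Suc m)
  have "bern k m (\<lambda>N. g (N(c := Suc (N c)))) y = bern k m (\<lambda>N. h (N(c := Suc (N c)))) y" if "c \<le> k" for c
    by (rule Suc.IH, rule Suc.prems) (use sum_fun_upd_Suc[OF that] in simp)
  then show ?case by simp
qed

lemma bern_abs_le:
  assumes "\<And>c. c \<le> k \<Longrightarrow> 0 \<le> y c" and "\<And>N. (\<Sum>i\<le>k. N i) = m \<Longrightarrow> \<bar>g N\<bar> \<le> h N"
  shows "\<bar>bern k m g y\<bar> \<le> bern k m h y"
proof -
  have "bern k m g y \<le> bern k m h y" "bern k m (\<lambda>N. -1 * g N) y \<le> bern k m h y"
    by (rule bern_mono; use assms in \<open>force simp: abs_le_iff\<close>)+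
  then show ?thesis unfolding bern_cmult by (simp add: abs_le_iff)
qed

text \<open>Size biasing: weighting by the count of outcome c is, up to the factor m y_c, the same
  as forcing one draw to be c. Read from right to left, it turns a derivative of a Bernstein
  polynomial into an expectation of values of the function itself.\<close>

lemma bern_size_bias:
  assumes "c \<le> k"
  shows "bern k m (\<lambda>N. real (N c) * g N) y = real m * y c * bern k (m - 1) (\<lambda>N. g (N(c := Suc (N c)))) y"
proof (induction m arbitrary: g)
  case 0
  then show ?case by simp
next
  case (Suc m)
  have "bern k (Suc m) (\<lambda>N. real (N c) * g N) y =
      (\<Sum>d\<le>k. y d * (bern k m (\<lambda>N. real (N c) * g (N(d := Suc (N d)))) y + (if d = c then bern k m (\<lambda>N. g (N(d := Suc (N d)))) y else 0)))"
  proof (simp only: bern.simps, rule sum.cong[OF refl])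
    fix d
    show "y d * bern k m (\<lambda>N. real ((N(d := Suc (N d))) c) * g (N(d := Suc (N d)))) y =
      y d * (bern k m (\<lambda>N. real (N c) * g (N(d := Suc (N d)))) y + (if d = c then bern k m (\<lambda>N. g (N(d := Suc (N d)))) y else 0))"
    proof (cases "d = c")
      case True
      have "(\<lambda>N. real ((N(d := Suc (N d))) c) * g (N(d := Suc (N d)))) = (\<lambda>N. real (N c) * g (N(d := Suc (N d))) + g (N(d := Suc (N d))))"
        using True by (auto simp: algebra_simps)
      then show ?thesis using True by (simp add: bern_add)
    qed auto
  qed
  also have "\<dots> = (\<Sum>d\<le>k. y d * (real m * y c * bern k (m - 1) (\<lambda>N. g ((N(c := Suc (N c)))(d := Suc ((N(c := Suc (N c))) d)))) y)) + y c * bern k m (\<lambda>N. g (N(c := Suc (N c)))) y"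
    unfolding Suc.IH using assms by (simp add: distrib_left sum.distrib if_distrib[of "(*) _"] sum.delta cong: if_cong)
  also have "(\<Sum>d\<le>k. y d * (real m * y c * bern k (m - 1) (\<lambda>N. g ((N(c := Suc (N c)))(d := Suc ((N(c := Suc (N c))) d)))) y)) = real m * y c * bern k m (\<lambda>N. g (N(c := Suc (N c)))) y"
  proof (cases m)
    case (Suc n)
    have comm: "(N(c := Suc (N c)))(d := Suc ((N(c := Suc (N c))) d)) = (N(d := Suc (N d)))(c := Suc ((N(d := Suc (N d))) c))" for N :: "nat \<Rightarrow> nat" and d
      by auto
    show ?thesis unfolding Suc by (simp only: bern.simps diff_Suc_1 comm sum_distrib_left mult_ac)
  qed simp
  finally show ?case by (simp add: distrib_right fun_upd_def)
qed

text \<open>Conditioning on one draw: for a function of a single count it only matters whether the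
  draw equals i.\<close>

lemma bern_step:
  assumes i: "i \<le> k" and y: "(\<Sum>c\<le>k. y c) = 1"
  shows "bern k (Suc m) (\<lambda>N. \<phi> (N i)) y = y i * bern k m (\<lambda>N. \<phi> (Suc (N i))) y + (1 - y i) * bern k m (\<lambda>N. \<phi> (N i)) y"
proof -
  have "bern k (Suc m) (\<lambda>N. \<phi> (N i)) y = (\<Sum>c\<le>k. y c * (if c = i then bern k m (\<lambda>N. \<phi> (Suc (N i))) y else bern k m (\<lambda>N. \<phi> (N i)) y))"
    by (auto intro!: sum.cong)
  also have "\<dots> = y i * bern k m (\<lambda>N. \<phi> (Suc (N i))) y + (\<Sum>c\<in>{..k}-{i}. y c * bern k m (\<lambda>N. \<phi> (N i)) y)"
    using i by (subst sum.remove[of _ i]) auto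
  also have "(\<Sum>c\<in>{..k}-{i}. y c * bern k m (\<lambda>N. \<phi> (N i)) y) = (1 - y i) * bern k m (\<lambda>N. \<phi> (N i)) y"
    using y i by (simp add: sum_distrib_right[symmetric] sum_diff1)
  finally show ?thesis .
qed

text \<open>The centred count \<open>V\<close> is a random walk with steps 1 - p of probability p
  and - p of probability 1 - p; its moments follow by recursion on the number of draws.\<close>

lemma bern_moments:
  assumes y: "\<And>c. c \<le> k \<Longrightarrow> 0 \<le> y c" "(\<Sum>c\<le>k. y c) = 1" and i: "i \<le> k"
  shows "bern k m (\<lambda>N. real (N i) - real m * y i) y = 0"
    and "bern k m (\<lambda>N. (real (N i) - real m * y i)\<^sup>2) y \<le> real m"
    and "bern k m (\<lambda>N. (real (N i) - real m * y i) ^ 4) y \<le> 4 * (real m)\<^sup>2"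
proof -
  define p where "p = y i"
  define V where "V m N = real (N i) - real m * p" for m and N :: "nat \<Rightarrow> nat"
  have p: "0 \<le> p" "p \<le> 1"
    using y i member_le_sum[of i "{..k}" y] by (auto simp: p_def)
  have step: "bern k (Suc m) (\<lambda>N. \<phi> (V (Suc m) N)) y = p * bern k m (\<lambda>N. \<phi> (V m N + (1 - p))) y + (1 - p) * bern k m (\<lambda>N. \<phi> (V m N + - p)) y" for m and \<phi> :: "real \<Rightarrow> real"
    using bern_step[OF i y(2), of m "\<lambda>n. \<phi> (real n - real (Suc m) * p)"] unfolding V_def p_def[symmetric] by (simp add: algebra_simps)
  have c: "bern k m (\<lambda>N. a) y = a" for a m using y by (simp add: bern_const)
  have 1: "bern k m (V m) y = 0" for m
  proof (induction m)
    case (Suc m)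
    have "bern k (Suc m) (\<lambda>N. V (Suc m) N) y = p * bern k m (\<lambda>N. V m N + (1 - p)) y + (1 - p) * bern k m (\<lambda>N. V m N + - p) y"
      by (rule step)
    then show ?case unfolding bern_add c using Suc by (simp add: algebra_simps)
  qed (simp add: V_def)
  have sq: "bern k m (\<lambda>N. (V m N + a)\<^sup>2) y = bern k m (\<lambda>N. (V m N)\<^sup>2) y + a\<^sup>2" for m a
  proof -
    have "(\<lambda>N. (V m N + a)\<^sup>2) = (\<lambda>N. ((V m N)\<^sup>2 + (2 * a) * V m N) + a\<^sup>2)"
      by (rule ext) (simp add: power2_eq_square algebra_simps)
    then show ?thesis by (simp only: bern_add bern_cmult c 1)
  qed
  have 2: "bern k m (\<lambda>N. (V m N)\<^sup>2) y = real m * (p * (1 - p))" for m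
  proof (induction m)
    case (Suc m)
    show ?case unfolding step[of _ "\<lambda>v. v\<^sup>2"] sq Suc by (simp add: power2_eq_square algebra_simps)
  qed (simp add: V_def)
  have 3: "bern k m (\<lambda>N. (V m N + a) ^ 4) y = bern k m (\<lambda>N. (V m N) ^ 4) y + 4 * a * bern k m (\<lambda>N. (V m N) ^ 3) y + 6 * a\<^sup>2 * (real m * (p * (1 - p))) + a ^ 4" for m a
  proof -
    have "(\<lambda>N. (V m N + a) ^ 4) = (\<lambda>N. ((((V m N) ^ 4 + (4 * a) * (V m N) ^ 3) + (6 * a\<^sup>2) * (V m N)\<^sup>2) + (4 * a ^ 3) * V m N) + a ^ 4)"
      by (rule ext) (simp add: power4_eq_xxxx power3_eq_cube power2_eq_square algebra_simps)
    then show ?thesis by (simp add: bern_add bern_cmult c 1 2)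
  qed
  have pq: "0 \<le> p * (1 - p)" "p * (1 - p) \<le> 1" using p by (auto intro: mult_le_one)
  \<comment> \<open>The step has mean zero, so the third moment C drops out and the fourth moment
    grows by at most 6 m + 2 per draw. This stays below 4 (m + 1)^2 - 4 m^2 = 8 m + 4.\<close>
  have gen: "p * (B + 4 * (1 - p) * C + 6 * (1 - p)\<^sup>2 * M + (1 - p) ^ 4) + (1 - p) * (B + 4 * - p * C + 6 * (- p)\<^sup>2 * M + (- p) ^ 4)
      = B + 6 * M * (p * (1 - p)) + (p * (1 - p) ^ 4 + (1 - p) * p ^ 4)" for B C M
    by (simp add: power2_eq_square power4_eq_xxxx algebra_simps)
  have 4: "bern k m (\<lambda>N. (V m N) ^ 4) y \<le> 4 * (real m)\<^sup>2" for m
  proof (induction m)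
    case (Suc m)
    have "bern k (Suc m) (\<lambda>N. (V (Suc m) N) ^ 4) y = bern k m (\<lambda>N. (V m N) ^ 4) y + 6 * real m * (p * (1 - p)) * (p * (1 - p)) + (p * (1 - p) ^ 4 + (1 - p) * p ^ 4)"
      unfolding step[of _ "\<lambda>v. v ^ 4"] 3 gen by (simp add: mult_ac)
    also have "\<dots> \<le> 4 * (real m)\<^sup>2 + 6 * real m * 1 * 1 + (1 * 1 + 1 * 1)"
      using p pq by (intro add_mono mult_mono Suc.IH) (auto intro: power_le_one)
    also have "\<dots> \<le> 4 * (real (Suc m))\<^sup>2" by (simp add: power2_eq_square algebra_simps)
    finally show ?case .
  qed (simp add: V_def)
  show "bern k m (\<lambda>N. real (N i) - real m * y i) y = 0" using 1[of m] unfolding V_def p_def .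
  have "real m * (p * (1 - p)) \<le> real m * 1" using pq by (intro mult_left_mono) auto
  then show "bern k m (\<lambda>N. (real (N i) - real m * y i)\<^sup>2) y \<le> real m" using 2[of m] unfolding V_def p_def by simp
  show "bern k m (\<lambda>N. (real (N i) - real m * y i) ^ 4) y \<le> 4 * (real m)\<^sup>2" using 4[of m] unfolding V_def p_def .
qed

section \<open>Barycentric coordinates and Bernstein polynomials on the standard simplex\<close>

definition bary :: "nat \<Rightarrow> (nat \<Rightarrow> real) \<Rightarrow> nat \<Rightarrow> real" where
  "bary k x i = (if i = 0 then 1 - (\<Sum>j=1..k. x j) else x i)"

text \<open>The count \<open>N 0\<close> does not appear: outcome 0 stands for the vertex at the
  origin, whose barycentric coordinate is recovered from the others.\<close>

definition grid_point :: "nat \<Rightarrow> nat \<Rightarrow> (nat \<Rightarrow> nat) \<Rightarrow> nat \<Rightarrow> real" where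
  "grid_point k m N = (\<lambda>i\<in>{1..k}. real (N i) / real m)"

definition int_simplex :: "nat \<Rightarrow> (nat \<Rightarrow> real) set" where
  "int_simplex k = {x \<in> extensional {1..k}. (\<forall>i\<in>{1..k}. 0 < x i) \<and> (\<Sum>i=1..k. x i) < 1}"

lemma int_simplex_subset: "int_simplex k \<subseteq> ref_simplex k"
  by (auto simp: int_simplex_def ref_simplex_def less_imp_le)

lemma sum_atMost_split0: "(\<Sum>i\<le>(k::nat). g i) = g 0 + (\<Sum>i=1..k. g i :: 'b::comm_monoid_add)"
  by (simp add: atMost_atLeast0 sum.atLeast_Suc_atMost)

lemma bary_sum: "(\<Sum>i\<le>k. bary k x i) = 1"
  unfolding sum_atMost_split0 by (simp add: bary_def)

lemma bary_nonneg: "x \<in> ref_simplex k \<Longrightarrow> i \<le> k \<Longrightarrow> 0 \<le> bary k x i"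
  by (auto simp: bary_def ref_simplex_def)

lemma bary_pos: "x \<in> int_simplex k \<Longrightarrow> i \<le> k \<Longrightarrow> 0 < bary k x i"
  by (auto simp: bary_def int_simplex_def)

lemma bary_grid_point:
  assumes "(\<Sum>i\<le>k. N i) = m" "m > 0" "i \<le> k"
  shows "bary k (grid_point k m N) i = real (N i) / real m"
proof -
  have "real m = real (N 0) + (\<Sum>i=1..k. real (N i))"
    using assms(1) unfolding sum_atMost_split0 by (metis of_nat_add of_nat_sum)
  then have "1 - (\<Sum>i=1..k. real (N i) / real m) = real (N 0) / real m"
    using assms(2) by (simp add: sum_divide_distrib[symmetric] field_simps)
  then show ?thesis using assms(3) by (auto simp: bary_def grid_point_def)
qed

lemma grid_point_ref:
  assumes "(\<Sum>i\<le>k. N i) = m" "m > 0"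
  shows "grid_point k m N \<in> ref_simplex k"
proof -
  have "0 \<le> bary k (grid_point k m N) 0" unfolding bary_grid_point[OF assms le0] by simp
  then show ?thesis by (auto simp: ref_simplex_def grid_point_def bary_def)
qed

definition bernstein :: "nat \<Rightarrow> nat \<Rightarrow> ((nat \<Rightarrow> real) \<Rightarrow> real) \<Rightarrow> (nat \<Rightarrow> real) \<Rightarrow> real" where
  "bernstein k m f = bern k m (\<lambda>N. f (grid_point k m N))"

text \<open>The partial derivative in the homogeneous variable y_c. On the simplex only differences
  of two of these are tangential; the one for c minus the one for 0 is the derivative along the
  Cartesian coordinate c.\<close>

definition bernstein_pd :: "nat \<Rightarrow> nat \<Rightarrow> ((nat \<Rightarrow> real) \<Rightarrow> real) \<Rightarrow> nat \<Rightarrow> (nat \<Rightarrow> real) \<Rightarrow> real" where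
  "bernstein_pd k m f c y = real m * bern k (m - 1) (\<lambda>N. f (grid_point k m (N(c := Suc (N c))))) y"

lemma bernstein_euler: "m > 0 \<Longrightarrow> (\<Sum>c\<le>k. y c * bernstein_pd k m f c y) = real m * bernstein k m f y"
  by (cases m) (simp_all add: bernstein_def bernstein_pd_def sum_distrib_left mult_ac del: of_nat_Suc)

lemma bernstein_bound:
  assumes x: "x \<in> ref_simplex k" and f: "\<And>z. z \<in> ref_simplex k \<Longrightarrow> \<bar>f z\<bar> \<le> B" and m: "m > 0"
  shows "\<bar>bernstein k m f (bary k x)\<bar> \<le> B"
proof -
  have "\<bar>bernstein k m f (bary k x)\<bar> \<le> bern k m (\<lambda>N. B) (bary k x)"
    unfolding bernstein_def by (intro bern_abs_le bary_nonneg[OF x] f grid_point_ref m)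
  then show ?thesis by (simp add: bern_const bary_sum)
qed

text \<open>Exchanging one draw moves the grid point by O(1/m), which offsets the factor m. Being
  uniform in x and m, the bound serves for dominated convergence.\<close>

lemma bernstein_pd_bound:
  assumes x: "x \<in> ref_simplex k" and f: "lip_simplex k L f" and m: "m > 0" and c: "c \<le> k"
  shows "\<bar>bernstein_pd k m f c (bary k x) - bernstein_pd k m f 0 (bary k x)\<bar> \<le> 2 * L"
proof -
  have L: "L \<ge> 0" using f by (simp add: lip_simplex_def)
  have "\<bar>bern k (m - 1) (\<lambda>N. f (grid_point k m (N(c := Suc (N c)))) - f (grid_point k m (N(0 := Suc (N 0))))) (bary k x)\<bar>
      \<le> bern k (m - 1) (\<lambda>N. 2 * L / real m) (bary k x)"
  proof (rule bern_abs_le[OF bary_nonneg[OF x]])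
    fix N :: "nat \<Rightarrow> nat" assume N: "(\<Sum>i\<le>k. N i) = m - 1"
    have r: "grid_point k m (N(d := Suc (N d))) \<in> ref_simplex k" if "d \<le> k" for d
      using sum_fun_upd_Suc[OF that, of N] N m by (intro grid_point_ref) auto
    have "\<bar>f (grid_point k m (N(c := Suc (N c)))) - f (grid_point k m (N(0 := Suc (N 0))))\<bar>
        \<le> L * (\<Sum>i=1..k. \<bar>grid_point k m (N(c := Suc (N c))) i - grid_point k m (N(0 := Suc (N 0))) i\<bar>)"
      using f r[OF c] r[of 0] unfolding lip_simplex_def by auto
    also have "\<dots> \<le> L * (2 / real m)"
    proof (rule mult_left_mono[OF _ L])
      have "(\<Sum>i=1..k. \<bar>grid_point k m (N(c := Suc (N c))) i - grid_point k m (N(0 := Suc (N 0))) i\<bar>) \<le> (\<Sum>i\<in>{1..k}. if i = c then 1 / real m else 0)"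
      by (intro sum_mono) (auto simp: grid_point_def diff_divide_distrib[symmetric])
      also have "\<dots> \<le> 2 / real m" using m by (auto simp: divide_simps)
      finally show "(\<Sum>i=1..k. \<bar>grid_point k m (N(c := Suc (N c))) i - grid_point k m (N(0 := Suc (N 0))) i\<bar>) \<le> 2 / real m" .
    qed
    finally show "\<bar>f (grid_point k m (N(c := Suc (N c)))) - f (grid_point k m (N(0 := Suc (N 0))))\<bar> \<le> 2 * L / real m"
      by (simp add: mult.commute)
  qed
  then have "real m * \<bar>bern k (m - 1) (\<lambda>N. f (grid_point k m (N(c := Suc (N c)))) - f (grid_point k m (N(0 := Suc (N 0))))) (bary k x)\<bar>
      \<le> real m * (2 * L / real m)" by (intro mult_left_mono) (auto simp: bern_const bary_sum)
  then show ?thesis using m unfolding bernstein_pd_def bern_diff by (simp add: abs_mult right_diff_distrib[symmetric])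
qed

definition grid_dev :: "nat \<Rightarrow> (nat \<Rightarrow> real) \<Rightarrow> nat \<Rightarrow> (nat \<Rightarrow> nat) \<Rightarrow> real" where
  "grid_dev k y n N = (\<Sum>i\<le>k. \<bar>real (N i) / real n - y i\<bar>)"

text \<open>Cauchy-Schwarz over the k + 1 coordinates reduces the moments of the l1-deviation to
  those of single counts and accounts for the powers of \<open>Suc k\<close>.\<close>

lemma grid_dev_moments:
  assumes y: "\<And>c. c \<le> k \<Longrightarrow> 0 \<le> y c" "(\<Sum>c\<le>k. y c) = 1" and n: "n > 0"
  shows "bern k n (\<lambda>N. (grid_dev k y n N)\<^sup>2) y \<le> real (Suc k) ^ 2 / real n"
    and "bern k n (\<lambda>N. (grid_dev k y n N) ^ 4) y \<le> 4 * real (Suc k) ^ 4 / (real n)\<^sup>2"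
proof -
  define V where "V i N = real (N i) - real n * y i" for i and N :: "nat \<Rightarrow> nat"
  have W: "real (N i) / real n - y i = V i N / real n" for i N using n by (simp add: V_def diff_divide_distrib)
  have 2: "(grid_dev k y n N)\<^sup>2 \<le> (\<Sum>i\<le>k. real (Suc k) / (real n)\<^sup>2 * (V i N)\<^sup>2)" for N
  proof -
    have "(grid_dev k y n N)\<^sup>2 \<le> (\<Sum>i\<le>k. \<bar>V i N / real n\<bar>\<^sup>2) * real (card {..k})"
      unfolding grid_dev_def W by (rule sum_squared_le_sum_of_squares)
    then show ?thesis by (simp add: power_divide sum_distrib_left sum_distrib_right sum_divide_distrib mult_ac)
  qed
  have 4: "(grid_dev k y n N) ^ 4 \<le> (\<Sum>i\<le>k. real (Suc k) ^ 3 / (real n) ^ 4 * (V i N) ^ 4)" for N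
  proof -
    have "(grid_dev k y n N) ^ 4 = ((grid_dev k y n N)\<^sup>2)\<^sup>2" by simp
    also have "\<dots> \<le> (\<Sum>i\<le>k. real (Suc k) / (real n)\<^sup>2 * (V i N)\<^sup>2)\<^sup>2" by (intro power_mono 2) simp
    also have "\<dots> \<le> (\<Sum>i\<le>k. (real (Suc k) / (real n)\<^sup>2 * (V i N)\<^sup>2)\<^sup>2) * real (card {..k})"
      by (rule sum_squared_le_sum_of_squares)
    also have "\<dots> = (\<Sum>i\<le>k. real (Suc k) ^ 3 / (real n) ^ 4 * (V i N) ^ 4)"
      unfolding sum_distrib_right
      by (simp add: power_mult_distrib power_divide power3_eq_cube power2_eq_square power4_eq_xxxx mult_ac del: of_nat_Suc)
    finally show ?thesis .
  qed
  have m2: "bern k n (\<lambda>N. (V i N)\<^sup>2) y \<le> real n" if "i \<le> k" for i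
    unfolding V_def by (rule bern_moments(2)[OF y that])
  have m4: "bern k n (\<lambda>N. (V i N) ^ 4) y \<le> 4 * (real n)\<^sup>2" if "i \<le> k" for i
    unfolding V_def by (rule bern_moments(3)[OF y that])
  have "bern k n (\<lambda>N. (grid_dev k y n N)\<^sup>2) y \<le> bern k n (\<lambda>N. \<Sum>i\<le>k. real (Suc k) / (real n)\<^sup>2 * (V i N)\<^sup>2) y"
    by (rule bern_mono[OF y(1) 2])
  also have "\<dots> \<le> (\<Sum>i\<le>k. real (Suc k) / (real n)\<^sup>2 * real n)"
    unfolding bern_sum bern_cmult by (intro sum_mono mult_left_mono m2) auto
  also have "\<dots> = real (Suc k) ^ 2 / real n" using n by (simp add: power2_eq_square)
  finally show "bern k n (\<lambda>N. (grid_dev k y n N)\<^sup>2) y \<le> real (Suc k) ^ 2 / real n" .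
  have "bern k n (\<lambda>N. (grid_dev k y n N) ^ 4) y \<le> bern k n (\<lambda>N. \<Sum>i\<le>k. real (Suc k) ^ 3 / (real n) ^ 4 * (V i N) ^ 4) y"
    by (rule bern_mono[OF y(1) 4])
  also have "\<dots> \<le> (\<Sum>i\<le>k. real (Suc k) ^ 3 / (real n) ^ 4 * (4 * (real n)\<^sup>2))"
    unfolding bern_sum bern_cmult by (intro sum_mono mult_left_mono m4) auto
  also have "\<dots> = 4 * real (Suc k) ^ 4 / (real n)\<^sup>2" using n by (simp add: power2_eq_square power4_eq_xxxx power3_eq_cube)
  finally show "bern k n (\<lambda>N. (grid_dev k y n N) ^ 4) y \<le> 4 * real (Suc k) ^ 4 / (real n)\<^sup>2" .
qed

lemma tendsto_by_rate:
  fixes a :: "nat \<Rightarrow> real"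
  assumes "\<And>\<eta>. \<eta> > 0 \<Longrightarrow> \<exists>C. \<forall>m. \<bar>a m - l\<bar> \<le> \<eta> + C / real (Suc m)"
  shows "a \<longlonglongrightarrow> l"
proof (rule LIMSEQ_I)
  fix r :: real assume r: "r > 0"
  obtain C where C: "\<And>m. \<bar>a m - l\<bar> \<le> r / 2 + C / real (Suc m)" using assms[of "r / 2"] r by auto
  have "(\<lambda>m. C / real (Suc m)) \<longlonglongrightarrow> 0" by (rule LIMSEQ_Suc[OF lim_const_over_n])
  from LIMSEQ_D[OF this half_gt_zero[OF r]] obtain M where M: "\<forall>m\<ge>M. norm (C / real (Suc m) - 0) < r / 2" by blast
  show "\<exists>M. \<forall>m\<ge>M. norm (a m - l) < r"
  proof (intro exI[of _ M] allI impI)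
    fix m assume "m \<ge> M"
    then have "\<bar>C / real (Suc m)\<bar> < r / 2" using M by simp
    then show "norm (a m - l) < r" using C[of m] unfolding real_norm_def by linarith
  qed
qed

lemma grid_point_dev:
  assumes "(\<Sum>i\<le>k. N i) = n" "n > 0"
  shows "(\<Sum>i=1..k. \<bar>grid_point k n N i - x i\<bar>) \<le> grid_dev k (bary k x) n N"
proof -
  have "(\<Sum>i=1..k. \<bar>grid_point k n N i - x i\<bar>) = (\<Sum>i=1..k. \<bar>real (N i) / real n - bary k x i\<bar>)"
    by (intro sum.cong) (auto simp: grid_point_def bary_def)
  also have "\<dots> \<le> grid_dev k (bary k x) n N" unfolding grid_dev_def sum_atMost_split0 by simp
  finally show ?thesis .
qed

text \<open>Chebyshev's argument: S \<le> e + S^2 / e bounds the mean deviation by an arbitrarily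
  small constant plus a second moment of order 1/m.\<close>

lemma bernstein_tendsto:
  assumes x: "x \<in> ref_simplex k" and f: "lip_simplex k L f"
  shows "(\<lambda>m. bernstein k (Suc m) f (bary k x)) \<longlonglongrightarrow> f x"
proof (rule tendsto_by_rate)
  fix \<eta> :: real assume \<eta>: "\<eta> > 0"
  have L: "L \<ge> 0" using f by (simp add: lip_simplex_def)
  \<comment> \<open>The summand 1 in the denominator admits L = 0.\<close>
  define e where "e = \<eta> / (L + 1)"
  have e: "e > 0" "L * e \<le> \<eta>" using \<eta> L by (auto simp: e_def field_simps)
  let ?y = "bary k x"
  note y = bary_nonneg[OF x] bary_sum
  have "\<bar>bernstein k (Suc m) f ?y - f x\<bar> \<le> \<eta> + L / e * real (Suc k) ^ 2 / real (Suc m)" for m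
  proof -
    let ?n = "Suc m"
    have "\<bar>bern k ?n (\<lambda>N. f (grid_point k ?n N) - f x) ?y\<bar> \<le> bern k ?n (\<lambda>N. L * e + L / e * (grid_dev k ?y ?n N)\<^sup>2) ?y"
    proof (rule bern_abs_le[OF y(1)])
      fix N :: "nat \<Rightarrow> nat" assume N: "(\<Sum>i\<le>k. N i) = ?n"
      define S where "S = grid_dev k ?y ?n N"
      have S0: "S \<ge> 0" unfolding S_def grid_dev_def by (intro sum_nonneg) auto
      have "\<bar>f (grid_point k ?n N) - f x\<bar> \<le> L * (\<Sum>i=1..k. \<bar>grid_point k ?n N i - x i\<bar>)"
        using f grid_point_ref[OF N] x unfolding lip_simplex_def by auto
      also have "\<dots> \<le> L * S" unfolding S_def using L by (intro mult_left_mono grid_point_dev N) auto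
      also have "S \<le> e + S\<^sup>2 / e"
      proof (cases "S \<le> e")
        case True then show ?thesis using e by (simp add: add_increasing2)
      next
        case False
        then have "S * e \<le> S * S" using S0 by (intro mult_left_mono) auto
        then have "S \<le> S\<^sup>2 / e" using e by (simp add: power2_eq_square pos_le_divide_eq)
        then show ?thesis using e by linarith
      qed
      finally show "\<bar>f (grid_point k ?n N) - f x\<bar> \<le> L * e + L / e * (grid_dev k ?y ?n N)\<^sup>2"
        using L unfolding S_def[symmetric] by (simp add: distrib_left mult_left_mono)
    qed
    also have "\<dots> = L * e + L / e * bern k ?n (\<lambda>N. (grid_dev k ?y ?n N)\<^sup>2) ?y"
      by (simp only: bern_add bern_cmult bern_const bary_sum power_one mult_1_right)
    also have "\<dots> \<le> \<eta> + L / e * (real (Suc k) ^ 2 / real ?n)"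
      using e L y by (intro add_mono mult_left_mono grid_dev_moments) auto
    finally show ?thesis unfolding bernstein_def bern_diff by (simp add: bern_const bary_sum)
  qed
  then show "\<exists>C. \<forall>m. \<bar>bernstein k (Suc m) f ?y - f x\<bar> \<le> \<eta> + C / real (Suc m)" by blast
qed

text \<open>By size biasing, the difference of derivatives is the expectation of Z f, where the
  score Z = N_c / y_c - N_0 / y_0 has mean 0, covariance 1 with the deviation W_c and covariance 0
  with the other W_a. The affine Taylor polynomial therefore contributes exactly \<open>D c\<close>.
  For the remainder, |Z| is at most n A S with S the total deviation, so the error is controlled by
  n times the second and fourth moments of S, that is by \<eta> + O(1/n). Division by y_c and y_0 is
  the reason for taking x in the interior.\<close>

lemma bernstein_pd_tendsto:
  assumes x: "x \<in> int_simplex k" and f: "lip_simplex k L f" and D: "diff_simplex k f D x" and c: "c \<in> {1..k}"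
  shows "(\<lambda>m. bernstein_pd k (Suc m) f c (bary k x) - bernstein_pd k (Suc m) f 0 (bary k x)) \<longlonglongrightarrow> D c"
proof (rule tendsto_by_rate)
  fix \<eta> :: real assume \<eta>: "\<eta> > 0"
  have L: "L \<ge> 0" using f by (simp add: lip_simplex_def)
  have xr: "x \<in> ref_simplex k" using x int_simplex_subset by blast
  define y where "y = bary k x"
  have y: "\<And>c. c \<le> k \<Longrightarrow> 0 \<le> y c" "(\<Sum>c\<le>k. y c) = 1" unfolding y_def using bary_nonneg[OF xr] bary_sum by auto
  have ck: "c \<le> k" "c \<noteq> 0" using c by auto
  have yc: "y c > 0" "y 0 > 0" unfolding y_def using bary_pos[OF x] ck by auto
  define A where "A = 1 / y c + 1 / y 0"
  have A: "A > 0" unfolding A_def using yc by (simp add: add_pos_pos)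
  \<comment> \<open>Normalised so that n A \<epsilon> times the second-moment bound
    \<open>real (Suc k) ^ 2 / real n\<close> equals \<eta>.\<close>
  define \<epsilon> where "\<epsilon> = \<eta> / (A * real (Suc k) ^ 2)"
  have \<epsilon>: "\<epsilon> > 0" unfolding \<epsilon>_def using \<eta> A by simp
  obtain \<delta> where \<delta>: "\<delta> > 0" "\<And>z. z \<in> ref_simplex k \<Longrightarrow> (\<Sum>i=1..k. \<bar>z i - x i\<bar>) < \<delta> \<Longrightarrow>
     \<bar>f z - f x - (\<Sum>i=1..k. D i * (z i - x i))\<bar> \<le> \<epsilon> * (\<Sum>i=1..k. \<bar>z i - x i\<bar>)"
    using D \<epsilon> unfolding diff_simplex_def by meson
  define DD where "DD = (\<Sum>i=1..k. \<bar>D i\<bar>)"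
  have DD: "DD \<ge> 0" unfolding DD_def by (intro sum_nonneg) auto
  \<comment> \<open>Outside the \<delta>-ball the remainder is at most (L + DD) S, and S \<ge>
    \<delta> there, so S \<le> S^3 / \<delta>^2. Together with the factor S from Z, this cubic term
    is what calls for a fourth moment.\<close>
  define K where "K = (L + DD) / \<delta>\<^sup>2"
  have K: "K \<ge> 0" unfolding K_def using L DD by simp
  have "\<bar>(bernstein_pd k (Suc m) f c y - bernstein_pd k (Suc m) f 0 y) - D c\<bar> \<le> \<eta> + (A * K * 4 * real (Suc k) ^ 4) / real (Suc m)" for m
  proof -
    define n where "n = Suc m"
    have n: "n > 0" by (simp add: n_def)
    define E where "E g = bern k n g y" for g
    have Esum: "E (\<lambda>N. g N + h N) = E g + E h" "E (\<lambda>N. g N - h N) = E g - E h" "E (\<lambda>N. a * g N) = a * E g" "E (\<lambda>N. a) = a" for g h a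
      unfolding E_def by (simp_all add: bern_add bern_diff bern_cmult bern_const y)
    have Emul: "E (\<lambda>N. g N * a) = E g * a" for g a using Esum(3)[of a g] by (simp add: mult.commute)
    define Z where "Z N = real (N c) / y c - real (N 0) / y 0" for N :: "nat \<Rightarrow> nat"
    define W where "W a N = real (N a) / real n - y a" for a and N :: "nat \<Rightarrow> nat"
    have sb: "E (\<lambda>N. real (N d) / y d * g N) = real n * bern k (n - 1) (\<lambda>N. g (N(d := Suc (N d)))) y" if "d \<le> k" "y d > 0" for d g
    proof -
      have "E (\<lambda>N. real (N d) / y d * g N) = E (\<lambda>N. (1 / y d) * (real (N d) * g N))" by (simp add: mult_ac)
      also have "\<dots> = (1 / y d) * (real n * y d * bern k (n - 1) (\<lambda>N. g (N(d := Suc (N d)))) y)"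
        unfolding Esum(3) unfolding E_def bern_size_bias[OF that(1)] ..
      finally show ?thesis using that by simp
    qed
    have Zg: "E (\<lambda>N. Z N * g N) = real n * bern k (n - 1) (\<lambda>N. g (N(c := Suc (N c)))) y - real n * bern k (n - 1) (\<lambda>N. g (N(0 := Suc (N 0)))) y" for g
      unfolding Z_def left_diff_distrib Esum(2) using sb ck yc by simp
    have Z1: "E Z = 0" using Zg[of "\<lambda>_. 1"] by simp
    have Zf: "E (\<lambda>N. Z N * f (grid_point k n N)) = bernstein_pd k n f c y - bernstein_pd k n f 0 y"
      unfolding Zg bernstein_pd_def ..
    have ZW: "E (\<lambda>N. Z N * W a N) = (if a = c then 1 else 0)" if a: "a \<in> {1..k}" for a
    proof -
      have "bern k (n - 1) (\<lambda>N. W a (N(d := Suc (N d)))) y = bern k (n - 1) (\<lambda>N. W a N) y + (if a = d then 1 / real n else 0)" for d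
      proof -
        have "(\<lambda>N. W a (N(d := Suc (N d)))) = (\<lambda>N. W a N + (if a = d then 1 / real n else 0))"
          by (auto simp: W_def add_divide_distrib)
        then show ?thesis by (simp add: bern_add bern_const y)
      qed
      then show ?thesis unfolding Zg using a n by (auto simp: distrib_left)
    qed
    define R where "R N = f (grid_point k n N) - f x - (\<Sum>a=1..k. D a * W a N)" for N
    have "E (\<lambda>N. Z N * R N) = E (\<lambda>N. Z N * f (grid_point k n N) - f x * Z N - (\<Sum>a=1..k. D a * (Z N * W a N)))"
      by (simp add: R_def right_diff_distrib sum_distrib_left mult_ac)
    also have "\<dots> = (bernstein_pd k n f c y - bernstein_pd k n f 0 y) - (\<Sum>a=1..k. D a * (if a = c then 1 else 0))"
    proof -
      have "E (\<lambda>N. \<Sum>a=1..k. D a * (Z N * W a N)) = (\<Sum>a=1..k. D a * (if a = c then 1 else 0))"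
        unfolding E_def bern_sum using ZW by (auto simp: E_def bern_cmult intro!: sum.cong)
      then show ?thesis unfolding Esum(2) Zf Esum(3) Z1 by simp
    qed
    also have "(\<Sum>a=1..k. D a * (if a = c then 1 else 0)) = D c" using c by (simp add: if_distrib cong: if_cong)
    finally have ER: "(bernstein_pd k n f c y - bernstein_pd k n f 0 y) - D c = E (\<lambda>N. Z N * R N)" by simp
    have "\<bar>E (\<lambda>N. Z N * R N)\<bar> \<le> E (\<lambda>N. (real n * A * \<epsilon>) * (grid_dev k y n N)\<^sup>2 + (real n * A * K) * (grid_dev k y n N) ^ 4)"
      unfolding E_def
    proof (rule bern_abs_le[OF y(1)])
      fix N :: "nat \<Rightarrow> nat" assume N: "(\<Sum>i\<le>k. N i) = n"
      define S where "S = grid_dev k y n N"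
      define S1 where "S1 = (\<Sum>i=1..k. \<bar>grid_point k n N i - x i\<bar>)"
      have S1: "S1 \<le> S" unfolding S1_def S_def y_def by (rule grid_point_dev[OF N n])
      have S1_0: "S1 \<ge> 0" unfolding S1_def by (intro sum_nonneg) auto
      have WS: "\<bar>W a N\<bar> \<le> S" if "a \<le> k" for a unfolding W_def S_def grid_dev_def
        using that member_le_sum[of a "{..k}" "\<lambda>i. \<bar>real (N i) / real n - y i\<bar>"] by auto
      have "Z N = real n * (W c N / y c - W 0 N / y 0)"
        using yc n by (simp add: Z_def W_def field_simps)
      then have "\<bar>Z N\<bar> = real n * \<bar>W c N / y c - W 0 N / y 0\<bar>" by (simp add: abs_mult)
      also have "\<dots> \<le> real n * (S / y c + S / y 0)"
        using WS[OF ck(1)] WS[of 0] yc by (intro mult_left_mono order_trans[OF abs_triangle_ineq4] add_mono) (auto simp: divide_right_mono)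
      finally have ZS: "\<bar>Z N\<bar> \<le> real n * A * S" by (simp add: A_def algebra_simps)
      have W: "(\<Sum>a=1..k. D a * W a N) = (\<Sum>i=1..k. D i * (grid_point k n N i - x i))"
        by (intro sum.cong) (auto simp: W_def grid_point_def y_def bary_def)
      have RS: "\<bar>R N\<bar> \<le> \<epsilon> * S + K * S ^ 3"
      proof (cases "S1 < \<delta>")
        case True
        have "\<bar>R N\<bar> \<le> \<epsilon> * S1" unfolding R_def W S1_def
          using \<delta>(2)[OF grid_point_ref[OF N n]] True unfolding S1_def by simp
        also have "\<dots> \<le> \<epsilon> * S" using S1 \<epsilon> by simp
        finally show ?thesis using K S1 S1_0 by (simp add: add_increasing2)
      next
        case False
        have "\<bar>f (grid_point k n N) - f x\<bar> \<le> L * S1" unfolding S1_def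
          using f grid_point_ref[OF N n] xr unfolding lip_simplex_def by auto
        moreover have "\<bar>\<Sum>i=1..k. D i * (grid_point k n N i - x i)\<bar> \<le> (\<Sum>i=1..k. \<bar>D i\<bar> * S1)"
          unfolding S1_def
          by (intro order_trans[OF sum_abs] sum_mono) (auto simp: abs_mult intro!: mult_left_mono member_le_sum)
        ultimately have "\<bar>R N\<bar> \<le> L * S1 + DD * S1" unfolding R_def W DD_def sum_distrib_right by linarith
        also have "\<dots> \<le> (L + DD) * S" using S1 L DD by (simp add: distrib_right[symmetric] mult_left_mono)
        also have "\<dots> \<le> (L + DD) * (S * (S\<^sup>2 / \<delta>\<^sup>2))"
        proof -
          have "\<delta>\<^sup>2 \<le> S\<^sup>2" using False S1 \<delta>(1) by (intro power_mono) auto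
          then have "1 \<le> S\<^sup>2 / \<delta>\<^sup>2" using \<delta>(1) by simp
          then have "S * 1 \<le> S * (S\<^sup>2 / \<delta>\<^sup>2)" using S1 S1_0 by (intro mult_left_mono) auto
          then show ?thesis using L DD by (intro mult_left_mono) auto
        qed
        also have "\<dots> = K * S ^ 3" by (simp add: K_def power2_eq_square power3_eq_cube)
        finally show ?thesis using \<epsilon> S1 S1_0 by (simp add: add_increasing)
      qed
      have "\<bar>Z N * R N\<bar> \<le> (real n * A * S) * (\<epsilon> * S + K * S ^ 3)"
        unfolding abs_mult using ZS RS by (intro mult_mono) auto
      also have "\<dots> = (real n * A * \<epsilon>) * S\<^sup>2 + (real n * A * K) * S ^ 4"
        by (simp add: algebra_simps power2_eq_square power3_eq_cube power4_eq_xxxx)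
      finally show "\<bar>Z N * R N\<bar> \<le> (real n * A * \<epsilon>) * (grid_dev k y n N)\<^sup>2 + (real n * A * K) * (grid_dev k y n N) ^ 4"
        unfolding S_def .
    qed
    also have "\<dots> \<le> (real n * A * \<epsilon>) * (real (Suc k) ^ 2 / real n) + (real n * A * K) * (4 * real (Suc k) ^ 4 / (real n)\<^sup>2)"
      unfolding Esum unfolding E_def using A \<epsilon> K y n by (intro add_mono mult_left_mono grid_dev_moments) auto
    also have "(real n * A * \<epsilon>) * (real (Suc k) ^ 2 / real n) = \<eta>"
      using n A by (simp add: \<epsilon>_def del: of_nat_Suc)
    also have "(real n * A * K) * (4 * real (Suc k) ^ 4 / (real n)\<^sup>2) = (A * K * 4 * real (Suc k) ^ 4) / real n"
      using n by (simp add: power2_eq_square del: of_nat_Suc)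
    finally show ?thesis using ER unfolding n_def by simp
  qed
  then show "\<exists>C. \<forall>m. \<bar>(bernstein_pd k (Suc m) f c (bary k x) - bernstein_pd k (Suc m) f 0 (bary k x)) - D c\<bar> \<le> \<eta> + C / real (Suc m)"
    unfolding y_def by blast
qed

section \<open>Divergence of homogeneous polynomials\<close>

lemma has_integral_beta:
  fixes s :: real
  assumes "s \<ge> 0"
  shows "((\<lambda>y. y ^ a * (s - y) ^ c) has_integral (fact a * fact c / fact (a + c + 1) * s ^ (a + c + 1))) {0..s}"
proof (induction a arbitrary: c)
  case 0
  have "((\<lambda>y. (s - y) ^ c) has_integral (- ((s - s) ^ Suc c) / real (Suc c)) - (- ((s - 0) ^ Suc c) / real (Suc c))) {0..s}"
  proof (rule fundamental_theorem_of_calculus[OF assms])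
    fix y
    have "((\<lambda>y. - ((s - y) ^ Suc c) / real (Suc c)) has_real_derivative - (real (Suc c) * (s - y) ^ c * (0 - 1)) / real (Suc c)) (at y within {0..s})"
      by (intro derivative_eq_intros | simp)+
    then show "((\<lambda>y. - ((s - y) ^ Suc c) / real (Suc c)) has_vector_derivative (s - y) ^ c) (at y within {0..s})"
      by (simp add: has_real_derivative_iff_has_vector_derivative del: of_nat_Suc)
  qed
  then show ?case by (simp add: field_simps del: of_nat_Suc)
next
  case (Suc a)
  \<comment> \<open>Integration by parts; the boundary terms vanish because both exponents in the
    antiderivative are positive.\<close>
  have "((\<lambda>y. real (Suc a) / real (Suc c) * (y ^ a * (s - y) ^ Suc c) - y ^ Suc a * (s - y) ^ c) has_integral
      (s ^ Suc a * (s - s) ^ Suc c / real (Suc c)) - (0 ^ Suc a * (s - 0) ^ Suc c / real (Suc c))) {0..s}"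
  proof (rule fundamental_theorem_of_calculus[OF assms])
    fix y
    have "((\<lambda>y. y ^ Suc a * (s - y) ^ Suc c / real (Suc c)) has_real_derivative
       ((real (Suc a) * y ^ a) * (s - y) ^ Suc c + (real (Suc c) * (s - y) ^ c * (0 - 1)) * y ^ Suc a) / real (Suc c)) (at y within {0..s})"
      by (intro derivative_eq_intros | simp)+
    moreover have "((real (Suc a) * y ^ a) * (s - y) ^ Suc c + (real (Suc c) * (s - y) ^ c * (0 - 1)) * y ^ Suc a) / real (Suc c)
        = real (Suc a) / real (Suc c) * (y ^ a * (s - y) ^ Suc c) - y ^ Suc a * (s - y) ^ c"
      by (simp add: field_simps del: of_nat_Suc power_Suc)
    ultimately show "((\<lambda>y. y ^ Suc a * (s - y) ^ Suc c / real (Suc c)) has_vector_derivative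
        real (Suc a) / real (Suc c) * (y ^ a * (s - y) ^ Suc c) - y ^ Suc a * (s - y) ^ c) (at y within {0..s})"
      by (simp add: has_real_derivative_iff_has_vector_derivative del: of_nat_Suc power_Suc)
  qed
  then have "((\<lambda>y. real (Suc a) / real (Suc c) * (y ^ a * (s - y) ^ Suc c) - y ^ Suc a * (s - y) ^ c) has_integral 0) {0..s}" by simp
  from has_integral_diff[OF has_integral_mult_right[OF Suc.IH[of "Suc c"], of "real (Suc a) / real (Suc c)"] this]
  have "((\<lambda>y. y ^ Suc a * (s - y) ^ c) has_integral
      real (Suc a) / real (Suc c) * (fact a * fact (Suc c) / fact (a + Suc c + 1) * s ^ (a + Suc c + 1)) - 0) {0..s}"
    by (simp del: of_nat_Suc power_Suc fact_Suc)
  moreover have "real (Suc a) / real (Suc c) * (fact a * fact (Suc c) / fact (a + Suc c + 1) * s ^ (a + Suc c + 1)) - 0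
      = fact (Suc a) * fact c / fact (Suc a + c + 1) * s ^ (Suc a + c + 1)"
  proof -
    have e: "a + Suc c + 1 = Suc a + c + 1" by simp
    have "C \<noteq> 0 \<Longrightarrow> A / C * (x * (C * z) / F * S) - 0 = A * x * z / F * S" for A C x z F S :: real by simp
    then show ?thesis unfolding e fact_Suc[of a] fact_Suc[of c] by simp
  qed
  ultimately show ?case by (simp only:)
qed

lemma nn_integral_beta:
  fixes s :: real
  assumes "s \<ge> 0"
  shows "(\<integral>\<^sup>+y. ennreal (if 0 \<le> y \<and> y \<le> s then y ^ a * (s - y) ^ c else 0) \<partial>lborel) = ennreal (fact a * fact c / fact (a + c + 1) * s ^ (a + c + 1))"
proof -
  have "((\<lambda>y. if y \<in> {0..s} then y ^ a * (s - y) ^ c else 0) has_integral (fact a * fact c / fact (a + c + 1) * s ^ (a + c + 1))) UNIV"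
    using has_integral_beta[OF assms] by (simp only: has_integral_restrict_UNIV)
  then have "((\<lambda>y. if 0 \<le> y \<and> y \<le> s then y ^ a * (s - y) ^ c else 0) has_integral (fact a * fact c / fact (a + c + 1) * s ^ (a + c + 1))) UNIV"
    by simp
  then show ?thesis by (rule nn_integral_has_integral_lborel[rotated 2]) auto
qed

lemma pred_nonneg_lpi:
  assumes "finite I"
  shows "Measurable.pred (lpi I) (\<lambda>x. \<forall>i\<in>I. 0 \<le> x i)"
proof -
  have "{x \<in> space (lpi I). \<forall>i\<in>I. 0 \<le> x i} = Pi\<^sub>E I (\<lambda>_. {0..})" by (simp add: set_eq_iff space_PiM PiE_iff conj_commute)
  then show ?thesis using assms by (simp add: pred_def sets_PiM_I_finite)
qed

lemma measurable_if_conj: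
  assumes [measurable]: "Measurable.pred M Q" "Measurable.pred M R" "F \<in> borel_measurable M"
  shows "(\<lambda>x. if Q x \<and> R x then F x else (0::real)) \<in> borel_measurable M"
  by measurable

text \<open>The last coordinate y is the outer variable: for fixed y the others range over the
  simplex of size s - y, which is why the size s stays general in the induction, and a beta integral
  remains. The exponent b belongs to the slack s minus the sum of the coordinates.\<close>

lemma nn_integral_dirichlet:
  fixes s :: real
  assumes "s \<ge> 0"
  shows "(\<integral>\<^sup>+x. ennreal (if (\<forall>i\<in>{1..k}. 0 \<le> x i) \<and> (\<Sum>i=1..k. x i) \<le> s then (\<Prod>i=1..k. x i ^ \<beta> i) * (s - (\<Sum>i=1..k. x i)) ^ b else 0) \<partial>lpi {1..k})
    = ennreal (s ^ (k + b + (\<Sum>i=1..k. \<beta> i)) * ((\<Prod>i=1..k. fact (\<beta> i)) * fact b / fact (k + b + (\<Sum>i=1..k. \<beta> i))))"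
  using assms
proof (induction k arbitrary: s)
  case 0
  interpret product_sigma_finite "\<lambda>_::nat. lborel :: real measure" by (rule product_sigma_finite_lborel)
  show ?case using 0 by (simp add: nn_integral_empty space_PiM)
next
  case (Suc k)
  interpret product_sigma_finite "\<lambda>_::nat. lborel :: real measure" by (rule product_sigma_finite_lborel)
  define P where "P k s x = (if (\<forall>i\<in>{1..k}. 0 \<le> x i) \<and> (\<Sum>i=1..k. x i) \<le> s then (\<Prod>i=1..k. x i ^ \<beta> i) * (s - (\<Sum>i=1..k. x i)) ^ b else 0)"
    for k :: nat and s :: real and x :: "nat \<Rightarrow> real"
  define K where "K = k + b + (\<Sum>i=1..k. \<beta> i)"
  define C :: real where "C = (\<Prod>i=1..k. fact (\<beta> i)) * fact b / fact K"
  have C: "C \<ge> 0" unfolding C_def by (intro divide_nonneg_nonneg mult_nonneg_nonneg prod_nonneg) auto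
  have ins: "{1..Suc k} = insert (Suc k) {1..k}" by auto
  have Pm: "P n s \<in> borel_measurable (lpi {1..n})" for n s
  proof -
    have sm: "(\<lambda>x. \<Sum>i=1..n. x i) \<in> borel_measurable (lpi {1..n})" by (intro borel_measurable_sum) auto
    have pm: "(\<lambda>x. \<Prod>i=1..n. x i ^ \<beta> i) \<in> borel_measurable (lpi {1..n})" by (intro borel_measurable_prod borel_measurable_power) auto
    show ?thesis unfolding P_def
      by (intro measurable_if_conj pred_nonneg_lpi borel_measurable_times borel_measurable_power borel_measurable_diff
          borel_measurable_const sm pm finite_atLeastAtMost pred_def[THEN iffD2] borel_measurable_le)
  qed
  have PS: "P (Suc k) s (x(Suc k := y)) = (if 0 \<le> y \<and> y \<le> s then y ^ \<beta> (Suc k) * P k (s - y) x else 0)" for x y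
  proof -
    have "(\<Sum>i=1..k. (x(Suc k := y)) i) = (\<Sum>i=1..k. x i)" by (intro sum.cong) auto
    moreover have "(\<Prod>i=1..k. (x(Suc k := y)) i ^ \<beta> i) = (\<Prod>i=1..k. x i ^ \<beta> i)" by (intro prod.cong) auto
    ultimately have "(\<Sum>i=1..Suc k. (x(Suc k := y)) i) = (\<Sum>i=1..k. x i) + y"
      "(\<Prod>i=1..Suc k. (x(Suc k := y)) i ^ \<beta> i) = (\<Prod>i=1..k. x i ^ \<beta> i) * y ^ \<beta> (Suc k)"
      by simp_all
    moreover have "(\<forall>i\<in>{1..Suc k}. 0 \<le> (x(Suc k := y)) i) \<longleftrightarrow> (\<forall>i\<in>{1..k}. 0 \<le> x i) \<and> 0 \<le> y" unfolding ins by auto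
    moreover have "(\<forall>i\<in>{1..k}. 0 \<le> x i) \<Longrightarrow> 0 \<le> (\<Sum>i=1..k. x i)" by (intro sum_nonneg) auto
    ultimately show ?thesis unfolding P_def by (auto simp: algebra_simps)
  qed
  have IH: "(\<integral>\<^sup>+x. ennreal (P k s x) \<partial>lpi {1..k}) = ennreal (s ^ K * C)" if "s \<ge> 0" for s
    unfolding P_def K_def C_def by (rule Suc.IH[OF that])
  have "(\<integral>\<^sup>+x. ennreal (P (Suc k) s x) \<partial>lpi {1..Suc k}) = (\<integral>\<^sup>+y. \<integral>\<^sup>+x. ennreal (P (Suc k) s (x(Suc k := y))) \<partial>lpi {1..k} \<partial>lborel)"
    unfolding ins using Pm[of "Suc k" s, unfolded ins] by (intro product_nn_integral_insert_rev) auto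
  also have "\<dots> = (\<integral>\<^sup>+y. ennreal C * ennreal (if 0 \<le> y \<and> y \<le> s then y ^ \<beta> (Suc k) * (s - y) ^ K else 0) \<partial>lborel)"
  proof (rule nn_integral_cong)
    fix y :: real
    show "(\<integral>\<^sup>+x. ennreal (P (Suc k) s (x(Suc k := y))) \<partial>lpi {1..k}) = ennreal C * ennreal (if 0 \<le> y \<and> y \<le> s then y ^ \<beta> (Suc k) * (s - y) ^ K else 0)"
    proof (cases "0 \<le> y \<and> y \<le> s")
      case True
      have nn: "0 \<le> P k s x" for s x unfolding P_def by (auto intro!: mult_nonneg_nonneg prod_nonneg)
      have "(\<integral>\<^sup>+x. ennreal (P (Suc k) s (x(Suc k := y))) \<partial>lpi {1..k}) = (\<integral>\<^sup>+x. ennreal (y ^ \<beta> (Suc k)) * ennreal (P k (s - y) x) \<partial>lpi {1..k})"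
        unfolding PS using True nn by (intro nn_integral_cong) (simp add: ennreal_mult)
      also have "\<dots> = ennreal (y ^ \<beta> (Suc k)) * ennreal ((s - y) ^ K * C)"
        using Pm IH[of "s - y"] True by (subst nn_integral_cmult) auto
      also have "\<dots> = ennreal C * ennreal (y ^ \<beta> (Suc k) * (s - y) ^ K)"
        using True C by (simp add: ennreal_mult[symmetric] mult_ac)
      finally show ?thesis using True by simp
    qed (auto simp: PS)
  qed
  also have "\<dots> = ennreal C * ennreal (fact (\<beta> (Suc k)) * fact K / fact (\<beta> (Suc k) + K + 1) * s ^ (\<beta> (Suc k) + K + 1))"
    using nn_integral_beta[OF Suc.prems, of "\<beta> (Suc k)" K] by (subst nn_integral_cmult) auto
  also have "\<dots> = ennreal (s ^ (Suc k + b + (\<Sum>i=1..Suc k. \<beta> i)) * ((\<Prod>i=1..Suc k. fact (\<beta> i)) * fact b / fact (Suc k + b + (\<Sum>i=1..Suc k. \<beta> i))))"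
  proof -
    define T where "T = Suc k + b + (\<Sum>i=1..Suc k. \<beta> i)"
    have M: "\<beta> (Suc k) + K + 1 = T" by (simp add: K_def T_def)
    have pr: "(\<Prod>i=1..Suc k. fact (\<beta> i)) = (\<Prod>i=1..k. fact (\<beta> i)) * (fact (\<beta> (Suc k)) :: real)" by simp
    have e: "C * (fact (\<beta> (Suc k)) * fact K / fact T * s ^ T) = s ^ T * ((\<Prod>i=1..k. fact (\<beta> i)) * fact (\<beta> (Suc k)) * fact b / fact T)"
      unfolding C_def by simp
    have "0 \<le> fact (\<beta> (Suc k)) * fact K / fact T * s ^ T" using Suc.prems by simp
    then show ?thesis unfolding M T_def[symmetric] pr using C e by (simp only: ennreal_mult[symmetric])
  qed
  finally show ?case unfolding P_def .
qed

text \<open>At size 1 the slack of the Dirichlet integral is barycentric coordinate 0, so all k + 1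
  coordinates enter symmetrically.\<close>

lemma has_integral_monomial:
  fixes \<beta> :: "nat \<Rightarrow> nat"
  shows "set_integrable (lpi {1..k}) (ref_simplex k) (\<lambda>x. \<Prod>i\<le>k. bary k x i ^ \<beta> i)"
    and "(LINT x:ref_simplex k|lpi {1..k}. \<Prod>i\<le>k. bary k x i ^ \<beta> i) = (\<Prod>i\<le>k. fact (\<beta> i)) / fact (k + (\<Sum>i\<le>k. \<beta> i))"
proof -
  define P where "P x = (if (\<forall>i\<in>{1..k}. 0 \<le> x i) \<and> (\<Sum>i=1..k. x i) \<le> 1 then (\<Prod>i=1..k. x i ^ \<beta> i) * (1 - (\<Sum>i=1..k. x i)) ^ \<beta> 0 else 0)" for x :: "nat \<Rightarrow> real"
  have prod0: "(\<Prod>i\<le>k. g i) = g 0 * (\<Prod>i=1..k. g i)" for g :: "nat \<Rightarrow> real"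
    by (simp add: atMost_atLeast0 prod.atLeast_Suc_atMost)
  have Pm: "P \<in> borel_measurable (lpi {1..k})"
  proof -
    have sm: "(\<lambda>x. \<Sum>i=1..k. x i) \<in> borel_measurable (lpi {1..k})" by (intro borel_measurable_sum) auto
    have pm: "(\<lambda>x. \<Prod>i=1..k. x i ^ \<beta> i) \<in> borel_measurable (lpi {1..k})" by (intro borel_measurable_prod borel_measurable_power) auto
    show ?thesis unfolding P_def
      by (intro measurable_if_conj pred_nonneg_lpi borel_measurable_times borel_measurable_power borel_measurable_diff
          borel_measurable_const sm pm finite_atLeastAtMost pred_def[THEN iffD2] borel_measurable_le)
  qed
  have P0: "0 \<le> P x" for x unfolding P_def by (auto intro!: mult_nonneg_nonneg prod_nonneg)
  define v :: real where "v = (\<Prod>i\<le>k. fact (\<beta> i)) / fact (k + (\<Sum>i\<le>k. \<beta> i))"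
  have v: "v \<ge> 0" unfolding v_def by (intro divide_nonneg_nonneg prod_nonneg) auto
  have "(\<integral>\<^sup>+x. ennreal (P x) \<partial>lpi {1..k}) = ennreal v"
    using nn_integral_dirichlet[of 1 k \<beta> "\<beta> 0"] unfolding P_def v_def sum_atMost_split0 prod0 by (simp add: mult_ac add_ac)
  then have "integrable (lpi {1..k}) P \<and> integral\<^sup>L (lpi {1..k}) P = v"
    using nn_integral_eq_integrable[OF Pm _ v] P0 by simp
  moreover
  have eq: "P x = indicator (ref_simplex k) x *\<^sub>R (\<Prod>i\<le>k. bary k x i ^ \<beta> i)" if "x \<in> space (lpi {1..k})" for x
  proof -
    have "x \<in> ref_simplex k \<longleftrightarrow> (\<forall>i\<in>{1..k}. 0 \<le> x i) \<and> (\<Sum>i=1..k. x i) \<le> 1"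
      using that by (auto simp: ref_simplex_def space_PiM PiE_iff)
    moreover have "(\<Prod>i=1..k. bary k x i ^ \<beta> i) = (\<Prod>i=1..k. x i ^ \<beta> i)" by (intro prod.cong) (auto simp: bary_def)
    ultimately show ?thesis unfolding P_def prod0 by (simp add: indicator_def bary_def mult.commute)
  qed
  ultimately have I: "integrable (lpi {1..k}) P" and V: "integral\<^sup>L (lpi {1..k}) P = v" by auto
  show "set_integrable (lpi {1..k}) (ref_simplex k) (\<lambda>x. \<Prod>i\<le>k. bary k x i ^ \<beta> i)"
    unfolding set_integrable_def by (rule iffD1[OF Bochner_Integration.integrable_cong[OF refl eq] I])
  show "(LINT x:ref_simplex k|lpi {1..k}. \<Prod>i\<le>k. bary k x i ^ \<beta> i) = (\<Prod>i\<le>k. fact (\<beta> i)) / fact (k + (\<Sum>i\<le>k. \<beta> i))"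
    unfolding set_lebesgue_integral_def v_def[symmetric] V[symmetric] by (rule Bochner_Integration.integral_cong[OF refl eq[symmetric]])
qed

text \<open>A homogeneous polynomial is kept as a function; linear statements about it follow by
  induction from monomials, without a normal form for the coefficients.\<close>

inductive hpoly :: "nat \<Rightarrow> nat \<Rightarrow> ((nat \<Rightarrow> real) \<Rightarrow> real) \<Rightarrow> bool" for n D where
  monomial: "(\<Sum>i\<le>n. \<beta> i) = D \<Longrightarrow> hpoly n D (\<lambda>y. a * (\<Prod>i\<le>n. y i ^ \<beta> i))"
| plus: "hpoly n D f \<Longrightarrow> hpoly n D g \<Longrightarrow> hpoly n D (\<lambda>y. f y + g y)"

lemma hpoly_cmult: "hpoly n D f \<Longrightarrow> hpoly n D (\<lambda>y. a * f y)"
proof (induction rule: hpoly.induct)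
  case (monomial \<beta> b)
  then show ?case using hpoly.monomial[of \<beta> n D "a * b"] by (simp add: mult_ac)
qed (simp add: distrib_left hpoly.plus)

lemma hpoly_zero: "hpoly n D (\<lambda>y. 0)"
  using hpoly.monomial[of "\<lambda>i. if i = 0 then D else 0" n D 0] by (simp add: sum.delta)

lemma hpoly_const: "hpoly n 0 (\<lambda>y. a)"
  using hpoly.monomial[of "\<lambda>i. 0" n 0 a] by simp

lemma hpoly_sum: "(\<And>i. i \<in> A \<Longrightarrow> hpoly n D (f i)) \<Longrightarrow> hpoly n D (\<lambda>y. \<Sum>i\<in>A. f i y)"
  by (induction A rule: infinite_finite_induct) (auto intro: hpoly_zero hpoly.plus)

lemma hpoly_mult: "hpoly n D f \<Longrightarrow> hpoly n E g \<Longrightarrow> hpoly n (D + E) (\<lambda>y. f y * g y)"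
proof (induction rule: hpoly.induct)
  case (monomial \<beta> a)
  note mono = monomial.hyps
  from monomial.prems show ?case
  proof (induction rule: hpoly.induct)
    case (monomial \<gamma> b)
    then show ?case using mono hpoly.monomial[of "\<lambda>i. \<beta> i + \<gamma> i" n "D + E" "a * b"]
      by (simp add: sum.distrib power_add prod.distrib mult_ac)
  qed (simp add: distrib_left hpoly.plus)
qed (simp add: distrib_right hpoly.plus)

lemma hpoly_prod: "finite A \<Longrightarrow> (\<And>i. i \<in> A \<Longrightarrow> hpoly n D (f i)) \<Longrightarrow> hpoly n (card A * D) (\<lambda>y. \<Prod>i\<in>A. f i y)"
  by (induction A rule: finite_induct) (auto intro: hpoly_const hpoly_mult)

lemma hpoly_var: "c \<le> n \<Longrightarrow> hpoly n 1 (\<lambda>y. y c)"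
  using hpoly.monomial[of "\<lambda>i. if i = c then 1 else 0" n 1 1] by (simp add: sum.delta if_distrib[of "\<lambda>k. _ ^ k"] prod.delta cong: if_cong)

lemma hpoly_bern: "hpoly k m (bern k m g)"
proof (induction m arbitrary: g)
  case 0
  then show ?case by (simp add: hpoly_const[of k])
next
  case (Suc m)
  have "hpoly k (Suc m) (\<lambda>y. \<Sum>c\<le>k. y c * bern k m (\<lambda>N. g (N(c := Suc (N c)))) y)"
    using hpoly_mult[OF hpoly_var Suc] by (intro hpoly_sum) auto
  then show ?case by simp
qed

lemma hpoly_integrable: "hpoly k D G \<Longrightarrow> set_integrable (lpi {1..k}) (ref_simplex k) (\<lambda>x. G (bary k x))"
proof (induction rule: hpoly.induct)
  case (monomial \<beta> a)
  show ?case by (rule set_integrable_mult_right) (use has_integral_monomial(1) in auto)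
qed (rule set_integral_add)

text \<open>Insertion of a zero in position \<open>l\<close>: the \<open>l\<close>-th face in barycentric coordinates.\<close>

definition zero_at :: "nat \<Rightarrow> (nat \<Rightarrow> 'b::zero) \<Rightarrow> nat \<Rightarrow> 'b" where
  "zero_at l z i = (if i = l then 0 else z (delete_index l i))"

lemma insert_index_bij: "l \<le> Suc k \<Longrightarrow> bij_betw (insert_index l) {..k} ({..Suc k} - {l})"
  unfolding bij_betw_def using insert_index_inj_on insert_index_image[of l "Suc k"]
  by (simp add: atLeast0LessThan lessThan_Suc_atMost)

lemma zero_at_insert_index: "zero_at l z (insert_index l i) = z i"
  by (simp add: zero_at_def)

definition partial_deriv :: "nat \<Rightarrow> ((nat \<Rightarrow> real) \<Rightarrow> real) \<Rightarrow> ((nat \<Rightarrow> real) \<Rightarrow> real) \<Rightarrow> bool" where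
  "partial_deriv l G G' \<longleftrightarrow> (\<forall>y. ((\<lambda>t. G (y(l := t))) has_field_derivative G' y) (at (y l)))"

text \<open>The divergence theorem for a homogeneous polynomial, in the direction of the vertex \<open>l\<close>: by Euler's
  relation the vector field \<open>G e\<^sub>l\<close> has been made tangential by subtracting a multiple of the position vector.\<close>

lemma hpoly_divergence:
  assumes "hpoly (Suc k) D G" "partial_deriv l G G'" and l: "l \<le> Suc k"
  shows "hpoly (Suc k) (D - 1) G'"
    and "hpoly k D (\<lambda>z. G (zero_at l z))"
    and "(LINT x:ref_simplex k|lpi {1..k}. G (zero_at l (bary k x))) + (LINT x:ref_simplex (Suc k)|lpi {1..Suc k}. G' (bary (Suc k) x))
      = real (D + k + 1) * (LINT x:ref_simplex (Suc k)|lpi {1..Suc k}. G (bary (Suc k) x))"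
proof -
  \<comment> \<open>The induction needs the existential: a derivative of a sum does not come with
    derivatives of its summands. The given G' is identified at the end by uniqueness.\<close>
  have "\<exists>G'. partial_deriv l G G' \<and> hpoly (Suc k) (D - 1) G' \<and> hpoly k D (\<lambda>z. G (zero_at l z)) \<and> 
     (LINT x:ref_simplex k|lpi {1..k}. G (zero_at l (bary k x))) + (LINT x:ref_simplex (Suc k)|lpi {1..Suc k}. G' (bary (Suc k) x))
      = real (D + k + 1) * (LINT x:ref_simplex (Suc k)|lpi {1..Suc k}. G (bary (Suc k) x))"
    using assms(1)
  proof (induction rule: hpoly.induct)
    case (monomial \<beta> a)
    define \<gamma> where "\<gamma> = \<beta>(l := \<beta> l - 1)"
    have pr: "(\<Prod>i\<le>Suc k. g i) = g l * (\<Prod>i\<in>{..Suc k} - {l}. g i)" for g :: "nat \<Rightarrow> real"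
      using l by (subst prod.remove[of _ l]) auto
    have pr': "(\<Prod>i\<in>{..Suc k} - {l}. g i) = (\<Prod>i\<le>k. g (insert_index l i))" for g :: "nat \<Rightarrow> real"
      by (rule prod.reindex_bij_betw[OF insert_index_bij[OF l], symmetric])
    have sr: "(\<Sum>i\<le>Suc k. g i) = g l + (\<Sum>i\<le>k. g (insert_index l i))" for g :: "nat \<Rightarrow> nat"
      using l sum.reindex_bij_betw[OF insert_index_bij[OF l], of g] by (subst sum.remove[of _ l]) auto
    have pd: "partial_deriv l (\<lambda>y. a * (\<Prod>i\<le>Suc k. y i ^ \<beta> i)) (\<lambda>y. (a * real (\<beta> l)) * (\<Prod>i\<le>Suc k. y i ^ \<gamma> i))"
      unfolding partial_deriv_def
    proof
      fix y :: "nat \<Rightarrow> real"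
      have "(\<Prod>i\<in>{..Suc k} - {l}. (y(l := t)) i ^ \<beta> i) = (\<Prod>i\<in>{..Suc k} - {l}. y i ^ \<beta> i)" for t by (intro prod.cong) auto
      moreover have "(\<Prod>i\<in>{..Suc k} - {l}. y i ^ \<gamma> i) = (\<Prod>i\<in>{..Suc k} - {l}. y i ^ \<beta> i)" by (intro prod.cong) (auto simp: \<gamma>_def)
      ultimately show "((\<lambda>t. a * (\<Prod>i\<le>Suc k. (y(l := t)) i ^ \<beta> i)) has_real_derivative (a * real (\<beta> l)) * (\<Prod>i\<le>Suc k. y i ^ \<gamma> i)) (at (y l))"
        unfolding pr by (auto intro!: derivative_eq_intros simp: \<gamma>_def)
    qed
    \<comment> \<open>A monomial without the variable l survives on the face and has zero
      derivative; one that contains it vanishes on the face. So at most one term on the left-hand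
      side of the formula is nonzero.\<close>
    have face: "a * (\<Prod>i\<le>Suc k. zero_at l z i ^ \<beta> i) = (if \<beta> l = 0 then a else 0) * (\<Prod>i\<le>k. z i ^ \<beta> (insert_index l i))" for z
      unfolding pr pr' by (auto simp: zero_at_insert_index zero_at_def[of l _ l] power_0_left)
    have facts: "fact (\<beta> l) = real (\<beta> l) * fact (\<beta> l - 1)" if "\<beta> l > 0" using that fact_reduce by blast
    show ?case
    proof (intro exI conjI)
      show "partial_deriv l (\<lambda>y. a * (\<Prod>i\<le>Suc k. y i ^ \<beta> i)) (\<lambda>y. (a * real (\<beta> l)) * (\<Prod>i\<le>Suc k. y i ^ \<gamma> i))" by (rule pd)
      show "hpoly (Suc k) (D - 1) (\<lambda>y. (a * real (\<beta> l)) * (\<Prod>i\<le>Suc k. y i ^ \<gamma> i))"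
      proof (cases "\<beta> l = 0")
        case False
        then show ?thesis using monomial sr[of \<beta>] sr[of \<gamma>] by (intro hpoly.monomial) (simp add: \<gamma>_def)
      qed (simp add: hpoly_zero)
      show "hpoly k D (\<lambda>z. a * (\<Prod>i\<le>Suc k. zero_at l z i ^ \<beta> i))"
        unfolding face using monomial sr[of \<beta>] by (cases "\<beta> l = 0") (auto intro: hpoly.monomial hpoly_zero)
      have "(LINT x:ref_simplex k|lpi {1..k}. a * (\<Prod>i\<le>Suc k. zero_at l (bary k x) i ^ \<beta> i)) =
         (if \<beta> l = 0 then a else 0) * ((\<Prod>i\<le>k. fact (\<beta> (insert_index l i))) / fact (k + (\<Sum>i\<le>k. \<beta> (insert_index l i))))"
        unfolding face set_integral_mult_right has_integral_monomial(2) ..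
      moreover have "(LINT x:ref_simplex (Suc k)|lpi {1..Suc k}. (a * real (\<beta> l)) * (\<Prod>i\<le>Suc k. bary (Suc k) x i ^ \<gamma> i)) =
         (a * real (\<beta> l)) * ((\<Prod>i\<le>Suc k. fact (\<gamma> i)) / fact (Suc k + (\<Sum>i\<le>Suc k. \<gamma> i)))"
        by (simp only: set_integral_mult_right has_integral_monomial(2))
      moreover have "(LINT x:ref_simplex (Suc k)|lpi {1..Suc k}. a * (\<Prod>i\<le>Suc k. bary (Suc k) x i ^ \<beta> i)) =
         a * ((\<Prod>i\<le>Suc k. fact (\<beta> i)) / fact (Suc k + D))"
        using monomial by (simp only: set_integral_mult_right has_integral_monomial(2))
      moreover have "(if \<beta> l = 0 then a else 0) * ((\<Prod>i\<le>k. fact (\<beta> (insert_index l i))) / fact (k + (\<Sum>i\<le>k. \<beta> (insert_index l i))))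
        + (a * real (\<beta> l)) * ((\<Prod>i\<le>Suc k. fact (\<gamma> i)) / fact (Suc k + (\<Sum>i\<le>Suc k. \<gamma> i)))
        = real (D + k + 1) * (a * ((\<Prod>i\<le>Suc k. fact (\<beta> i)) / fact (Suc k + D)))"
      proof -
        have pg: "(\<Prod>i\<le>k. fact (\<gamma> (insert_index l i))) = (\<Prod>i\<le>k. fact (\<beta> (insert_index l i)) :: real)"
          by (intro prod.cong) (auto simp: \<gamma>_def)
        \<comment> \<open>The top factor of this factorial is the constant on the right-hand side of
          the divergence formula.\<close>
        have f: "fact (Suc k + D) = real (D + k + 1) * fact (k + D)" by (simp add: add_ac)
        then have r: "real (D + k + 1) * (a * ((\<Prod>i\<le>Suc k. fact (\<beta> i)) / fact (Suc k + D))) = a * ((\<Prod>i\<le>Suc k. fact (\<beta> i)) / fact (k + D))"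
        proof -
          have "C \<noteq> 0 \<Longrightarrow> C * (a * (P / (C * F))) = a * (P / F)" for C P F :: real by simp
          then show ?thesis unfolding f by simp
        qed
        show ?thesis
        proof (cases "\<beta> l = 0")
          case True
          then show ?thesis unfolding r using monomial sr[of \<beta>] by (simp add: pr pr' del: prod.atMost_Suc)
        next
          case False
          then have S: "Suc k + (\<Sum>i\<le>Suc k. \<gamma> i) = k + D"
            using monomial sr[of \<beta>] sr[of \<gamma>] by (simp add: \<gamma>_def del: sum.atMost_Suc)
          have g: "fact (\<gamma> l) = (fact (\<beta> l - 1) :: real)" by (simp add: \<gamma>_def)
          show ?thesis unfolding r unfolding S pr pr' pg g using False facts by simp
        qed
      qed
      ultimately show "(LINT x:ref_simplex k|lpi {1..k}. a * (\<Prod>i\<le>Suc k. zero_at l (bary k x) i ^ \<beta> i))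
         + (LINT x:ref_simplex (Suc k)|lpi {1..Suc k}. (a * real (\<beta> l)) * (\<Prod>i\<le>Suc k. bary (Suc k) x i ^ \<gamma> i))
         = real (D + k + 1) * (LINT x:ref_simplex (Suc k)|lpi {1..Suc k}. a * (\<Prod>i\<le>Suc k. bary (Suc k) x i ^ \<beta> i))" by simp
    qed
  next
    case (plus f g)
    from plus.IH obtain f' g' where
      f': "partial_deriv l f f'" "hpoly (Suc k) (D - 1) f'" "hpoly k D (\<lambda>z. f (zero_at l z))"
        "(LINT x:ref_simplex k|lpi {1..k}. f (zero_at l (bary k x))) + (LINT x:ref_simplex (Suc k)|lpi {1..Suc k}. f' (bary (Suc k) x))
        = real (D + k + 1) * (LINT x:ref_simplex (Suc k)|lpi {1..Suc k}. f (bary (Suc k) x))" and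
      g': "partial_deriv l g g'" "hpoly (Suc k) (D - 1) g'" "hpoly k D (\<lambda>z. g (zero_at l z))"
        "(LINT x:ref_simplex k|lpi {1..k}. g (zero_at l (bary k x))) + (LINT x:ref_simplex (Suc k)|lpi {1..Suc k}. g' (bary (Suc k) x))
        = real (D + k + 1) * (LINT x:ref_simplex (Suc k)|lpi {1..Suc k}. g (bary (Suc k) x))" by blast
    show ?case
    proof (intro exI conjI)
      show "partial_deriv l (\<lambda>y. f y + g y) (\<lambda>y. f' y + g' y)"
        using f'(1) g'(1) unfolding partial_deriv_def by (auto intro!: DERIV_add)
      show "hpoly (Suc k) (D - 1) (\<lambda>y. f' y + g' y)" using f' g' by (intro hpoly.plus)
      show "hpoly k D (\<lambda>z. f (zero_at l z) + g (zero_at l z))" using f'(3) g'(3) by (rule hpoly.plus)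
      show "(LINT x:ref_simplex k|lpi {1..k}. f (zero_at l (bary k x)) + g (zero_at l (bary k x)))
          + (LINT x:ref_simplex (Suc k)|lpi {1..Suc k}. f' (bary (Suc k) x) + g' (bary (Suc k) x))
        = real (D + k + 1) * (LINT x:ref_simplex (Suc k)|lpi {1..Suc k}. f (bary (Suc k) x) + g (bary (Suc k) x))"
        using f'(4) g'(4) 
        by (simp only: set_integral_add(2) hpoly_integrable[OF f'(3)] hpoly_integrable[OF g'(3)] hpoly_integrable[OF f'(2)]
          hpoly_integrable[OF g'(2)] hpoly_integrable[OF plus.hyps(1)] hpoly_integrable[OF plus.hyps(2)] distrib_left)
    qed
  qed
  then obtain H where H: "partial_deriv l G H" "hpoly (Suc k) (D - 1) H" "hpoly k D (\<lambda>z. G (zero_at l z))"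
     "(LINT x:ref_simplex k|lpi {1..k}. G (zero_at l (bary k x))) + (LINT x:ref_simplex (Suc k)|lpi {1..Suc k}. H (bary (Suc k) x))
      = real (D + k + 1) * (LINT x:ref_simplex (Suc k)|lpi {1..Suc k}. G (bary (Suc k) x))" by blast
  have "H = G'" using H(1) assms(2) DERIV_unique unfolding partial_deriv_def by blast
  then show "hpoly (Suc k) (D - 1) G'" "hpoly k D (\<lambda>z. G (zero_at l z))"
    "(LINT x:ref_simplex k|lpi {1..k}. G (zero_at l (bary k x))) + (LINT x:ref_simplex (Suc k)|lpi {1..Suc k}. G' (bary (Suc k) x))
      = real (D + k + 1) * (LINT x:ref_simplex (Suc k)|lpi {1..Suc k}. G (bary (Suc k) x))" using H by auto
qed

section \<open>Minors and Piola's identity\<close>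

definition dt :: "nat \<Rightarrow> (nat \<Rightarrow> nat \<Rightarrow> real) \<Rightarrow> real" where
  "dt n A = Determinant.det (Matrix.mat n n (\<lambda>(i, j). A i j))"

lemma dt_perm: "dt n A = (\<Sum>p | p permutes {0..<n}. of_int (sign p) * (\<Prod>i=0..<n. A i (p i)))"
proof -
  have "dt n A = (\<Sum>p | p permutes {0..<n}. of_int (sign p) * (\<Prod>i=0..<n. Matrix.mat n n (\<lambda>(i, j). A i j) $$ (i, p i)))"
    unfolding dt_def by (rule det_def'[of _ n]) simp
  also have "\<dots> = (\<Sum>p | p permutes {0..<n}. of_int (sign p) * (\<Prod>i=0..<n. A i (p i)))"
  proof (intro sum.cong prod.cong refl arg_cong2[where f="(*)"])
    fix p i assume "p \<in> {p. p permutes {0..<n}}" "i \<in> {0..<n}"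
    then have "p i < n" "i < n" using permutes_in_image by fastforce+
    then show "Matrix.mat n n (\<lambda>(i, j). A i j) $$ (i, p i) = A i (p i)" by simp
  qed
  finally show ?thesis .
qed

lemma dt_cong: "(\<And>i j. i < n \<Longrightarrow> j < n \<Longrightarrow> A i j = B i j) \<Longrightarrow> dt n A = dt n B"
  unfolding dt_def by (intro arg_cong[where f=Determinant.det] eq_matI) auto

lemma dt_mult: "dt n (\<lambda>i j. \<Sum>l<n. A i l * B l j) = dt n A * dt n B"
proof -
  have "Matrix.mat n n (\<lambda>(i, j). \<Sum>l<n. A i l * B l j) = Matrix.mat n n (\<lambda>(i, j). A i j) * Matrix.mat n n (\<lambda>(i, j). B i j)"
    by (rule eq_matI) (auto simp: scalar_prod_def atLeast0LessThan intro!: sum.cong)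
  then show ?thesis unfolding dt_def by (simp add: det_mult[of _ n])
qed

lemma cofactor_dt:
  assumes "i < Suc n" "j < Suc n"
  shows "cofactor (Matrix.mat (Suc n) (Suc n) (\<lambda>(i, j). A i j)) i j = (-1) ^ (i + j) * dt n (\<lambda>i' j'. A (insert_index i i') (insert_index j j'))"
proof -
  have "mat_delete (Matrix.mat (Suc n) (Suc n) (\<lambda>(i, j). A i j)) i j = Matrix.mat n n (\<lambda>(i', j'). A (insert_index i i') (insert_index j j'))"
    by (rule eq_matI) (auto simp: mat_delete_def insert_index_def)
  then show ?thesis unfolding cofactor_def dt_def by simp
qed

lemma dt_laplace_row:
  assumes "i < Suc n"
  shows "dt (Suc n) A = (\<Sum>j<Suc n. (-1) ^ (i + j) * A i j * dt n (\<lambda>i' j'. A (insert_index i i') (insert_index j j')))"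
proof -
  have "dt (Suc n) A = (\<Sum>j<Suc n. Matrix.mat (Suc n) (Suc n) (\<lambda>(i, j). A i j) $$ (i, j) * cofactor (Matrix.mat (Suc n) (Suc n) (\<lambda>(i, j). A i j)) i j)"
    unfolding dt_def by (rule laplace_expansion_row) (use assms in auto)
  also have "\<dots> = (\<Sum>j<Suc n. (-1) ^ (i + j) * A i j * dt n (\<lambda>i' j'. A (insert_index i i') (insert_index j j')))"
    using assms by (intro sum.cong) (auto simp: cofactor_dt simp del: sum.lessThan_Suc)
  finally show ?thesis .
qed

lemma dt_laplace_column:
  assumes "j < Suc n"
  shows "dt (Suc n) A = (\<Sum>i<Suc n. (-1) ^ (i + j) * A i j * dt n (\<lambda>i' j'. A (insert_index i i') (insert_index j j')))"
proof -
  have "dt (Suc n) A = (\<Sum>i<Suc n. Matrix.mat (Suc n) (Suc n) (\<lambda>(i, j). A i j) $$ (i, j) * cofactor (Matrix.mat (Suc n) (Suc n) (\<lambda>(i, j). A i j)) i j)"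
    unfolding dt_def by (rule laplace_expansion_column) (use assms in auto)
  also have "\<dots> = (\<Sum>i<Suc n. (-1) ^ (i + j) * A i j * dt n (\<lambda>i' j'. A (insert_index i i') (insert_index j j')))"
    using assms by (intro sum.cong) (auto simp: cofactor_dt simp del: sum.lessThan_Suc)
  finally show ?thesis .
qed

lemma prod_list_map_upt_1: "(\<And>i. i < n \<Longrightarrow> f i = (1::real)) \<Longrightarrow> prod_list (map f [0..<n]) = 1"
  by (induction n) auto

lemma dt_upper: "(\<And>i j. j < i \<Longrightarrow> i < n \<Longrightarrow> A i j = 0) \<Longrightarrow> (\<And>i. i < n \<Longrightarrow> A i i = 1) \<Longrightarrow> dt n A = 1"
  unfolding dt_def
  by (subst det_upper_triangular[of _ n]) (auto simp: upper_triangular_def diag_mat_def prod_list_map_upt_1)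

lemma dt_lower: "(\<And>i j. i < j \<Longrightarrow> j < n \<Longrightarrow> A i j = 0) \<Longrightarrow> (\<And>i. i < n \<Longrightarrow> A i i = 1) \<Longrightarrow> dt n A = 1"
  unfolding dt_def
  by (subst det_lower_triangular[of n]) (auto simp: diag_mat_def prod_list_map_upt_1)

lemma dt_zero_row:
  assumes "i < n" "\<And>j. j < n \<Longrightarrow> A i j = 0"
  shows "dt n A = 0"
  unfolding dt_perm
proof (rule sum.neutral, rule ballI)
  fix p assume "p \<in> {p. p permutes {0..<n}}"
  then have "p i < n" using assms(1) permutes_in_image by fastforce
  then have "(\<Prod>i=0..<n. A i (p i)) = 0" using assms by (intro prod_zero) (auto intro!: bexI[of _ i])
  then show "of_int (sign p) * (\<Prod>i=0..<n. A i (p i)) = 0" by simp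
qed

lemma dt_identical_rows:
  assumes "i < n" "j < n" "i \<noteq> j" "\<And>l. l < n \<Longrightarrow> A i l = A j l"
  shows "dt n A = 0"
  unfolding dt_def by (rule det_identical_rows[of _ n i j]) (use assms in \<open>auto intro!: eq_vecI\<close>)

lemma dt_scale_column:
  assumes "j < Suc n"
  shows "dt (Suc n) (\<lambda>i l. if l = j then s * A i l else A i l) = s * dt (Suc n) A"
proof -
  have "dt (Suc n) (\<lambda>i l. if l = j then s * A i l else A i l) =
    (\<Sum>i<Suc n. (-1) ^ (i + j) * (s * A i j) * dt n (\<lambda>i' j'. A (insert_index i i') (insert_index j j')))"
    unfolding dt_laplace_column[OF assms, of "\<lambda>i l. if l = j then s * A i l else A i l"]
    by (intro sum.cong refl arg_cong2[where f="(*)"] dt_cong) (auto simp: insert_index_def split: if_splits)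
  then show ?thesis unfolding dt_laplace_column[OF assms, of A] by (simp add: sum_distrib_left mult_ac del: sum.lessThan_Suc)
qed

lemma dt_tendsto:
  "(\<And>i j. i < n \<Longrightarrow> j < n \<Longrightarrow> ((\<lambda>m. A m i j) \<longlongrightarrow> B i j) F) \<Longrightarrow> ((\<lambda>m. dt n (A m)) \<longlongrightarrow> dt n B) F"
  unfolding dt_perm
  by (intro tendsto_sum tendsto_mult tendsto_const tendsto_prod) (use permutes_in_image in fastforce)

lemma dt_measurable:
  "(\<And>i j. i < n \<Longrightarrow> j < n \<Longrightarrow> (\<lambda>x. A x i j) \<in> borel_measurable M) \<Longrightarrow> (\<lambda>x. dt n (A x)) \<in> borel_measurable M"
  unfolding dt_perm
  by (intro borel_measurable_sum borel_measurable_times borel_measurable_const borel_measurable_prod) (use permutes_in_image in fastforce)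

lemma dt_bound:
  assumes "\<And>i j. i < n \<Longrightarrow> j < n \<Longrightarrow> \<bar>A i j\<bar> \<le> B"
  shows "\<bar>dt n A\<bar> \<le> fact n * B ^ n"
proof -
  have "\<bar>dt n A\<bar> \<le> (\<Sum>p | p permutes {0..<n}. B ^ n)"
    unfolding dt_perm
  proof (rule order_trans[OF sum_abs], rule sum_mono)
    fix p assume "p \<in> {p. p permutes {0..<n}}"
    then have "(\<Prod>i=0..<n. \<bar>A i (p i)\<bar>) \<le> (\<Prod>i=0..<n. B)"
      using permutes_in_image by (intro prod_mono) (fastforce intro: assms)
    then show "\<bar>of_int (sign p) * (\<Prod>i=0..<n. A i (p i))\<bar> \<le> B ^ n"
      by (simp add: abs_mult abs_prod sign_def)
  qed
  also have "\<dots> = fact n * B ^ n" by (simp add: card_permutations[of "{0..<n}" n])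
  finally show ?thesis .
qed

text \<open>Expansion along row 0 on the left and along row j on the right produces the same minors;
  only the signs differ.\<close>

lemma dt_move_row:
  assumes "j < Suc n"
  shows "dt (Suc n) (\<lambda>i. if i = 0 then A j else A (insert_index j (i - 1))) = (-1) ^ j * dt (Suc n) A"
proof -
  have "dt (Suc n) (\<lambda>i. if i = 0 then A j else A (insert_index j (i - 1)))
     = (\<Sum>l<Suc n. (-1) ^ l * A j l * dt n (\<lambda>i' j'. A (insert_index j i') (insert_index l j')))"
    by (subst dt_laplace_row[of 0]) (auto simp del: sum.lessThan_Suc)
  also have "\<dots> = (-1) ^ j * dt (Suc n) A"
    unfolding dt_laplace_row[OF assms, of A] sum_distrib_left
    by (intro sum.cong) (auto simp: power_add mult_ac left_right_inverse_power simp flip: power_mult_distrib)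
  finally show ?thesis .
qed

text \<open>For a homogeneous map, Euler's relation turns \<open>[g | \<partial>g]\<close> into the Jacobian in homogeneous coordinates.\<close>

lemma dt_homogeneous:
  assumes y: "(\<Sum>c\<le>k. y c) = 1" and euler: "\<And>b. b \<le> k \<Longrightarrow> (\<Sum>c\<le>k. y c * P b c) = s * g b"
  shows "s * dt (Suc k) (\<lambda>b c. if c = 0 then g b else P b c - P b 0) = dt (Suc k) P"
proof -
  \<comment> \<open>Column 0 holds y, and column j > 0 is the difference of the unit vectors j and
    0. Then P U has s g in column 0, by Euler's relation, and the tangential derivatives
    elsewhere.\<close>
  define U where "U c j = (if j = 0 then y c else (if c = j then 1 else 0) - (if c = 0 then 1 else 0 :: real))" for c j :: nat
  \<comment> \<open>Adds all rows to row 0, which becomes (1, 0, ..., 0) because y sums to 1 and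
    every other column of \<open>U\<close> to 0. The product is lower triangular with unit diagonal,
    hence det U = 1.\<close>
  define R where "R i j = (if i = 0 \<or> i = j then 1 else 0 :: real)" for i j :: nat
  have "dt (Suc k) (\<lambda>i j. \<Sum>l<Suc k. R i l * U l j) = 1"
  proof (rule dt_lower)
    have RU: "(\<Sum>l<Suc k. R i l * U l j) = (if i = 0 then (\<Sum>l<Suc k. U l j) else U i j)" if "i < Suc k" for i j
    proof (cases "i = 0")
      case False
      then have "(\<Sum>l<Suc k. R i l * U l j) = (\<Sum>l<Suc k. if l = i then U l j else 0)" by (intro sum.cong) (auto simp: R_def)
      then show ?thesis using that False by (simp add: sum.delta del: sum.lessThan_Suc)
    qed (simp add: R_def)
    have S: "(\<Sum>l<Suc k. U l j) = (if j = 0 then 1 else 0)" if "j < Suc k" for j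
      using y that by (auto simp: U_def sum_subtractf sum.delta lessThan_Suc_atMost)
    show "(\<Sum>l<Suc k. R i l * U l j) = 0" if "i < j" "j < Suc k" for i j
      using RU[of i j] S[of j] that by (auto simp: U_def)
    show "(\<Sum>l<Suc k. R i l * U l i) = 1" if "i < Suc k" for i
      using RU[of i i] S[of i] that by (auto simp: U_def)
  qed
  moreover have "dt (Suc k) R = 1" by (rule dt_upper) (auto simp: R_def)
  ultimately have U1: "dt (Suc k) U = 1" unfolding dt_mult by simp
  have "dt (Suc k) P = dt (Suc k) (\<lambda>i j. \<Sum>l<Suc k. P i l * U l j)" unfolding dt_mult U1 by simp
  also have "\<dots> = dt (Suc k) (\<lambda>b c. if c = 0 then s * (if c = 0 then g b else P b c - P b 0) else (if c = 0 then g b else P b c - P b 0))"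
  proof (rule dt_cong)
    fix i j assume ij: "i < Suc k" "j < Suc k"
    show "(\<Sum>l<Suc k. P i l * U l j) = (if j = 0 then s * (if j = 0 then g i else P i j - P i 0) else (if j = 0 then g i else P i j - P i 0))"
    proof (cases "j = 0")
      case True
      then show ?thesis using euler[of i] ij by (simp add: U_def lessThan_Suc_atMost mult.commute)
    next
      case False
      have "(\<Sum>l<Suc k. P i l * U l j) = (\<Sum>l<Suc k. (if l = j then P i l else 0) - (if l = 0 then P i l else 0))"
        using False by (intro sum.cong) (auto simp: U_def)
      also have "\<dots> = P i j - P i 0" using ij by (simp add: sum_subtractf sum.delta del: sum.lessThan_Suc)
      finally show ?thesis using False by simp
    qed
  qed
  also have "\<dots> = s * dt (Suc k) (\<lambda>b c. if c = 0 then g b else P b c - P b 0)" by (rule dt_scale_column) simp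
  finally show ?thesis by simp
qed

text \<open>Border the family by a row of ones. Expansion along it gives the right-hand side;
  subtracting column 0 from all other columns, the effect of \<open>R\<close>, gives the left-hand
  side. For homogeneous partial derivatives this writes the Cartesian Jacobian as the sum of the
  signed minors.\<close>

lemma dt_relative:
  "dt d (\<lambda>b c. P b (Suc c) - P b 0) = (\<Sum>j\<le>d. (-1) ^ j * dt d (\<lambda>b c. P b (insert_index j c)))"
proof -
  define A where "A i j = (if i = 0 then 1 else P (i - 1) j)" for i j :: nat
  define R where "R i j = (if i = j then 1 else if i = 0 then -1 else 0 :: real)" for i j :: nat
  have "dt (Suc d) A = (\<Sum>j\<le>d. (-1) ^ j * dt d (\<lambda>b c. P b (insert_index j c)))"
    by (subst dt_laplace_row[of 0]) (auto simp: A_def lessThan_Suc_atMost)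
  moreover have "dt (Suc d) R = 1" by (rule dt_upper) (auto simp: R_def)
  then have "dt (Suc d) A = dt (Suc d) (\<lambda>i j. \<Sum>l<Suc d. A i l * R l j)" unfolding dt_mult by simp
  moreover have AR: "(\<Sum>l<Suc d. A i l * R l j) = (if j = 0 then A i 0 else A i j - A i 0)" if "j < Suc d" for i j
  proof -
    have "(\<Sum>l<Suc d. A i l * R l j) = (\<Sum>l<Suc d. (if l = j then A i l else 0) - (if l = 0 \<and> j \<noteq> 0 then A i l else 0))"
      by (intro sum.cong) (auto simp: R_def)
    also have "\<dots> = (if j = 0 then A i 0 else A i j - A i 0)" using that by (auto simp: sum_subtractf sum.delta simp del: sum.lessThan_Suc)
    finally show ?thesis .
  qed
  have "dt (Suc d) (\<lambda>i j. \<Sum>l<Suc d. A i l * R l j) = dt (Suc d) (\<lambda>i j. if j = 0 then A i 0 else A i j - A i 0)"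
    using AR by (intro dt_cong)
  moreover have "dt (Suc d) (\<lambda>i j. if j = 0 then A i 0 else A i j - A i 0) = dt d (\<lambda>b c. P b (Suc c) - P b 0)"
  proof -
    have "dt (Suc d) (\<lambda>i j. if j = 0 then A i 0 else A i j - A i 0) = 
      (\<Sum>j<Suc d. if j = 0 then dt d (\<lambda>b c. P b (Suc c) - P b 0) else 0)"
      by (subst dt_laplace_row[of 0], simp, rule sum.cong) (auto simp: A_def)
    then show ?thesis by (simp add: sum.delta del: sum.lessThan_Suc)
  qed
  ultimately show ?thesis by simp
qed

section \<open>Derivatives of Bernstein polynomials and the field of their signed minors\<close>

lemma partial_deriv_bern:
  assumes c: "c \<le> k"
  shows "partial_deriv c (bern k m g) (\<lambda>y. real m * bern k (m - 1) (\<lambda>N. g (N(c := Suc (N c)))) y)"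
proof (induction m arbitrary: g)
  case 0
  then show ?case by (simp add: partial_deriv_def)
next
  case (Suc m)
  show ?case
    unfolding partial_deriv_def
  proof
    fix y :: "nat \<Rightarrow> real"
    define h where "h d = (\<lambda>N. g (N(d := Suc (N d))))" for d
    have 1: "((\<lambda>t. (y(c := t)) d) has_real_derivative (if d = c then 1 else 0)) (at (y c))" for d
      by (cases "d = c") (auto intro!: derivative_eq_intros)
    have 2: "((\<lambda>t. bern k m (h d) (y(c := t))) has_real_derivative (real m * bern k (m - 1) (\<lambda>N. h d (N(c := Suc (N c)))) y)) (at (y c))" for d
      using Suc.IH[of "h d"] unfolding partial_deriv_def by blast
    have "((\<lambda>t. \<Sum>d\<le>k. (y(c := t)) d * bern k m (h d) (y(c := t))) has_real_derivative
       (\<Sum>d\<le>k. (if d = c then 1 else 0) * bern k m (h d) (y(c := y c)) + (real m * bern k (m - 1) (\<lambda>N. h d (N(c := Suc (N c)))) y) * (y(c := y c)) d)) (at (y c))"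
      by (intro DERIV_sum DERIV_mult 1 2)
    moreover have "(\<Sum>d\<le>k. (if d = c then 1 else 0) * bern k m (h d) (y(c := y c)) + (real m * bern k (m - 1) (\<lambda>N. h d (N(c := Suc (N c)))) y) * (y(c := y c)) d)
       = real (Suc m) * bern k m (h c) y"
    proof -
      have a: "(\<Sum>d\<le>k. (if d = c then 1 else 0) * bern k m (h d) y) = bern k m (h c) y"
        using c by (simp add: if_distrib[of "\<lambda>u. u * _"] sum.delta cong: if_cong)
      have b: "(\<Sum>d\<le>k. (real m * bern k (m - 1) (\<lambda>N. h d (N(c := Suc (N c)))) y) * y d) = real m * bern k m (h c) y"
      proof (cases m)
        case (Suc n)
        \<comment> \<open>Adding a draw c and adding a draw d commute, so the sum over d is again
          one step of the recursion.\<close>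
        have "h d (N(c := Suc (N c))) = h c (N(d := Suc (N d)))" for d N
        proof -
          have "(N(c := Suc (N c)))(d := Suc ((N(c := Suc (N c))) d)) = (N(d := Suc (N d)))(c := Suc ((N(d := Suc (N d))) c))" by auto
          then show ?thesis unfolding h_def by simp
        qed
        then show ?thesis unfolding Suc by (simp add: sum_distrib_left mult_ac del: of_nat_Suc)
      qed simp
      show ?thesis unfolding fun_upd_triv sum.distrib a b by (simp add: algebra_simps)
    qed
    ultimately show "((\<lambda>t. bern k (Suc m) g (y(c := t))) has_real_derivative real (Suc m) * bern k (Suc m - 1) (\<lambda>N. g (N(c := Suc (N c)))) y) (at (y c))"
      unfolding h_def by (simp del: of_nat_Suc)
  qed
qed

text \<open>Piola's identity: the signed maximal minors of a Jacobian form a divergence-free field. Each second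
  derivative occurs twice, for permutations that differ by a transposition.\<close>

lemma piola_sum_zero:
  fixes P :: "nat \<Rightarrow> nat \<Rightarrow> real" and B :: "nat \<Rightarrow> nat \<Rightarrow> nat \<Rightarrow> real"
  assumes sym: "\<And>b i j. B b i j = B b j i"
  shows "(\<Sum>p | p permutes {0..<Suc d}. of_int (sign p) * (\<Sum>b=0..<d. B b (p (Suc b)) (p 0) * (\<Prod>b'\<in>{0..<d} - {b}. P b' (p (Suc b'))))) = 0"
proof -
  define \<phi> where "\<phi> b p = of_int (sign p) * (B b (p (Suc b)) (p 0) * (\<Prod>b'\<in>{0..<d} - {b}. P b' (p (Suc b'))))" for b and p :: "nat \<Rightarrow> nat"
  have "(\<Sum>p | p permutes {0..<Suc d}. \<phi> b p) = 0" if b: "b < d" for b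
  proof -
    \<comment> \<open>Here \<open>p 0\<close> is the variable of differentiation and
      \<open>p (Suc b)\<close> the column taken from row b. Exchanging them leaves the second
      derivative unchanged and flips the sign.\<close>
    define \<tau> where "\<tau> = Transposition.transpose 0 (Suc b)"
    have \<tau>: "\<tau> permutes {0..<Suc d}" unfolding \<tau>_def using b by (intro permutes_swap_id) auto
    have "(\<Sum>p | p permutes {0..<Suc d}. \<phi> b p) = (\<Sum>p | p permutes {0..<Suc d}. \<phi> b (p \<circ> \<tau>))"
      by (rule sum_permutations_compose_right[OF \<tau>])
    also have "\<dots> = (\<Sum>p | p permutes {0..<Suc d}. - \<phi> b p)"
    proof (rule sum.cong[OF refl])
      fix p assume "p \<in> {p. p permutes {0..<Suc d}}"
      then have "permutation p" using permutation_permutes by blast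
      moreover have "permutation \<tau>" unfolding \<tau>_def by (rule permutation_swap_id)
      ultimately have s: "sign (p \<circ> \<tau>) = - sign p"
        by (simp add: sign_compose) (simp add: \<tau>_def sign_swap_id)
      have "(\<Prod>b'\<in>{0..<d} - {b}. P b' ((p \<circ> \<tau>) (Suc b'))) = (\<Prod>b'\<in>{0..<d} - {b}. P b' (p (Suc b')))"
        by (intro prod.cong) (auto simp: \<tau>_def Transposition.transpose_def)
      moreover have "(p \<circ> \<tau>) 0 = p (Suc b)" "(p \<circ> \<tau>) (Suc b) = p 0" by (auto simp: \<tau>_def)
      ultimately show "\<phi> b (p \<circ> \<tau>) = - \<phi> b p" unfolding \<phi>_def s using sym[of b] by simp
    qed
    finally show ?thesis by (simp add: sum_negf)
  qed
  then have "(\<Sum>b=0..<d. \<Sum>p | p permutes {0..<Suc d}. \<phi> b p) = 0" by simp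
  then show ?thesis by (subst (asm) sum.swap) (simp add: \<phi>_def sum_distrib_left)
qed

lemma set_lebesgue_integral_sum:
  fixes f :: "'b \<Rightarrow> 'c \<Rightarrow> real"
  assumes "\<And>i. i \<in> I \<Longrightarrow> set_integrable M A (f i)"
  shows "(LINT x:A|M. \<Sum>i\<in>I. f i x) = (\<Sum>i\<in>I. LINT x:A|M. f i x)"
  using assms unfolding set_lebesgue_integral_def set_integrable_def scaleR_sum_right
  by (rule Bochner_Integration.integral_sum)

text \<open>The divergence formula is applied to each signed minor of the Jacobian, a homogeneous
  polynomial of degree d (m - 1), in the direction of the column it omits. Summed over j, the
  divergences cancel by Piola's identity; the face terms and a multiple of the volume integral
  remain.\<close>

lemma bernstein_minor_stokes:
  fixes f :: "nat \<Rightarrow> (nat \<Rightarrow> real) \<Rightarrow> real"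
  assumes d: "d = Suc k" and m: "m > 0"
  defines "M \<equiv> \<lambda>j y. dt d (\<lambda>b c. bernstein_pd d m (f b) (insert_index j c) y)"
  shows "(\<Sum>j\<le>d. (-1) ^ j * (LINT x:ref_simplex k|lpi {1..k}. M j (zero_at j (bary k x)))) =
    real m * real d * (LINT x:ref_simplex d|lpi {1..d}. \<Sum>j\<le>d. (-1) ^ j * M j (bary d x))"
    and "\<And>j. j \<le> d \<Longrightarrow> set_integrable (lpi {1..d}) (ref_simplex d) (\<lambda>x. M j (bary d x))"
proof -
  define P where "P b c = bernstein_pd d m (f b) c" for b c
  \<comment> \<open>Permutations of d + 1 symbols with p 0 = j encode the terms of the minor that
    omits column j, including its sign \<open>(-1) ^ j\<close>. Over all j they exhaust the
    permutations, as \<open>piola_sum_zero\<close> requires.\<close>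
  define S where "S j = {p. p permutes {0..<Suc d} \<and> p 0 = j}" for j
  define Mt where "Mt j y = (\<Sum>p\<in>S j. of_int (sign p) * (\<Prod>b=0..<d. P b (p (Suc b)) y))" for j y
  \<comment> \<open>The second derivative, with two extra draws i and j; its symmetry is the
    irrelevance of their order.\<close>
  define B where "B b i j y = real m * (real (m - 1) * bern d (m - 1 - 1) (\<lambda>N. f b (grid_point d m (((N(j := Suc (N j)))(i := Suc ((N(j := Suc (N j))) i)))))) y)" for b i j y
  define M' where "M' j y = (\<Sum>p\<in>S j. of_int (sign p) * (\<Sum>b=0..<d. B b (p (Suc b)) j y * (\<Prod>b'\<in>{0..<d} - {b}. P b' (p (Suc b')) y)))" for j y
  have fin: "finite (S j)" for j unfolding S_def by (rule finite_subset[OF _ finite_permutations[of "{0..<Suc d}"]]) auto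
  have group: "(\<Sum>j\<le>d. \<Sum>p\<in>S j. h p) = (\<Sum>p | p permutes {0..<Suc d}. h p)" for h :: "(nat \<Rightarrow> nat) \<Rightarrow> real"
  proof -
    have "(\<lambda>p. p 0) ` {p. p permutes {0..<Suc d}} \<subseteq> {..d}"
    proof (rule image_subsetI)
      fix p assume "p \<in> {p. p permutes {0..<Suc d}}"
      then have p: "p permutes {0..<Suc d}" by simp
      then have "p 0 \<in> {0..<Suc d}" using permutes_in_image[OF p, of 0] by simp
      then show "p 0 \<in> {..d}" by simp
    qed
    then have "(\<Sum>j\<le>d. sum h {p \<in> {p. p permutes {0..<Suc d}}. p 0 = j}) = sum h {p. p permutes {0..<Suc d}}"
      by (intro sum.group finite_permutations) auto
    then show ?thesis unfolding S_def by simp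
  qed
  have MM: "(-1) ^ j * M j y = Mt j y" if "j \<le> d" for j y
  proof -
    \<comment> \<open>Bordering by the unit vector j as top row turns the minor into a determinant
      of size d + 1, whose expansion supplies the sign.\<close>
    define A where "A i c = (if i = 0 then (if c = j then 1 else 0) else P (i - 1) c y)" for i c :: nat
    have "dt (Suc d) A = (\<Sum>c<Suc d. if c = j then (-1) ^ j * M j y else 0)"
      by (subst dt_laplace_row[of 0], simp, rule sum.cong) (auto simp: A_def M_def P_def)
    then have 1: "dt (Suc d) A = (-1) ^ j * M j y" using that by (simp add: sum.delta del: sum.lessThan_Suc)
    have pr: "(\<Prod>i=0..<Suc d. A i (p i)) = A 0 (p 0) * (\<Prod>b=0..<d. P b (p (Suc b)) y)" for p
      by (subst prod.atLeast0_lessThan_Suc_shift) (simp add: A_def)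
    have "dt (Suc d) A = (\<Sum>p | p permutes {0..<Suc d}. if p 0 = j then of_int (sign p) * (\<Prod>b=0..<d. P b (p (Suc b)) y) else 0)"
      unfolding dt_perm pr by (intro sum.cong) (auto simp: A_def)
    also have "\<dots> = Mt j y" unfolding Mt_def S_def
      by (subst sum.inter_filter[symmetric]) (auto simp: finite_permutations)
    finally show ?thesis using 1 by simp
  qed
  have hP: "hpoly d (m - 1) (P b c)" for b c
    unfolding P_def bernstein_pd_def by (intro hpoly_cmult hpoly_bern)
  have hM: "hpoly d (d * (m - 1)) (Mt j)" for j
    unfolding Mt_def using hpoly_prod[OF _ hP, of "{0..<d}"] by (intro hpoly_sum hpoly_cmult) auto
  have pdP: "partial_deriv j (P b i) (B b i j)" if "j \<le> d" for b i j
  proof -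
    note D = partial_deriv_bern[OF that, of "m - 1" "\<lambda>N. f b (grid_point d m (N(i := Suc (N i))))"]
    show ?thesis unfolding partial_deriv_def
    proof
      fix y
      show "((\<lambda>t. P b i (y(j := t))) has_real_derivative B b i j y) (at (y j))"
        using D unfolding partial_deriv_def P_def bernstein_pd_def B_def by (intro DERIV_cmult) blast
    qed
  qed
  have pdM: "partial_deriv j (Mt j) (M' j)" if "j \<le> d" for j
    unfolding partial_deriv_def
  proof
    fix y
    have "((\<lambda>t. \<Prod>b=0..<d. P b (p (Suc b)) (y(j := t))) has_real_derivative
       (\<Sum>b=0..<d. B b (p (Suc b)) j y * (\<Prod>b'\<in>{0..<d} - {b}. P b' (p (Suc b')) (y(j := y j))))) (at (y j))" for p
      using pdP[OF that] unfolding partial_deriv_def by (intro has_field_derivative_prod) auto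
    then show "((\<lambda>t. Mt j (y(j := t))) has_real_derivative M' j y) (at (y j))"
      unfolding Mt_def M'_def fun_upd_triv by (intro DERIV_sum DERIV_cmult)
  qed
  have comm: "(N(j := Suc (N j)))(i := Suc ((N(j := Suc (N j))) i)) = (N(i := Suc (N i)))(j := Suc ((N(i := Suc (N i))) j))" for N :: "nat \<Rightarrow> nat" and i j
    by auto
  have piola: "(\<Sum>j\<le>d. M' j y) = 0" for y
  proof -
    have "(\<Sum>j\<le>d. M' j y) = (\<Sum>j\<le>d. \<Sum>p\<in>S j. of_int (sign p) * (\<Sum>b=0..<d. B b (p (Suc b)) (p 0) y * (\<Prod>b'\<in>{0..<d} - {b}. P b' (p (Suc b')) y)))"
      unfolding M'_def by (intro sum.cong) (auto simp: S_def)
    also have "\<dots> = 0" unfolding group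
      by (rule piola_sum_zero) (simp only: B_def comm)
    finally show ?thesis .
  qed
  note div = hpoly_divergence[OF hM[unfolded d] pdM[unfolded d]]
  have iM: "set_integrable (lpi {1..d}) (ref_simplex d) (\<lambda>x. Mt j (bary d x))" for j
    by (rule hpoly_integrable[OF hM])
  have iM': "set_integrable (lpi {1..d}) (ref_simplex d) (\<lambda>x. M' j (bary d x))" if "j \<le> d" for j
    using hpoly_integrable[OF div(1)] that unfolding d by blast
  \<comment> \<open>The minors have degree d (m - 1), and d = k + 1, so the constant of the
    divergence formula becomes m d.\<close>
  have D: "real (d * (m - 1) + k + 1) = real m * real d"
  proof -
    have "d * (m - 1) + k + 1 = m * d" using m by (cases m) (simp_all add: d)
    then show ?thesis by (metis of_nat_mult)
  qed
  have "(\<Sum>j\<le>d. (LINT x:ref_simplex k|lpi {1..k}. Mt j (zero_at j (bary k x)))) + (\<Sum>j\<le>d. (LINT x:ref_simplex d|lpi {1..d}. M' j (bary d x)))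
    = (\<Sum>j\<le>d. real m * real d * (LINT x:ref_simplex d|lpi {1..d}. Mt j (bary d x)))"
    unfolding sum.distrib[symmetric] D[symmetric]
  proof (rule sum.cong[OF refl])
    fix j assume "j \<in> {..d}"
    then have "j \<le> Suc k" by (simp add: d)
    from div(3)[OF this this] show "(LINT x:ref_simplex k|lpi {1..k}. Mt j (zero_at j (bary k x))) + (LINT x:ref_simplex d|lpi {1..d}. M' j (bary d x))
      = real (d * (m - 1) + k + 1) * (LINT x:ref_simplex d|lpi {1..d}. Mt j (bary d x))" unfolding d .
  qed
  moreover have "(\<Sum>j\<le>d. (LINT x:ref_simplex d|lpi {1..d}. M' j (bary d x))) = 0"
  proof -
    have "(LINT x:ref_simplex d|lpi {1..d}. \<Sum>j\<le>d. M' j (bary d x)) = (\<Sum>j\<le>d. (LINT x:ref_simplex d|lpi {1..d}. M' j (bary d x)))"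
      using iM' by (intro set_lebesgue_integral_sum) auto
    then show ?thesis unfolding piola by simp
  qed
  moreover have "(\<Sum>j\<le>d. real m * real d * (LINT x:ref_simplex d|lpi {1..d}. Mt j (bary d x))) = real m * real d * (LINT x:ref_simplex d|lpi {1..d}. \<Sum>j\<le>d. Mt j (bary d x))"
    using iM by (subst set_lebesgue_integral_sum) (auto simp: sum_distrib_left)
  ultimately have "(\<Sum>j\<le>d. (LINT x:ref_simplex k|lpi {1..k}. Mt j (zero_at j (bary k x)))) = real m * real d * (LINT x:ref_simplex d|lpi {1..d}. \<Sum>j\<le>d. Mt j (bary d x))"
    by simp
  moreover have "(\<Sum>j\<le>d. (LINT x:ref_simplex k|lpi {1..k}. Mt j (zero_at j (bary k x)))) = (\<Sum>j\<le>d. (-1) ^ j * (LINT x:ref_simplex k|lpi {1..k}. M j (zero_at j (bary k x))))"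
    using MM by (intro sum.cong) (auto simp flip: set_integral_mult_right)
  moreover have "(\<lambda>x. \<Sum>j\<le>d. Mt j (bary d x)) = (\<lambda>x. \<Sum>j\<le>d. (-1) ^ j * M j (bary d x))"
    using MM by (intro ext sum.cong) auto
  ultimately show "(\<Sum>j\<le>d. (-1) ^ j * (LINT x:ref_simplex k|lpi {1..k}. M j (zero_at j (bary k x)))) =
    real m * real d * (LINT x:ref_simplex d|lpi {1..d}. \<Sum>j\<le>d. (-1) ^ j * M j (bary d x))" by simp
  show "set_integrable (lpi {1..d}) (ref_simplex d) (\<lambda>x. M j (bary d x))" if "j \<le> d" for j
  proof -
    have sq: "(-1) ^ j * (-1) ^ j = (1 :: real)" by (simp only: power_mult_distrib[symmetric]) simp
    have "M j y = (-1) ^ j * Mt j y" for y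
      unfolding MM[OF that, symmetric] mult.assoc[symmetric] sq by simp
    then show ?thesis using iM by simp
  qed
qed

section \<open>Stokes' theorem for Lipschitz functions on the simplex\<close>

lemma bary_measurable: "i \<le> k \<Longrightarrow> (\<lambda>x. bary k x i) \<in> borel_measurable (lpi {1..k})"
  unfolding bary_def by (cases "i = 0") (auto intro!: borel_measurable_diff borel_measurable_sum)

lemma bern_bary_measurable: "(\<lambda>x. bern k m g (bary k x)) \<in> borel_measurable (lpi {1..k})"
proof (induction m arbitrary: g)
  case (Suc m)
  show ?case unfolding bern.simps by (intro borel_measurable_sum borel_measurable_times bary_measurable Suc) simp
qed simp

lemmas bern_bary_measurable' = bern_bary_measurable[unfolded One_nat_def]

lemma ref_simplex_integrable_const: "set_integrable (lpi {1..k}) (ref_simplex k) (\<lambda>x. c :: real)"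
  using set_integrable_mult_right[OF has_integral_monomial(1)[of k "\<lambda>_. 0"], of c] by simp

lemma dilated_simplex_sets:
  fixes k :: nat
  shows "{x \<in> space (lpi {1..k}). (\<forall>i\<in>{1..k}. 0 \<le> x i) \<and> (\<Sum>i=1..k. x i) \<le> s} \<in> sets (lpi {1..k})"
proof -
  have "(\<lambda>x. \<Sum>i=1..k. x i) \<in> borel_measurable (lpi {1..k})" by (intro borel_measurable_sum) auto
  from borel_measurable_le[OF this borel_measurable_const[of s]] pred_nonneg_lpi[OF finite_atLeastAtMost, of 1 k, unfolded pred_def]
  have "{x \<in> space (lpi {1..k}). \<forall>i\<in>{1..k}. 0 \<le> x i} \<inter> {x \<in> space (lpi {1..k}). (\<Sum>i=1..k. x i) \<le> s} \<in> sets (lpi {1..k})"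
    by (intro sets.Int) auto
  also have "{x \<in> space (lpi {1..k}). \<forall>i\<in>{1..k}. 0 \<le> x i} \<inter> {x \<in> space (lpi {1..k}). (\<Sum>i=1..k. x i) \<le> s}
      = {x \<in> space (lpi {1..k}). (\<forall>i\<in>{1..k}. 0 \<le> x i) \<and> (\<Sum>i=1..k. x i) \<le> s}" by auto
  finally show ?thesis .
qed

lemma ref_simplex_sets: "ref_simplex k \<in> sets (lpi {1..k})"
proof -
  have "ref_simplex k = {x \<in> space (lpi {1..k}). (\<forall>i\<in>{1..k}. 0 \<le> x i) \<and> (\<Sum>i=1..k. x i) \<le> 1}"
    by (auto simp: ref_simplex_def space_PiM PiE_def)
  then show ?thesis using dilated_simplex_sets[of k 1] by simp
qed

lemma emeasure_dilated_simplex: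
  assumes "0 \<le> s"
  shows "emeasure (lpi {1..k}) {x \<in> space (lpi {1..k}). (\<forall>i\<in>{1..k}. 0 \<le> x i) \<and> (\<Sum>i=1..k. x i) \<le> s} = ennreal (s ^ k / fact k)"
proof -
  let ?A = "{x \<in> space (lpi {1..k}). (\<forall>i\<in>{1..k}. 0 \<le> x i) \<and> (\<Sum>i=1..k. x i) \<le> s}"
  note A = dilated_simplex_sets[of k s]
  have "emeasure (lpi {1..k}) ?A = (\<integral>\<^sup>+x. indicator ?A x \<partial>lpi {1..k})" using A by simp
  also have "\<dots> = (\<integral>\<^sup>+x. ennreal (if (\<forall>i\<in>{1..k}. 0 \<le> x i) \<and> (\<Sum>i=1..k. x i) \<le> s then (\<Prod>i=1..k. x i ^ 0) * (s - (\<Sum>i=1..k. x i)) ^ 0 else 0) \<partial>lpi {1..k})"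
    by (intro nn_integral_cong) (auto simp: indicator_def)
  also have "\<dots> = ennreal (s ^ k / fact k)"
    using nn_integral_dirichlet[OF assms, of k "\<lambda>_. 0" 0] by simp
  finally show ?thesis .
qed

text \<open>The coordinate hyperplanes are null as products. The oblique face is disjoint from the
  simplex of size s < 1, so its measure is at most (1 - s^k) / k!, which tends to 0 as s tends to
  1.\<close>

lemma ref_simplex_boundary_null: "AE x in lpi {1..k}. x \<in> ref_simplex k \<longrightarrow> x \<in> int_simplex k"
proof (cases "k = 0")
  case True
  then show ?thesis by (auto simp: ref_simplex_def int_simplex_def)
next
  case k: False
  interpret product_sigma_finite "\<lambda>_::nat. lborel :: real measure" by (rule product_sigma_finite_lborel)
  have c: "AE x in lpi {1..k}. x i \<noteq> 0" if i: "i \<in> {1..k}" for i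
  proof (rule AE_I')
    let ?E = "\<lambda>j. if j = i then {0} else UNIV :: real set"
    have "emeasure (lpi {1..k}) (Pi\<^sub>E {1..k} ?E) = (\<Prod>j=1..k. emeasure lborel (?E j))"
      by (intro emeasure_PiM) auto
    also have "\<dots> = 0" using i by (intro prod_zero) auto
    finally show "Pi\<^sub>E {1..k} ?E \<in> null_sets (lpi {1..k})" by (auto intro!: null_setsI sets_PiM_I_finite)
    show "{x \<in> space (lpi {1..k}). \<not> x i \<noteq> 0} \<subseteq> Pi\<^sub>E {1..k} ?E" by (auto simp: space_PiM PiE_iff extensional_def)
  qed
  define A where "A s = {x \<in> space (lpi {1..k}). (\<forall>i\<in>{1..k}. 0 \<le> x i) \<and> (\<Sum>i=1..k. x i) \<le> s}" for s :: real
  have mA: "emeasure (lpi {1..k}) (A s) = ennreal (s ^ k / fact k)" if "s \<ge> 0" for s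
    unfolding A_def by (rule emeasure_dilated_simplex[OF that])
  have A1: "A 1 = ref_simplex k" by (auto simp: A_def ref_simplex_def space_PiM PiE_def)
  define H where "H = {x \<in> ref_simplex k. (\<Sum>i=1..k. x i) = 1}"
  have "(\<lambda>x. \<Sum>i=1..k. x i) \<in> borel_measurable (lpi {1..k})" by (intro borel_measurable_sum) auto
  from borel_measurable_eq[OF this borel_measurable_const[of 1]] ref_simplex_sets[of k]
  have "{x \<in> space (lpi {1..k}). (\<Sum>i=1..k. x i) = 1} \<inter> ref_simplex k \<in> sets (lpi {1..k})" by (intro sets.Int)
  moreover have "{x \<in> space (lpi {1..k}). (\<Sum>i=1..k. x i) = 1} \<inter> ref_simplex k = H"
    by (auto simp: H_def ref_simplex_def space_PiM PiE_def)
  ultimately have H: "H \<in> sets (lpi {1..k})" by simp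
  have "emeasure (lpi {1..k}) H \<le> ennreal (1 / fact k - s ^ k / fact k)" if s: "0 \<le> s" "s < 1" for s
  proof -
    have As: "A s \<in> sets (lpi {1..k})"
      unfolding A_def by (rule dilated_simplex_sets)
    have "emeasure (lpi {1..k}) H + emeasure (lpi {1..k}) (A s) = emeasure (lpi {1..k}) (H \<union> A s)"
      using s by (intro plus_emeasure H As) (auto simp: H_def A_def)
    also have "\<dots> \<le> emeasure (lpi {1..k}) (A 1)"
    proof (rule emeasure_mono)
      show "H \<union> A s \<subseteq> A 1" using s by (auto simp: H_def A_def ref_simplex_def space_PiM PiE_def)
      show "A 1 \<in> sets (lpi {1..k})" unfolding A1 by (rule ref_simplex_sets)
    qed
    finally have "emeasure (lpi {1..k}) H + ennreal (s ^ k / fact k) \<le> ennreal (1 / fact k)" using mA s by simp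
    then show ?thesis
    proof (cases "emeasure (lpi {1..k}) H" rule: ennreal_cases)
      case (real r)
      then have "ennreal (r + s ^ k / fact k) \<le> ennreal (1 / fact k)"
        using \<open>emeasure (lpi {1..k}) H + ennreal (s ^ k / fact k) \<le> ennreal (1 / fact k)\<close> s by (simp add: ennreal_plus)
      then have "r \<le> 1 / fact k - s ^ k / fact k" by (simp add: ennreal_le_iff)
      then show ?thesis unfolding real by (rule ennreal_leI)
    qed (simp add: top_unique)
  qed
  note bound = this
  have "emeasure (lpi {1..k}) H \<le> 0"
  proof (rule LIMSEQ_le_const)
    have "(\<lambda>n. 1 / fact k - (1 - 1 / real (Suc n)) ^ k / fact k) \<longlonglongrightarrow> 1 / fact k - (1 - 0) ^ k / fact k"
      by (intro tendsto_intros LIMSEQ_Suc[OF lim_const_over_n]) auto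
    then show "(\<lambda>n. ennreal (1 / fact k - (1 - 1 / real (Suc n)) ^ k / fact k)) \<longlonglongrightarrow> 0"
      using tendsto_ennrealI[of _ 0] by simp
    show "\<exists>N. \<forall>n\<ge>N. emeasure (lpi {1..k}) H \<le> ennreal (1 / fact k - (1 - 1 / real (Suc n)) ^ k / fact k)"
      by (intro exI[of _ 0] allI impI bound) auto
  qed
  then have "H \<in> null_sets (lpi {1..k})" using H by (auto simp: null_sets_def)
  then have "AE x in lpi {1..k}. x \<notin> H" by (rule AE_not_in)
  moreover have "AE x in lpi {1..k}. \<forall>i\<in>{1..k}. x i \<noteq> 0" using c by (intro AE_finite_allI) auto
  ultimately show ?thesis
  proof eventually_elim
    case (elim x)
    then show ?case by (auto simp: H_def ref_simplex_def int_simplex_def less_le)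
  qed
qed

text \<open>The completed measure is essential: gradients are chosen by \<open>SOME\<close>, so the
  integrands are only almost everywhere equal to measurable functions.\<close>

definition lebesgue_simplex :: "nat \<Rightarrow> ((nat \<Rightarrow> real) \<Rightarrow> real) \<Rightarrow> real" where
  "lebesgue_simplex k h = (LINT q:ref_simplex k|completion (lpi {1..k}). h q)"

lemma completion_measurable_cong_AE:
  fixes f g :: "'b \<Rightarrow> real"
  assumes g: "g \<in> borel_measurable (completion M)" and ae: "AE x in completion M. f x = g x"
  shows "f \<in> borel_measurable (completion M)"
proof (rule measurableI)
  fix A :: "real set" assume A: "A \<in> sets borel"
  show "f -` A \<inter> space (completion M) \<in> sets (completion M)"
  proof (rule completion.in_sets_AE)
    show "g -` A \<inter> space (completion M) \<in> sets (completion M)" using measurable_sets[OF g A] .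
    show "AE x in completion M. (x \<in> g -` A \<inter> space (completion M)) = (x \<in> f -` A \<inter> space (completion M))"
      using ae by eventually_elim auto
  qed auto
qed auto

text \<open>Dominated convergence towards a limit h that is not known to be Borel measurable: the
  function g, a limit taken at every point, replaces it, and the completed measure does not see the
  difference.\<close>

lemma lebesgue_simplex_limit:
  assumes s: "\<And>m. s m \<in> borel_measurable (lpi {1..k})"
    and bound: "\<And>m x. x \<in> ref_simplex k \<Longrightarrow> \<bar>s m x\<bar> \<le> B"
    and lim: "AE x in lpi {1..k}. x \<in> ref_simplex k \<longrightarrow> (\<lambda>m. s m x) \<longlonglongrightarrow> h x"
  shows "(\<lambda>m. LINT x:ref_simplex k|lpi {1..k}. s m x) \<longlonglongrightarrow> lebesgue_simplex k h"
    and "set_integrable (completion (lpi {1..k})) (ref_simplex k) h"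
proof -
  let ?M = "lpi {1..k}" and ?Q = "ref_simplex k"
  define S where "S m x = indicator ?Q x *\<^sub>R s m x" for m x
  define g where "g x = lim (\<lambda>m. S m x)" for x
  have S[measurable]: "S m \<in> borel_measurable ?M" for m
    unfolding S_def using s ref_simplex_sets by (intro borel_measurable_scaleR borel_measurable_indicator) auto
  have g[measurable]: "g \<in> borel_measurable ?M" unfolding g_def by measurable
  have SQ: "AE x in ?M. (\<lambda>m. S m x) \<longlonglongrightarrow> indicator ?Q x *\<^sub>R h x"
    using lim by eventually_elim (auto simp: S_def indicator_def)
  have gh: "AE x in ?M. indicator ?Q x *\<^sub>R h x = g x"
    using SQ by eventually_elim (auto simp: g_def dest: limI)
  have lim': "AE x in ?M. (\<lambda>m. S m x) \<longlonglongrightarrow> g x"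
    using SQ gh by eventually_elim simp
  have w: "integrable ?M (\<lambda>x. indicator ?Q x *\<^sub>R B)" using ref_simplex_integrable_const unfolding set_integrable_def .
  have bd: "AE x in ?M. norm (S m x) \<le> indicator ?Q x *\<^sub>R B" for m
    using bound by (intro AE_I2) (auto simp: S_def indicator_def)
  note dc = g S w lim' bd
  have hm: "(\<lambda>x. indicator ?Q x *\<^sub>R h x) \<in> borel_measurable (completion ?M)" by (rule completion_measurable_cong_AE[OF measurable_completion[OF g] AE_completion[OF gh]])
  have ig: "integrable (completion ?M) g" using integrable_dominated_convergence[OF dc] g by (simp add: integrable_completion)
  show "set_integrable (completion ?M) ?Q h"
    unfolding set_integrable_def
    by (rule integrable_cong_AE_imp[OF ig hm]) (use AE_completion[OF gh] in \<open>eventually_elim, simp\<close>)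
  have "lebesgue_simplex k h = integral\<^sup>L (completion ?M) g"
    unfolding lebesgue_simplex_def set_lebesgue_integral_def
    using ig by (intro integral_cong_AE hm AE_completion[OF gh]) auto
  also have "\<dots> = integral\<^sup>L ?M g" using g by (rule integral_completion)
  finally show "(\<lambda>m. LINT x:?Q|?M. s m x) \<longlonglongrightarrow> lebesgue_simplex k h"
    using integral_dominated_convergence[OF dc] unfolding set_lebesgue_integral_def S_def by simp
qed

section \<open>Faces of the standard simplex in barycentric coordinates\<close>

lemma lin_simplex_bary:
  fixes as :: "'b::real_vector list"
  assumes "length as = Suc k" "x \<in> ref_simplex k"
  shows "lin_simplex as x = (\<Sum>t\<le>k. bary k x t *\<^sub>R (as ! t))"
proof -
  have "lin_simplex as x = as ! 0 + (\<Sum>i=1..k. x i *\<^sub>R (as ! i - as ! 0))"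
    using assms by (simp add: lin_simplex_def)
  also have "\<dots> = (1 - (\<Sum>i=1..k. x i)) *\<^sub>R (as ! 0) + (\<Sum>i=1..k. x i *\<^sub>R (as ! i))"
    by (simp add: scaleR_diff_right scaleR_diff_left sum_subtractf scaleR_sum_left)
  also have "(\<Sum>i=1..k. x i *\<^sub>R (as ! i)) = (\<Sum>i=1..k. bary k x i *\<^sub>R (as ! i))"
    by (intro sum.cong) (auto simp: bary_def)
  finally show ?thesis unfolding sum_atMost_split0 by (simp add: bary_def)
qed

lemma length_delete_nth: "i < length xs \<Longrightarrow> length (delete_nth i xs) = length xs - 1"
  by (auto simp: delete_nth_def)

lemma nth_delete_nth: "i < length xs \<Longrightarrow> j < length xs - 1 \<Longrightarrow> delete_nth i xs ! j = xs ! (insert_index i j)"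
  by (auto simp: delete_nth_def nth_append insert_index_def min_def)

lemma delete_index_le: "j \<le> Suc k \<Longrightarrow> j \<noteq> l \<Longrightarrow> l \<le> Suc k \<Longrightarrow> delete_index l j \<le> k"
  by (auto simp: delete_index_def)

text \<open>Vertex t of the face is vertex \<open>insert_index l t\<close> of the simplex, and the
  affine map carries barycentric coordinates along.\<close>

lemma face_map_zero_at:
  assumes x: "x \<in> ref_simplex k" and l: "l \<le> Suc k"
  shows "face_map (Suc k) l x = (\<lambda>j\<in>{1..Suc k}. zero_at l (bary k x) j)"
proof -
  have "lin_simplex (map (\<lambda>p. p j) (delete_nth l (map (ref_vertex (Suc k)) [0..<Suc (Suc k)]))) x = zero_at l (bary k x) j"
    if j: "j \<in> {1..Suc k}" for j
  proof -
    let ?q = "map (ref_vertex (Suc k)) [0..<Suc (Suc k)]"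
    have lq: "length ?q = Suc (Suc k)" by (simp only: length_map length_upt diff_zero)
    then have "l < length ?q" using l by linarith
    from length_delete_nth[OF this] lq have len: "length (delete_nth l ?q) = Suc k" by linarith
    have nth: "delete_nth l ?q ! t = ref_vertex (Suc k) (insert_index l t)" if "t \<le> k" for t
    proof -
      have "insert_index l t < Suc (Suc k)" using that by (auto simp: insert_index_def)
      then show ?thesis using l that by (subst nth_delete_nth) (auto simp del: upt_Suc)
    qed
    define D where "D = delete_nth l ?q"
    have D: "length D = Suc k" "\<And>t. t \<le> k \<Longrightarrow> D ! t = ref_vertex (Suc k) (insert_index l t)"
      unfolding D_def using len nth by blast+
    have "lin_simplex (map (\<lambda>p. p j) D) x = (\<Sum>t\<le>k. bary k x t *\<^sub>R (map (\<lambda>p. p j) D ! t))"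
      by (rule lin_simplex_bary[OF _ x]) (simp only: length_map D)
    also have "\<dots> = (\<Sum>t\<le>k. if insert_index l t = j then bary k x t else 0)"
      using j D by (intro sum.cong) (auto simp: ref_vertex_def)
    also have "\<dots> = zero_at l (bary k x) j"
    proof (cases "j = l")
      case True
      then show ?thesis by (auto simp: zero_at_def intro!: sum.neutral)
    next
      case False
      then have "insert_index l t = j \<longleftrightarrow> t = delete_index l j" for t using insert_delete_index[OF False] delete_insert_index[of l t] by metis
      then show ?thesis using delete_index_le[of j k l] j l False by (simp add: zero_at_def sum.delta)
    qed
    finally show ?thesis unfolding D_def .
  qed
  then show ?thesis unfolding face_map_def by auto
qed

lemma sum_zero_at:
  assumes l: "l \<le> Suc k"
  shows "(\<Sum>j\<le>Suc k. h (zero_at l z j)) = h 0 + (\<Sum>i\<le>k. h (z i) :: real)"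
proof -
  have "(\<Sum>j\<le>Suc k. h (zero_at l z j)) = h (zero_at l z l) + (\<Sum>j\<in>{..Suc k} - {l}. h (zero_at l z j))"
    using l by (subst sum.remove[of _ l]) auto
  also have "(\<Sum>j\<in>{..Suc k} - {l}. h (zero_at l z j)) = (\<Sum>i\<le>k. h (zero_at l z (insert_index l i)))"
    by (rule sum.reindex_bij_betw[OF insert_index_bij[OF l], symmetric])
  finally show ?thesis by (simp add: zero_at_insert_index) (simp add: zero_at_def)
qed

lemma bary_face_map:
  assumes x: "x \<in> ref_simplex k" and l: "l \<le> Suc k" and i: "i \<le> Suc k"
  shows "bary (Suc k) (face_map (Suc k) l x) i = zero_at l (bary k x) i"
proof -
  have "(\<Sum>j=1..Suc k. face_map (Suc k) l x j) = (\<Sum>j=1..Suc k. zero_at l (bary k x) j)"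
    unfolding face_map_zero_at[OF x l] by (intro sum.cong) auto
  moreover have "zero_at l (bary k x) 0 + (\<Sum>j=1..Suc k. zero_at l (bary k x) j) = 1"
    using sum_zero_at[OF l, of "\<lambda>u. u" "bary k x"] bary_sum[of k x] unfolding sum_atMost_split0[of _ "Suc k"] by simp
  ultimately have "1 - (\<Sum>j=1..Suc k. face_map (Suc k) l x j) = zero_at l (bary k x) 0" by linarith
  then show ?thesis using i unfolding bary_def[of "Suc k"] by (auto simp: face_map_zero_at[OF x l])
qed

lemma ref_simplex_iff_bary: "x \<in> ref_simplex k \<longleftrightarrow> x \<in> extensional {1..k} \<and> (\<forall>i\<le>k. 0 \<le> bary k x i)"
proof
  assume "x \<in> extensional {1..k} \<and> (\<forall>i\<le>k. 0 \<le> bary k x i)"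
  moreover from this have "0 \<le> bary k x 0" by blast
  ultimately show "x \<in> ref_simplex k" unfolding ref_simplex_def bary_def by force
qed (auto simp: bary_nonneg ref_simplex_def)

lemma face_map_ref:
  assumes x: "x \<in> ref_simplex k" and l: "l \<le> Suc k"
  shows "face_map (Suc k) l x \<in> ref_simplex (Suc k)"
  unfolding ref_simplex_iff_bary
proof (intro conjI allI impI)
  show "face_map (Suc k) l x \<in> extensional {1..Suc k}" by (simp add: face_map_def)
  fix i assume "i \<le> Suc k"
  then show "0 \<le> bary (Suc k) (face_map (Suc k) l x) i"
    unfolding bary_face_map[OF x l \<open>i \<le> Suc k\<close>] zero_at_def using bary_nonneg[OF x] delete_index_le l by auto
qed

text \<open>A face map renumbers the barycentric coordinates and inserts a 0. For l = 0 the
  coordinate of the origin turns into a Cartesian one; its change is bounded by the l1-distance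
  itself, hence the factor 2.\<close>

lemma face_map_l1:
  assumes x: "x \<in> ref_simplex k" and y: "y \<in> ref_simplex k" and l: "l \<le> Suc k"
  shows "(\<Sum>i=1..Suc k. \<bar>face_map (Suc k) l x i - face_map (Suc k) l y i\<bar>) \<le> 2 * (\<Sum>i=1..k. \<bar>x i - y i\<bar>)"
proof -
  let ?z = "\<lambda>i. bary k x i - bary k y i"
  have "(\<Sum>i=1..Suc k. \<bar>face_map (Suc k) l x i - face_map (Suc k) l y i\<bar>) = (\<Sum>i=1..Suc k. \<bar>zero_at l ?z i\<bar>)"
    by (intro sum.cong) (auto simp: face_map_zero_at[OF x l] face_map_zero_at[OF y l] zero_at_def)
  also have "\<dots> \<le> (\<Sum>i\<le>Suc k. \<bar>zero_at l ?z i\<bar>)" unfolding sum_atMost_split0[of _ "Suc k"] by simp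
  also have "\<dots> = (\<Sum>i\<le>k. \<bar>?z i\<bar>)" using sum_zero_at[OF l, of abs ?z] by simp
  also have "\<dots> = \<bar>?z 0\<bar> + (\<Sum>i=1..k. \<bar>x i - y i\<bar>)"
    unfolding sum_atMost_split0 by (auto simp: bary_def intro!: sum.cong)
  also have "\<bar>?z 0\<bar> \<le> (\<Sum>i=1..k. \<bar>x i - y i\<bar>)"
    using sum_abs[of "\<lambda>i. y i - x i" "{1..k}"] by (simp add: bary_def sum_subtractf abs_minus_commute)
  finally show ?thesis by simp
qed

lemma lip_simplex_face:
  assumes f: "lip_simplex (Suc k) L f" and l: "l \<le> Suc k"
  shows "lip_simplex k (2 * L) (\<lambda>x. f (face_map (Suc k) l x))"
proof -
  have L: "L \<ge> 0" using f by (simp add: lip_simplex_def)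
  have "\<bar>f (face_map (Suc k) l x) - f (face_map (Suc k) l y)\<bar> \<le> 2 * L * (\<Sum>i=1..k. \<bar>x i - y i\<bar>)"
    if x: "x \<in> ref_simplex k" and y: "y \<in> ref_simplex k" for x y
  proof -
    have "\<bar>f (face_map (Suc k) l x) - f (face_map (Suc k) l y)\<bar> \<le> L * (\<Sum>i=1..Suc k. \<bar>face_map (Suc k) l x i - face_map (Suc k) l y i\<bar>)"
      using f face_map_ref[OF x l] face_map_ref[OF y l] unfolding lip_simplex_def by blast
    also have "\<dots> \<le> L * (2 * (\<Sum>i=1..k. \<bar>x i - y i\<bar>))" by (rule mult_left_mono[OF face_map_l1[OF x y l] L])
    finally show ?thesis by simp
  qed
  then show ?thesis using L unfolding lip_simplex_def by simp
qed

text \<open>Draws of the outcome l have weight zero, so what remains are draws on the face with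
  renumbered outcomes.\<close>

lemma bern_zero_at:
  assumes l: "l \<le> Suc k"
  shows "bern (Suc k) m g (zero_at l z) = bern k m (\<lambda>N. g (zero_at l N)) z"
proof (induction m arbitrary: g)
  case 0
  have "zero_at l (\<lambda>_. 0 :: nat) = (\<lambda>_. 0)" by (auto simp: zero_at_def)
  then show ?case by simp
next
  case (Suc m)
  have upd: "zero_at l (N(i := Suc (N i))) = (zero_at l N)(insert_index l i := Suc (zero_at l N (insert_index l i)))" for N i
  proof
    fix j
    show "zero_at l (N(i := Suc (N i))) j = ((zero_at l N)(insert_index l i := Suc (zero_at l N (insert_index l i)))) j"
    proof (cases "j = l")
      case True
      moreover have "l \<noteq> insert_index l i" by (simp add: insert_index_def)
      ultimately show ?thesis by (simp add: zero_at_def)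
    next
      case False
      then have "j = insert_index l (delete_index l j)" by (simp add: insert_delete_index)
      then show ?thesis by (metis fun_upd_apply zero_at_insert_index delete_insert_index)
    qed
  qed
  have "bern (Suc k) (Suc m) g (zero_at l z) = (\<Sum>c\<in>{..Suc k} - {l}. zero_at l z c * bern (Suc k) m (\<lambda>N. g (N(c := Suc (N c)))) (zero_at l z))"
    using l by (simp only: bern.simps, subst sum.remove[of _ l]) (auto simp: zero_at_def)
  also have "\<dots> = (\<Sum>i\<le>k. z i * bern (Suc k) m (\<lambda>N. g (N(insert_index l i := Suc (N (insert_index l i))))) (zero_at l z))"
    by (subst sum.reindex_bij_betw[OF insert_index_bij[OF l], symmetric]) (simp add: zero_at_insert_index)
  also have "\<dots> = bern k (Suc m) (\<lambda>N. g (zero_at l N)) z"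
    by (simp add: Suc.IH upd)
  finally show ?case .
qed

lemma face_map_grid_point:
  assumes N: "(\<Sum>i\<le>k. N i) = m" and m: "m > 0" and l: "l \<le> Suc k"
  shows "face_map (Suc k) l (grid_point k m N) = grid_point (Suc k) m (zero_at l N)"
  unfolding face_map_zero_at[OF grid_point_ref[OF N m] l]
  using bary_grid_point[OF N m] delete_index_le l unfolding grid_point_def[of "Suc k"]
  by (auto simp: zero_at_def restrict_def fun_eq_iff)

text \<open>Derivatives in the variables of a face involve only grid points on that face, so they
  are those of the Bernstein polynomial of the restricted function. Convergence on a face thereby
  becomes a statement about the restriction alone.\<close>

lemma bernstein_face:
  assumes l: "l \<le> Suc k" and m: "m > 0" and c: "c \<le> k"
  shows "bernstein_pd (Suc k) m f (insert_index l c) (zero_at l z) = bernstein_pd k m (\<lambda>x. f (face_map (Suc k) l x)) c z"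
proof -
  have upd: "(zero_at l N)(insert_index l c := Suc (zero_at l N (insert_index l c))) = zero_at l (N(c := Suc (N c)))" for N
  proof
    fix j
    show "((zero_at l N)(insert_index l c := Suc (zero_at l N (insert_index l c)))) j = zero_at l (N(c := Suc (N c))) j"
    proof (cases "j = l")
      case True
      moreover have "l \<noteq> insert_index l c" by (simp add: insert_index_def)
      ultimately show ?thesis by (simp add: zero_at_def)
    next
      case False
      then have "j = insert_index l (delete_index l j)" by (simp add: insert_delete_index)
      then show ?thesis by (metis fun_upd_apply zero_at_insert_index delete_insert_index)
    qed
  qed
  show ?thesis
    unfolding bernstein_pd_def bern_zero_at[OF l] upd
  proof (rule arg_cong2[where f="(*)", OF refl], rule bern_cong)
    fix N :: "nat \<Rightarrow> nat" assume "(\<Sum>i\<le>k. N i) = m - 1"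
    then have "(\<Sum>i\<le>k. (N(c := Suc (N c))) i) = m" using sum_fun_upd_Suc[OF c, of N] m by simp
    then show "f (grid_point (Suc k) m (zero_at l (N(c := Suc (N c))))) = f (face_map (Suc k) l (grid_point k m (N(c := Suc (N c)))))"
      by (subst face_map_grid_point[OF _ m l]) auto
  qed
qed

section \<open>Gradients almost everywhere and passage to the limit\<close>

definition grad :: "nat \<Rightarrow> ((nat \<Rightarrow> real) \<Rightarrow> real) \<Rightarrow> (nat \<Rightarrow> real) \<Rightarrow> nat \<Rightarrow> real" where
  "grad k f x = (SOME D. diff_simplex k f D x)"

text \<open>The coefficient of \<open>\<Sum>\<^sub>i (-1)\<^sup>i f\<^sub>i df\<^sub>0 \<and> \<dots> \<and> df\<^sub>k\<close> (without \<open>df\<^sub>i\<close>), by Laplace expansion.\<close>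

definition omega :: "nat \<Rightarrow> (nat \<Rightarrow> (nat \<Rightarrow> real) \<Rightarrow> real) \<Rightarrow> (nat \<Rightarrow> real) \<Rightarrow> real" where
  "omega k f x = dt (Suc k) (\<lambda>b c. if c = 0 then f b x else grad k (f b) x c)"

text \<open>The coefficient of the exterior product of the differentials of f 0, ..., f (d -
  1).\<close>

definition jac :: "nat \<Rightarrow> (nat \<Rightarrow> (nat \<Rightarrow> real) \<Rightarrow> real) \<Rightarrow> (nat \<Rightarrow> real) \<Rightarrow> real" where
  "jac d f x = dt d (\<lambda>b c. grad d (f b) x (Suc c))"

lemma lip_simplex_bounded:
  assumes f: "lip_simplex k L f" and x: "x \<in> ref_simplex k"
  shows "\<bar>f x\<bar> \<le> \<bar>f (\<lambda>i\<in>{1..k}. 0)\<bar> + L"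
proof -
  have "\<bar>f x - f (\<lambda>i\<in>{1..k}. 0)\<bar> \<le> L * (\<Sum>i=1..k. \<bar>x i - (\<lambda>i\<in>{1..k}. 0) i\<bar>)"
    using f x ref_simplex_nonempty unfolding lip_simplex_def by blast
  also have "(\<Sum>i=1..k. \<bar>x i - (\<lambda>i\<in>{1..k}. 0) i\<bar>) = (\<Sum>i=1..k. x i)"
    using x by (intro sum.cong) (auto simp: ref_simplex_def)
  also have "L * (\<Sum>i=1..k. x i) \<le> L * 1" using x f by (intro mult_left_mono) (auto simp: ref_simplex_def lip_simplex_def)
  finally show ?thesis by linarith
qed

lemma lip_simplex_good_ae:
  assumes f: "\<And>b. b \<in> A \<Longrightarrow> lip_simplex k (L b) (f b)" and A: "finite A"
  shows "AE x in lpi {1..k}. x \<in> ref_simplex k \<longrightarrow> x \<in> int_simplex k \<and> (\<forall>b\<in>A. diff_simplex k (f b) (grad k (f b) x) x)"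
proof -
  have "AE x in lpi {1..k}. \<forall>b\<in>A. x \<in> ref_simplex k \<longrightarrow> (\<exists>D. diff_simplex k (f b) D x)"
    using lip_simplex_diff_ae[OF f] A by (intro AE_finite_allI) auto
  then show ?thesis using ref_simplex_boundary_null[of k]
  proof eventually_elim
    case (elim x)
    then show ?case unfolding grad_def using someI_ex[of "\<lambda>D. diff_simplex k _ D x"] by blast
  qed
qed

lemma omega_limit:
  assumes f: "\<And>b. b < Suc k \<Longrightarrow> lip_simplex k (L b) (f b)"
  defines "s \<equiv> \<lambda>m x. dt (Suc k) (\<lambda>b c. if c = 0 then bernstein k (Suc m) (f b) (bary k x)
      else bernstein_pd k (Suc m) (f b) c (bary k x) - bernstein_pd k (Suc m) (f b) 0 (bary k x))"
  shows "(\<lambda>m. LINT x:ref_simplex k|lpi {1..k}. s m x) \<longlonglongrightarrow> lebesgue_simplex k (omega k f)"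
    and "set_integrable (completion (lpi {1..k})) (ref_simplex k) (omega k f)"
proof -
  \<comment> \<open>One bound for all entries: |f(0)| + L for the values and 2 L for the
    derivatives, summed over the functions.\<close>
  define B where "B = (\<Sum>b<Suc k. \<bar>f b (\<lambda>i\<in>{1..k}. 0)\<bar> + 3 * L b)"
  have L: "L b \<ge> 0" if "b < Suc k" for b using f[OF that] by (simp add: lip_simplex_def)
  have B: "\<bar>f b (\<lambda>i\<in>{1..k}. 0)\<bar> + 3 * L b \<le> B" if "b < Suc k" for b
    unfolding B_def using that L by (intro member_le_sum) auto
  have meas: "s m \<in> borel_measurable (lpi {1..k})" for m
    unfolding s_def bernstein_def bernstein_pd_def
  proof (rule dt_measurable)
    fix b c :: nat
    show "(\<lambda>x. if c = 0 then bern k (Suc m) (\<lambda>N. f b (grid_point k (Suc m) N)) (bary k x)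
        else real (Suc m) * bern k (Suc m - 1) (\<lambda>N. f b (grid_point k (Suc m) (N(c := Suc (N c))))) (bary k x) -
          real (Suc m) * bern k (Suc m - 1) (\<lambda>N. f b (grid_point k (Suc m) (N(0 := Suc (N 0))))) (bary k x)) \<in> borel_measurable (lpi {1..k})"
      by (cases "c = 0") (auto intro!: borel_measurable_diff borel_measurable_times bern_bary_measurable' simp del: bern.simps)
  qed
  have bound: "\<bar>s m x\<bar> \<le> fact (Suc k) * B ^ Suc k" if x: "x \<in> ref_simplex k" for m x
    unfolding s_def
  proof (rule dt_bound)
    fix b c assume b: "b < Suc k" and c: "c < Suc k"
    have "\<bar>bernstein k (Suc m) (f b) (bary k x)\<bar> \<le> \<bar>f b (\<lambda>i\<in>{1..k}. 0)\<bar> + L b"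
      using lip_simplex_bounded[OF f[OF b]] by (intro bernstein_bound[OF x]) auto
    moreover have "\<bar>bernstein_pd k (Suc m) (f b) c (bary k x) - bernstein_pd k (Suc m) (f b) 0 (bary k x)\<bar> \<le> 2 * L b"
      using c by (intro bernstein_pd_bound[OF x f[OF b]]) auto
    ultimately show "\<bar>if c = 0 then bernstein k (Suc m) (f b) (bary k x)
      else bernstein_pd k (Suc m) (f b) c (bary k x) - bernstein_pd k (Suc m) (f b) 0 (bary k x)\<bar> \<le> B"
      using B[OF b] L[OF b] by auto
  qed
  have "AE x in lpi {1..k}. x \<in> ref_simplex k \<longrightarrow> x \<in> int_simplex k \<and> (\<forall>b\<in>{..<Suc k}. diff_simplex k (f b) (grad k (f b) x) x)"
    using f by (intro lip_simplex_good_ae) auto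
  then have lim: "AE x in lpi {1..k}. x \<in> ref_simplex k \<longrightarrow> (\<lambda>m. s m x) \<longlonglongrightarrow> omega k f x"
  proof eventually_elim
    case (elim x)
    show ?case
    proof
      assume x: "x \<in> ref_simplex k"
      show "(\<lambda>m. s m x) \<longlonglongrightarrow> omega k f x"
        unfolding s_def omega_def
      proof (rule dt_tendsto)
        fix b c assume b: "b < Suc k" and c: "c < Suc k"
        show "(\<lambda>m. if c = 0 then bernstein k (Suc m) (f b) (bary k x)
            else bernstein_pd k (Suc m) (f b) c (bary k x) - bernstein_pd k (Suc m) (f b) 0 (bary k x)) \<longlonglongrightarrow> (if c = 0 then f b x else grad k (f b) x c)"
          using bernstein_tendsto[OF x f[OF b]] bernstein_pd_tendsto[OF _ f[OF b], of x "grad k (f b) x" c] elim x b c by auto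
      qed
    qed
  qed
  show "(\<lambda>m. LINT x:ref_simplex k|lpi {1..k}. s m x) \<longlonglongrightarrow> lebesgue_simplex k (omega k f)"
    by (rule lebesgue_simplex_limit(1)[OF meas bound lim])
  show "set_integrable (completion (lpi {1..k})) (ref_simplex k) (omega k f)"
    by (rule lebesgue_simplex_limit(2)[OF meas bound lim])
qed

lemma jac_limit:
  assumes f: "\<And>b. b < d \<Longrightarrow> lip_simplex d (L b) (f b)"
  defines "s \<equiv> \<lambda>m x. dt d (\<lambda>b c. bernstein_pd d (Suc m) (f b) (Suc c) (bary d x) - bernstein_pd d (Suc m) (f b) 0 (bary d x))"
  shows "(\<lambda>m. LINT x:ref_simplex d|lpi {1..d}. s m x) \<longlonglongrightarrow> lebesgue_simplex d (jac d f)"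
    and "set_integrable (completion (lpi {1..d})) (ref_simplex d) (jac d f)"
proof -
  define B where "B = (\<Sum>b<d. 2 * L b)"
  have L: "L b \<ge> 0" if "b < d" for b using f[OF that] by (simp add: lip_simplex_def)
  have B: "2 * L b \<le> B" if "b < d" for b
    unfolding B_def using that L by (intro member_le_sum) auto
  have meas: "s m \<in> borel_measurable (lpi {1..d})" for m
    unfolding s_def bernstein_pd_def
    by (intro dt_measurable) (auto intro!: borel_measurable_diff borel_measurable_times bern_bary_measurable')
  have bound: "\<bar>s m x\<bar> \<le> fact d * B ^ d" if x: "x \<in> ref_simplex d" for m x
    unfolding s_def
  proof (rule dt_bound)
    fix b c assume b: "b < d" and c: "c < d"
    show "\<bar>bernstein_pd d (Suc m) (f b) (Suc c) (bary d x) - bernstein_pd d (Suc m) (f b) 0 (bary d x)\<bar> \<le> B"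
      using c B[OF b] bernstein_pd_bound[OF x f[OF b], of "Suc m" "Suc c"] by auto
  qed
  have "AE x in lpi {1..d}. x \<in> ref_simplex d \<longrightarrow> x \<in> int_simplex d \<and> (\<forall>b\<in>{..<d}. diff_simplex d (f b) (grad d (f b) x) x)"
    using f by (intro lip_simplex_good_ae) auto
  then have lim: "AE x in lpi {1..d}. x \<in> ref_simplex d \<longrightarrow> (\<lambda>m. s m x) \<longlonglongrightarrow> jac d f x"
  proof eventually_elim
    case (elim x)
    show ?case
      unfolding s_def jac_def
      by (intro impI dt_tendsto bernstein_pd_tendsto[OF _ f]) (use elim in auto)
  qed
  show "(\<lambda>m. LINT x:ref_simplex d|lpi {1..d}. s m x) \<longlonglongrightarrow> lebesgue_simplex d (jac d f)"
    by (rule lebesgue_simplex_limit(1)[OF meas bound lim])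
  show "set_integrable (completion (lpi {1..d})) (ref_simplex d) (jac d f)"
    by (rule lebesgue_simplex_limit(2)[OF meas bound lim])
qed

text \<open>For the approximating polynomials both sides consist of the same signed minors: on a
  face, \<open>dt_homogeneous\<close> identifies m times the integrand with a minor; on the simplex,
  \<open>dt_relative\<close> sums the minors to the Jacobian. The factor m cancels before the limit
  is taken. The factor \<open>Suc k\<close> arises because the exterior derivative of the form
  behind \<open>omega\<close> is k + 1 times the product of the differentials.\<close>

theorem lipschitz_stokes:
  assumes f: "\<And>b. b < Suc k \<Longrightarrow> lip_simplex (Suc k) (L b) (f b)"
  shows "(\<Sum>l\<le>Suc k. (-1) ^ l * lebesgue_simplex k (omega k (\<lambda>b x. f b (face_map (Suc k) l x)))) =
    real (Suc k) * lebesgue_simplex (Suc k) (jac (Suc k) f)"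
proof -
  define S where "S l m x = dt (Suc k) (\<lambda>b c. if c = 0 then bernstein k (Suc m) (\<lambda>x. f b (face_map (Suc k) l x)) (bary k x)
      else bernstein_pd k (Suc m) (\<lambda>x. f b (face_map (Suc k) l x)) c (bary k x) - bernstein_pd k (Suc m) (\<lambda>x. f b (face_map (Suc k) l x)) 0 (bary k x))" for l m x
  define J where "J m x = dt (Suc k) (\<lambda>b c. bernstein_pd (Suc k) (Suc m) (f b) (Suc c) (bary (Suc k) x) - bernstein_pd (Suc k) (Suc m) (f b) 0 (bary (Suc k) x))" for m x
  have S: "(\<lambda>m. LINT x:ref_simplex k|lpi {1..k}. S l m x) \<longlonglongrightarrow> lebesgue_simplex k (omega k (\<lambda>b x. f b (face_map (Suc k) l x)))" if "l \<le> Suc k" for l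
    unfolding S_def by (rule omega_limit(1), rule lip_simplex_face[OF f that])
  have J: "(\<lambda>m. LINT x:ref_simplex (Suc k)|lpi {1..Suc k}. J m x) \<longlonglongrightarrow> lebesgue_simplex (Suc k) (jac (Suc k) f)"
    unfolding J_def by (rule jac_limit(1)[OF f])
  have eq: "(\<Sum>l\<le>Suc k. (-1) ^ l * (LINT x:ref_simplex k|lpi {1..k}. S l m x)) = real (Suc k) * (LINT x:ref_simplex (Suc k)|lpi {1..Suc k}. J m x)" for m
  proof -
    define M where "M j y = dt (Suc k) (\<lambda>b c. bernstein_pd (Suc k) (Suc m) (f b) (insert_index j c) y)" for j y
    have SM: "real (Suc m) * S l m x = M l (zero_at l (bary k x))" if l: "l \<le> Suc k" for l x
    proof -
      have "real (Suc m) * S l m x = dt (Suc k) (\<lambda>b c. bernstein_pd k (Suc m) (\<lambda>x. f b (face_map (Suc k) l x)) c (bary k x))"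
        unfolding S_def by (rule dt_homogeneous[where y="bary k x"]) (simp_all add: bary_sum bernstein_euler)
      also have "\<dots> = M l (zero_at l (bary k x))"
        unfolding M_def by (rule dt_cong) (simp add: bernstein_face[OF l])
      finally show ?thesis .
    qed
    have "real (Suc m) * (\<Sum>l\<le>Suc k. (-1) ^ l * (LINT x:ref_simplex k|lpi {1..k}. S l m x)) = (\<Sum>l\<le>Suc k. (-1) ^ l * (LINT x:ref_simplex k|lpi {1..k}. real (Suc m) * S l m x))"
      unfolding set_integral_mult_right sum_distrib_left by (simp only: mult.left_commute)
    also have "\<dots> = (\<Sum>l\<le>Suc k. (-1) ^ l * (LINT x:ref_simplex k|lpi {1..k}. M l (zero_at l (bary k x))))"
      by (intro sum.cong refl) (simp only: SM atMost_iff)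
    also have "\<dots> = real (Suc m) * real (Suc k) * (LINT x:ref_simplex (Suc k)|lpi {1..Suc k}. \<Sum>j\<le>Suc k. (-1) ^ j * M j (bary (Suc k) x))"
      unfolding M_def by (rule bernstein_minor_stokes(1)) auto
    also have "(\<lambda>x. \<Sum>j\<le>Suc k. (-1) ^ j * M j (bary (Suc k) x)) = J m"
      unfolding J_def M_def by (rule ext) (rule dt_relative[symmetric])
    finally show ?thesis by (simp only: mult.assoc mult_cancel_left) simp
  qed
  have "(\<lambda>m. \<Sum>l\<le>Suc k. (-1) ^ l * (LINT x:ref_simplex k|lpi {1..k}. S l m x)) \<longlonglongrightarrow> (\<Sum>l\<le>Suc k. (-1) ^ l * lebesgue_simplex k (omega k (\<lambda>b x. f b (face_map (Suc k) l x))))"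
    by (intro tendsto_sum tendsto_mult tendsto_const S) auto
  moreover have "(\<lambda>m. \<Sum>l\<le>Suc k. (-1) ^ l * (LINT x:ref_simplex k|lpi {1..k}. S l m x)) \<longlonglongrightarrow> real (Suc k) * lebesgue_simplex (Suc k) (jac (Suc k) f)"
    unfolding eq by (intro tendsto_mult tendsto_const J)
  ultimately show ?thesis by (rule LIMSEQ_unique)
qed

section \<open>Hat functions\<close>

text \<open>Barycentric coordinates on the polyhedron. The vertices of the whole complex are in
  general affinely dependent; the requirement that the support lie in one simplex is what makes u
  unique.\<close>

definition bcoords :: "'a::euclidean_space set set \<Rightarrow> 'a \<Rightarrow> ('a \<Rightarrow> real) \<Rightarrow> bool" where
  "bcoords X x u \<longleftrightarrow> (\<forall>v. 0 \<le> u v) \<and> sum u (vertices X) = 1 \<and> (\<Sum>v\<in>vertices X. u v *\<^sub>R v) = x \<and>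
     (\<exists>\<tau>\<in>X. \<forall>v. u v \<noteq> 0 \<longrightarrow> v \<in> vertices X \<inter> \<tau>)"

context
  fixes X :: "'a::euclidean_space set set"
  assumes X: "simplicial_complex X"
begin

lemma complex_face: "\<tau> \<in> X \<Longrightarrow> F face_of \<tau> \<Longrightarrow> F \<in> X"
  using X unfolding simplicial_complex_def by blast

lemma complex_inter: "\<tau> \<in> X \<Longrightarrow> \<rho> \<in> X \<Longrightarrow> \<tau> \<inter> \<rho> face_of \<tau>"
  using X unfolding simplicial_complex_def by blast

lemma complex_finite: "finite X"
  using X unfolding simplicial_complex_def by blast

lemma vertices_finite: "finite (vertices X)"
proof -
  have "(\<lambda>v. {v}) ` vertices X \<subseteq> X" by (auto simp: vertices_def)
  then show ?thesis by (rule finite_imageD[OF finite_subset[OF _ complex_finite]]) (auto simp: inj_on_def)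
qed

lemma complex_simplex_obtain:
  assumes "\<tau> \<in> X"
  obtains C where "\<not> affine_dependent C" "\<tau> = convex hull C"
proof -
  obtain n where "n simplex \<tau>" using X assms unfolding simplicial_complex_def by blast
  then show thesis using that unfolding simplex_def by blast
qed

text \<open>A vertex v of the complex that lies in a simplex meets it in {v}, and intersections of
  members of the complex are faces; a one-point face is spanned by a vertex of the simplex.\<close>

lemma hull_vertices:
  assumes C: "\<not> affine_dependent C" and \<tau>: "convex hull C \<in> X"
  shows "vertices X \<inter> convex hull C = C"
proof
  show "C \<subseteq> vertices X \<inter> convex hull C"
  proof
    fix v assume v: "v \<in> C"
    have "convex hull {v} face_of convex hull C" unfolding face_of_convex_hull_affine_independent[OF C] using v by blast
    then have "{v} \<in> X" using complex_face[OF \<tau>] by simp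
    then show "v \<in> vertices X \<inter> convex hull C" using v by (auto simp: vertices_def hull_inc)
  qed
  show "vertices X \<inter> convex hull C \<subseteq> C"
  proof
    fix v assume v: "v \<in> vertices X \<inter> convex hull C"
    then have "convex hull C \<inter> {v} face_of convex hull C" by (intro complex_inter[OF \<tau>]) (simp add: vertices_def)
    moreover have "convex hull C \<inter> {v} = {v}" using v by auto
    ultimately obtain c where c: "c \<subseteq> C" "{v} = convex hull c" unfolding face_of_convex_hull_affine_independent[OF C] by auto
    have "c \<noteq> {}" using c(2) by auto
    moreover have "c \<subseteq> {v}" unfolding c(2) by (rule hull_subset)
    ultimately show "v \<in> C" using c(1) by blast
  qed
qed

lemma complex_simplex:
  assumes "\<tau> \<in> X"
  shows "\<not> affine_dependent (vertices X \<inter> \<tau>)" "\<tau> = convex hull (vertices X \<inter> \<tau>)"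
proof -
  obtain C where C: "\<not> affine_dependent C" "\<tau> = convex hull C" by (rule complex_simplex_obtain[OF assms])
  have "vertices X \<inter> \<tau> = C" using hull_vertices[OF C(1)] assms unfolding C(2) by simp
  then show "\<not> affine_dependent (vertices X \<inter> \<tau>)" "\<tau> = convex hull (vertices X \<inter> \<tau>)" using C by simp_all
qed

lemma subset_vertices_hull:
  assumes "\<tau> \<in> X" "C \<subseteq> vertices X \<inter> \<tau>"
  shows "convex hull C \<in> X" "\<not> affine_dependent C"
proof -
  have "convex hull C face_of convex hull (vertices X \<inter> \<tau>)"
    unfolding face_of_convex_hull_affine_independent[OF complex_simplex(1)[OF assms(1)]] using assms(2) by blast
  then show "convex hull C \<in> X" using complex_face[OF assms(1)] complex_simplex(2)[OF assms(1)] by simp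
  show "\<not> affine_dependent C" using complex_simplex(1)[OF assms(1)] assms(2) affine_dependent_subset by blast
qed

lemma sum_vertices_restrict:
  assumes "\<And>v. u v \<noteq> 0 \<Longrightarrow> v \<in> vertices X \<inter> \<tau>"
  shows "sum u (vertices X) = sum u (vertices X \<inter> \<tau>)" "(\<Sum>v\<in>vertices X. u v *\<^sub>R v) = (\<Sum>v\<in>vertices X \<inter> \<tau>. u v *\<^sub>R v)"
  using assms by (auto intro!: sum.mono_neutral_right vertices_finite)

lemma affine_coords_unique:
  assumes \<tau>: "\<tau> \<in> X" and u: "\<And>v. u v \<noteq> 0 \<Longrightarrow> v \<in> vertices X \<inter> \<tau>" and w: "\<And>v. w v \<noteq> 0 \<Longrightarrow> v \<in> vertices X \<inter> \<tau>"
    and "sum u (vertices X) = sum w (vertices X)" "(\<Sum>v\<in>vertices X. u v *\<^sub>R v) = (\<Sum>v\<in>vertices X. w v *\<^sub>R v)"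
  shows "u = w"
proof (rule ccontr)
  assume "u \<noteq> w"
  then obtain v where v: "u v \<noteq> w v" by blast
  then have "v \<in> vertices X \<inter> \<tau>" using u w by (cases "u v = 0") auto
  moreover have "(\<Sum>v\<in>vertices X \<inter> \<tau>. u v - w v) = 0" "(\<Sum>v\<in>vertices X \<inter> \<tau>. (u v - w v) *\<^sub>R v) = 0"
    using assms(4,5) sum_vertices_restrict[OF u] sum_vertices_restrict[OF w]
    by (simp_all add: sum_subtractf scaleR_diff_left)
  ultimately have "affine_dependent (vertices X \<inter> \<tau>)"
    using v vertices_finite by (subst affine_dependent_explicit_finite) (auto intro!: exI[of _ "\<lambda>v. u v - w v"] bexI[of _ v])
  then show False using complex_simplex(1)[OF \<tau>] by blast
qed

lemma coords_exist:
  assumes \<tau>: "\<tau> \<in> X" and x: "x \<in> \<tau>"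
  shows "\<exists>u. (\<forall>v. 0 \<le> u v) \<and> sum u (vertices X) = 1 \<and> (\<Sum>v\<in>vertices X. u v *\<^sub>R v) = x \<and> (\<forall>v. u v \<noteq> 0 \<longrightarrow> v \<in> vertices X \<inter> \<tau>)"
proof -
  have "x \<in> convex hull (vertices X \<inter> \<tau>)" using x complex_simplex(2)[OF \<tau>] by simp
  then obtain u where u: "\<And>v. v \<in> vertices X \<inter> \<tau> \<Longrightarrow> 0 \<le> u v" "sum u (vertices X \<inter> \<tau>) = 1" "(\<Sum>v\<in>vertices X \<inter> \<tau>. u v *\<^sub>R v) = x"
    using vertices_finite by (subst (asm) convex_hull_finite) auto
  define w where "w v = (if v \<in> vertices X \<inter> \<tau> then u v else 0)" for v
  have w: "\<And>v. w v \<noteq> 0 \<Longrightarrow> v \<in> vertices X \<inter> \<tau>" by (auto simp: w_def split: if_splits)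
  show ?thesis
  proof (intro exI[of _ w] conjI allI impI)
    show "0 \<le> w v" for v using u(1) by (simp add: w_def)
    show "sum w (vertices X) = 1" "(\<Sum>v\<in>vertices X. w v *\<^sub>R v) = x"
      using sum_vertices_restrict[of w \<tau>, OF w] u(2,3) by (simp_all add: w_def)
    show "v \<in> vertices X \<inter> \<tau>" if "w v \<noteq> 0" for v using w[OF that] .
  qed
qed

text \<open>The simplex \<rho> that carries u meets \<tau> in a face containing x. Coordinates of x
  in this face are also coordinates in \<rho>, where they are unique.\<close>

lemma bcoords_support:
  assumes b: "bcoords X x u" and \<tau>: "\<tau> \<in> X" "x \<in> \<tau>" and v: "u v \<noteq> 0"
  shows "v \<in> vertices X \<inter> \<tau>"
proof -
  obtain \<rho> where \<rho>: "\<rho> \<in> X" "\<And>v. u v \<noteq> 0 \<Longrightarrow> v \<in> vertices X \<inter> \<rho>" using b unfolding bcoords_def by blast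
  have "x \<in> convex hull (vertices X \<inter> \<rho>)"
  proof -
    have "sum u (vertices X \<inter> \<rho>) = 1" "(\<Sum>v\<in>vertices X \<inter> \<rho>. u v *\<^sub>R v) = x"
      using b sum_vertices_restrict[OF \<rho>(2)] unfolding bcoords_def by auto
    then show ?thesis using b vertices_finite unfolding bcoords_def by (subst convex_hull_finite) auto
  qed
  then have "x \<in> \<rho>" using complex_simplex(2)[OF \<rho>(1)] by simp
  then have xF: "x \<in> \<tau> \<inter> \<rho>" using \<tau> by blast
  have F: "\<tau> \<inter> \<rho> \<in> X" by (rule complex_face[OF \<tau>(1) complex_inter[OF \<tau>(1) \<rho>(1)]])
  obtain w where w: "\<And>v. 0 \<le> w v" "sum w (vertices X) = 1" "(\<Sum>v\<in>vertices X. w v *\<^sub>R v) = x" "\<And>v. w v \<noteq> 0 \<Longrightarrow> v \<in> vertices X \<inter> (\<tau> \<inter> \<rho>)"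
    using coords_exist[OF F xF] by blast
  have "u = w"
    by (rule affine_coords_unique[OF \<rho>]) (use b w in \<open>auto simp: bcoords_def\<close>)
  then show ?thesis using w(4) v by blast
qed

lemma bcoords_ex1:
  assumes "x \<in> \<Union>X"
  shows "\<exists>!u. bcoords X x u"
proof -
  obtain \<tau> where \<tau>: "\<tau> \<in> X" "x \<in> \<tau>" using assms by blast
  obtain u where u: "\<And>v. 0 \<le> u v" "sum u (vertices X) = 1" "(\<Sum>v\<in>vertices X. u v *\<^sub>R v) = x" "\<And>v. u v \<noteq> 0 \<Longrightarrow> v \<in> vertices X \<inter> \<tau>"
    using coords_exist[OF \<tau>] by blast
  have bu: "bcoords X x u" unfolding bcoords_def using u \<tau> by blast
  show ?thesis
  proof (rule ex1I[where P="bcoords X x" and a=u], rule bu)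
    fix w assume w: "bcoords X x w"
    show "w = u"
      by (rule affine_coords_unique[OF \<tau>(1) bcoords_support[OF w \<tau>] u(4)]) (use w u in \<open>auto simp: bcoords_def\<close>)
  qed
qed

text \<open>An explicit candidate for \<open>hat\<close>, which is itself given by a
  description.\<close>

definition coord :: "'a \<Rightarrow> 'a \<Rightarrow> real" where
  "coord v x = (if x \<in> \<Union>X then (THE u. bcoords X x u) v else 0)"

lemma coord_bcoords: "x \<in> \<Union>X \<Longrightarrow> bcoords X x (\<lambda>v. coord v x)"
  using theI'[OF bcoords_ex1] by (simp add: coord_def)

lemma coord_eqI: "x \<in> \<Union>X \<Longrightarrow> bcoords X x u \<Longrightarrow> coord v x = u v"
  using bcoords_ex1 coord_bcoords by blast

lemma coord_vertex: "w \<in> vertices X \<Longrightarrow> coord v w = (if w = v then 1 else 0)"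
proof (rule coord_eqI)
  assume w: "w \<in> vertices X"
  then show "w \<in> \<Union>X" by (auto simp: vertices_def)
  have "(\<Sum>v\<in>vertices X. (if w = v then 1 else 0) *\<^sub>R v) = (\<Sum>v\<in>vertices X. if w = v then v else 0)" by (intro sum.cong) auto
  then show "bcoords X w (\<lambda>v. if w = v then 1 else 0)"
    using w vertices_finite unfolding bcoords_def by (auto simp: vertices_def intro!: bexI[of _ "{w}"])
qed

text \<open>The edge vectors at one vertex of \<tau> are linearly independent, so some linear map
  has the required values on them; it then agrees with the coordinate by expansion in barycentric
  coordinates.\<close>

lemma coord_affine:
  assumes \<tau>: "\<tau> \<in> X"
  shows "\<exists>g c. linear g \<and> (\<forall>x\<in>\<tau>. coord v x = c + (g x :: real))"
proof (cases "vertices X \<inter> \<tau> = {}")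
  case True
  then have "\<tau> = {}" using complex_simplex(2)[OF \<tau>] by simp
  then show ?thesis by (auto intro!: exI[of _ "\<lambda>_. 0"] linear_zero)
next
  case False
  then obtain a where a: "a \<in> vertices X \<inter> \<tau>" by blast
  let ?C = "vertices X \<inter> \<tau>"
  have "independent ((\<lambda>x. - a + x) ` (?C - {a}))"
    using complex_simplex(1)[OF \<tau>] affine_dependent_iff_dependent2[OF a] by blast
  from linear_independent_extend[OF this, of "\<lambda>y. coord v (y + a) - coord v a"] obtain g :: "'a \<Rightarrow> real" where
    g: "linear g" "\<And>y. y \<in> (\<lambda>x. - a + x) ` (?C - {a}) \<Longrightarrow> g y = coord v (y + a) - coord v a" by blast
  have gw: "g (w - a) = coord v w - coord v a" if "w \<in> ?C" for w
  proof (cases "w = a")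
    case True
    then show ?thesis using linear_0[OF g(1)] by simp
  next
    case False
    then have "- a + w \<in> (\<lambda>x. - a + x) ` (?C - {a})" using that by blast
    from g(2)[OF this] show ?thesis by (simp add: add.commute)
  qed
  have "coord v x = (coord v a - g a) + g x" if x: "x \<in> \<tau>" for x
  proof -
    have xU: "x \<in> \<Union>X" using x \<tau> by blast
    define u where "u w = coord w x" for w
    have u: "bcoords X x u" unfolding u_def by (rule coord_bcoords[OF xU])
    have supp: "u w \<noteq> 0 \<Longrightarrow> w \<in> ?C" for w by (rule bcoords_support[OF u \<tau> x])
    have s: "sum u ?C = 1" "(\<Sum>w\<in>?C. u w *\<^sub>R w) = x"
      using u sum_vertices_restrict[of u, OF supp] unfolding bcoords_def by auto
    have "g x - g a = g (\<Sum>w\<in>?C. u w *\<^sub>R (w - a))"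
      using s by (simp add: scaleR_diff_right sum_subtractf scaleR_sum_left[symmetric] linear_diff[OF g(1)])
    also have "\<dots> = (\<Sum>w\<in>?C. u w * g (w - a))"
      by (simp add: linear_sum[OF g(1)] linear_cmul[OF g(1)])
    also have "\<dots> = (\<Sum>w\<in>?C. u w * coord v w) - coord v a"
      using s(1) by (simp add: gw right_diff_distrib sum_subtractf sum_distrib_right[symmetric])
    also have "(\<Sum>w\<in>?C. u w * coord v w) = (\<Sum>w\<in>?C. if w = v then u w else 0)"
      by (intro sum.cong) (auto simp: coord_vertex)
    also have "\<dots> = u v" using supp[of v] vertices_finite by (auto simp: sum.delta)
    finally show ?thesis by (simp add: u_def)
  qed
  then show ?thesis using g(1) by blast
qed

lemma complex_closed: "\<tau> \<in> X \<Longrightarrow> closed \<tau>" and complex_convex: "\<tau> \<in> X \<Longrightarrow> convex \<tau>"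
proof -
  assume "\<tau> \<in> X"
  then have "\<tau> = convex hull (vertices X \<inter> \<tau>)" by (rule complex_simplex)
  moreover have "compact (convex hull (vertices X \<inter> \<tau>))" using vertices_finite by (intro finite_imp_compact_convex_hull) auto
  ultimately show "closed \<tau>" "convex \<tau>" using compact_imp_closed convex_convex_hull by metis+
qed

text \<open>For uniqueness: two functions that are affine on a simplex agree on a convex subset of
  it, and this subset contains the vertices.\<close>

lemma hat_eq_coord: "hat X v = coord v"
  unfolding hat_def
proof (rule the_equality)
  have "continuous_on (\<Union>X) (coord v)"
  proof -
    have "continuous_on \<tau> (coord v)" if \<tau>: "\<tau> \<in> X" for \<tau>
    proof -
      obtain g c where g: "linear g" "\<And>x. x \<in> \<tau> \<Longrightarrow> coord v x = c + (g x :: real)" using coord_affine[OF \<tau>, of v] by blast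
      have "continuous_on \<tau> (\<lambda>x. c + g x)" using linear_conv_bounded_linear[THEN iffD1, OF g(1)] by (intro continuous_on_add continuous_on_const linear_continuous_on)
      moreover have "continuous_on \<tau> (coord v) \<longleftrightarrow> continuous_on \<tau> (\<lambda>x. c + g x)" by (rule continuous_on_cong[OF refl g(2)])
      ultimately show ?thesis by simp
    qed
    then have "continuous_on (\<Union>\<tau>\<in>X. \<tau>) (coord v)"
      using complex_finite complex_closed by (intro continuous_on_closed_Union) auto
    then show ?thesis by simp
  qed
  moreover have "coord v ((1 - t) *\<^sub>R x + t *\<^sub>R y) = (1 - t) * coord v x + t * coord v y"
    if \<tau>: "\<tau> \<in> X" "x \<in> \<tau>" "y \<in> \<tau>" "t \<in> {0..1}" for \<tau> x y t
  proof -
    obtain g c where g: "linear g" "\<And>x. x \<in> \<tau> \<Longrightarrow> coord v x = c + (g x :: real)" using coord_affine[OF \<tau>(1), of v] by blast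
    have "(1 - t) *\<^sub>R x + t *\<^sub>R y \<in> \<tau>" using complex_convex[OF \<tau>(1)] \<tau> unfolding convex_alt by auto
    moreover have "g ((1 - t) *\<^sub>R x + t *\<^sub>R y) = (1 - t) * g x + t * g y"
      by (simp only: linear_add[OF g(1)] linear_cmul[OF g(1)] real_scaleR_def)
    ultimately show ?thesis using g(2) \<tau> by (simp add: algebra_simps)
  qed
  ultimately show "continuous_on (\<Union>X) (coord v) \<and>
    (\<forall>\<tau>\<in>X. \<forall>x\<in>\<tau>. \<forall>y\<in>\<tau>. \<forall>t\<in>{0..1}. coord v ((1 - t) *\<^sub>R x + t *\<^sub>R y) = (1 - t) * coord v x + t * coord v y) \<and>
    (\<forall>w\<in>vertices X. coord v w = (if w = v then 1 else 0)) \<and> (\<forall>x. x \<notin> \<Union>X \<longrightarrow> coord v x = 0)"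
    by (auto simp: coord_vertex) (auto simp: coord_def)
  note co = this
  fix f assume f: "continuous_on (\<Union>X) f \<and>
    (\<forall>\<tau>\<in>X. \<forall>x\<in>\<tau>. \<forall>y\<in>\<tau>. \<forall>t\<in>{0..1}. f ((1 - t) *\<^sub>R x + t *\<^sub>R y) = (1 - t) * f x + t * f y) \<and>
    (\<forall>w\<in>vertices X. f w = (if w = v then 1 else 0)) \<and> (\<forall>x. x \<notin> \<Union>X \<longrightarrow> f x = 0)"
  have "f x = coord v x" if \<tau>: "\<tau> \<in> X" "x \<in> \<tau>" for \<tau> x
  proof -
    have "convex {x \<in> \<tau>. f x = coord v x}"
      unfolding convex_alt
    proof (intro ballI allI impI)
      fix x y t assume "x \<in> {x \<in> \<tau>. f x = coord v x}" "y \<in> {x \<in> \<tau>. f x = coord v x}" "0 \<le> t \<and> t \<le> (1::real)"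
      then show "(1 - t) *\<^sub>R x + t *\<^sub>R y \<in> {x \<in> \<tau>. f x = coord v x}"
        using complex_convex[OF \<tau>(1)] f co \<tau>(1) unfolding convex_alt by auto
    qed
    moreover have "vertices X \<inter> \<tau> \<subseteq> {x \<in> \<tau>. f x = coord v x}" using f co by auto
    ultimately have "convex hull (vertices X \<inter> \<tau>) \<subseteq> {x \<in> \<tau>. f x = coord v x}" by (rule hull_minimal[rotated])
    then show ?thesis using \<tau> complex_simplex(2)[OF \<tau>(1)] by blast
  qed
  note eq = this
  show "f = coord v"
  proof
    fix x
    show "f x = coord v x"
    proof (cases "x \<in> \<Union>X")
      case True
      then show ?thesis using eq by blast
    next
      case False
      then show ?thesis using f unfolding coord_def by simp
    qed
  qed
qed

lemma hat_bcoords: "x \<in> \<Union>X \<Longrightarrow> bcoords X x (\<lambda>v. hat X v x)"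
  unfolding hat_eq_coord by (rule coord_bcoords)

lemma hat_nonneg: "0 \<le> hat X v x"
proof (cases "x \<in> \<Union>X")
  case True
  then show ?thesis using hat_bcoords unfolding bcoords_def by blast
qed (auto simp: hat_eq_coord coord_def)

lemma hat_sum: "x \<in> \<Union>X \<Longrightarrow> (\<Sum>v\<in>vertices X. hat X v x) = 1"
  using hat_bcoords unfolding bcoords_def by blast

lemma hat_point: "x \<in> \<Union>X \<Longrightarrow> (\<Sum>v\<in>vertices X. hat X v x *\<^sub>R v) = x"
  using hat_bcoords unfolding bcoords_def by blast

lemma hat_support: "\<tau> \<in> X \<Longrightarrow> x \<in> \<tau> \<Longrightarrow> hat X v x \<noteq> 0 \<Longrightarrow> v \<in> vertices X \<inter> \<tau>"
  using bcoords_support[OF hat_bcoords] by blast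

lemma hat_vertex: "w \<in> vertices X \<Longrightarrow> hat X v w = (if w = v then 1 else 0)"
  unfolding hat_eq_coord by (rule coord_vertex)

lemma hat_affine:
  assumes "\<tau> \<in> X"
  shows "\<exists>g c. linear g \<and> (\<forall>x\<in>\<tau>. hat X v x = c + (g x :: real))"
  using coord_affine[OF assms] unfolding hat_eq_coord by blast

text \<open>The relative interior of a simplex consists of its points with all coordinates positive,
  so the carrier is the hull of the vertices whose hat functions do not vanish at x.\<close>

lemma carrier_simplex:
  assumes x: "x \<in> \<Union>X"
  shows "carrier_simplex X x \<in> X" "x \<in> carrier_simplex X x" "vertices X \<inter> carrier_simplex X x = {v. hat X v x \<noteq> 0}"
proof -
  define \<kappa> where "\<kappa> = convex hull {v. hat X v x \<noteq> 0}"
  obtain \<tau> where \<tau>: "\<tau> \<in> X" "x \<in> \<tau>" using x by blast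
  have sub: "{v. hat X v x \<noteq> 0} \<subseteq> vertices X \<inter> \<tau>" using hat_support[OF \<tau>] by blast
  have \<kappa>: "\<kappa> \<in> X" "\<not> affine_dependent {v. hat X v x \<noteq> 0}" unfolding \<kappa>_def using subset_vertices_hull[OF \<tau>(1) sub] by auto
  have V\<kappa>: "vertices X \<inter> \<kappa> = {v. hat X v x \<noteq> 0}" unfolding \<kappa>_def using hull_vertices[OF \<kappa>(2)] \<kappa>(1)[unfolded \<kappa>_def] by simp
  have rel: "rel_interior \<rho> = {y. \<exists>u. (\<forall>v\<in>vertices X \<inter> \<rho>. 0 < u v) \<and> sum u (vertices X \<inter> \<rho>) = 1 \<and> (\<Sum>v\<in>vertices X \<inter> \<rho>. u v *\<^sub>R v) = y}" if "\<rho> \<in> X" for \<rho>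
    using rel_interior_convex_hull_explicit[OF complex_simplex(1)[OF that]] complex_simplex(2)[OF that] by simp
  have xr: "x \<in> rel_interior \<kappa>"
    unfolding rel[OF \<kappa>(1)] V\<kappa>
  proof (intro CollectI exI[of _ "\<lambda>v. hat X v x"] conjI ballI)
    show "0 < hat X v x" if "v \<in> {v. hat X v x \<noteq> 0}" for v using that hat_nonneg[of v x] by simp
    show "(\<Sum>v | hat X v x \<noteq> 0. hat X v x) = 1" "(\<Sum>v | hat X v x \<noteq> 0. hat X v x *\<^sub>R v) = x"
      using hat_sum[OF x] hat_point[OF x] sum_vertices_restrict[of "\<lambda>v. hat X v x" \<kappa>] V\<kappa> by auto
  qed
  have "carrier_simplex X x = \<kappa>"
    unfolding carrier_simplex_def
  proof (rule the_equality)
    fix \<rho> assume \<rho>: "\<rho> \<in> X \<and> x \<in> rel_interior \<rho>"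
    then obtain u where u: "\<forall>v\<in>vertices X \<inter> \<rho>. 0 < u v" "sum u (vertices X \<inter> \<rho>) = 1" "(\<Sum>v\<in>vertices X \<inter> \<rho>. u v *\<^sub>R v) = x"
      using rel[of \<rho>] by auto
    define w where "w v = (if v \<in> vertices X \<inter> \<rho> then u v else 0)" for v
    have w: "\<And>v. w v \<noteq> 0 \<Longrightarrow> v \<in> vertices X \<inter> \<rho>" by (auto simp: w_def split: if_splits)
    have "sum w (vertices X) = 1" "(\<Sum>v\<in>vertices X. w v *\<^sub>R v) = x"
      using sum_vertices_restrict[of w \<rho>, OF w] u(2,3) by (simp_all add: w_def)
    then have "bcoords X x w" unfolding bcoords_def using w u(1) \<rho> by (auto simp: w_def less_imp_le)
    then have "w = (\<lambda>v. hat X v x)" using bcoords_ex1[OF x] hat_bcoords[OF x] by blast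
    moreover have "w v \<noteq> 0 \<longleftrightarrow> v \<in> vertices X \<inter> \<rho>" for v using u(1) by (force simp: w_def)
    ultimately have "vertices X \<inter> \<rho> = {v. hat X v x \<noteq> 0}" by auto
    then show "\<rho> = \<kappa>" using complex_simplex(2) \<rho> unfolding \<kappa>_def by metis
  qed (use \<kappa> xr in blast)
  then show "carrier_simplex X x \<in> X" "x \<in> carrier_simplex X x" "vertices X \<inter> carrier_simplex X x = {v. hat X v x \<noteq> 0}"
    using \<kappa> xr V\<kappa> rel_interior_subset by auto
qed

text \<open>On a simplex of smaller dimension \<open>frechet_derivative\<close> is determined only
  on tangent vectors. Since the D v sum to 0, the vector is a combination of the v - x, and on each
  of these the derivative is read off along the segment from x to v inside \<tau>.\<close>

lemma hat_derivative:
  assumes \<tau>: "\<tau> \<in> X" and x: "x \<in> \<tau>" and D: "\<And>v. D v \<noteq> 0 \<Longrightarrow> v \<in> vertices X \<inter> \<tau>" "sum D (vertices X) = 0"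
  shows "frechet_derivative (hat X w) (at x within \<tau>) (\<Sum>v\<in>vertices X. D v *\<^sub>R v) = D w"
proof -
  obtain g c where g: "linear g" "\<And>x. x \<in> \<tau> \<Longrightarrow> hat X w x = c + (g x :: real)" using hat_affine[OF \<tau>, of w] by blast
  have bl: "bounded_linear g" using g(1) linear_conv_bounded_linear by blast
  have "((\<lambda>x. c + g x) has_derivative g) (at x within \<tau>)"
    by (auto intro!: derivative_eq_intros bounded_linear.has_derivative[OF bl])
  then have hg: "(hat X w has_derivative g) (at x within \<tau>)"
    by (rule has_derivative_transform[OF x, rotated]) (simp add: g(2))
  define F where "F = frechet_derivative (hat X w) (at x within \<tau>)"
  have hF: "(hat X w has_derivative F) (at x within \<tau>)"
    unfolding F_def using hg frechet_derivative_works differentiable_def by blast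
  have lF: "linear F" using hF has_derivative_linear by blast
  have Fg: "F (z - x) = g (z - x)" if z: "z \<in> \<tau>" for z
  proof -
    define p where "p t = x + t *\<^sub>R (z - x)" for t :: real
    have p: "(p has_derivative (\<lambda>t. t *\<^sub>R (z - x))) (at 0 within {0..1})" unfolding p_def by (auto intro!: derivative_eq_intros)
    have "p ` {0..1} \<subseteq> \<tau>"
    proof
      fix y assume "y \<in> p ` {0..1}"
      then obtain t where t: "t \<in> {0..1}" "y = p t" by blast
      then have "y = (1 - t) *\<^sub>R x + t *\<^sub>R z" by (simp add: p_def algebra_simps)
      then show "y \<in> \<tau>" using complex_convex[OF \<tau>] x z t(1) unfolding convex_alt by auto
    qed
    then have *: "((hat X w \<circ> p) has_vector_derivative L (z - x)) (at 0 within {0..1})"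
      if L: "(hat X w has_derivative L) (at x within \<tau>)" for L
    proof -
      have "(hat X w has_derivative L) (at (p 0) within p ` {0..1})"
        using has_derivative_subset[OF L \<open>p ` {0..1} \<subseteq> \<tau>\<close>] by (simp add: p_def)
      from diff_chain_within[OF p this] show ?thesis
        unfolding has_vector_derivative_def o_def using linear_cmul[OF has_derivative_linear[OF L]] by simp
    qed
    have nb: "at 0 within {0..1::real} \<noteq> bot" by (simp add: trivial_limit_within islimpt_Icc)
    show ?thesis by (rule vector_derivative_unique_within[OF nb *[OF hF] *[OF hg]])
  qed
  have DV: "(\<Sum>v\<in>vertices X. D v *\<^sub>R v) = (\<Sum>v\<in>vertices X \<inter> \<tau>. D v *\<^sub>R (v - x))"
  proof -
    have "(\<Sum>v\<in>vertices X \<inter> \<tau>. D v *\<^sub>R (v - x)) = (\<Sum>v\<in>vertices X \<inter> \<tau>. D v *\<^sub>R v) - sum D (vertices X \<inter> \<tau>) *\<^sub>R x"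
      by (simp add: scaleR_diff_right sum_subtractf scaleR_sum_left)
    then show ?thesis using sum_vertices_restrict[of D \<tau>, OF D(1)] D(2) by simp
  qed
  have "F (\<Sum>v\<in>vertices X. D v *\<^sub>R v) = (\<Sum>v\<in>vertices X \<inter> \<tau>. D v * F (v - x))"
    unfolding DV by (simp add: linear_sum[OF lF] linear_cmul[OF lF])
  also have "\<dots> = (\<Sum>v\<in>vertices X \<inter> \<tau>. D v * (hat X w v - hat X w x))"
    using Fg g x by (intro sum.cong) (auto simp: linear_diff[OF g(1)])
  also have "\<dots> = (\<Sum>v\<in>vertices X \<inter> \<tau>. D v * hat X w v) - sum D (vertices X \<inter> \<tau>) * hat X w x"
    by (simp add: right_diff_distrib sum_subtractf sum_distrib_right)
  also have "sum D (vertices X \<inter> \<tau>) = 0" using sum_vertices_restrict(1)[of D \<tau>, OF D(1)] D(2) by simp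
  also have "(\<Sum>v\<in>vertices X \<inter> \<tau>. D v * hat X w v) = (\<Sum>v\<in>vertices X \<inter> \<tau>. if v = w then D v else 0)"
    by (intro sum.cong) (auto simp: hat_vertex)
  also have "\<dots> = D w" using D(1)[of w] vertices_finite by (auto simp: sum.delta)
  finally show ?thesis by (simp add: F_def)
qed

lemma hat_lipschitz_on_simplices:
  "\<exists>K\<ge>0. \<forall>\<tau>\<in>X. \<forall>x\<in>\<tau>. \<forall>y\<in>\<tau>. \<bar>hat X v x - hat X v y\<bar> \<le> K * norm (x - y)"
proof -
  have "\<exists>K\<ge>0. \<forall>x\<in>\<tau>. \<forall>y\<in>\<tau>. \<bar>hat X v x - hat X v y\<bar> \<le> K * norm (x - y)" if \<tau>: "\<tau> \<in> X" for \<tau>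
  proof -
    obtain g c where g: "linear g" "\<And>x. x \<in> \<tau> \<Longrightarrow> hat X v x = c + (g x :: real)" using hat_affine[OF \<tau>, of v] by blast
    obtain K where "\<And>x. norm (g x) \<le> norm x * K" "K > 0" using bounded_linear.pos_bounded linear_conv_bounded_linear g(1) by metis
    then show ?thesis using g by (intro exI[of _ K]) (simp add: linear_diff[OF g(1), symmetric] mult.commute)
  qed
  then obtain K where K: "\<And>\<tau>. \<tau> \<in> X \<Longrightarrow> K \<tau> \<ge> 0" "\<And>\<tau> x y. \<tau> \<in> X \<Longrightarrow> x \<in> \<tau> \<Longrightarrow> y \<in> \<tau> \<Longrightarrow> \<bar>hat X v x - hat X v y\<bar> \<le> K \<tau> * norm (x - y)"
    by metis
  show ?thesis
  proof (intro exI[of _ "sum K X"] conjI ballI)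
    show "0 \<le> sum K X" using K(1) by (rule sum_nonneg)
    fix \<tau> x y assume "\<tau> \<in> X" "x \<in> \<tau>" "y \<in> \<tau>"
    then show "\<bar>hat X v x - hat X v y\<bar> \<le> sum K X * norm (x - y)"
      using K(2) member_le_sum[of \<tau> X K] K(1) complex_finite by (meson mult_right_mono norm_ge_zero order_trans DiffD1)
  qed
qed

text \<open>The estimate for the hat function holds within each simplex, and the polyhedron need not
  be convex. The comparison therefore runs along the image of a segment of the standard simplex: the
  closed sets \<open>U \<tau>\<close> cover [0, 1], and a function on an interval that is Lipschitz
  on each of finitely many closed pieces is Lipschitz with the same constant.\<close>

lemma hat_comp_lipschitz:
  assumes T: "T \<in> lipschitz_simplices k (\<Union>X)"
  obtains L where "lip_simplex k L (\<lambda>q. hat X v (T q))"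
proof -
  obtain C where C: "\<And>x y. x \<in> ref_simplex k \<Longrightarrow> y \<in> ref_simplex k \<Longrightarrow> dist (T x) (T y) \<le> C * euclid_dist k x y"
    and TX: "\<And>x. x \<in> ref_simplex k \<Longrightarrow> T x \<in> \<Union>X" using T unfolding lipschitz_simplices_def by (auto simp: PiE_iff)
  obtain K where K: "K \<ge> 0" "\<And>\<tau> x y. \<tau> \<in> X \<Longrightarrow> x \<in> \<tau> \<Longrightarrow> y \<in> \<tau> \<Longrightarrow> \<bar>hat X v x - hat X v y\<bar> \<le> K * norm (x - y)"
    using hat_lipschitz_on_simplices[of v] by blast
  have C1: "dist (T x) (T y) \<le> \<bar>C\<bar> * (\<Sum>i=1..k. \<bar>x i - y i\<bar>)" if "x \<in> ref_simplex k" "y \<in> ref_simplex k" for x y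
  proof -
    have e: "0 \<le> euclid_dist k x y" "euclid_dist k x y \<le> (\<Sum>i=1..k. \<bar>x i - y i\<bar>)"
      unfolding euclid_dist_def by (auto intro: L2_set_le_sum_abs)
    have "C * euclid_dist k x y \<le> \<bar>C\<bar> * (\<Sum>i=1..k. \<bar>x i - y i\<bar>)" using e by (intro mult_mono) auto
    then show ?thesis using C[OF that] by linarith
  qed
  have "\<bar>hat X v (T x) - hat X v (T y)\<bar> \<le> K * \<bar>C\<bar> * (\<Sum>i=1..k. \<bar>x i - y i\<bar>)" if x: "x \<in> ref_simplex k" and y: "y \<in> ref_simplex k" for x y
  proof -
    define l where "l = (\<Sum>i=1..k. \<bar>x i - y i\<bar>)"
    have l: "l \<ge> 0" unfolding l_def by (intro sum_nonneg) auto
    define p where "p t = (\<lambda>i\<in>{1..k}. (1 - t) * x i + t * y i)" for t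
    have pQ: "p t \<in> ref_simplex k" if "t \<in> {0..1}" for t
    proof -
      have "(\<Sum>i=1..k. p t i) = (1 - t) * (\<Sum>i=1..k. x i) + t * (\<Sum>i=1..k. y i)"
        by (simp add: p_def sum.distrib sum_distrib_left)
      also have "\<dots> \<le> (1 - t) * 1 + t * 1" using x y that by (intro add_mono mult_left_mono) (auto simp: ref_simplex_def)
      finally show ?thesis using x y that by (auto simp: ref_simplex_def p_def)
    qed
    have p01: "p 0 = x" "p 1 = y" using x y by (auto simp: p_def ref_simplex_def extensional_def restrict_def fun_eq_iff)
    have pd: "dist (T (p s)) (T (p t)) \<le> \<bar>C\<bar> * l * \<bar>s - t\<bar>" if "s \<in> {0..1}" "t \<in> {0..1}" for s t
    proof -
      have "(\<Sum>i=1..k. \<bar>p s i - p t i\<bar>) = (\<Sum>i=1..k. \<bar>s - t\<bar> * \<bar>x i - y i\<bar>)"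
        by (intro sum.cong) (auto simp: p_def abs_mult[symmetric] abs_minus_commute algebra_simps)
      then show ?thesis using C1[OF pQ[OF that(1)] pQ[OF that(2)]] by (simp add: l_def sum_distrib_left mult_ac)
    qed
    have cont: "continuous_on {0..1} (\<lambda>t. T (p t))"
      by (rule lipschitz_on_continuous_on[of "\<bar>C\<bar> * l"], rule lipschitz_onI) (use pd l in \<open>auto simp: dist_real_def\<close>)
    define U where "U \<tau> = {t \<in> {0..1}. T (p t) \<in> \<tau>}" for \<tau>
    have "(K * (\<bar>C\<bar> * l))-lipschitz_on {0..1} (\<lambda>t. hat X v (T (p t)))"
    proof (rule lipschitz_on_closed_Union[of X _ U])
      fix \<tau> assume \<tau>: "\<tau> \<in> X"
      show "(K * (\<bar>C\<bar> * l))-lipschitz_on (U \<tau>) (\<lambda>t. hat X v (T (p t)))"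
      proof (rule lipschitz_onI)
        fix s t assume st: "s \<in> U \<tau>" "t \<in> U \<tau>"
        then have "\<bar>hat X v (T (p s)) - hat X v (T (p t))\<bar> \<le> K * norm (T (p s) - T (p t))" using K(2)[OF \<tau>] by (auto simp: U_def)
        also have "\<dots> \<le> K * (\<bar>C\<bar> * l * \<bar>s - t\<bar>)" using pd[of s t] st K(1) by (intro mult_left_mono) (auto simp: U_def dist_norm)
        finally show "dist (hat X v (T (p s))) (hat X v (T (p t))) \<le> K * (\<bar>C\<bar> * l) * dist s t" by (simp add: dist_real_def mult_ac)
      qed (use K l in simp)
      show "closed (U \<tau>)" unfolding U_def
        using continuous_closed_preimage[OF cont _ complex_closed[OF \<tau>]] by (simp add: vimage_def Int_def)
    qed (use complex_finite K l TX pQ in \<open>auto simp: U_def\<close>)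
    from lipschitz_onD[OF this, of 0 1] show ?thesis by (simp add: p01 dist_real_def l_def mult_ac)
  qed
  then show thesis using K(1) by (intro that[of "K * \<bar>C\<bar>"]) (simp add: lip_simplex_def)
qed

lemma hat_eqI: "x \<in> \<Union>X \<Longrightarrow> bcoords X x u \<Longrightarrow> hat X v x = u v"
  unfolding hat_eq_coord by (rule coord_eqI)

end

section \<open>Pullbacks of Whitney forms\<close>

lemma shift_in_simplex:
  assumes q: "q \<in> int_simplex k" and c: "c \<in> {1..k}"
  obtains r where "r > 0" "\<And>t. \<bar>t\<bar> \<le> r \<Longrightarrow> q(c := q c + t) \<in> ref_simplex k"
proof
  define r where "r = min (q c) (1 - (\<Sum>i=1..k. q i))"
  show "r > 0" using q c by (auto simp: r_def int_simplex_def)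
  fix t :: real assume t: "\<bar>t\<bar> \<le> r"
  have "(\<Sum>i=1..k. (q(c := q c + t)) i) = (\<Sum>i=1..k. q i) + t"
    using c by (subst (1 2) sum.remove[of _ c]) auto
  then have "(\<Sum>i=1..k. (q(c := q c + t)) i) \<le> 1" using t unfolding r_def by linarith
  moreover have "0 \<le> q c + t" using t unfolding r_def by linarith
  ultimately show "q(c := q c + t) \<in> ref_simplex k"
    using q c by (auto simp: ref_simplex_def int_simplex_def extensional_def less_imp_le)
qed

lemma has_total_derivative_unique:
  fixes T :: "(nat \<Rightarrow> real) \<Rightarrow> 'b::real_normed_vector"
  assumes q: "q \<in> int_simplex k" and D: "has_total_derivative k T D q" and D': "has_total_derivative k T D' q" and c: "c \<in> {1..k}"
  shows "D c = D' c"
proof -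
  have "norm (D c - D' c) \<le> 0 + e" if e: "e > 0" for e
  proof -
    obtain r where r: "r > 0" "\<And>t. \<bar>t\<bar> \<le> r \<Longrightarrow> q(c := q c + t) \<in> ref_simplex k" by (rule shift_in_simplex[OF q c]) blast
    have "e / 2 > 0" using e by simp
    obtain \<delta> where \<delta>: "\<delta> > 0" "\<And>x. x \<in> ref_simplex k \<Longrightarrow> euclid_dist k x q < \<delta> \<Longrightarrow>
        norm (T x - T q - (\<Sum>i=1..k. (x i - q i) *\<^sub>R D i)) \<le> e / 2 * euclid_dist k x q"
      using D \<open>e / 2 > 0\<close> unfolding has_total_derivative_def by blast
    obtain \<delta>' where \<delta>': "\<delta>' > 0" "\<And>x. x \<in> ref_simplex k \<Longrightarrow> euclid_dist k x q < \<delta>' \<Longrightarrow>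
        norm (T x - T q - (\<Sum>i=1..k. (x i - q i) *\<^sub>R D' i)) \<le> e / 2 * euclid_dist k x q"
      using D' \<open>e / 2 > 0\<close> unfolding has_total_derivative_def by blast
    define t where "t = min r (min \<delta> \<delta>' / 2)"
    have t: "t > 0" "t \<le> r" "t < \<delta>" "t < \<delta>'" using r \<delta> \<delta>' by (auto simp: t_def)
    define x where "x = q(c := q c + t)"
    have xQ: "x \<in> ref_simplex k" unfolding x_def using r(2) t by simp
    have xs: "(\<Sum>i=1..k. (x i - q i) *\<^sub>R E i) = t *\<^sub>R E c" for E :: "nat \<Rightarrow> 'b"
    proof -
      have "(\<Sum>i=1..k. (x i - q i) *\<^sub>R E i) = (\<Sum>i=1..k. if i = c then t *\<^sub>R E i else 0)" by (intro sum.cong) (auto simp: x_def)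
      then show ?thesis using c by simp
    qed
    have "(\<Sum>i=1..k. (x i - q i)\<^sup>2) = (\<Sum>i=1..k. if i = c then t\<^sup>2 else 0)" by (intro sum.cong) (auto simp: x_def)
    then have ed: "euclid_dist k x q = t" using c t unfolding euclid_dist_def L2_set_def by simp
    have "t * norm (D c - D' c) = norm (t *\<^sub>R D c - t *\<^sub>R D' c)" using t by (simp add: scaleR_diff_right[symmetric])
    also have "\<dots> \<le> norm (T x - T q - t *\<^sub>R D c) + norm (T x - T q - t *\<^sub>R D' c)"
      using norm_triangle_ineq4[of "T x - T q - t *\<^sub>R D' c" "T x - T q - t *\<^sub>R D c"] by (simp add: algebra_simps)
    also have "\<dots> \<le> e / 2 * t + e / 2 * t" using \<delta>(2)[OF xQ] \<delta>'(2)[OF xQ] t unfolding ed xs by (intro add_mono) auto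
    finally have "t * norm (D c - D' c) \<le> t * e" by (simp add: mult.commute)
    then show ?thesis using t by simp
  qed
  then have "norm (D c - D' c) \<le> 0" by (rule field_le_epsilon)
  then show ?thesis by simp
qed

lemma has_total_derivative_cong:
  assumes "\<And>x. x \<in> ref_simplex k \<Longrightarrow> S x = T x" "q \<in> ref_simplex k"
  shows "has_total_derivative k S D q \<longleftrightarrow> has_total_derivative k T D q"
  unfolding has_total_derivative_def using assms by (simp cong: ball_cong)

text \<open>The main uses are w v = v, where the sum is the singular simplex itself, and w v = 1,
  where it is the constant 1. Differentiability of the hat functions along T thus yields that of
  T.\<close>

lemma has_total_derivative_sum:
  fixes w :: "'v \<Rightarrow> 'b::real_normed_vector"
  assumes A: "finite A" and D: "\<And>v. v \<in> A \<Longrightarrow> diff_simplex k (f v) (D v) q"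
  shows "has_total_derivative k (\<lambda>x. \<Sum>v\<in>A. f v x *\<^sub>R w v) (\<lambda>c. \<Sum>v\<in>A. D v c *\<^sub>R w v) q"
  unfolding has_total_derivative_def
proof (intro allI impI)
  fix e :: real assume e: "e > 0"
  define W where "W = (\<Sum>v\<in>A. norm (w v)) + 1"
  have "0 \<le> (\<Sum>v\<in>A. norm (w v))" by (intro sum_nonneg) auto
  then have W: "W > 0" by (simp add: W_def)
  \<comment> \<open>Absorbs the norms of the vectors and the passage from the l1-norm to the
    Euclidean norm, which costs at most k + 1. The summand 1 in \<open>W\<close> keeps the
    denominator positive.\<close>
  define \<eta> where "\<eta> = e / (W * real (Suc k))"
  have \<eta>: "\<eta> > 0" unfolding \<eta>_def using e W by simp
  define l where "l x = (\<Sum>i=1..k. \<bar>x i - q i\<bar>)" for x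
  have "\<exists>\<delta>>0. \<forall>x\<in>ref_simplex k. l x < \<delta> \<longrightarrow> \<bar>f v x - f v q - (\<Sum>i=1..k. D v i * (x i - q i))\<bar> \<le> \<eta> * l x" if "v \<in> A" for v
    using D[OF that] \<eta> unfolding diff_simplex_def l_def by blast
  then obtain \<delta> where \<delta>: "\<And>v. v \<in> A \<Longrightarrow> \<delta> v > 0"
      "\<And>v x. v \<in> A \<Longrightarrow> x \<in> ref_simplex k \<Longrightarrow> l x < \<delta> v \<Longrightarrow> \<bar>f v x - f v q - (\<Sum>i=1..k. D v i * (x i - q i))\<bar> \<le> \<eta> * l x"
    by metis
  define d where "d = Min (insert 1 (\<delta> ` A))"
  have d: "d > 0" "\<And>v. v \<in> A \<Longrightarrow> d \<le> \<delta> v" unfolding d_def using \<delta>(1) A by auto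
  have l: "l x \<le> real (Suc k) * euclid_dist k x q" for x
  proof -
    have "\<bar>x i - q i\<bar> \<le> euclid_dist k x q" if "i \<in> {1..k}" for i
      using member_le_L2_set[of "{1..k}" i "\<lambda>i. \<bar>x i - q i\<bar>"] that unfolding euclid_dist_def by (simp add: L2_set_def)
    then have "l x \<le> (\<Sum>i=1..k. euclid_dist k x q)" unfolding l_def by (rule sum_mono)
    also have "\<dots> \<le> real (Suc k) * euclid_dist k x q" by (simp add: euclid_dist_def mult_right_mono)
    finally show ?thesis .
  qed
  show "\<exists>\<delta>>0. \<forall>x\<in>ref_simplex k. euclid_dist k x q < \<delta> \<longrightarrow>
     norm ((\<Sum>v\<in>A. f v x *\<^sub>R w v) - (\<Sum>v\<in>A. f v q *\<^sub>R w v) - (\<Sum>i=1..k. (x i - q i) *\<^sub>R (\<Sum>v\<in>A. D v i *\<^sub>R w v))) \<le> e * euclid_dist k x q"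
  proof (intro exI[of _ "d / real (Suc k)"] conjI ballI impI)
    show "0 < d / real (Suc k)" using d by simp
    fix x assume x: "x \<in> ref_simplex k" and "euclid_dist k x q < d / real (Suc k)"
    then have "real (Suc k) * euclid_dist k x q < d" by (simp add: field_simps)
    then have lx: "l x < d" using l[of x] by linarith
    have "(\<Sum>v\<in>A. f v x *\<^sub>R w v) - (\<Sum>v\<in>A. f v q *\<^sub>R w v) - (\<Sum>i=1..k. (x i - q i) *\<^sub>R (\<Sum>v\<in>A. D v i *\<^sub>R w v))
      = (\<Sum>v\<in>A. (f v x - f v q - (\<Sum>i=1..k. D v i * (x i - q i))) *\<^sub>R w v)"
    proof -
      have "(\<Sum>i=1..k. (x i - q i) *\<^sub>R (\<Sum>v\<in>A. D v i *\<^sub>R w v)) = (\<Sum>v\<in>A. (\<Sum>i=1..k. D v i * (x i - q i)) *\<^sub>R w v)"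
        unfolding scaleR_sum_right scaleR_sum_left by (subst sum.swap) (simp add: mult.commute)
      then show ?thesis by (simp add: scaleR_diff_left sum_subtractf)
    qed
    also have "norm \<dots> \<le> (\<Sum>v\<in>A. (\<eta> * l x) * norm (w v))"
    proof (rule order_trans[OF norm_sum], rule sum_mono)
      fix v assume v: "v \<in> A"
      then have "\<bar>f v x - f v q - (\<Sum>i=1..k. D v i * (x i - q i))\<bar> \<le> \<eta> * l x"
        using \<delta>(2)[OF v x] lx d(2)[OF v] by linarith
      then show "norm ((f v x - f v q - (\<Sum>i=1..k. D v i * (x i - q i))) *\<^sub>R w v) \<le> \<eta> * l x * norm (w v)"
        by (simp add: mult_right_mono)
    qed
    also have "\<dots> = \<eta> * l x * (W - 1)" by (simp add: W_def sum_distrib_left)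
    also have "\<dots> \<le> \<eta> * l x * W"
      using \<eta> by (intro mult_left_mono mult_nonneg_nonneg) (auto simp: l_def intro: sum_nonneg)
    also have "\<dots> \<le> \<eta> * (real (Suc k) * euclid_dist k x q) * W"
      using \<eta> W l by (intro mult_right_mono mult_left_mono) auto
    also have "\<dots> = e * euclid_dist k x q" using W by (simp add: \<eta>_def del: of_nat_Suc)
    finally show "norm ((\<Sum>v\<in>A. f v x *\<^sub>R w v) - (\<Sum>v\<in>A. f v q *\<^sub>R w v) - (\<Sum>i=1..k. (x i - q i) *\<^sub>R (\<Sum>v\<in>A. D v i *\<^sub>R w v))) \<le> e * euclid_dist k x q" .
  qed
qed

lemma diff_simplex_unique:
  assumes q: "q \<in> int_simplex k" and D: "diff_simplex k f D q" "diff_simplex k f D' q" and c: "c \<in> {1..k}"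
  shows "D c = D' c"
proof -
  have "has_total_derivative k f E q" if "diff_simplex k f E q" for E
    using has_total_derivative_sum[of "{()}" k "\<lambda>_. f" "\<lambda>_. E" q "\<lambda>_. 1 :: real"] that by (simp add: real_scaleR_def)
  then show ?thesis using has_total_derivative_unique[OF q _ _ c] D by blast
qed

lemma diff_simplex_min:
  assumes q: "q \<in> int_simplex k" and D: "diff_simplex k f D q" and c: "c \<in> {1..k}"
    and f: "f q = 0" "\<And>x. x \<in> ref_simplex k \<Longrightarrow> 0 \<le> f x"
  shows "D c = 0"
proof -
  have "\<bar>D c\<bar> \<le> 0 + e" if e: "e > 0" for e
  proof -
    obtain r where r: "r > 0" "\<And>t. \<bar>t\<bar> \<le> r \<Longrightarrow> q(c := q c + t) \<in> ref_simplex k" by (rule shift_in_simplex[OF q c]) blast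
    obtain \<delta> where \<delta>: "\<delta> > 0" "\<And>x. x \<in> ref_simplex k \<Longrightarrow> (\<Sum>i=1..k. \<bar>x i - q i\<bar>) < \<delta> \<Longrightarrow>
        \<bar>f x - f q - (\<Sum>i=1..k. D i * (x i - q i))\<bar> \<le> e * (\<Sum>i=1..k. \<bar>x i - q i\<bar>)"
      using D e unfolding diff_simplex_def by blast
    define t where "t = min r (\<delta> / 2)"
    have t: "t > 0" "t \<le> r" "t < \<delta>" using r \<delta> by (auto simp: t_def)
    have "- (D c * s) \<le> e * t" if s: "\<bar>s\<bar> = t" for s
    proof -
      define x where "x = q(c := q c + s)"
      have xQ: "x \<in> ref_simplex k" unfolding x_def using r(2) t s by simp
      have "(\<Sum>i=1..k. \<bar>x i - q i\<bar>) = (\<Sum>i=1..k. if i = c then t else 0)" using s by (intro sum.cong) (auto simp: x_def)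
      then have 1: "(\<Sum>i=1..k. \<bar>x i - q i\<bar>) = t" using c by simp
      have "(\<Sum>i=1..k. D i * (x i - q i)) = (\<Sum>i=1..k. if i = c then D i * s else 0)" by (intro sum.cong) (auto simp: x_def)
      then have 2: "(\<Sum>i=1..k. D i * (x i - q i)) = D c * s" using c by simp
      show ?thesis using \<delta>(2)[OF xQ] t f(1) f(2)[OF xQ] unfolding 1 2 by linarith
    qed
    from this[of t] this[of "- t"] t have "(- D c) * t \<le> e * t" "D c * t \<le> e * t" by auto
    then have "- D c \<le> e" "D c \<le> e" using t(1) mult_right_le_imp_le by blast+
    then show ?thesis by simp
  qed
  then have "\<bar>D c\<bar> \<le> 0" by (rule field_le_epsilon)
  then show ?thesis by simp
qed

lemma diff_simplex_cong:
  assumes "\<And>x. x \<in> ref_simplex k \<Longrightarrow> f x = g x" "q \<in> ref_simplex k"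
  shows "diff_simplex k f D q \<longleftrightarrow> diff_simplex k g D q"
  unfolding diff_simplex_def using assms by (simp cong: ball_cong)

lemma omega_cong:
  assumes "\<And>b x. b < Suc k \<Longrightarrow> x \<in> ref_simplex k \<Longrightarrow> f b x = g b x" "q \<in> ref_simplex k"
  shows "omega k f q = omega k g q"
  unfolding omega_def
proof (rule dt_cong)
  fix b c assume b: "b < Suc k"
  have "diff_simplex k (f b) D q \<longleftrightarrow> diff_simplex k (g b) D q" for D
    by (rule diff_simplex_cong) (use assms b in auto)
  then show "(if c = 0 then f b q else grad k (f b) q c) = (if c = 0 then g b q else grad k (g b) q c)"
    using assms b by (simp add: grad_def)
qed

lemma wedge_dt: "length \<beta>s = k \<Longrightarrow> wedge \<beta>s hs = dt k (\<lambda>j l. (\<beta>s ! j) (hs ! l))"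
  unfolding wedge_def dt_perm by (simp add: atLeast0LessThan)

lemma lebesgue_simplex_cong_AE:
  assumes ae: "AE x in lpi {1..k}. x \<in> ref_simplex k \<longrightarrow> f x = g x" and g: "set_integrable (completion (lpi {1..k})) (ref_simplex k) g"
  shows "lebesgue_simplex k f = lebesgue_simplex k g"
proof -
  have ae': "AE x in completion (lpi {1..k}). indicator (ref_simplex k) x *\<^sub>R f x = indicator (ref_simplex k) x *\<^sub>R g x"
    using AE_completion[OF ae] by eventually_elim (auto simp: indicator_def)
  have mg: "(\<lambda>x. indicator (ref_simplex k) x *\<^sub>R g x) \<in> borel_measurable (completion (lpi {1..k}))"
    using g unfolding set_integrable_def by auto
  show ?thesis unfolding lebesgue_simplex_def set_lebesgue_integral_def
    by (rule integral_cong_AE[OF completion_measurable_cong_AE[OF mg ae'] mg ae'])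
qed

lemma lebesgue_simplex_const: "lebesgue_simplex k (\<lambda>_. c) = c / fact k"
proof -
  have "lebesgue_simplex k (\<lambda>_. c) = (LINT x:ref_simplex k|lpi {1..k}. c)"
    unfolding lebesgue_simplex_def set_lebesgue_integral_def
    using ref_simplex_integrable_const[of k c, unfolded set_integrable_def] by (intro integral_completion) auto
  also have "\<dots> = c * (LINT x:ref_simplex k|lpi {1..k}. \<Prod>i\<le>k. bary k x i ^ 0)" by (simp flip: set_integral_mult_right)
  also have "\<dots> = c / fact k" by (subst has_integral_monomial(2)) simp
  finally show ?thesis .
qed

lemma set_delete_nth: "set (delete_nth i xs) \<subseteq> set xs"
  by (auto simp: delete_nth_def dest: in_set_takeD in_set_dropD)

lemma sorted_delete_nth: "sorted_wrt P xs \<Longrightarrow> sorted_wrt P (delete_nth i xs)"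
proof -
  assume a: "sorted_wrt P xs"
  have "sorted_wrt P (take i xs @ drop i xs)" using a by simp
  then show ?thesis unfolding delete_nth_def sorted_wrt_append
    using set_drop_subset_set_drop[of i "Suc i" xs] sorted_wrt_drop[OF a] by (meson le_SucI order_refl sorted_wrt_append subsetD)
qed

lemma distinct_delete_nth: "distinct xs \<Longrightarrow> distinct (delete_nth i xs)"
  by (auto simp: delete_nth_def set_take_disj_set_drop_if_distinct)

lemma simplices_finite_subset:
  assumes X: "simplicial_complex X"
  shows "finite (simplices X r k)" "\<And>\<sigma>. \<sigma> \<in> simplices X r k \<Longrightarrow> set \<sigma> \<subseteq> vertices X"
    "\<And>\<sigma>. \<sigma> \<in> simplices X r k \<Longrightarrow> length \<sigma> = Suc k"
proof -
  show sub: "set \<sigma> \<subseteq> vertices X" if "\<sigma> \<in> simplices X r k" for \<sigma>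
    using that hull_vertices[OF X, of "set \<sigma>"] unfolding simplices_def by blast
  show "length \<sigma> = Suc k" if "\<sigma> \<in> simplices X r k" for \<sigma> using that by (simp add: simplices_def)
  have "simplices X r k \<subseteq> {\<sigma>. set \<sigma> \<subseteq> vertices X \<and> length \<sigma> = Suc k}" using sub by (auto simp: simplices_def)
  then show "finite (simplices X r k)" by (rule finite_subset) (rule finite_lists_length_eq[OF vertices_finite[OF X]])
qed

section \<open>Hat functions along a Lipschitz singular simplex\<close>

context
  fixes X :: "'a::euclidean_space set set" and T :: "(nat \<Rightarrow> real) \<Rightarrow> 'a" and k :: nat
  assumes X: "simplicial_complex X" and T: "T \<in> lipschitz_simplices k (\<Union>X)"
begin

definition hat_along :: "'a \<Rightarrow> (nat \<Rightarrow> real) \<Rightarrow> real" where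
  "hat_along v q = hat X v (T q)"

text \<open>Interior points at which all hat functions along T are differentiable. Almost every
  point qualifies, and the pointwise identities are proved there.\<close>

definition good_point :: "(nat \<Rightarrow> real) \<Rightarrow> bool" where
  "good_point q \<longleftrightarrow> q \<in> int_simplex k \<and> (\<forall>v\<in>vertices X. diff_simplex k (hat_along v) (grad k (hat_along v) q) q)"

lemma T_in: "q \<in> ref_simplex k \<Longrightarrow> T q \<in> \<Union>X"
  using T by (auto simp: lipschitz_simplices_def PiE_iff)

lemma hat_along_lip: "\<exists>L. lip_simplex k L (hat_along v)"
  using hat_comp_lipschitz[OF X T, of v] unfolding hat_along_def by blast

lemma good_point_ae: "AE q in lpi {1..k}. q \<in> ref_simplex k \<longrightarrow> good_point q"
proof -
  obtain L where "\<And>v. lip_simplex k (L v) (hat_along v)" using hat_along_lip by metis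
  from lip_simplex_good_ae[OF this vertices_finite[OF X]] show ?thesis unfolding good_point_def .
qed

text \<open>Since T is the sum of \<open>hat_along v\<close> times v, the gradients of the hat
  functions are the barycentric components of DT(q). They sum to 0 and vanish off the carrier, so
  DT(q) is tangent to the carrier simplex, as the evaluation of traces requires.\<close>

lemma good_point_derivatives:
  assumes q: "good_point q" and c: "c \<in> {1..k}"
  shows "hat_along v q \<noteq> 0 \<Longrightarrow> v \<in> vertices X \<inter> carrier_simplex X (T q)"
    and "v \<in> vertices X \<Longrightarrow> grad k (hat_along v) q c \<noteq> 0 \<Longrightarrow> v \<in> vertices X \<inter> carrier_simplex X (T q)"
    and "(\<Sum>v\<in>vertices X. hat_along v q) = 1"
    and "(\<Sum>v\<in>vertices X. grad k (hat_along v) q c) = 0"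
    and "total_derivative k T q c = (\<Sum>v\<in>vertices X. grad k (hat_along v) q c *\<^sub>R v)"
proof -
  have qi: "q \<in> int_simplex k" and qr: "q \<in> ref_simplex k" using q int_simplex_subset unfolding good_point_def by blast+
  have D: "\<And>v. v \<in> vertices X \<Longrightarrow> diff_simplex k (hat_along v) (grad k (hat_along v) q) q" using q unfolding good_point_def by blast
  note ca = carrier_simplex[OF X T_in[OF qr]]
  show "hat_along v q \<noteq> 0 \<Longrightarrow> v \<in> vertices X \<inter> carrier_simplex X (T q)" using ca(3) by (auto simp: hat_along_def)
  show "v \<in> vertices X \<inter> carrier_simplex X (T q)" if v: "v \<in> vertices X" and "grad k (hat_along v) q c \<noteq> 0"
  proof (rule ccontr)
    assume "v \<notin> vertices X \<inter> carrier_simplex X (T q)"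
    then have "hat_along v q = 0" using ca(3) by (auto simp: hat_along_def)
    then have "grad k (hat_along v) q c = 0" using hat_nonneg[OF X] by (intro diff_simplex_min[OF qi D[OF v] c]) (auto simp: hat_along_def)
    then show False using that by simp
  qed
  show "(\<Sum>v\<in>vertices X. hat_along v q) = 1" using hat_sum[OF X T_in[OF qr]] by (simp add: hat_along_def)
  show "(\<Sum>v\<in>vertices X. grad k (hat_along v) q c) = 0"
  proof -
    have 1: "has_total_derivative k (\<lambda>x. 1 :: real) (\<lambda>c. \<Sum>v\<in>vertices X. grad k (hat_along v) q c *\<^sub>R 1) q"
      using has_total_derivative_sum[where A="vertices X" and f=hat_along and D="\<lambda>v. grad k (hat_along v) q", OF vertices_finite[OF X] D, where w="\<lambda>_. 1 :: real"] has_total_derivative_cong[of k "\<lambda>x. \<Sum>v\<in>vertices X. hat_along v x *\<^sub>R 1" "\<lambda>x. 1 :: real", OF _ qr]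
        hat_sum[OF X T_in] by (simp add: hat_along_def)
    \<comment> \<open>The constant 1 also has derivative 0; uniqueness at the interior point q makes
      the gradients sum to 0.\<close>
    have 0: "has_total_derivative k (\<lambda>x. 1 :: real) (\<lambda>c. 0) q" unfolding has_total_derivative_def euclid_dist_def
      by (intro allI impI exI[of _ 1] conjI ballI) (simp_all add: mult_nonneg_nonneg)
    show ?thesis using has_total_derivative_unique[OF qi 1 0 c] by simp
  qed
  have 1: "has_total_derivative k T (\<lambda>c. \<Sum>v\<in>vertices X. grad k (hat_along v) q c *\<^sub>R v) q"
    using has_total_derivative_sum[where A="vertices X" and f=hat_along and D="\<lambda>v. grad k (hat_along v) q", OF vertices_finite[OF X] D, where w="\<lambda>v. v"] has_total_derivative_cong[of k "\<lambda>x. \<Sum>v\<in>vertices X. hat_along v x *\<^sub>R v" T, OF _ qr]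
      hat_point[OF X T_in] by (simp add: hat_along_def)
  then have 2: "has_total_derivative k T (total_derivative k T q) q"
    unfolding total_derivative_def by (rule someI[of "\<lambda>D. has_total_derivative k T D q"])
  show "total_derivative k T q c = (\<Sum>v\<in>vertices X. grad k (hat_along v) q c *\<^sub>R v)"
    by (rule has_total_derivative_unique[OF qi 2 1 c])
qed

lemma pullback_whitney:
  assumes q: "good_point q"
  shows "pullback X k T (whitney_map X r k \<alpha>) q = (\<Sum>\<sigma>\<in>simplices X r k. \<alpha> \<sigma> * (fact k * omega k (\<lambda>b. hat_along (\<sigma> ! b)) q))"
proof -
  have qr: "q \<in> ref_simplex k" using q int_simplex_subset unfolding good_point_def by blast
  define \<tau> where "\<tau> = carrier_simplex X (T q)"
  note ca = carrier_simplex[OF X T_in[OF qr], folded \<tau>_def]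
  define hs where "hs = map (total_derivative k T q) [1..<Suc k]"
  have fd: "frechet_derivative (hat X v) (at (T q) within \<tau>) (hs ! l) = grad k (hat_along v) q (Suc l)"
    if v: "v \<in> vertices X" and l: "l < k" for v l
  proof -
    have c: "Suc l \<in> {1..k}" using l by simp
    \<comment> \<open>Set to 0 off the vertices of X, where the gradients carry no information,
      because \<open>hat_derivative\<close> constrains D at every point.\<close>
    define D where "D v = (if v \<in> vertices X then grad k (hat_along v) q (Suc l) else 0)" for v
    have "hs ! l = total_derivative k T q (Suc l)" using l unfolding hs_def by (simp del: upt_Suc)
    also have "\<dots> = (\<Sum>v\<in>vertices X. D v *\<^sub>R v)" unfolding good_point_derivatives(5)[OF q c] by (intro sum.cong) (auto simp: D_def)
    finally have h: "hs ! l = (\<Sum>v\<in>vertices X. D v *\<^sub>R v)" .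
    have "frechet_derivative (hat X v) (at (T q) within \<tau>) (\<Sum>v\<in>vertices X. D v *\<^sub>R v) = D v"
    proof (rule hat_derivative[OF X ca(1,2)])
      show "D v \<noteq> 0 \<Longrightarrow> v \<in> vertices X \<inter> \<tau>" for v using good_point_derivatives(2)[OF q c] unfolding D_def \<tau>_def by (auto split: if_splits)
      show "sum D (vertices X) = 0" using good_point_derivatives(4)[OF q c] by (simp add: D_def)
    qed
    then show ?thesis unfolding h using v by (simp add: D_def)
  qed
  have "whitney_form X \<sigma> \<tau> (T q) hs = fact k * omega k (\<lambda>b. hat_along (\<sigma> ! b)) q" if \<sigma>: "\<sigma> \<in> simplices X r k" for \<sigma>
  proof -
    have len: "length \<sigma> = Suc k" and sub: "set \<sigma> \<subseteq> vertices X" using simplices_finite_subset[OF X] \<sigma> by auto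
    have "wedge (map (\<lambda>v. frechet_derivative (hat X v) (at (T q) within \<tau>)) (delete_nth i \<sigma>)) hs = dt k (\<lambda>j l. grad k (hat_along (\<sigma> ! insert_index i j)) q (Suc l))"
      if i: "i < Suc k" for i
    proof -
      have ld: "length (delete_nth i \<sigma>) = k" using i len by (simp add: length_delete_nth)
      have "wedge (map (\<lambda>v. frechet_derivative (hat X v) (at (T q) within \<tau>)) (delete_nth i \<sigma>)) hs
        = dt k (\<lambda>j l. (map (\<lambda>v. frechet_derivative (hat X v) (at (T q) within \<tau>)) (delete_nth i \<sigma>) ! j) (hs ! l))"
        by (rule wedge_dt) (simp add: ld)
      also have "\<dots> = dt k (\<lambda>j l. grad k (hat_along (\<sigma> ! insert_index i j)) q (Suc l))"
      proof (rule dt_cong)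
        fix j l assume j: "j < k" and l: "l < k"
        have "insert_index i j < Suc k" using j by (auto simp: insert_index_def)
        then have "\<sigma> ! insert_index i j \<in> vertices X" using sub len by (auto simp: subset_iff)
        then show "(map (\<lambda>v. frechet_derivative (hat X v) (at (T q) within \<tau>)) (delete_nth i \<sigma>) ! j) (hs ! l) = grad k (hat_along (\<sigma> ! insert_index i j)) q (Suc l)"
          using j l ld i len fd by (simp add: nth_delete_nth)
      qed
      finally show ?thesis .
    qed
    then have "whitney_form X \<sigma> \<tau> (T q) hs = fact k * (\<Sum>i<Suc k. (-1) ^ i * hat_along (\<sigma> ! i) q * dt k (\<lambda>j l. grad k (hat_along (\<sigma> ! insert_index i j)) q (Suc l)))"
      unfolding whitney_form_def len hat_along_def by (simp del: sum.lessThan_Suc)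
    also have "(\<Sum>i<Suc k. (-1) ^ i * hat_along (\<sigma> ! i) q * dt k (\<lambda>j l. grad k (hat_along (\<sigma> ! insert_index i j)) q (Suc l))) = omega k (\<lambda>b. hat_along (\<sigma> ! b)) q"
      unfolding omega_def by (subst dt_laplace_column[of 0]) (auto simp del: sum.lessThan_Suc)
    finally show ?thesis .
  qed
  then show ?thesis unfolding pullback_def whitney_map_def \<tau>_def hs_def by (intro sum.cong) auto
qed

lemma omega_integrable: "set_integrable (completion (lpi {1..k})) (ref_simplex k) (omega k (\<lambda>b. hat_along (\<sigma> ! b)))"
proof -
  obtain L where "\<And>v. lip_simplex k (L v) (hat_along v)" using hat_along_lip by metis
  then show ?thesis by (intro omega_limit(2))
qed

lemma integral_simplex_whitney:
  "integral_simplex X k T (whitney_map X r k \<alpha>) = (\<Sum>\<sigma>\<in>simplices X r k. \<alpha> \<sigma> * (fact k * lebesgue_simplex k (omega k (\<lambda>b. hat_along (\<sigma> ! b)))))"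
  and omega_sum_integral: "lebesgue_simplex k (\<lambda>q. \<Sum>\<sigma>\<in>simplices X r k. \<alpha> \<sigma> * (fact k * omega k (\<lambda>b. hat_along (\<sigma> ! b)) q)) =
    (\<Sum>\<sigma>\<in>simplices X r k. \<alpha> \<sigma> * (fact k * lebesgue_simplex k (omega k (\<lambda>b. hat_along (\<sigma> ! b)))))"
proof -
  let ?S = "\<lambda>q. \<Sum>\<sigma>\<in>simplices X r k. \<alpha> \<sigma> * (fact k * omega k (\<lambda>b. hat_along (\<sigma> ! b)) q)"
  have int: "set_integrable (completion (lpi {1..k})) (ref_simplex k) (\<lambda>q. \<alpha> \<sigma> * (fact k * omega k (\<lambda>b. hat_along (\<sigma> ! b)) q))" for \<sigma>
    by (intro set_integrable_mult_right impI omega_integrable)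
  have iS: "set_integrable (completion (lpi {1..k})) (ref_simplex k) ?S"
    unfolding set_integrable_def scaleR_sum_right
    using int unfolding set_integrable_def by (intro Bochner_Integration.integrable_sum)
  show 2: "lebesgue_simplex k ?S = (\<Sum>\<sigma>\<in>simplices X r k. \<alpha> \<sigma> * (fact k * lebesgue_simplex k (omega k (\<lambda>b. hat_along (\<sigma> ! b)))))"
    unfolding lebesgue_simplex_def by (subst set_lebesgue_integral_sum[OF int]) simp
  have "AE q in lpi {1..k}. q \<in> ref_simplex k \<longrightarrow> pullback X k T (whitney_map X r k \<alpha>) q = ?S q"
    using good_point_ae by eventually_elim (auto simp: pullback_whitney)
  from lebesgue_simplex_cong_AE[OF this iS] 2 show "integral_simplex X k T (whitney_map X r k \<alpha>) = (\<Sum>\<sigma>\<in>simplices X r k. \<alpha> \<sigma> * (fact k * lebesgue_simplex k (omega k (\<lambda>b. hat_along (\<sigma> ! b)))))"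
    unfolding integral_simplex_def lebesgue_simplex_def by simp
qed

end

section \<open>Chains and cochains\<close>

lemma delete_nth_props:
  assumes "j < length \<rho>"
  shows "set \<rho> = insert (\<rho> ! j) (set (delete_nth j \<rho>))" "distinct \<rho> \<longleftrightarrow> distinct (delete_nth j \<rho>) \<and> \<rho> ! j \<notin> set (delete_nth j \<rho>)"
proof -
  have \<rho>: "\<rho> = take j \<rho> @ \<rho> ! j # drop (Suc j) \<rho>" using assms by (rule id_take_nth_drop)
  have "set (take j \<rho> @ \<rho> ! j # drop (Suc j) \<rho>) = insert (\<rho> ! j) (set (delete_nth j \<rho>))"
    by (auto simp: delete_nth_def)
  then show "set \<rho> = insert (\<rho> ! j) (set (delete_nth j \<rho>))" using \<rho> by simp
  have "distinct (take j \<rho> @ \<rho> ! j # drop (Suc j) \<rho>) \<longleftrightarrow> distinct (delete_nth j \<rho>) \<and> \<rho> ! j \<notin> set (delete_nth j \<rho>)"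
    by (auto simp: delete_nth_def)
  then show "distinct \<rho> \<longleftrightarrow> distinct (delete_nth j \<rho>) \<and> \<rho> ! j \<notin> set (delete_nth j \<rho>)" using \<rho> by simp
qed

text \<open>This realises a simplex with an adjoined vertex as an increasing list from which one
  entry is deleted.\<close>

lemma insert_sorted_wrt:
  assumes r: "linear_order_on V r" and "sorted_wrt (\<lambda>u v. (u, v) \<in> r) \<sigma>" "set \<sigma> \<subseteq> V" "v \<in> V"
  shows "\<exists>\<rho> j. j < length \<rho> \<and> delete_nth j \<rho> = \<sigma> \<and> \<rho> ! j = v \<and> sorted_wrt (\<lambda>u v. (u, v) \<in> r) \<rho>"
  using assms(2,3)
proof (induction \<sigma>)
  case Nil
  show ?case by (rule exI[of _ "[v]"], rule exI[of _ 0]) (simp add: delete_nth_def)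
next
  case (Cons x \<sigma>)
  have refl: "refl_on V r" and tr: "trans r" and tot: "total_on V r"
    using r by (auto simp: linear_order_on_def partial_order_on_def preorder_on_def)
  show ?case
  proof (cases "(v, x) \<in> r")
    case True
    then have "sorted_wrt (\<lambda>u v. (u, v) \<in> r) (v # x # \<sigma>)" using Cons.prems(1) tr by (auto dest: transD)
    then show ?thesis by (intro exI[of _ "v # x # \<sigma>"] exI[of _ 0]) (simp add: delete_nth_def)
  next
    case False
    have xv: "(x, v) \<in> r"
    proof (cases "x = v")
      case True
      then show ?thesis using refl assms(4) by (auto dest: refl_onD)
    next
      case False
      then show ?thesis using tot \<open>(v, x) \<notin> r\<close> Cons.prems(2) assms(4) unfolding total_on_def by auto
    qed
    obtain \<rho> j where \<rho>: "j < length \<rho>" "delete_nth j \<rho> = \<sigma>" "\<rho> ! j = v" "sorted_wrt (\<lambda>u v. (u, v) \<in> r) \<rho>"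
      using Cons by auto
    have "sorted_wrt (\<lambda>u v. (u, v) \<in> r) (x # \<rho>)" using \<rho>(4) xv Cons.prems(1) delete_nth_props(1)[OF \<rho>(1)] \<rho>(2,3) by auto
    moreover have "delete_nth (Suc j) (x # \<rho>) = x # \<sigma>" using \<rho>(2) by (simp add: delete_nth_def)
    ultimately show ?thesis using \<rho> by (intro exI[of _ "x # \<rho>"] exI[of _ "Suc j"]) simp
  qed
qed

lemma sorted_wrt_set_unique:
  assumes "antisym r"
  shows "sorted_wrt (\<lambda>u v. (u, v) \<in> r) xs \<Longrightarrow> sorted_wrt (\<lambda>u v. (u, v) \<in> r) ys \<Longrightarrow> distinct xs \<Longrightarrow> distinct ys \<Longrightarrow> set xs = set ys \<Longrightarrow> xs = ys"
proof (induction xs arbitrary: ys)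
  case (Cons x xs)
  then obtain y zs where ys: "ys = y # zs" by (cases ys) auto
  have "x = y"
  proof (rule ccontr)
    assume "x \<noteq> y"
    then have "x \<in> set zs" "y \<in> set xs" using Cons.prems(5) ys by auto
    then have "(y, x) \<in> r" "(x, y) \<in> r" using Cons.prems ys by auto
    then show False using assms \<open>x \<noteq> y\<close> by (auto dest: antisymD)
  qed
  moreover have "xs = zs" using Cons.prems ys \<open>x = y\<close> by (intro Cons.IH) auto
  ultimately show ?case using ys by simp
qed simp

lemma simplices_delete_nth:
  assumes X: "simplicial_complex X" and \<rho>: "\<rho> \<in> simplices X r (Suc k)" and j: "j < Suc (Suc k)"
  shows "delete_nth j \<rho> \<in> simplices X r k"
proof -
  have a: "\<not> affine_dependent (set \<rho>)" and h: "convex hull (set \<rho>) \<in> X" using \<rho> by (auto simp: simplices_def)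
  have "set (delete_nth j \<rho>) \<subseteq> vertices X \<inter> convex hull (set \<rho>)"
    using set_delete_nth hull_vertices[OF X a h] by metis
  from subset_vertices_hull[OF X h this] show ?thesis
    using \<rho> j unfolding simplices_def by (auto simp: length_delete_nth sorted_delete_nth distinct_delete_nth)
qed

text \<open>The common form of \<open>pairing\<close> and \<open>integral_chain\<close>, so that
  linearity in the chain is proved once.\<close>

definition eval_chain :: "('b \<Rightarrow> real) \<Rightarrow> ('b \<Rightarrow>\<^sub>0 real) \<Rightarrow> real" where
  "eval_chain I c = (\<Sum>T\<in>Poly_Mapping.keys c. Poly_Mapping.lookup c T * I T)"

lemma eval_chain_superset:
  "finite A \<Longrightarrow> Poly_Mapping.keys c \<subseteq> A \<Longrightarrow> eval_chain I c = (\<Sum>T\<in>A. Poly_Mapping.lookup c T * I T)"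
  unfolding eval_chain_def by (rule sum.mono_neutral_left) (auto simp: in_keys_iff)

lemma eval_chain_zero [simp]: "eval_chain I 0 = 0"
  by (simp add: eval_chain_def)

lemma eval_chain_add: "eval_chain I (c + d) = eval_chain I c + eval_chain I d"
proof -
  let ?A = "Poly_Mapping.keys c \<union> Poly_Mapping.keys d"
  have "eval_chain I (c + d) = (\<Sum>T\<in>?A. Poly_Mapping.lookup (c + d) T * I T)"
    by (rule eval_chain_superset) (auto dest: subsetD[OF Poly_Mapping.keys_add])
  then show ?thesis
    using eval_chain_superset[of ?A c I] eval_chain_superset[of ?A d I] by (simp add: lookup_add distrib_right sum.distrib)
qed

lemma eval_chain_diff: "eval_chain I (c - d) = eval_chain I c - eval_chain I d"
  using eval_chain_add[of I "c - d" d] by simp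

lemma eval_chain_single: "eval_chain I (Poly_Mapping.single T a) = a * I T"
  by (cases "a = 0") (simp_all add: eval_chain_def)

lemma eval_chain_sum: "eval_chain I (\<Sum>i\<in>A. c i) = (\<Sum>i\<in>A. eval_chain I (c i))"
  by (induction A rule: infinite_finite_induct) (simp_all add: eval_chain_add)

lemma eval_chain_scale: "eval_chain I (Poly_Mapping.map ((*) s) c) = s * eval_chain I c"
proof -
  have l: "Poly_Mapping.lookup (Poly_Mapping.map ((*) s) c) T = s * Poly_Mapping.lookup c T" for T
    by (simp add: Poly_Mapping.map.rep_eq when_def)
  have "eval_chain I (Poly_Mapping.map ((*) s) c) = (\<Sum>T\<in>Poly_Mapping.keys c. Poly_Mapping.lookup (Poly_Mapping.map ((*) s) c) T * I T)"
    by (rule eval_chain_superset) (auto simp: in_keys_iff l)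
  then show ?thesis by (simp add: l eval_chain_def sum_distrib_left mult_ac)
qed

lemma integral_chain_eval: "integral_chain X k c u = eval_chain (\<lambda>T. integral_simplex X k T u) c"
  by (simp add: integral_chain_def eval_chain_def)

lemma pairing_eval: "pairing \<alpha> c = eval_chain \<alpha> c"
  by (simp add: pairing_def eval_chain_def)

lemma boundary_single: "boundary (Poly_Mapping.single \<sigma> 1) = (\<Sum>i<length \<sigma>. Poly_Mapping.single (delete_nth i \<sigma>) ((-1) ^ i))"
  by (simp add: boundary_def)

lemma coboundary_eq:
  "\<sigma> \<in> simplices X r (Suc k) \<Longrightarrow> coboundary X r k \<alpha> \<sigma> = (\<Sum>i<Suc (Suc k). (-1) ^ i * \<alpha> (delete_nth i \<sigma>))"
  by (simp add: coboundary_def pairing_eval boundary_single eval_chain_sum eval_chain_single simplices_def del: sum.lessThan_Suc)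

lemma face_lipschitz_simplex:
  assumes T: "T \<in> lipschitz_simplices (Suc k) M" and l: "l \<le> Suc k"
  shows "restrict (T \<circ> face_map (Suc k) l) (ref_simplex k) \<in> lipschitz_simplices k M"
proof -
  obtain C where C: "\<And>x y. x \<in> ref_simplex (Suc k) \<Longrightarrow> y \<in> ref_simplex (Suc k) \<Longrightarrow> dist (T x) (T y) \<le> C * euclid_dist (Suc k) x y"
    using T unfolding lipschitz_simplices_def by blast
  have "dist (T (face_map (Suc k) l x)) (T (face_map (Suc k) l y)) \<le> (\<bar>C\<bar> * (2 * real (Suc k))) * euclid_dist k x y"
    if x: "x \<in> ref_simplex k" and y: "y \<in> ref_simplex k" for x y
  proof -
    have coord: "\<bar>x i - y i\<bar> \<le> euclid_dist k x y" if "i \<in> {1..k}" for i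
      using member_le_L2_set[of "{1..k}" i "\<lambda>i. \<bar>x i - y i\<bar>"] that unfolding euclid_dist_def by (simp add: L2_set_def)
    have l1: "(\<Sum>i=1..k. \<bar>x i - y i\<bar>) \<le> real (Suc k) * euclid_dist k x y"
    proof -
      have "(\<Sum>i=1..k. \<bar>x i - y i\<bar>) \<le> (\<Sum>i=1..k. euclid_dist k x y)" using coord by (rule sum_mono)
      also have "\<dots> \<le> real (Suc k) * euclid_dist k x y" by (simp add: euclid_dist_def mult_right_mono)
      finally show ?thesis .
    qed
    have "euclid_dist (Suc k) (face_map (Suc k) l x) (face_map (Suc k) l y) \<le> (\<Sum>i=1..Suc k. \<bar>face_map (Suc k) l x i - face_map (Suc k) l y i\<bar>)"
      unfolding euclid_dist_def by (rule L2_set_le_sum_abs)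
    also have "\<dots> \<le> 2 * (\<Sum>i=1..k. \<bar>x i - y i\<bar>)" by (rule face_map_l1[OF x y l])
    also have "\<dots> \<le> 2 * (real (Suc k) * euclid_dist k x y)" using l1 by (simp del: of_nat_Suc)
    finally have e: "euclid_dist (Suc k) (face_map (Suc k) l x) (face_map (Suc k) l y) \<le> 2 * real (Suc k) * euclid_dist k x y" by (simp only: mult.assoc)
    have "dist (T (face_map (Suc k) l x)) (T (face_map (Suc k) l y)) \<le> C * euclid_dist (Suc k) (face_map (Suc k) l x) (face_map (Suc k) l y)"
      by (rule C[OF face_map_ref[OF x l] face_map_ref[OF y l]])
    also have "\<dots> \<le> \<bar>C\<bar> * (2 * real (Suc k) * euclid_dist k x y)"
      using e by (intro mult_mono) (auto simp: euclid_dist_def)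
    finally show ?thesis by (simp add: mult_ac)
  qed
  moreover have "T (face_map (Suc k) l x) \<in> M" if "x \<in> ref_simplex k" for x
    using T face_map_ref[OF that l] by (auto simp: lipschitz_simplices_def PiE_iff)
  ultimately show ?thesis unfolding lipschitz_simplices_def by (auto intro!: exI[of _ "\<bar>C\<bar> * (2 * real (Suc k))"])
qed

section \<open>The Whitney map intertwines the coboundary and the exterior derivative\<close>

context
  fixes X :: "'a::euclidean_space set set" and r :: "'a rel"
  assumes X: "simplicial_complex X" and r: "linear_order_on (vertices X) r"
begin

lemma simplices_unique: "\<sigma> \<in> simplices X r k \<Longrightarrow> \<tau> \<in> simplices X r k' \<Longrightarrow> set \<sigma> = set \<tau> \<Longrightarrow> \<sigma> = \<tau>"
  using r by (intro sorted_wrt_set_unique[of r]) (auto simp: simplices_def linear_order_on_def partial_order_on_def)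

text \<open>A (k + 1)-simplex with a position in it corresponds to a k-simplex \<sigma> with an
  added vertex v, the sign \<open>(-1) ^ j\<close> moving the row of v to the front. Pairs that do
  not arise contribute zero, so v may run over all vertices. The hat functions add up to 1, so the
  rows of v add up to (1, 0, ..., 0), and the Jacobian of the functions of \<sigma> remains.\<close>

lemma whitney_coboundary_pointwise:
  assumes T: "T \<in> lipschitz_simplices (Suc k) (\<Union>X)" and q: "good_point X T (Suc k) q"
  shows "(\<Sum>\<rho>\<in>simplices X r (Suc k). coboundary X r k \<alpha> \<rho> * omega (Suc k) (\<lambda>b. hat_along X T (\<rho> ! b)) q)
    = (\<Sum>\<sigma>\<in>simplices X r k. \<alpha> \<sigma> * jac (Suc k) (\<lambda>b. hat_along X T (\<sigma> ! b)) q)"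
proof -
  define V where "V = vertices X"
  define R where "R v c = (if c = 0 then hat_along X T v q else grad (Suc k) (hat_along X T v) q c)" for v c
  define OM where "OM l = dt (Suc (Suc k)) (\<lambda>b. R (l ! b))" for l
  define \<tau> where "\<tau> = carrier_simplex X (T q)"
  have fV: "finite V" unfolding V_def by (rule vertices_finite[OF X])
  have qr: "q \<in> ref_simplex (Suc k)" using q int_simplex_subset unfolding good_point_def[OF X T] by blast
  note ca = carrier_simplex[OF X T_in[OF X T qr], folded \<tau>_def V_def]
  note gd = good_point_derivatives[OF X T q, folded \<tau>_def V_def]
  have R0: "R v c = 0" if "v \<in> V" "v \<notin> V \<inter> \<tau>" "c < Suc (Suc k)" for v c
    using gd(1)[of 1 v] gd(2)[of c v] that unfolding R_def by (cases "c = 0") auto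
  have Rsum: "(\<Sum>v\<in>V. R v c) = (if c = 0 then 1 else 0)" if "c < Suc (Suc k)" for c
    using gd(3)[of 1] gd(4)[of c] that unfolding R_def by auto
  have Fin: "finite (simplices X r k)" for k by (rule simplices_finite_subset(1)[OF X])
  have sub: "\<sigma> \<in> simplices X r k \<Longrightarrow> set \<sigma> \<subseteq> V" "\<sigma> \<in> simplices X r k \<Longrightarrow> length \<sigma> = Suc k" for \<sigma> k
    using simplices_finite_subset[OF X] unfolding V_def by auto
  define A where "A = simplices X r (Suc k) \<times> {..<Suc (Suc k)}"
  define m where "m = (\<lambda>(\<rho> :: 'a list, j). (delete_nth j \<rho>, \<rho> ! j))"
  have om: "omega (Suc k) (\<lambda>b. hat_along X T (\<rho> ! b)) q = OM \<rho>" for \<rho>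
    unfolding omega_def OM_def R_def by (rule dt_cong) simp
  have front: "(-1) ^ j * OM \<rho> = OM (\<rho> ! j # delete_nth j \<rho>)" if "\<rho> \<in> simplices X r (Suc k)" "j < Suc (Suc k)" for \<rho> j
  proof -
    have len: "length \<rho> = Suc (Suc k)" by (rule sub(2)[OF that(1)])
    have "(-1) ^ j * OM \<rho> = dt (Suc (Suc k)) (\<lambda>i. if i = 0 then R (\<rho> ! j) else R (\<rho> ! insert_index j (i - 1)))"
      unfolding OM_def by (rule dt_move_row[OF that(2), symmetric])
    also have "\<dots> = OM (\<rho> ! j # delete_nth j \<rho>)"
      unfolding OM_def
    proof (rule dt_cong)
      fix i c assume "i < Suc (Suc k)"
      then show "(if i = 0 then R (\<rho> ! j) else R (\<rho> ! insert_index j (i - 1))) c = R ((\<rho> ! j # delete_nth j \<rho>) ! i) c"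
        using that len by (cases i) (auto simp: nth_delete_nth)
    qed
    finally show ?thesis .
  qed
  have "(\<Sum>\<rho>\<in>simplices X r (Suc k). coboundary X r k \<alpha> \<rho> * OM \<rho>) = (\<Sum>\<rho>\<in>simplices X r (Suc k). \<Sum>j<Suc (Suc k). \<alpha> (delete_nth j \<rho>) * OM (\<rho> ! j # delete_nth j \<rho>))"
  proof (rule sum.cong[OF refl])
    fix \<rho> assume \<rho>: "\<rho> \<in> simplices X r (Suc k)"
    show "coboundary X r k \<alpha> \<rho> * OM \<rho> = (\<Sum>j<Suc (Suc k). \<alpha> (delete_nth j \<rho>) * OM (\<rho> ! j # delete_nth j \<rho>))"
      unfolding coboundary_eq[OF \<rho>] sum_distrib_right
    proof (rule sum.cong[OF refl])
      fix j assume "j \<in> {..<Suc (Suc k)}"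
      then have "OM (\<rho> ! j # delete_nth j \<rho>) = (-1) ^ j * OM \<rho>" using front[OF \<rho>] by simp
      then show "(-1) ^ j * \<alpha> (delete_nth j \<rho>) * OM \<rho> = \<alpha> (delete_nth j \<rho>) * OM (\<rho> ! j # delete_nth j \<rho>)" by simp
    qed
  qed
  also have "\<dots> = (\<Sum>p\<in>A. (\<lambda>(\<sigma>, v). \<alpha> \<sigma> * OM (v # \<sigma>)) (m p))"
    unfolding A_def by (subst sum.cartesian_product) (auto simp: m_def intro!: sum.cong simp del: sum.lessThan_Suc)
  also have "\<dots> = (\<Sum>(\<sigma>, v)\<in>m ` A. \<alpha> \<sigma> * OM (v # \<sigma>))"
  proof (rule sum.reindex[symmetric, unfolded o_def])
    \<comment> \<open>A simplex is an increasing list, hence recovered from its vertex set.\<close>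
    show "inj_on m A"
    proof (rule inj_onI, clarify)
      fix \<rho> j \<rho>' j' assume a: "(\<rho>, j) \<in> A" "(\<rho>', j') \<in> A" "m (\<rho>, j) = m (\<rho>', j')"
      then have len: "j < length \<rho>" "j' < length \<rho>'" using sub(2) unfolding A_def by auto
      have "\<rho> = \<rho>'"
        using a delete_nth_props(1)[OF len(1)] delete_nth_props(1)[OF len(2)] unfolding A_def m_def by (intro simplices_unique) auto
      moreover have "distinct \<rho>" using a by (auto simp: A_def simplices_def)
      ultimately show "\<rho> = \<rho>' \<and> j = j'" using a len by (auto simp: m_def nth_eq_iff_index_eq)
    qed
  qed
  also have "\<dots> = (\<Sum>(\<sigma>, v)\<in>simplices X r k \<times> V. \<alpha> \<sigma> * OM (v # \<sigma>))"
  proof (rule sum.mono_neutral_left)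
    show "finite (simplices X r k \<times> V)" using Fin fV by simp
    show "m ` A \<subseteq> simplices X r k \<times> V"
    proof
      fix p assume "p \<in> m ` A"
      then obtain \<rho> j where p: "p = (delete_nth j \<rho>, \<rho> ! j)" "\<rho> \<in> simplices X r (Suc k)" "j < Suc (Suc k)" by (auto simp: A_def m_def)
      then show "p \<in> simplices X r k \<times> V" using simplices_delete_nth[OF X p(2,3)] sub[OF p(2)] by (auto simp: subset_iff)
    qed
    \<comment> \<open>Either v occurs in \<sigma> and two rows agree; or some vertex lies outside
      the carrier and its row vanishes; or all vertices lie in the carrier, hence span a simplex of
      X, and the pair was not missing.\<close>
    show "\<forall>p\<in>simplices X r k \<times> V - m ` A. (case p of (\<sigma>, v) \<Rightarrow> \<alpha> \<sigma> * OM (v # \<sigma>)) = 0"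
    proof clarify
      fix \<sigma> v assume \<sigma>: "\<sigma> \<in> simplices X r k" and v: "v \<in> V" and ni: "(\<sigma>, v) \<notin> m ` A"
      have "OM (v # \<sigma>) = 0"
      proof (cases "v \<in> set \<sigma>")
        case True
        then obtain i where i: "i < length \<sigma>" "\<sigma> ! i = v" by (auto simp: in_set_conv_nth)
        show ?thesis unfolding OM_def
          by (rule dt_identical_rows[of 0 _ "Suc i"]) (use i sub(2)[OF \<sigma>] in auto)
      next
        case False
        note vn = False
        show ?thesis
        proof (cases "insert v (set \<sigma>) \<subseteq> V \<inter> \<tau>")
          case True
          obtain \<rho> j where \<rho>: "j < length \<rho>" "delete_nth j \<rho> = \<sigma>" "\<rho> ! j = v" "sorted_wrt (\<lambda>u v. (u, v) \<in> r) \<rho>"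
            using insert_sorted_wrt[OF r, of \<sigma> v] \<sigma> sub(1)[OF \<sigma>] v unfolding simplices_def V_def by blast
          have set: "set \<rho> = insert v (set \<sigma>)" using delete_nth_props(1)[OF \<rho>(1)] \<rho>(2,3) by simp
          have "distinct \<rho>" using delete_nth_props(2)[OF \<rho>(1)] \<rho>(2,3) vn \<sigma> by (simp add: simplices_def)
          moreover have len: "length \<rho> = Suc (Suc k)" using length_delete_nth[OF \<rho>(1)] \<rho>(1,2) sub(2)[OF \<sigma>] by simp
          moreover have "set \<rho> \<subseteq> vertices X \<inter> \<tau>" using True set unfolding V_def by simp
          note subset_vertices_hull[OF X ca(1) this]
          ultimately have "\<rho> \<in> simplices X r (Suc k)" using \<rho>(4) by (simp add: simplices_def)
          then have "(\<rho>, j) \<in> A" using \<rho>(1) len by (simp add: A_def)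
          then have "m (\<rho>, j) \<in> m ` A" by (rule imageI)
          then show ?thesis using ni \<rho>(2,3) by (simp add: m_def)
        next
          case False
          then obtain w where w: "w \<in> insert v (set \<sigma>)" "w \<notin> V \<inter> \<tau>" by blast
          then have "w \<in> set (v # \<sigma>)" by simp
          then obtain i where i: "i < length (v # \<sigma>)" "(v # \<sigma>) ! i = w" unfolding in_set_conv_nth by blast
          have "w \<in> V" using w(1) v sub(1)[OF \<sigma>] by auto
          then show ?thesis unfolding OM_def using R0 w(2) i sub(2)[OF \<sigma>] by (intro dt_zero_row[of i]) auto
        qed
      qed
      then show "\<alpha> \<sigma> * OM (v # \<sigma>) = 0" by simp
    qed
  qed
  also have "\<dots> = (\<Sum>\<sigma>\<in>simplices X r k. \<alpha> \<sigma> * (\<Sum>v\<in>V. OM (v # \<sigma>)))"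
    by (subst sum.cartesian_product[symmetric]) (simp add: sum_distrib_left)
  also have "\<dots> = (\<Sum>\<sigma>\<in>simplices X r k. \<alpha> \<sigma> * jac (Suc k) (\<lambda>b. hat_along X T (\<sigma> ! b)) q)"
  proof (intro sum.cong refl arg_cong2[where f="(*)"])
    fix \<sigma>
    have "(\<Sum>v\<in>V. OM (v # \<sigma>)) = (\<Sum>v\<in>V. \<Sum>c<Suc (Suc k). (-1) ^ c * R v c * dt (Suc k) (\<lambda>i c'. R (\<sigma> ! i) (insert_index c c')))"
      unfolding OM_def by (intro sum.cong refl, subst dt_laplace_row[of 0]) (auto simp del: sum.lessThan_Suc)
    also have "\<dots> = (\<Sum>c<Suc (Suc k). (-1) ^ c * (\<Sum>v\<in>V. R v c) * dt (Suc k) (\<lambda>i c'. R (\<sigma> ! i) (insert_index c c')))"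
      by (subst sum.swap) (simp add: sum_distrib_left sum_distrib_right mult_ac del: sum.lessThan_Suc)
    also have "\<dots> = (\<Sum>c<Suc (Suc k). if c = 0 then dt (Suc k) (\<lambda>i c'. R (\<sigma> ! i) (Suc c')) else 0)"
      by (intro sum.cong) (auto simp: Rsum simp del: sum.lessThan_Suc)
    also have "\<dots> = dt (Suc k) (\<lambda>i c'. R (\<sigma> ! i) (Suc c'))" by (simp add: sum.delta del: sum.lessThan_Suc)
    also have "\<dots> = jac (Suc k) (\<lambda>b. hat_along X T (\<sigma> ! b)) q"
      unfolding jac_def R_def by simp
    finally show "(\<Sum>v\<in>V. OM (v # \<sigma>)) = jac (Suc k) (\<lambda>b. hat_along X T (\<sigma> ! b)) q" .
  qed
  finally show ?thesis unfolding om .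
qed

text \<open>The factor k + 1 from \<open>lipschitz_stokes\<close> and the k! of the Whitney forms
  combine to (k + 1)!, the normalisation in the next degree, so the pointwise identity applies
  without a constant.\<close>

lemma whitney_stokes_simplex:
  assumes T: "T \<in> lipschitz_simplices (Suc k) (\<Union>X)"
  shows "(\<Sum>l\<le>Suc k. (-1) ^ l * integral_simplex X k (restrict (T \<circ> face_map (Suc k) l) (ref_simplex k)) (whitney_map X r k \<alpha>))
    = integral_simplex X (Suc k) T (whitney_map X r (Suc k) (coboundary X r k \<alpha>))"
proof -
  define f where "f \<sigma> b = hat_along X T (\<sigma> ! b)" for \<sigma> and b :: nat
  obtain L where L: "\<And>v. lip_simplex (Suc k) (L v) (hat_along X T v)" using hat_along_lip[OF X T] by metis
  have Lf: "lip_simplex (Suc k) (L (\<sigma> ! b)) (f \<sigma> b)" for \<sigma> b unfolding f_def by (rule L)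
  let ?face = "\<lambda>l. restrict (T \<circ> face_map (Suc k) l) (ref_simplex k)"
  have face: "integral_simplex X k (?face l) (whitney_map X r k \<alpha>) =
      (\<Sum>\<sigma>\<in>simplices X r k. \<alpha> \<sigma> * (fact k * lebesgue_simplex k (omega k (\<lambda>b x. f \<sigma> b (face_map (Suc k) l x)))))" if l: "l \<le> Suc k" for l
  proof -
    note Tl = face_lipschitz_simplex[OF T l]
    have "lebesgue_simplex k (omega k (\<lambda>b. hat_along X (?face l) (\<sigma> ! b))) = lebesgue_simplex k (omega k (\<lambda>b x. f \<sigma> b (face_map (Suc k) l x)))" for \<sigma>
    proof (rule lebesgue_simplex_cong_AE[OF AE_I2])
      show "x \<in> ref_simplex k \<longrightarrow> omega k (\<lambda>b. hat_along X (?face l) (\<sigma> ! b)) x = omega k (\<lambda>b x. f \<sigma> b (face_map (Suc k) l x)) x" for x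
        by (intro impI omega_cong) (auto simp: f_def hat_along_def[OF X T] hat_along_def[OF X Tl])
      show "set_integrable (completion (lpi {1..k})) (ref_simplex k) (omega k (\<lambda>b x. f \<sigma> b (face_map (Suc k) l x)))"
        by (rule omega_limit(2), rule lip_simplex_face[OF Lf l])
    qed
    then show ?thesis unfolding integral_simplex_whitney[OF X Tl] by simp
  qed
  have "(\<Sum>l\<le>Suc k. (-1) ^ l * integral_simplex X k (?face l) (whitney_map X r k \<alpha>))
    = (\<Sum>l\<le>Suc k. \<Sum>\<sigma>\<in>simplices X r k. \<alpha> \<sigma> * (fact k * ((-1) ^ l * lebesgue_simplex k (omega k (\<lambda>b x. f \<sigma> b (face_map (Suc k) l x))))))"
    by (intro sum.cong refl) (simp only: face atMost_iff sum_distrib_left mult_ac)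
  also have "\<dots> = (\<Sum>\<sigma>\<in>simplices X r k. \<alpha> \<sigma> * (fact k * (\<Sum>l\<le>Suc k. (-1) ^ l * lebesgue_simplex k (omega k (\<lambda>b x. f \<sigma> b (face_map (Suc k) l x))))))"
    by (subst sum.swap) (simp only: sum_distrib_left)
  also have "\<dots> = (\<Sum>\<sigma>\<in>simplices X r k. \<alpha> \<sigma> * (fact k * (real (Suc k) * lebesgue_simplex (Suc k) (jac (Suc k) (f \<sigma>)))))"
    by (simp only: lipschitz_stokes[OF Lf])
  also have "\<dots> = (\<Sum>\<sigma>\<in>simplices X r k. \<alpha> \<sigma> * (fact (Suc k) * lebesgue_simplex (Suc k) (jac (Suc k) (f \<sigma>))))"
    by (simp only: fact_Suc of_nat_mult of_nat_fact mult_ac)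
  also have "\<dots> = lebesgue_simplex (Suc k) (\<lambda>q. \<Sum>\<sigma>\<in>simplices X r k. \<alpha> \<sigma> * (fact (Suc k) * jac (Suc k) (f \<sigma>) q))"
  proof -
    have "set_integrable (completion (lpi {1..Suc k})) (ref_simplex (Suc k)) (\<lambda>q. \<alpha> \<sigma> * (fact (Suc k) * jac (Suc k) (f \<sigma>) q))" for \<sigma>
      by (intro set_integrable_mult_right impI jac_limit(2)[OF Lf])
    then show ?thesis unfolding lebesgue_simplex_def by (subst set_lebesgue_integral_sum) (simp_all del: fact_Suc)
  qed
  also have "\<dots> = lebesgue_simplex (Suc k) (\<lambda>q. \<Sum>\<rho>\<in>simplices X r (Suc k). coboundary X r k \<alpha> \<rho> * (fact (Suc k) * omega (Suc k) (\<lambda>b. hat_along X T (\<rho> ! b)) q))"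
  proof (rule lebesgue_simplex_cong_AE)
    show "AE q in lpi {1..Suc k}. q \<in> ref_simplex (Suc k) \<longrightarrow> (\<Sum>\<sigma>\<in>simplices X r k. \<alpha> \<sigma> * (fact (Suc k) * jac (Suc k) (f \<sigma>) q))
      = (\<Sum>\<rho>\<in>simplices X r (Suc k). coboundary X r k \<alpha> \<rho> * (fact (Suc k) * omega (Suc k) (\<lambda>b. hat_along X T (\<rho> ! b)) q))"
      using good_point_ae[OF X T]
    proof eventually_elim
      case (elim q)
      show ?case
      proof
        assume "q \<in> ref_simplex (Suc k)"
        then have "good_point X T (Suc k) q" using elim by blast
        from whitney_coboundary_pointwise[OF T this, of \<alpha>]
        have "fact (Suc k) * (\<Sum>\<rho>\<in>simplices X r (Suc k). coboundary X r k \<alpha> \<rho> * omega (Suc k) (\<lambda>b. hat_along X T (\<rho> ! b)) q)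
          = fact (Suc k) * (\<Sum>\<sigma>\<in>simplices X r k. \<alpha> \<sigma> * jac (Suc k) (f \<sigma>) q)" unfolding f_def by simp
        then show "(\<Sum>\<sigma>\<in>simplices X r k. \<alpha> \<sigma> * (fact (Suc k) * jac (Suc k) (f \<sigma>) q))
          = (\<Sum>\<rho>\<in>simplices X r (Suc k). coboundary X r k \<alpha> \<rho> * (fact (Suc k) * omega (Suc k) (\<lambda>b. hat_along X T (\<rho> ! b)) q))"
          by (simp only: sum_distrib_left mult.left_commute)
      qed
    qed
    show "set_integrable (completion (lpi {1..Suc k})) (ref_simplex (Suc k))
      (\<lambda>q. \<Sum>\<rho>\<in>simplices X r (Suc k). coboundary X r k \<alpha> \<rho> * (fact (Suc k) * omega (Suc k) (\<lambda>b. hat_along X T (\<rho> ! b)) q))"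
      unfolding set_integrable_def scaleR_sum_right
      by (intro Bochner_Integration.integrable_sum, fold set_integrable_def) (intro set_integrable_mult_right impI omega_integrable[OF X T])
  qed
  also have "\<dots> = integral_simplex X (Suc k) T (whitney_map X r (Suc k) (coboundary X r k \<alpha>))"
    unfolding integral_simplex_whitney[OF X T] by (rule omega_sum_integral[OF X T])
  finally show ?thesis .
qed

lemma whitney_stokes_chain:
  assumes c: "c \<in> lipschitz_chains (Suc k) (\<Union>X)"
  shows "integral_chain X k (singular_boundary (Suc k) c) (whitney_map X r k \<alpha>) = integral_chain X (Suc k) c (whitney_map X r (Suc k) (coboundary X r k \<alpha>))"
proof -
  have "integral_chain X k (singular_boundary (Suc k) c) (whitney_map X r k \<alpha>) =
    (\<Sum>T\<in>Poly_Mapping.keys c. \<Sum>l\<le>Suc k. ((-1) ^ l * Poly_Mapping.lookup c T) *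
      integral_simplex X k (restrict (T \<circ> face_map (Suc k) l) (ref_simplex k)) (whitney_map X r k \<alpha>))"
    unfolding integral_chain_eval singular_boundary_def eval_chain_sum eval_chain_single by simp
  also have "\<dots> = (\<Sum>T\<in>Poly_Mapping.keys c. Poly_Mapping.lookup c T * (\<Sum>l\<le>Suc k. (-1) ^ l *
      integral_simplex X k (restrict (T \<circ> face_map (Suc k) l) (ref_simplex k)) (whitney_map X r k \<alpha>)))"
    by (simp only: sum_distrib_left mult_ac)
  also have "\<dots> = (\<Sum>T\<in>Poly_Mapping.keys c. Poly_Mapping.lookup c T * integral_simplex X (Suc k) T (whitney_map X r (Suc k) (coboundary X r k \<alpha>)))"
    using c whitney_stokes_simplex unfolding lipschitz_chains_def by (intro sum.cong refl arg_cong2[where f="(*)"]) blast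
  finally show ?thesis unfolding integral_chain_def .
qed

section \<open>The operators induced by a cone operator\<close>

text \<open>The hat function is written as a sum over positions so that one formula also covers the
  vertices outside \<sigma>, where it gives 0.\<close>

lemma lin_simplex_in:
  assumes \<sigma>: "\<sigma> \<in> simplices X r k" and q: "q \<in> ref_simplex k"
  shows "lin_simplex \<sigma> q \<in> \<Union>X" "hat X v (lin_simplex \<sigma> q) = (\<Sum>t\<le>k. if \<sigma> ! t = v then bary k q t else 0)"
proof -
  have len: "length \<sigma> = Suc k" and dist: "distinct \<sigma>" and h: "convex hull (set \<sigma>) \<in> X" using \<sigma> by (auto simp: simplices_def)
  have sub: "set \<sigma> \<subseteq> vertices X" by (rule simplices_finite_subset(2)[OF X \<sigma>])
  have l: "lin_simplex \<sigma> q = (\<Sum>t\<le>k. bary k q t *\<^sub>R (\<sigma> ! t))" by (rule lin_simplex_bary[OF len q])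
  have "lin_simplex \<sigma> q \<in> convex hull (set \<sigma>)"
    unfolding l using len by (intro convex_sum convex_convex_hull bary_sum bary_nonneg[OF q] hull_inc) auto
  then show in_X: "lin_simplex \<sigma> q \<in> \<Union>X" using h by blast
  define u where "u v = (\<Sum>t\<le>k. if \<sigma> ! t = v then bary k q t else 0)" for v
  have inner: "(\<Sum>v\<in>vertices X. if \<sigma> ! t = v then h v else 0) = h (\<sigma> ! t)" if "t \<le> k" for t and h :: "'a \<Rightarrow> 'c::comm_monoid_add"
  proof -
    have "\<sigma> ! t \<in> vertices X" using sub that len by (auto simp: subset_iff)
    then show ?thesis using vertices_finite[OF X] by simp
  qed
  have "bcoords X (lin_simplex \<sigma> q) u"
    unfolding bcoords_def
  proof (intro conjI allI)
    show "0 \<le> u v" for v unfolding u_def using bary_nonneg[OF q] by (intro sum_nonneg) auto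
    show "sum u (vertices X) = 1"
      unfolding u_def by (subst sum.swap) (simp add: inner bary_sum)
    have "(\<Sum>v\<in>vertices X. u v *\<^sub>R v) = (\<Sum>v\<in>vertices X. \<Sum>t\<le>k. if \<sigma> ! t = v then bary k q t *\<^sub>R v else 0)"
      unfolding u_def scaleR_sum_left by (intro sum.cong) auto
    also have "\<dots> = (\<Sum>t\<le>k. bary k q t *\<^sub>R (\<sigma> ! t))" by (subst sum.swap) (simp add: inner)
    finally show "(\<Sum>v\<in>vertices X. u v *\<^sub>R v) = lin_simplex \<sigma> q" unfolding l .
    show "\<exists>\<tau>\<in>X. \<forall>v. u v \<noteq> 0 \<longrightarrow> v \<in> vertices X \<inter> \<tau>"
    proof (intro bexI[OF _ h] allI impI)
      fix v assume "u v \<noteq> 0"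
      then obtain t where "t \<le> k" "\<sigma> ! t = v" unfolding u_def by (rule sum.not_neutral_contains_not_neutral) (auto split: if_splits)
      then have "v \<in> set \<sigma>" using len by auto
      then show "v \<in> vertices X \<inter> convex hull (set \<sigma>)" using sub by (auto intro: hull_inc)
    qed
  qed
  from hat_eqI[OF X in_X this] show "hat X v (lin_simplex \<sigma> q) = (\<Sum>t\<le>k. if \<sigma> ! t = v then bary k q t else 0)" unfolding u_def .
qed

lemma lin_simplex_lipschitz:
  assumes \<sigma>: "\<sigma> \<in> simplices X r k"
  shows "lin_simplex \<sigma> \<in> lipschitz_simplices k (\<Union>X)"
proof -
  have len: "length \<sigma> = Suc k" using \<sigma> by (simp add: simplices_def)
  have "lin_simplex \<sigma> \<in> ref_simplex k \<rightarrow>\<^sub>E \<Union>X"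
    using lin_simplex_in(1)[OF \<sigma>] len by (auto simp: PiE_iff lin_simplex_def extensional_def)
  moreover have "dist (lin_simplex \<sigma> x) (lin_simplex \<sigma> y) \<le> (\<Sum>i=1..k. norm (\<sigma> ! i - \<sigma> ! 0)) * euclid_dist k x y"
    if x: "x \<in> ref_simplex k" and y: "y \<in> ref_simplex k" for x y
  proof -
    have "lin_simplex \<sigma> x - lin_simplex \<sigma> y = (\<Sum>i=1..k. (x i - y i) *\<^sub>R (\<sigma> ! i - \<sigma> ! 0))"
      using x y len by (simp add: lin_simplex_def scaleR_diff_left sum_subtractf)
    also have "norm \<dots> \<le> (\<Sum>i=1..k. euclid_dist k x y * norm (\<sigma> ! i - \<sigma> ! 0))"
    proof (rule order_trans[OF norm_sum], rule sum_mono)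
      fix i assume "i \<in> {1..k}"
      then have "\<bar>x i - y i\<bar> \<le> euclid_dist k x y"
        using member_le_L2_set[of "{1..k}" i "\<lambda>i. \<bar>x i - y i\<bar>"] unfolding euclid_dist_def by (simp add: L2_set_def)
      then show "norm ((x i - y i) *\<^sub>R (\<sigma> ! i - \<sigma> ! 0)) \<le> euclid_dist k x y * norm (\<sigma> ! i - \<sigma> ! 0)"
        by (simp add: mult_right_mono)
    qed
    finally show ?thesis by (simp add: dist_norm sum_distrib_left mult.commute)
  qed
  ultimately show ?thesis unfolding lipschitz_simplices_def by blast
qed

lemma diff_simplex_bary: "diff_simplex k (\<lambda>x. bary k x b) (\<lambda>c. (if b = c then 1 else 0) - (if b = 0 then 1 else 0)) q" if "b \<le> k"
proof -
  have "bary k y b - bary k q b = (\<Sum>i=1..k. ((if b = i then 1 else 0) - (if b = 0 then 1 else 0)) * (y i - q i))" for y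
  proof (cases "b = 0")
    case True
    have "(\<Sum>i=1..k. ((if b = i then 1 else 0) - (if b = 0 then 1 else 0)) * (y i - q i)) = (\<Sum>i=1..k. q i - y i)"
      using True by (intro sum.cong) auto
    then show ?thesis using True by (simp add: bary_def sum_subtractf)
  next
    case False
    have "(\<Sum>i=1..k. ((if b = i then 1 else 0) - (if b = 0 then 1 else 0)) * (y i - q i)) = (\<Sum>i=1..k. if b = i then y i - q i else 0)"
      using False by (intro sum.cong) auto
    then show ?thesis using False that by (simp add: bary_def)
  qed
  then show ?thesis unfolding diff_simplex_def
    by (intro allI impI exI[of _ 1] conjI ballI) (simp_all add: sum_nonneg)
qed

text \<open>Along an affine simplex the hat functions are its barycentric coordinates, or 0 for
  vertices outside. If \<tau> \<noteq> \<sigma>, some vertex of \<tau> is outside, as both have k +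
  1 vertices, and a row vanishes. If \<tau> = \<sigma>, the determinant is 1, and the volume 1/k!
  cancels the factor k!.\<close>

lemma integral_whitney_lin_simplex:
  assumes \<sigma>: "\<sigma> \<in> simplices X r k"
  shows "integral_simplex X k (lin_simplex \<sigma>) (whitney_map X r k \<alpha>) = \<alpha> \<sigma>"
proof -
  let ?T = "lin_simplex \<sigma>"
  note T = lin_simplex_lipschitz[OF \<sigma>]
  have len: "length \<sigma> = Suc k" and dist: "distinct \<sigma>" using \<sigma> by (auto simp: simplices_def)
  have "lebesgue_simplex k (omega k (\<lambda>b. hat_along X ?T (\<tau> ! b))) = lebesgue_simplex k (\<lambda>_. if \<tau> = \<sigma> then 1 else 0)"
    if \<tau>: "\<tau> \<in> simplices X r k" for \<tau>
  proof (rule lebesgue_simplex_cong_AE)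
    have lt: "length \<tau> = Suc k" and dt: "distinct \<tau>" using \<tau> by (auto simp: simplices_def)
    show "AE q in lpi {1..k}. q \<in> ref_simplex k \<longrightarrow> omega k (\<lambda>b. hat_along X ?T (\<tau> ! b)) q = (if \<tau> = \<sigma> then 1 else 0)"
      using good_point_ae[OF X T]
    proof (eventually_elim, intro impI)
      fix q assume "q \<in> ref_simplex k \<longrightarrow> good_point X ?T k q" and qr: "q \<in> ref_simplex k"
      then have g: "good_point X ?T k q" by blast
      then have qi: "q \<in> int_simplex k" and D: "\<And>v. v \<in> vertices X \<Longrightarrow> diff_simplex k (hat_along X ?T v) (grad k (hat_along X ?T v) q) q"
        unfolding good_point_def[OF X T] by auto
      have sub: "set \<tau> \<subseteq> vertices X" by (rule simplices_finite_subset(2)[OF X \<tau>])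
      show "omega k (\<lambda>b. hat_along X ?T (\<tau> ! b)) q = (if \<tau> = \<sigma> then 1 else 0)"
      proof (cases "\<tau> = \<sigma>")
        case False
        have "\<not> set \<tau> \<subseteq> set \<sigma>"
        proof
          assume "set \<tau> \<subseteq> set \<sigma>"
          moreover have "card (set \<tau>) = card (set \<sigma>)" using distinct_card[OF dist] distinct_card[OF dt] len lt by simp
          ultimately have "set \<tau> = set \<sigma>" by (intro card_subset_eq) auto
          then show False using simplices_unique[OF \<tau> \<sigma>] False by blast
        qed
        then obtain b where b: "b < Suc k" "\<tau> ! b \<notin> set \<sigma>" using lt by (metis in_set_conv_nth subsetI)
        have z: "hat_along X ?T (\<tau> ! b) x = 0" if "x \<in> ref_simplex k" for x
          unfolding hat_along_def[OF X T] lin_simplex_in(2)[OF \<sigma> that] using b(2) len nth_mem[of _ \<sigma>] by (intro sum.neutral) (metis atMost_iff le_imp_less_Suc)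
        have "grad k (hat_along X ?T (\<tau> ! b)) q c = 0" if "c \<in> {1..k}" for c
        proof (rule diff_simplex_min[OF qi D that])
          show "\<tau> ! b \<in> vertices X" using sub b lt by (auto simp: subset_iff)
        qed (use z qr in auto)
        then show ?thesis using False z[OF qr] b(1) unfolding omega_def by (simp, intro dt_zero_row[of b]) auto
      next
        case True
        have hb: "hat_along X ?T (\<sigma> ! b) x = bary k x b" if "b < Suc k" "x \<in> ref_simplex k" for b x
        proof -
          have "hat_along X ?T (\<sigma> ! b) x = (\<Sum>t\<le>k. if t = b then bary k x t else 0)"
            unfolding hat_along_def[OF X T] lin_simplex_in(2)[OF \<sigma> that(2)]
            using that len dist by (intro sum.cong) (auto simp: nth_eq_iff_index_eq)
          then show ?thesis using that by simp
        qed
        have gb: "grad k (hat_along X ?T (\<sigma> ! b)) q c = (if b = c then 1 else 0) - (if b = 0 then 1 else 0)" if b: "b < Suc k" and c: "c \<in> {1..k}" for b c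
        proof (rule diff_simplex_unique[OF qi _ _ c])
          have "\<sigma> ! b \<in> vertices X" using simplices_finite_subset(2)[OF X \<sigma>] b len by (auto simp: subset_iff)
          then show "diff_simplex k (hat_along X ?T (\<sigma> ! b)) (grad k (hat_along X ?T (\<sigma> ! b)) q) q" by (rule D)
          have "diff_simplex k (\<lambda>x. bary k x b) (\<lambda>c. (if b = c then 1 else 0) - (if b = 0 then 1 else 0)) q"
            using b by (intro diff_simplex_bary) simp
          then show "diff_simplex k (hat_along X ?T (\<sigma> ! b)) (\<lambda>c. (if b = c then 1 else 0) - (if b = 0 then 1 else 0)) q"
            by (subst diff_simplex_cong[OF hb[OF b] qr])
        qed
        \<comment> \<open>The homogeneous partial derivatives of the barycentric coordinates form
          the identity matrix; \<open>dt_homogeneous\<close> in degree s = 1 transfers its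
          determinant.\<close>
        define P where "P b c = (if b = c then 1 else 0 :: real)" for b c :: nat
        have "omega k (\<lambda>b. hat_along X ?T (\<sigma> ! b)) q = 1 * dt (Suc k) (\<lambda>b c. if c = 0 then bary k q b else P b c - P b 0)"
          unfolding omega_def mult_1 by (rule dt_cong) (auto simp: hb[OF _ qr] gb P_def)
        also have "\<dots> = dt (Suc k) P"
          by (rule dt_homogeneous[OF bary_sum[of k q]]) (simp add: P_def if_distrib[of "(*) _"] cong: if_cong)
        also have "\<dots> = 1" by (rule dt_upper) (auto simp: P_def)
        finally show ?thesis using True by simp
      qed
    qed
    show "set_integrable (completion (lpi {1..k})) (ref_simplex k) (\<lambda>_. if \<tau> = \<sigma> then 1 else 0 :: real)"
      using ref_simplex_integrable_const[of k "if \<tau> = \<sigma> then 1 else 0"] unfolding set_integrable_def by (subst integrable_completion) auto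
  qed
  then have "integral_simplex X k ?T (whitney_map X r k \<alpha>) = (\<Sum>\<tau>\<in>simplices X r k. \<alpha> \<tau> * (fact k * ((if \<tau> = \<sigma> then 1 else 0) / fact k)))"
    unfolding integral_simplex_whitney[OF X T] lebesgue_simplex_const[symmetric] by simp
  also have "\<dots> = (\<Sum>\<tau>\<in>simplices X r k. if \<tau> = \<sigma> then \<alpha> \<tau> else 0)" by (intro sum.cong) auto
  also have "\<dots> = \<alpha> \<sigma>" using \<sigma> simplices_finite_subset(1)[OF X] by simp
  finally show ?thesis .
qed

lemma whitney_map_cong: "(\<And>\<sigma>. \<sigma> \<in> simplices X r k \<Longrightarrow> \<alpha> \<sigma> = \<beta> \<sigma>) \<Longrightarrow> whitney_map X r k \<alpha> = whitney_map X r k \<beta>"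
  unfolding whitney_map_def by (intro ext sum.cong) auto

text \<open>The Whitney form with prescribed integrals exists and is unique because
  \<open>integral_whitney_lin_simplex\<close> recovers its coefficients. The de Rham map returns the
  prescribed numbers, so the operator on cochains is integration of the Whitney form over
  cones.\<close>

lemma cochain_cone_operator_eq:
  "cochain_cone_operator X r Co k \<alpha> \<sigma> =
    (if \<sigma> \<in> simplices X r (k - 1) then integral_chain X k (Co (k - 1) (Poly_Mapping.single \<sigma> 1)) (whitney_map X r k \<alpha>) else 0)"
proof -
  define \<beta> where "\<beta> \<sigma> = integral_chain X k (Co (k - 1) (Poly_Mapping.single \<sigma> 1)) (whitney_map X r k \<alpha>)" for \<sigma>
  have "whitney_cone_operator X r Co k (whitney_map X r k \<alpha>) = whitney_map X r (k - 1) \<beta>"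
    unfolding whitney_cone_operator_def
  proof (rule the_equality)
    show "whitney_map X r (k - 1) \<beta> \<in> whitney_space X r (k - 1) \<and>
      (\<forall>\<sigma>\<in>simplices X r (k - 1). integral_simplex X (k - 1) (lin_simplex \<sigma>) (whitney_map X r (k - 1) \<beta>) =
        integral_chain X k (Co (k - 1) (Poly_Mapping.single \<sigma> 1)) (whitney_map X r k \<alpha>))"
      using integral_whitney_lin_simplex[of _ "k - 1" \<beta>] by (auto simp: whitney_space_def whitney_map_def \<beta>_def)
    fix w assume w: "w \<in> whitney_space X r (k - 1) \<and>
      (\<forall>\<sigma>\<in>simplices X r (k - 1). integral_simplex X (k - 1) (lin_simplex \<sigma>) w =
        integral_chain X k (Co (k - 1) (Poly_Mapping.single \<sigma> 1)) (whitney_map X r k \<alpha>))"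
    then obtain c where c: "w = whitney_map X r (k - 1) c" unfolding whitney_space_def whitney_map_def by auto
    have "c \<sigma> = \<beta> \<sigma>" if "\<sigma> \<in> simplices X r (k - 1)" for \<sigma>
      using w integral_whitney_lin_simplex[OF that, of c] that unfolding c \<beta>_def by simp
    then show "w = whitney_map X r (k - 1) \<beta>" unfolding c by (rule whitney_map_cong)
  qed
  then show ?thesis
    unfolding cochain_cone_operator_def de_rham_map_def using integral_whitney_lin_simplex[of \<sigma> "k - 1" \<beta>] by (simp add: \<beta>_def)
qed

end

text \<open>A cone operator is linear on the chains of X only, so membership in
  \<open>chains\<close> is carried along in the induction.\<close>

lemma eval_chain_cone:
  assumes Co: "singular_cone_operator X r a Co" and "finite A" and \<tau>: "\<And>i. i \<in> A \<Longrightarrow> \<tau> i \<in> simplices X r k"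
  shows "eval_chain I (Co k (\<Sum>i\<in>A. Poly_Mapping.single (\<tau> i) (s i))) = (\<Sum>i\<in>A. s i * eval_chain I (Co k (Poly_Mapping.single (\<tau> i) 1)))"
proof -
  have add: "c \<in> chains X r k \<Longrightarrow> d \<in> chains X r k \<Longrightarrow> Co k (c + d) = Co k c + Co k d"
    and scale: "c \<in> chains X r k \<Longrightarrow> Co k (Poly_Mapping.map ((*) s) c) = Poly_Mapping.map ((*) s) (Co k c)" for c d s
    using Co unfolding singular_cone_operator_def by blast+
  have single: "Poly_Mapping.single \<sigma> s \<in> chains X r k" if "\<sigma> \<in> simplices X r k" for \<sigma> s
    using that by (simp add: chains_def)
  have "(\<Sum>i\<in>A. Poly_Mapping.single (\<tau> i) (s i)) \<in> chains X r k \<and>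
    eval_chain I (Co k (\<Sum>i\<in>A. Poly_Mapping.single (\<tau> i) (s i))) = (\<Sum>i\<in>A. s i * eval_chain I (Co k (Poly_Mapping.single (\<tau> i) 1)))"
    using assms(2) \<tau>
  proof (induction A rule: finite_induct)
    case empty
    have "Co k (0 + 0) = Co k 0 + Co k 0" by (rule add) (simp_all add: chains_def)
    then show ?case by (simp add: chains_def)
  next
    case (insert i A)
    let ?c = "\<Sum>i\<in>A. Poly_Mapping.single (\<tau> i) (s i)"
    have c: "?c \<in> chains X r k" and IH: "eval_chain I (Co k ?c) = (\<Sum>i\<in>A. s i * eval_chain I (Co k (Poly_Mapping.single (\<tau> i) 1)))"
      using insert by auto
    have i: "\<tau> i \<in> simplices X r k" using insert.prems by simp
    have m: "Poly_Mapping.single (\<tau> i) (s i) = Poly_Mapping.map ((*) (s i)) (Poly_Mapping.single (\<tau> i) 1)"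
      by (rule poly_mapping_eqI) (simp add: Poly_Mapping.map.rep_eq lookup_single when_def)
    have "eval_chain I (Co k (Poly_Mapping.single (\<tau> i) (s i))) = s i * eval_chain I (Co k (Poly_Mapping.single (\<tau> i) 1))"
      unfolding m scale[OF single[OF i]] by (rule eval_chain_scale)
    moreover have "Poly_Mapping.single (\<tau> i) (s i) + ?c \<in> chains X r k"
      using Poly_Mapping.keys_add[of "Poly_Mapping.single (\<tau> i) (s i)" ?c] c single[OF i, of "s i"] unfolding chains_def mem_Collect_eq
      by (meson Un_least subset_trans)
    ultimately show ?case using insert.hyps IH add[OF single[OF i] c] by (simp add: eval_chain_add)
  qed
  then show ?thesis by blast
qed

lemma integral_point: "integral_simplex X 0 (lin_simplex [a]) u = u (carrier_simplex X a) a []"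
proof -
  have ref: "ref_simplex 0 = {\<lambda>_. undefined}" by (auto simp: ref_simplex_def)
  have s: "ref_simplex 0 \<in> sets (completion (lpi {1..0}))" using ref_simplex_sets by (rule sets_completionI_sets)
  have "integral_simplex X 0 (lin_simplex [a]) u = lebesgue_simplex 0 (\<lambda>_. u (carrier_simplex X a) a [])"
    unfolding integral_simplex_def lebesgue_simplex_def
    by (rule set_lebesgue_integral_cong[OF s]) (auto simp: pullback_def lin_simplex_def ref)
  then show ?thesis by (simp add: lebesgue_simplex_const)
qed

theorem corollary3p9:
  fixes X :: "'a::euclidean_space set set"
    and r :: "'a rel"
    and a :: 'a
    and Co :: "nat \<Rightarrow> ('a list \<Rightarrow>\<^sub>0 real) \<Rightarrow> (((nat \<Rightarrow> real) \<Rightarrow> 'a) \<Rightarrow>\<^sub>0 real)"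
  assumes "simplicial_complex X"
    and "linear_order_on (vertices X) r"
    and "singular_cone_operator X r a Co"
  shows "(\<forall>k\<ge>1. \<forall>\<alpha>\<in>cochains X r k.
            (\<lambda>\<sigma>. coboundary X r (k - 1) (cochain_cone_operator X r Co k \<alpha>) \<sigma> +
                 cochain_cone_operator X r Co (k + 1) (coboundary X r k \<alpha>) \<sigma>) = \<alpha>) \<and>
         (\<forall>\<alpha>\<in>cochains X r 0.
            cochain_cone_operator X r Co 1 (coboundary X r 0 \<alpha>) = (\<lambda>\<sigma>. \<alpha> \<sigma> - pi_W X r a \<alpha> \<sigma>))"
proof (intro conjI allI ballI impI ext)
  note X = assms(1) and r = assms(2) and Co = assms(3)
  note P = cochain_cone_operator_eq[OF X r]
  have chain: "Co k (Poly_Mapping.single \<sigma> 1) \<in> lipschitz_chains (Suc k) (\<Union>X)" if "\<sigma> \<in> simplices X r k" for k \<sigma>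
    using Co that unfolding singular_cone_operator_def chains_def by auto
  fix k :: nat and \<alpha> \<sigma>
  assume k: "1 \<le> k" and \<alpha>: "\<alpha> \<in> cochains X r k"
  obtain j where j: "k = Suc j" using k by (cases k) auto
  show "coboundary X r (k - 1) (cochain_cone_operator X r Co k \<alpha>) \<sigma> +
    cochain_cone_operator X r Co (k + 1) (coboundary X r k \<alpha>) \<sigma> = \<alpha> \<sigma>"
  proof (cases "\<sigma> \<in> simplices X r k")
    case False
    \<comment> \<open>Off the k-simplices both operators give 0, and so does \<alpha> by the
      convention for cochains.\<close>
    then show ?thesis using \<alpha> by (simp add: P coboundary_def j cochains_def)
  next
    case True
    let ?s = "Poly_Mapping.single \<sigma> 1 :: 'a list \<Rightarrow>\<^sub>0 real" and ?I = "\<lambda>c. integral_chain X k c (whitney_map X r k \<alpha>)"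
    have \<sigma>: "\<sigma> \<in> simplices X r (Suc j)" and len: "length \<sigma> = Suc (Suc j)" using True by (simp_all add: j simplices_def)
    have d: "delete_nth i \<sigma> \<in> simplices X r j" if "i < Suc (Suc j)" for i by (rule simplices_delete_nth[OF X \<sigma> that])
    \<comment> \<open>The alternating sum over the faces of \<sigma> is, by linearity, the integral
      over the cone of the boundary.\<close>
    have "coboundary X r j (cochain_cone_operator X r Co k \<alpha>) \<sigma> = (\<Sum>i<Suc (Suc j). (-1) ^ i * ?I (Co j (Poly_Mapping.single (delete_nth i \<sigma>) 1)))"
      unfolding coboundary_eq[OF \<sigma>] P using d by (intro sum.cong) (auto simp: j)
    also have "\<dots> = ?I (Co j (boundary ?s))"
      unfolding integral_chain_eval boundary_single len using d by (intro eval_chain_cone[OF Co, symmetric]) auto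
    finally have 1: "coboundary X r (k - 1) (cochain_cone_operator X r Co k \<alpha>) \<sigma> = ?I (Co (k - 1) (boundary ?s))" by (simp add: j)
    \<comment> \<open>Stokes' theorem on the cone of \<sigma> trades the coboundary for the boundary
      of that chain.\<close>
    have 2: "cochain_cone_operator X r Co (k + 1) (coboundary X r k \<alpha>) \<sigma> = ?I (singular_boundary (k + 1) (Co k ?s))"
      using whitney_stokes_chain[OF X r chain[OF True], of \<alpha>] True by (simp add: P)
    have "Co (k - 1) (boundary ?s) + singular_boundary (k + 1) (Co k ?s) = Poly_Mapping.single (lin_simplex \<sigma>) 1"
      using Co k True unfolding singular_cone_operator_def by blast
    from arg_cong[OF this, of ?I] show ?thesis
      unfolding 1 2 by (simp add: integral_chain_eval eval_chain_add eval_chain_single integral_whitney_lin_simplex[OF X r True])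
  qed
next
  note X = assms(1) and r = assms(2) and Co = assms(3)
  fix \<alpha> \<sigma>
  assume \<alpha>: "\<alpha> \<in> cochains X r 0"
  show "cochain_cone_operator X r Co 1 (coboundary X r 0 \<alpha>) \<sigma> = \<alpha> \<sigma> - pi_W X r a \<alpha> \<sigma>"
  proof (cases "\<sigma> \<in> simplices X r 0")
    case False
    then show ?thesis using \<alpha> by (simp add: cochain_cone_operator_eq[OF X r] pi_W_def cochains_def)
  next
    case True
    then obtain v where v: "\<sigma> = [v]" by (auto simp: simplices_def length_Suc_conv)
    have chain: "Co 0 (Poly_Mapping.single \<sigma> 1) \<in> lipschitz_chains (Suc 0) (\<Union>X)"
      using Co True unfolding singular_cone_operator_def chains_def by auto
    \<comment> \<open>The end of the cone at a is a constant 0-simplex; integrating over it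
      evaluates the Whitney form at a, which is the value of \<open>pi_W\<close>.\<close>
    have "singular_boundary 1 (Co 0 (Poly_Mapping.single \<sigma> 1)) = Poly_Mapping.single (lin_simplex \<sigma>) 1 - Poly_Mapping.single (lin_simplex [a]) 1"
      using Co True unfolding singular_cone_operator_def v by blast
    then have "integral_chain X (Suc 0) (Co 0 (Poly_Mapping.single \<sigma> 1)) (whitney_map X r (Suc 0) (coboundary X r 0 \<alpha>)) =
      integral_simplex X 0 (lin_simplex \<sigma>) (whitney_map X r 0 \<alpha>) - integral_simplex X 0 (lin_simplex [a]) (whitney_map X r 0 \<alpha>)"
      using whitney_stokes_chain[OF X r chain, of \<alpha>] by (simp add: integral_chain_eval eval_chain_diff eval_chain_single)
    then show ?thesis
      using True by (simp add: cochain_cone_operator_eq[OF X r] pi_W_def integral_whitney_lin_simplex[OF X r True] integral_point)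
  qed
qed

end
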